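(* Let $\sigma$ be a positive Borel measure with $\operatorname{supp}(\sigma)=\mathbb{R}_-$ and $|\sigma|>1$, such that for every compact subset $K\subset\mathbb{R}_-$ the potential $U^{\sigma|_K}$ is continuous on $\mathbb{C}$. Let $\varphi$ be a real valued continuous function on $\mathbb{R}_+$ such that $$\lim_{x\to\infty}(\varphi(x)-4\log x)=+\infty .$$ Then the following statements are equivalent and have the same unique solution: (A) There exists $\vec\lambda\in\mathfrak{M}^*(\sigma)$ such that $J_\varphi(\vec\lambda)=J_\varphi>-\infty$. (B) There exists $\vec\lambda\in\mathfrak{M}^*(\sigma)$ such that for all $\vec\nu\in\mathfrak{M}^*(\sigma)$, $$\int W_1^{\vec\lambda}\,d(\nu_1-\lambda_1)+\int W_2^{\vec\lambda}\,d(\nu_2-\lambda_2)\ge 0 .$$ (C) There exist $\vec\lambda=(\lambda_1,\lambda_2)\in\mathfrak{M}^*(\sigma)$ and constants $w_1=w_1(\sigma,\varphi)$, $w_2=w_2(\sigma,\varphi)$ such that $$2U^{\lambda_1}(x)-U^{\lambda_2}(x)+\varphi(x)\ \begin{cases}=w_1,& x\in\operatorname{supp}(\lambda_1),\\ \ge w_1,& x\in\mathbb{R}_+,\end{cases}$$ $$2U^{\lambda_2}(x)-U^{\lambda_1}(x)\ \begin{cases}\le w_2,& x\in\operatorname{supp}(\lambda_2)=\mathbb{R}_-,\\ =w_2,& x\in\operatorname{supp}(\sigma-\lambda_2).\end{cases}$$ The constants $w_1,w_2$ are uniquely determined as well. Moreover, $U^{\lambda_1}$ and $U^{\lambda_2}$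 are continuous on $\mathbb{C}$, and $\operatorname{supp}(\lambda_1)$ is compact. If $x\varphi'(x)>0$ for $x>0$ and $x\varphi'(x)$ is increasing on $\mathbb{R}_+$, then $\operatorname{supp}(\lambda_1)$ is also connected. If $\varphi$ is increasing on $\mathbb{R}_+$, then $0\in\operatorname{supp}(\lambda_1)$. If $\int\log(1+y^2)\,d\sigma(y)=+\infty$ and $\sigma$ satisfies the condition that for every $\varepsilon>0$ there exist $0<\delta<1/2$ and $R_0>0$ such that $$\sup_{|R|\ge R_0}\int_{R-\delta}^{R+\delta}\log\frac{1}{|R-y|}\,d\sigma(y)<\varepsilon ,$$ then $w_2(\sigma,\varphi)=0$.
   Context: Notation: $\mathbb{R}_+=[0,+\infty)$, $\mathbb{R}_-=(-\infty,0]$. $|\mu|$ is the total mass of a positive measure $\mu$ ($|\sigma|$ may be infinite), and $\sigma|_K$ is the restriction of $\sigma$ to $K$. For a closed set $\Delta\subset\mathbb{R}$ and $c>0$, $\mathcal{M}_c^+(\Delta)$ is the set of finite positive Borel measures $\mu$ with $\operatorname{supp}(\mu)\subset\Delta$ and $|\mu|=c$. Whenever well defined, $$U^\mu(x)=\int\log\frac1{|x-y|}\,d\mu(y),\quad I(\mu)=\iint\log\frac1{|x-y|}\,d\mu(x)d\mu(y),\quad I(\mu_1,\mu_2)=\iint\log\frac1{|x-y|}\,d\mu_1(x)d\mu_2(y).$$ The inequality $\mu\le\sigma$ means that $\sigma-\mu$ is a positive measure. Set $$\mathfrak{M}(\sigma)=\{\vec\mu=(\mu_1,\mu_2)^t\in\mathcal{M}_2^+(\mathbb{R}_+)\times\mathcal{M}_1^+(\mathbb{R}_-):\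 \mu_2\le\sigma\},$$ $$\mathfrak{M}^*(\sigma)=\Big\{\vec\mu\in\mathfrak{M}(\sigma):\ I(\mu_j)<+\infty,\ \int\log(1+|x|^2)\,d\mu_j(x)<+\infty,\ j=1,2\Big\},$$ $$J_\varphi(\vec\mu)=2\Big(I(\mu_1)-I(\mu_1,\mu_2)+I(\mu_2)+\int\varphi\,d\mu_1\Big),\qquad J_\varphi=\inf\{J_\varphi(\vec\mu):\vec\mu\in\mathfrak{M}^*(\sigma)\},$$ $$W_1^{\vec\mu}(x)=2U^{\mu_1}(x)-U^{\mu_2}(x)+\varphi(x),\qquad W_2^{\vec\mu}(x)=2U^{\mu_2}(x)-U^{\mu_1}(x).$$ *)

theory Defs
  imports "HOL-Analysis.Analysis"
begin

(* Integral of an extended-real function.  Potentials and energies may be infinite, so the Bochner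
   integral (which is 0 on non-integrable functions) is not suitable.  If the integrals of the
   positive and of the negative part are both infinite, the integral is ill defined and the value
   is \<infinity> - \<infinity> = \<infinity>; hence a value different from \<infinity> always comes from a well-defined integral. *)
definition ext_integral :: "'a measure \<Rightarrow> ('a \<Rightarrow> ereal) \<Rightarrow> ereal" where
  "ext_integral M f =
     enn2ereal (\<integral>\<^sup>+ x. e2ennreal (f x) \<partial>M) - enn2ereal (\<integral>\<^sup>+ x. e2ennreal (- f x) \<partial>M)"

(* \<integral> f d(\<nu> - \<mu>) for the difference of two finite positive measures. *)
definition ext_integral_diff :: "'a measure \<Rightarrow> 'a measure \<Rightarrow> ('a \<Rightarrow> ereal) \<Rightarrow> ereal" where
  "ext_integral_diff \<nu> \<mu> f = ext_integral \<nu> f - ext_integral \<mu> f"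

definition measure_support :: "'a::topological_space measure \<Rightarrow> 'a set" where
  "measure_support M = {x. \<forall>S. open S \<longrightarrow> x \<in> S \<longrightarrow> emeasure M S > 0}"

(* The restriction \<sigma>|K, as a measure on the whole of the original space. *)
definition measure_restrict :: "'a measure \<Rightarrow> 'a set \<Rightarrow> 'a measure" where
  "measure_restrict M K = density M (indicator K)"

(* The diagonal value has to be \<infinity>; the HOL term ln (1 / 0) would be 0. *)
definition log_kernel :: "'a::metric_space \<Rightarrow> 'a \<Rightarrow> ereal" where
  "log_kernel x y = (if x = y then \<infinity> else ereal (ln (1 / dist x y)))"

definition log_potential :: "real measure \<Rightarrow> complex \<Rightarrow> ereal" where
  "log_potential \<mu> z = ext_integral \<mu> (\<lambda>y. log_kernel z (complex_of_real y))"

definition mutual_energy :: "real measure \<Rightarrow> real measure \<Rightarrow> ereal" where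
  "mutual_energy \<mu> \<nu> = ext_integral (\<mu> \<Otimes>\<^sub>M \<nu>) (\<lambda>(x, y). log_kernel x y)"

definition log_energy :: "real measure \<Rightarrow> ereal" where
  "log_energy \<mu> = mutual_energy \<mu> \<mu>"

(* Continuity as a real-valued function: finiteness is required explicitly, since for instance the
   potential of a point mass is continuous as a map into the extended reals. *)
definition continuous_potential :: "real measure \<Rightarrow> bool" where
  "continuous_potential \<mu> \<longleftrightarrow>
     (\<forall>z. \<bar>log_potential \<mu> z\<bar> \<noteq> \<infinity>) \<and> continuous_on UNIV (log_potential \<mu>)"

definition measures_mass :: "real \<Rightarrow> real set \<Rightarrow> real measure set" where
  "measures_mass c \<Delta> =
     {\<mu>. sets \<mu> = sets borel \<and> measure_support \<mu> \<subseteq> \<Delta> \<and> emeasure \<mu> UNIV = ennreal c}"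

(* On measures with the same sigma-algebra, \<le> is the setwise order. *)
definition admissible :: "real measure \<Rightarrow> (real measure \<times> real measure) set" where
  "admissible \<sigma> =
     {(\<mu>1, \<mu>2). \<mu>1 \<in> measures_mass 2 {0..} \<and> \<mu>2 \<in> measures_mass 1 {..0} \<and> \<mu>2 \<le> \<sigma>}"

definition finite_energy_log_moment :: "real measure \<Rightarrow> bool" where
  "finite_energy_log_moment \<mu> \<longleftrightarrow>
     log_energy \<mu> < \<infinity> \<and> (\<integral>\<^sup>+ x. ennreal (ln (1 + \<bar>x\<bar>\<^sup>2)) \<partial>\<mu>) < \<infinity>"

definition admissible_star :: "real measure \<Rightarrow> (real measure \<times> real measure) set" where
  "admissible_star \<sigma> =
     {(\<mu>1, \<mu>2). (\<mu>1, \<mu>2) \<in> admissible \<sigma> \<and>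
        finite_energy_log_moment \<mu>1 \<and> finite_energy_log_moment \<mu>2}"

fun J_functional :: "(real \<Rightarrow> real) \<Rightarrow> real measure \<times> real measure \<Rightarrow> ereal" where
  "J_functional \<phi> (\<mu>1, \<mu>2) =
     2 * (log_energy \<mu>1 - mutual_energy \<mu>1 \<mu>2 + log_energy \<mu>2
          + ext_integral \<mu>1 (\<lambda>x. ereal (\<phi> x)))"

definition J_inf :: "real measure \<Rightarrow> (real \<Rightarrow> real) \<Rightarrow> ereal" where
  "J_inf \<sigma> \<phi> = (INF \<mu> \<in> admissible_star \<sigma>. J_functional \<phi> \<mu>)"

fun W1 :: "(real \<Rightarrow> real) \<Rightarrow> real measure \<times> real measure \<Rightarrow> real \<Rightarrow> ereal" where
  "W1 \<phi> (\<mu>1, \<mu>2) x =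
     2 * log_potential \<mu>1 (complex_of_real x) - log_potential \<mu>2 (complex_of_real x) + ereal (\<phi> x)"

fun W2 :: "real measure \<times> real measure \<Rightarrow> real \<Rightarrow> ereal" where
  "W2 (\<mu>1, \<mu>2) x =
     2 * log_potential \<mu>2 (complex_of_real x) - log_potential \<mu>1 (complex_of_real x)"

definition minimizes_energy ::
  "real measure \<Rightarrow> (real \<Rightarrow> real) \<Rightarrow> real measure \<times> real measure \<Rightarrow> bool" where
  "minimizes_energy \<sigma> \<phi> \<mu> \<longleftrightarrow>
     \<mu> \<in> admissible_star \<sigma> \<and> J_functional \<phi> \<mu> = J_inf \<sigma> \<phi> \<and> J_inf \<sigma> \<phi> > -\<infinity>"

definition variational_inequality ::
  "real measure \<Rightarrow> (real \<Rightarrow> real) \<Rightarrow> real measure \<times> real measure \<Rightarrow> bool" where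
  "variational_inequality \<sigma> \<phi> \<mu> \<longleftrightarrow>
     \<mu> \<in> admissible_star \<sigma> \<and>
     (\<forall>\<nu> \<in> admissible_star \<sigma>.
        ext_integral_diff (fst \<nu>) (fst \<mu>) (W1 \<phi> \<mu>) + ext_integral_diff (snd \<nu>) (snd \<mu>) (W2 \<mu>) \<ge> 0)"

definition equilibrium_conditions ::
  "real measure \<Rightarrow> (real \<Rightarrow> real) \<Rightarrow> real measure \<times> real measure \<Rightarrow> real \<Rightarrow> real \<Rightarrow> bool" where
  "equilibrium_conditions \<sigma> \<phi> \<mu> w1 w2 \<longleftrightarrow>
     \<mu> \<in> admissible_star \<sigma> \<and>
     (\<forall>x \<in> measure_support (fst \<mu>). W1 \<phi> \<mu> x = ereal w1) \<and>
     (\<forall>x \<in> {0..}. W1 \<phi> \<mu> x \<ge> ereal w1) \<and>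
     measure_support (snd \<mu>) = {..0} \<and>
     (\<forall>x \<in> measure_support (snd \<mu>). W2 \<mu> x \<le> ereal w2) \<and>
     (\<forall>x \<in> measure_support (diff_measure \<sigma> (snd \<mu>)). W2 \<mu> x = ereal w2)"

definition vanishing_local_potentials :: "real measure \<Rightarrow> bool" where
  "vanishing_local_potentials \<sigma> \<longleftrightarrow>
     (\<forall>\<epsilon>>0. \<exists>\<delta> R0. 0 < \<delta> \<and> \<delta> < 1/2 \<and> R0 > 0 \<and>
        (SUP R \<in> {R. \<bar>R\<bar> \<ge> R0}.
           ext_integral (measure_restrict \<sigma> {R - \<delta>..R + \<delta>}) (\<lambda>y. log_kernel R y)) < ereal \<epsilon>)"

end

theory Submission
  imports Defs "HOL-Probability.Probability"
begin

text \<open>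
  The functional is a strictly convex quadratic function of the pair of measures, and the whole
  proof rests on a representation that makes this visible.  Let \<open>boxfn \<mu> (r, u)\<close> be the density
  \<open>\<mu> {u<..u + r} / r\<close> of a finite measure in the box of length \<open>r\<close> that starts at \<open>u\<close>.  Integrating
  \<open>boxfn \<alpha> * boxfn \<beta>\<close> over all boxes of length less than \<open>R\<close> gives the mutual energy of \<open>\<alpha>\<close> and \<open>\<beta>\<close>
  for the kernel \<open>ln (R / d) - 1 + d / R\<close> on distances \<open>d < R\<close>, which is the logarithmic kernel up to
  the constant \<open>ln R - 1\<close> and a term that vanishes as \<open>R\<close> grows.  For measures of equal mass the
  constants cancel, and the logarithmic energy of \<open>\<alpha> - \<beta>\<close> is the squared norm of
  \<open>boxfn \<alpha> - boxfn \<beta>\<close> in the Lebesgue space \<open>L\<^sup>2\<close> of the plane (\<open>energy_neutral\<close>); it vanishes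
  only if \<open>\<alpha> = \<beta>\<close> (\<open>energy_neutral_eq_0\<close>).

  The interaction form satisfies \<open>x\<^sup>2 - x y + y\<^sup>2 = (y - x / 2)\<^sup>2 + 3 / 4 x\<^sup>2\<close>.  Along a
  segment of admissible pairs the functional is therefore a quadratic polynomial with nonnegative
  leading coefficient, which is zero only for a trivial segment.  Hence minimizers are unique and
  are exactly the solutions of the variational inequality (\<open>slope_nonneg_iff_min\<close>,
  \<open>min_unique\<close>).

  Existence is the delicate point, because \<open>\<sigma>\<close> may have infinite logarithmic moment and the second
  component of a minimizing sequence could a priori spread out to infinity.  Completing the square
  with the help of a fixed compactly supported measure writes the functional, up to an additive
  constant, as a sum \<open>shifted_J\<close> of nonnegative terms that are lower semicontinuous under weak
  convergence and make sense for all admissible pairs.  Mass of the first component cannot escape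
  since the external field outgrows the logarithm (\<open>tail_bound\<close>).  Mass \<open>\<eta>\<close> of the second component
  beyond \<open>-R\<close> would make all boxes around \<open>{-T..T}\<close> of length between \<open>2 T\<close> and \<open>R\<close> unbalanced, at
  a cost of order \<open>\<eta>\<^sup>2 ln (R / T)\<close> (\<open>escape_bound\<close>).  So a minimizing sequence is tight, and
  Helly's selection theorem yields a minimizer of \<open>shifted_J\<close>.  Its second component has a finite
  logarithmic moment: as \<open>\<sigma>\<close> has mass greater than one, there is room for more mass on some
  compact set, and the first variation for moving far mass into that set bounds all truncated
  moments (\<open>minimizer_truncated_moment\<close>).

  The regularity of the potentials is expressed by the condition \<open>kato\<close>: the part of the potential
  that comes from points within distance \<open>\<delta>\<close> is uniformly small on bounded sets.  It makes the
  potential continuous in the plane, passes to smaller measures, and holds for \<open>\<sigma>\<close>.  For a measure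
  of compact support it follows from continuity of the potential on the support
  (\<open>kato_of_continuous\<close>).  Let \<open>(\<kappa>1, \<kappa>2)\<close> be the minimizer.  Testing with small copies of a fixed
  measure near a point gives \<open>W1 \<ge> w1\<close>; since \<open>w1\<close> is the mean of \<open>W1\<close> over \<open>\<kappa>1\<close>, equality holds
  almost everywhere and, by semicontinuity, on the support.  There the potential of \<open>\<kappa>1\<close> is thus a
  combination of continuous functions, and the growth of the field makes the support compact, so
  \<open>kato\<close> holds for \<open>\<kappa>1\<close> too.  Exchanging mass between \<open>\<kappa>2\<close> and \<open>\<sigma> - \<kappa>2\<close> shows that \<open>W2\<close> on the
  support of \<open>\<kappa>2\<close> does not exceed \<open>W2\<close> on the support of \<open>\<sigma> - \<kappa>2\<close> (\<open>exchange\<close>).  Conversely the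
  equilibrium conditions imply the variational inequality, since off the support of \<open>\<sigma> - \<mu>2\<close> the
  measure \<open>\<mu>2\<close> is as large as the constraint allows (\<open>is_min_of_equilibrium\<close>).

  The supports are determined by \<open>(z - t)\<^sup>2 = (x - t) (y - t) + t (x + y - 2 z)\<close>, valid when
  \<open>z\<^sup>2 = x y\<close>.  On a half line the potential of a measure on the same half line is convex along
  geometric means within any gap of the measure, and the potential of a measure on the opposite
  half line is strictly concave.  A gap in the support of \<open>\<kappa>2\<close>, or of \<open>\<kappa>1\<close> when \<open>\<phi> \<circ> exp\<close> is
  convex, thus makes \<open>W2\<close> or \<open>W1\<close> strictly convex along geometric means in the gap, while the
  extremal conditions say that the function there is at least its value at the ends.  Finally, if
  \<open>\<sigma>\<close> has infinite logarithmic moment then \<open>\<sigma> - \<kappa>2\<close> has unbounded support; on it \<open>W2 = w2\<close>, and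
  \<open>W2\<close> tends to zero at infinity up to the near part of the potential of \<open>\<kappa>2\<close>, because
  \<open>2 \<kappa>2\<close> and \<open>\<kappa>1\<close> have the same mass.
\<close>

section \<open>Integrals of extended-real functions\<close>

lemma ext_integral_eq_real:
  fixes f :: "'a \<Rightarrow> ereal" and g :: "'a \<Rightarrow> real"
  assumes ae: "AE x in M. f x = ereal (g x)" and g: "integrable M g"
  shows "ext_integral M f = ereal (integral\<^sup>L M g)"
proof -
  have 1: "(\<integral>\<^sup>+ x. e2ennreal (f x) \<partial>M) = (\<integral>\<^sup>+ x. ennreal (g x) \<partial>M)"
    by (rule nn_integral_cong_AE) (use ae in \<open>auto simp: ennreal.abs_eq\<close>)
  have 2: "(\<integral>\<^sup>+ x. e2ennreal (- f x) \<partial>M) = (\<integral>\<^sup>+ x. ennreal (- g x) \<partial>M)"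
    by (rule nn_integral_cong_AE) (use ae in \<open>auto simp: ennreal.abs_eq\<close>)
  have f1: "(\<integral>\<^sup>+ x. ennreal (g x) \<partial>M) < top" "(\<integral>\<^sup>+ x. ennreal (- g x) \<partial>M) < top"
    using real_integrable_def[of M g] g by (auto simp: top.not_eq_extremum)
  have e: "enn2ereal z = ereal (enn2real z)" if "z < top" for z
    using that by (metis enn2ereal_ennreal enn2real_nonneg ennreal_enn2real)
  show ?thesis
    unfolding ext_integral_def 1 2 real_lebesgue_integral_def[OF g] e[OF f1(1)] e[OF f1(2)]
    by simp
qed

text \<open>An integrable lower bound makes the integral of the negative part finite, so the extended
  integral is infinite as soon as that of the positive part is.\<close>
lemma ext_integral_lt_PInf:
  fixes f :: "'a \<Rightarrow> ereal" and h :: "'a \<Rightarrow> real"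
  assumes f[measurable]: "f \<in> borel_measurable M"
    and h: "integrable M h" and le: "AE x in M. ereal (h x) \<le> f x"
    and fin: "ext_integral M f < \<infinity>"
  shows "integrable M (\<lambda>x. real_of_ereal (f x))"
    and "AE x in M. f x = ereal (real_of_ereal (f x))"
proof -
  have neg: "(\<integral>\<^sup>+ x. e2ennreal (- f x) \<partial>M) < top"
  proof -
    have "(\<integral>\<^sup>+ x. e2ennreal (- f x) \<partial>M) \<le> (\<integral>\<^sup>+ x. ennreal (- h x) \<partial>M)"
    proof (rule nn_integral_mono_AE)
      show "AE x in M. e2ennreal (- f x) \<le> ennreal (- h x)"
        using le
      proof eventually_elim
        case (elim x)
        then have "- f x \<le> ereal (- h x)" by (cases "f x") auto
        then have "e2ennreal (- f x) \<le> e2ennreal (ereal (- h x))" by (rule e2ennreal_mono)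
        then show ?case by (simp add: ennreal.abs_eq)
      qed
    qed
    also have "\<dots> < top" using real_integrable_def[of M h] h by (auto simp: top.not_eq_extremum)
    finally show ?thesis .
  qed
  have pos: "(\<integral>\<^sup>+ x. e2ennreal (f x) \<partial>M) < top"
  proof (rule ccontr)
    assume "\<not> ?thesis"
    then have "(\<integral>\<^sup>+ x. e2ennreal (f x) \<partial>M) = top" using top.not_eq_extremum by blast
    moreover obtain r where "(\<integral>\<^sup>+ x. e2ennreal (- f x) \<partial>M) = ennreal r" "r \<ge> 0"
      using neg by (cases "\<integral>\<^sup>+ x. e2ennreal (- f x) \<partial>M") auto
    ultimately have "ext_integral M f = \<infinity>" by (simp add: ext_integral_def)
    with fin show False by simp
  qed
  have "AE x in M. e2ennreal (f x) \<noteq> \<infinity>"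
    by (rule nn_integral_PInf_AE) (use pos in auto)
  with le show ae: "AE x in M. f x = ereal (real_of_ereal (f x))"
  proof eventually_elim
    case (elim x)
    then show ?case by (cases "f x") auto
  qed
  show "integrable M (\<lambda>x. real_of_ereal (f x))"
  proof -
    have "(\<integral>\<^sup>+ x. ennreal (real_of_ereal (f x)) \<partial>M) = (\<integral>\<^sup>+ x. e2ennreal (f x) \<partial>M)"
      by (rule nn_integral_cong_AE, use ae in eventually_elim) (metis e2ennreal_ereal)
    moreover have "(\<integral>\<^sup>+ x. ennreal (- real_of_ereal (f x)) \<partial>M) = (\<integral>\<^sup>+ x. e2ennreal (- f x) \<partial>M)"
      by (rule nn_integral_cong_AE, use ae in eventually_elim)
         (metis e2ennreal_ereal uminus_ereal.simps(1))
    ultimately show ?thesis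
      using pos neg unfolding real_integrable_def by (simp add: less_top)
  qed
qed

lemma ext_integral_PInf:
  fixes f :: "'a \<Rightarrow> ereal" and g h :: "'a \<Rightarrow> real"
  assumes ae: "AE x in M. f x = ereal (g x)" and g[measurable]: "g \<in> borel_measurable M"
    and h: "integrable M h" and le: "AE x in M. h x \<le> g x" and ni: "\<not> integrable M g"
  shows "ext_integral M f = \<infinity>"
proof (rule ccontr)
  assume "ext_integral M f \<noteq> \<infinity>"
  then have fin: "ext_integral M f < \<infinity>" by simp
  have "ext_integral M f = ext_integral M (\<lambda>x. ereal (g x))"
  proof -
    have 1: "(\<integral>\<^sup>+ x. e2ennreal (f x) \<partial>M) = (\<integral>\<^sup>+ x. e2ennreal (ereal (g x)) \<partial>M)"
      by (rule nn_integral_cong_AE) (use ae in \<open>auto\<close>)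
    have 2: "(\<integral>\<^sup>+ x. e2ennreal (- f x) \<partial>M) = (\<integral>\<^sup>+ x. e2ennreal (- ereal (g x)) \<partial>M)"
      by (rule nn_integral_cong_AE) (use ae in \<open>auto\<close>)
    show ?thesis unfolding ext_integral_def 1 2 ..
  qed
  with fin have "ext_integral M (\<lambda>x. ereal (g x)) < \<infinity>" by simp
  from ext_integral_lt_PInf(1)[OF _ h _ this] le have "integrable M (\<lambda>x. real_of_ereal (ereal (g x)))"
    by auto
  with ni show False by simp
qed

section \<open>Supports\<close>

lemma closed_measure_support: "closed (measure_support M)"
proof -
  have "open (- measure_support M)"
  proof (subst open_subopen, intro ballI)
    fix x assume "x \<in> - measure_support M"
    then obtain S where "open S" "x \<in> S" "\<not> emeasure M S > 0" by (auto simp: measure_support_def)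
    then show "\<exists>T. open T \<and> x \<in> T \<and> T \<subseteq> - measure_support M"
      by (intro exI[of _ S]) (auto simp: measure_support_def)
  qed
  then show ?thesis by (simp add: closed_def)
qed

text \<open>The complement of the support is a union of open null sets, of which countably many from a basis
  suffice.\<close>
lemma emeasure_compl_support:
  fixes M :: "real measure"
  assumes "sets M = sets borel"
  shows "emeasure M (- measure_support M) = 0"
proof -
  obtain B :: "real set set" where B: "countable B" "topological_basis B"
    using ex_countable_basis by blast
  define C where "C = {b \<in> B. emeasure M b = 0}"
  have C: "countable C" using B by (auto simp: C_def)
  have "- measure_support M = \<Union>C"
  proof (intro set_eqI iffI)
    fix x assume "x \<in> - measure_support M"
    then obtain S where S: "open S" "x \<in> S" "emeasure M S = 0" by (auto simp: measure_support_def)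
    obtain b where b: "b \<in> B" "x \<in> b" "b \<subseteq> S" using topological_basisE[OF B(2) S(1,2)] by blast
    have "emeasure M b \<le> emeasure M S" using S b assms by (intro emeasure_mono) auto
    with S b show "x \<in> \<Union>C" by (auto simp: C_def)
  next
    fix x assume "x \<in> \<Union>C"
    then obtain b where b: "b \<in> B" "emeasure M b = 0" "x \<in> b" by (auto simp: C_def)
    with topological_basis_open[OF B(2)] show "x \<in> - measure_support M"
      by (auto simp: measure_support_def)
  qed
  moreover have "(\<Union>b\<in>C. b) \<in> null_sets M"
    using C assms topological_basis_open[OF B(2)]
    by (intro null_sets_UN') (auto simp: C_def null_sets_def)
  ultimately show ?thesis by auto
qed

lemma AE_support:
  fixes M :: "real measure"
  assumes "sets M = sets borel"
  shows "AE x in M. x \<in> measure_support M"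
  by (rule AE_I[of _ _ "- measure_support M"])
    (use emeasure_compl_support[OF assms] closed_measure_support[of M] assms in auto)

lemma support_subset_iff:
  fixes M :: "real measure"
  assumes "sets M = sets borel" "closed S"
  shows "measure_support M \<subseteq> S \<longleftrightarrow> (AE x in M. x \<in> S)"
proof
  assume "measure_support M \<subseteq> S"
  then show "AE x in M. x \<in> S" using AE_support[OF assms(1)] by (auto elim: eventually_mono)
next
  assume ae: "AE x in M. x \<in> S"
  have sp: "space M = UNIV" using assms(1) by (metis sets_eq_imp_space_eq space_borel)
  have "emeasure M (- S) = 0"
  proof -
    have "{x \<in> space M. \<not> x \<in> S} = - S" using sp by auto
    moreover have "{x \<in> space M. x \<in> S} \<in> sets M" using assms sp by auto
    ultimately show ?thesis using ae AE_iff_measurable[of "- S" M "\<lambda>x. x \<in> S"] assms by auto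
  qed
  show "measure_support M \<subseteq> S"
  proof
    fix x assume x: "x \<in> measure_support M"
    show "x \<in> S"
    proof (rule ccontr)
      assume "x \<notin> S"
      have "\<forall>T. open T \<longrightarrow> x \<in> T \<longrightarrow> emeasure M T > 0"
        using x by (simp only: measure_support_def mem_Collect_eq)
      from this[rule_format, of "- S"] have "emeasure M (- S) > 0"
        using \<open>x \<notin> S\<close> assms(2) by (simp only: closed_def Compl_iff simp_thms)
      with \<open>emeasure M (- S) = 0\<close> show False by simp
    qed
  qed
qed

lemma support_pos: "x \<in> measure_support M \<Longrightarrow> open S \<Longrightarrow> x \<in> S \<Longrightarrow> emeasure M S > 0"
  unfolding measure_support_def by auto

lemma AE_mem_iff:
  fixes M :: "real measure"
  assumes "sets M = sets borel" "K \<in> sets borel"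
  shows "(AE x in M. x \<in> K) \<longleftrightarrow> emeasure M (- K) = 0"
proof -
  have "space M = UNIV" using assms by (metis sets_eq_imp_space_eq space_borel)
  then have "{x \<in> space M. \<not> x \<in> K} = - K" by auto
  then show ?thesis using AE_iff_measurable[of "- K" M "\<lambda>x. x \<in> K"] assms by auto
qed

lemma AE_nonneg_iff:
  fixes M :: "real measure"
  assumes "sets M = sets borel"
  shows "(AE x in M. 0 \<le> x) \<longleftrightarrow> emeasure M {..<0} = 0"
  using AE_mem_iff[OF assms, of "{0..}"] by (simp add: Compl_atLeast)

lemma emeasure_measure_restrict:
  fixes M :: "real measure"
  assumes "sets M = sets borel" "K \<in> sets borel" "A \<in> sets borel"
  shows "emeasure (measure_restrict M K) A = emeasure M (K \<inter> A)"
  unfolding measure_restrict_def using assms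
  by (subst emeasure_density)
     (auto simp: indicator_inter_arith[symmetric] cong: measurable_cong_sets)

lemma sets_measure_restrict: "sets (measure_restrict M K) = sets M"
  by (simp add: measure_restrict_def)

section \<open>Nonnegative combinations of two measures\<close>

text \<open>The measure \<open>a \<alpha> + b \<beta>\<close>.  Scaling by \<open>a\<close> is expressed as \<open>mix a \<alpha> 0 \<alpha>\<close>.\<close>
definition mix :: "real \<Rightarrow> real measure \<Rightarrow> real \<Rightarrow> real measure \<Rightarrow> real measure" where
  "mix a \<alpha> b \<beta> = measure_of UNIV (sets borel)
     (\<lambda>A. ennreal a * emeasure \<alpha> A + ennreal b * emeasure \<beta> A)"

lemma sets_mix[simp, measurable_cong]: "sets (mix a \<alpha> b \<beta>) = sets borel"
  and space_mix[simp]: "space (mix a \<alpha> b \<beta>) = UNIV"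
  unfolding mix_def using sets.sigma_sets_eq[of "borel :: real measure"] by (simp_all)

lemma emeasure_mix:
  assumes "sets \<alpha> = sets borel" "sets \<beta> = sets borel" "A \<in> sets borel"
  shows "emeasure (mix a \<alpha> b \<beta>) A = ennreal a * emeasure \<alpha> A + ennreal b * emeasure \<beta> A"
  unfolding mix_def
proof (rule emeasure_measure_of_sigma)
  show "sigma_algebra UNIV (sets (borel :: real measure))"
    using sets.sigma_algebra_axioms[of "borel :: real measure"] by simp
  show "positive (sets borel) (\<lambda>A. ennreal a * emeasure \<alpha> A + ennreal b * emeasure \<beta> A)"
    by (simp add: positive_def)
  show "countably_additive (sets borel) (\<lambda>A. ennreal a * emeasure \<alpha> A + ennreal b * emeasure \<beta> A)"
  proof (rule countably_additiveI)
    fix A :: "nat \<Rightarrow> real set" assume A: "range A \<subseteq> sets borel" "disjoint_family A"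
    have "(\<Sum>i. emeasure \<alpha> (A i)) = emeasure \<alpha> (\<Union>i. A i)"
      "(\<Sum>i. emeasure \<beta> (A i)) = emeasure \<beta> (\<Union>i. A i)"
      using A assms by (auto intro!: suminf_emeasure)
    then show "(\<Sum>i. ennreal a * emeasure \<alpha> (A i) + ennreal b * emeasure \<beta> (A i)) =
      ennreal a * emeasure \<alpha> (\<Union>i. A i) + ennreal b * emeasure \<beta> (\<Union>i. A i)"
      by (subst suminf_add[symmetric]) (auto simp: ennreal_suminf_cmult)
  qed
qed fact

lemma nn_integral_mix:
  assumes "sets \<alpha> = sets borel" "sets \<beta> = sets borel" "f \<in> borel_measurable borel"
  shows "(\<integral>\<^sup>+x. f x \<partial>mix a \<alpha> b \<beta>) = ennreal a * (\<integral>\<^sup>+x. f x \<partial>\<alpha>) + ennreal b * (\<integral>\<^sup>+x. f x \<partial>\<beta>)"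
  using assms(3)
proof induction
  case (cong f g)
  have "(\<integral>\<^sup>+x. f x \<partial>M) = (\<integral>\<^sup>+x. g x \<partial>M)" for M :: "real measure"
    by (rule nn_integral_cong) (use cong in auto)
  with cong show ?case by simp
next
  case (set A)
  then show ?case using assms by (simp add: emeasure_mix)
next
  case (mult u c)
  have [measurable]: "u \<in> borel_measurable \<alpha>" "u \<in> borel_measurable \<beta>"
    using mult assms by (auto cong: measurable_cong_sets)
  show ?case using mult assms(1,2) by (simp add: nn_integral_cmult algebra_simps)
next
  case (add u v)
  have [measurable]: "u \<in> borel_measurable \<alpha>" "u \<in> borel_measurable \<beta>"
    "v \<in> borel_measurable \<alpha>" "v \<in> borel_measurable \<beta>"
    using add assms by (auto cong: measurable_cong_sets)
  show ?case using add by (simp add: nn_integral_add algebra_simps)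
next
  case (seq U)
  have [measurable]: "U i \<in> borel_measurable \<alpha>" "U i \<in> borel_measurable \<beta>" for i
    using seq assms by (auto cong: measurable_cong_sets)
  have inc: "incseq (\<lambda>i. (\<integral>\<^sup>+x. U i x \<partial>M))" for M
    using seq(3) by (auto simp: incseq_def le_fun_def intro!: nn_integral_mono)
  have e: "(\<lambda>x. (SUP i. U i) x) = (\<lambda>x. SUP i. U i x)"
    by (auto simp: image_comp)
  show ?case
    unfolding e
    by (subst (1 2 3) nn_integral_monotone_convergence_SUP)
       (use seq inc in \<open>auto simp: SUP_mult_left_ennreal[symmetric] ennreal_SUP_add
          incseq_def mult_left_mono image_comp\<close>)
qed

lemma finite_borel_measureD:
  assumes "finite_borel_measure \<mu>"
  shows "sets \<mu> = sets borel" "space \<mu> = UNIV" "finite_measure \<mu>" "emeasure \<mu> A < \<infinity>"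
    "sigma_finite_measure \<mu>"
proof -
  interpret finite_borel_measure \<mu> by fact
  show "sets \<mu> = sets borel" "space \<mu> = UNIV" "finite_measure \<mu>"
    using M_is_borel borel_UNIV by (auto intro: finite_measure_axioms)
  show "emeasure \<mu> A < \<infinity>" using emeasure_finite[of A] top.not_eq_extremum by fastforce
  show "sigma_finite_measure \<mu>" by unfold_locales
qed

lemma finite_borel_measureI:
  assumes "sets \<mu> = sets borel" "emeasure \<mu> UNIV < \<infinity>"
  shows "finite_borel_measure \<mu>"
proof -
  have "space \<mu> = UNIV" using assms(1) by (metis sets_eq_imp_space_eq space_borel)
  with assms show ?thesis
    by (auto simp: finite_borel_measure_def finite_borel_measure_axioms_def intro!: finite_measureI)
qed

lemma finite_borel_mix:
  assumes "finite_borel_measure \<alpha>" "finite_borel_measure \<beta>"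
  shows "finite_borel_measure (mix a \<alpha> b \<beta>)"
  using finite_borel_measureD[OF assms(1)] finite_borel_measureD[OF assms(2)]
  by (intro finite_borel_measureI) (auto simp: emeasure_mix ennreal_mult_less_top)

lemma measure_mix:
  assumes "finite_borel_measure \<alpha>" "finite_borel_measure \<beta>" "A \<in> sets borel" "a \<ge> 0" "b \<ge> 0"
  shows "measure (mix a \<alpha> b \<beta>) A = a * measure \<alpha> A + b * measure \<beta> A"
proof -
  note d = finite_borel_measureD[OF assms(1)] finite_borel_measureD[OF assms(2)]
  show ?thesis
    unfolding measure_def using d assms
    by (subst emeasure_mix) (auto simp: enn2real_mult enn2real_plus ennreal_mult_less_top)
qed

lemma integral_mix:
  fixes f :: "real \<Rightarrow> real"
  assumes s: "sets \<alpha> = sets borel" "sets \<beta> = sets borel" and ab: "a \<ge> 0" "b \<ge> 0"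
    and f: "integrable \<alpha> f" "integrable \<beta> f"
  shows "integrable (mix a \<alpha> b \<beta>) f"
    and "integral\<^sup>L (mix a \<alpha> b \<beta>) f = a * integral\<^sup>L \<alpha> f + b * integral\<^sup>L \<beta> f"
proof -
  have m[measurable]: "f \<in> borel_measurable borel"
    using f(1) s by (auto dest!: borel_measurable_integrable cong: measurable_cong_sets)
  have fin: "(\<integral>\<^sup>+x. ennreal (f x) \<partial>\<alpha>) < top" "(\<integral>\<^sup>+x. ennreal (- f x) \<partial>\<alpha>) < top"
     "(\<integral>\<^sup>+x. ennreal (f x) \<partial>\<beta>) < top" "(\<integral>\<^sup>+x. ennreal (- f x) \<partial>\<beta>) < top"
    using f by (auto simp: real_integrable_def top.not_eq_extremum)
  show i: "integrable (mix a \<alpha> b \<beta>) f"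
    unfolding real_integrable_def using fin s
    by (auto simp: nn_integral_mix ennreal_mult_eq_top_iff)
  show "integral\<^sup>L (mix a \<alpha> b \<beta>) f = a * integral\<^sup>L \<alpha> f + b * integral\<^sup>L \<beta> f"
    unfolding real_lebesgue_integral_def[OF i] real_lebesgue_integral_def[OF f(1)]
      real_lebesgue_integral_def[OF f(2)]
    using fin s ab
    by (subst (1 2) nn_integral_mix)
       (auto simp: enn2real_plus enn2real_mult ennreal_mult_less_top algebra_simps)
qed

section \<open>Counting boxes\<close>

text \<open>The pair \<open>(r, u)\<close> stands for the box \<open>{u<..u + r}\<close>.  Boxes are half-open so that their
  measures are differences of the distribution function.\<close>
definition boxfn :: "real measure \<Rightarrow> real \<times> real \<Rightarrow> real" where
  "boxfn \<mu> p = (if fst p > 0 then measure \<mu> {snd p<..snd p + fst p} / fst p else 0)"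

definition box_ind :: "real \<Rightarrow> real \<times> real \<Rightarrow> real" where
  "box_ind x p = (if fst p > 0 \<and> snd p < x \<and> x \<le> snd p + fst p then 1 / fst p else 0)"

text \<open>The value of \<open>\<integral> (r - d) / r\<^sup>2 dr\<close> over \<open>{d..R}\<close>: the weight of the boxes shorter than \<open>R\<close>
  that contain two given points at distance \<open>d\<close>.\<close>
definition box_kernel :: "real \<Rightarrow> real \<Rightarrow> real" where
  "box_kernel R d = (if d < R then ln (R / d) - 1 + d / R else 0)"

text \<open>On the diagonal the real formula would give the default value of a division by zero instead of
  \<open>\<infinity>\<close>.\<close>
definition box_ekernel :: "real \<Rightarrow> real \<Rightarrow> real \<Rightarrow> ennreal" where
  "box_ekernel R x y = (if x = y then \<infinity> else ennreal (box_kernel R \<bar>x - y\<bar>))"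

lemma box_ind_measurable[measurable]: "(\<lambda>(x, p). box_ind x p) \<in> borel_measurable (borel \<Otimes>\<^sub>M borel)"
proof -
  have "(\<lambda>(x, p). box_ind x p) \<in> borel_measurable (borel \<Otimes>\<^sub>M (borel \<Otimes>\<^sub>M borel))"
    unfolding box_ind_def by measurable
  then show ?thesis by (simp add: borel_prod)
qed

lemma fst_less_measurable[measurable]: "{p. fst p < R} \<in> sets (borel :: (real \<times> real) measure)"
  by (intro borel_open open_Collect_less continuous_intros)

lemma box_ind_nonneg: "0 \<le> box_ind x p"
  by (simp add: box_ind_def)

lemma box_kernel_nonneg: "0 < d \<Longrightarrow> 0 < R \<Longrightarrow> 0 \<le> box_kernel R d"
  using ln_le_minus_one[of "d / R"] by (auto simp: box_kernel_def ln_div)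

lemma box_kernel_measurable[measurable]: "box_kernel R \<in> borel_measurable borel"
  unfolding box_kernel_def by measurable

lemma box_ekernel_measurable[measurable]:
  "(\<lambda>(x, y). box_ekernel R x y) \<in> borel_measurable (borel \<Otimes>\<^sub>M borel)"
  unfolding box_ekernel_def by measurable

text \<open>The boxes of length \<open>r\<close> that contain both \<open>x\<close> and \<open>y\<close> start in an interval of length
  \<open>r - \<bar>x - y\<bar>\<close> and count with weight \<open>1 / r\<^sup>2\<close>; for \<open>x = y\<close> this leaves the divergent integral
  of \<open>1 / r\<close> at zero.\<close>
lemma nn_integral_box_ind:
  assumes R: "R > 0"
  shows "(\<integral>\<^sup>+p. ennreal (box_ind x p * box_ind y p) * indicator {p. fst p < R} p
     \<partial>(lborel \<Otimes>\<^sub>M lborel)) = box_ekernel R x y"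
proof -
  define d where "d = \<bar>x - y\<bar>"
  have d0: "d \<ge> 0" by (simp add: d_def)
  have inner: "(\<integral>\<^sup>+u. ennreal (box_ind x (r, u) * box_ind y (r, u)) * indicator {p. fst p < R} (r, u) \<partial>lborel)
    = ennreal ((r - d) / r\<^sup>2) * indicator {d<..<R} r" for r
  proof (cases "0 < r \<and> r < R")
    case True
    have "(\<integral>\<^sup>+u. ennreal (box_ind x (r, u) * box_ind y (r, u)) * indicator {p. fst p < R} (r, u) \<partial>lborel)
      = (\<integral>\<^sup>+u. ennreal (1 / r\<^sup>2) * indicator {max x y - r..<min x y} u \<partial>lborel)"
      using True by (intro nn_integral_cong) (auto simp: box_ind_def power2_eq_square split: split_indicator)
    also have "\<dots> = ennreal (1 / r\<^sup>2) * emeasure lborel {max x y - r..<min x y}"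
      by (subst nn_integral_cmult_indicator) auto
    also have "\<dots> = ennreal ((r - d) / r\<^sup>2) * indicator {d<..<R} r"
    proof (cases "d < r")
      case True
      have "emeasure lborel {max x y - r..<min x y} = ennreal (r - d)"
      proof -
        have "min x y - (max x y - r) = r - d" by (simp add: d_def min_def max_def)
        moreover from this have "max x y - r \<le> min x y" using True by linarith
        ultimately show ?thesis by (metis emeasure_lborel_Ico)
      qed
      then show ?thesis using True \<open>0 < r \<and> r < R\<close> by (simp add: ennreal_mult'[symmetric])
    next
      case False
      then have e: "{max x y - r..<min x y} = {}" by (auto simp: d_def)
      show ?thesis unfolding e using False by simp
    qed
    finally show ?thesis .
  next
    case False
    then show ?thesis using d0 by (auto simp: box_ind_def split: split_indicator)
  qed
  have "(\<integral>\<^sup>+p. ennreal (box_ind x p * box_ind y p) * indicator {p. fst p < R} p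
     \<partial>(lborel \<Otimes>\<^sub>M lborel)) = (\<integral>\<^sup>+r. \<integral>\<^sup>+u. ennreal (box_ind x (r, u) * box_ind y (r, u)) * indicator {p. fst p < R} (r, u) \<partial>lborel \<partial>lborel)"
  proof (rule lborel.nn_integral_fst[symmetric])
    have "(\<lambda>p. ennreal (box_ind x p * box_ind y p) * indicator {p. fst p < R} p) \<in> borel_measurable borel"
      by measurable
    then show "(\<lambda>p. ennreal (box_ind x p * box_ind y p) * indicator {p. fst p < R} p) \<in> borel_measurable (lborel \<Otimes>\<^sub>M lborel)"
      by (simp add: lborel_prod)
  qed
  also have "\<dots> = (\<integral>\<^sup>+r. ennreal ((r - d) / r\<^sup>2) * indicator {d<..<R} r \<partial>lborel)"
    unfolding inner ..
  also have "\<dots> = box_ekernel R x y"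
  proof (cases "d = 0")
    case False
    then have d: "d > 0" using d0 by simp
    show ?thesis
    proof (cases "d < R")
      case True
      have "(\<integral>\<^sup>+r. ennreal ((r - d) / r\<^sup>2) * indicator {d<..<R} r \<partial>lborel) =
        (\<integral>\<^sup>+r. ennreal ((r - d) / r\<^sup>2) * indicator {d..R} r \<partial>lborel)"
      proof (rule nn_integral_cong_AE)
        show "AE r in lborel. ennreal ((r - d) / r\<^sup>2) * indicator {d<..<R} r = ennreal ((r - d) / r\<^sup>2) * indicator {d..R} r"
          using AE_lborel_singleton[of R] AE_lborel_singleton[of d]
          by eventually_elim (auto split: split_indicator)
      qed
      also have "\<dots> = ennreal ((ln R + d / R) - (ln d + d / d))"
      proof (rule nn_integral_FTC_Icc)
        fix r assume r: "r \<in> {d..R}"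
        then have "r > 0" using d by auto
        then show "((\<lambda>r. ln r + d / r) has_real_derivative (r - d) / r\<^sup>2) (at r)"
          by (auto intro!: derivative_eq_intros simp: power2_eq_square field_simps)
        show "0 \<le> (r - d) / r\<^sup>2" using r by simp
      qed (use True in auto)
      also have "\<dots> = box_ekernel R x y"
        using d True R by (auto simp: box_ekernel_def box_kernel_def d_def ln_div algebra_simps)
      finally show ?thesis .
    next
      case F: False
      then have "{d<..<R} = {}" by auto
      then show ?thesis using F d by (auto simp: box_ekernel_def box_kernel_def d_def)
    qed
  next
    case True
    then have xy: "x = y" by (simp add: d_def)
    have "(\<integral>\<^sup>+r. ennreal ((r - d) / r\<^sup>2) * indicator {d<..<R} r \<partial>lborel) \<ge> ennreal (real n)" for n
    proof -
      (* the part of the integral between a and R already equals n *)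
      define a where "a = R * exp (- real n)"
      have a: "0 < a" "a \<le> R" using R by (auto simp: a_def)
      have "ennreal (ln R - ln a) = (\<integral>\<^sup>+r. ennreal (1 / r) * indicator {a..R} r \<partial>lborel)"
      proof (rule nn_integral_FTC_Icc[symmetric])
        fix r assume r: "r \<in> {a..R}"
        then have "r > 0" using a by auto
        then show "(ln has_real_derivative 1 / r) (at r)"
          by (auto intro!: derivative_eq_intros)
        show "0 \<le> 1 / r" using \<open>r > 0\<close> by simp
      qed (use a in auto)
      also have "\<dots> \<le> (\<integral>\<^sup>+r. ennreal ((r - d) / r\<^sup>2) * indicator {d<..<R} r \<partial>lborel)"
      proof (rule nn_integral_mono_AE)
        show "AE r in lborel. ennreal (1 / r) * indicator {a..R} r \<le> ennreal ((r - d) / r\<^sup>2) * indicator {d<..<R} r"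
          using AE_lborel_singleton[of R]
          by eventually_elim (use True a in \<open>auto split: split_indicator simp: power2_eq_square\<close>)
      qed
      also have "ln R - ln a = real n" using R by (simp add: a_def ln_mult)
      finally show ?thesis .
    qed
    then have "(\<integral>\<^sup>+r. ennreal ((r - d) / r\<^sup>2) * indicator {d<..<R} r \<partial>lborel) = top"
      by (metis ennreal_of_nat_eq_real_of_nat linorder_not_le ennreal_Ex_less_of_nat less_top)
    then show ?thesis using xy by (simp add: box_ekernel_def)
  qed
  finally show ?thesis .
qed

lemma boxfn_measurable[measurable]:
  assumes "finite_borel_measure \<mu>"
  shows "boxfn \<mu> \<in> borel_measurable borel"
proof -
  interpret finite_borel_measure \<mu> by fact
  note [measurable_cong] = M_is_borel
  have [measurable]: "(\<lambda>p. measure \<mu> {snd p<..snd p + fst p}) \<in> borel_measurable (borel \<Otimes>\<^sub>M borel)"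
  proof (rule measurable_measure[where N = "borel \<Otimes>\<^sub>M borel"])
    have "{x \<in> space ((borel \<Otimes>\<^sub>M borel) \<Otimes>\<^sub>M \<mu>). snd (fst x) < snd x \<and> snd x \<le> snd (fst x) + fst (fst x)} \<in> sets ((borel \<Otimes>\<^sub>M borel) \<Otimes>\<^sub>M \<mu> :: ((real \<times> real) \<times> real) measure)"
      by measurable
    also have "{x \<in> space ((borel \<Otimes>\<^sub>M borel) \<Otimes>\<^sub>M \<mu>). snd (fst x) < snd x \<and> snd x \<le> snd (fst x) + fst (fst x)} =
      {x \<in> space ((borel \<Otimes>\<^sub>M borel) \<Otimes>\<^sub>M \<mu>). snd x \<in> {snd (fst x)<..snd (fst x) + fst (fst x)}}"
      by auto
    finally show "{x \<in> space ((borel \<Otimes>\<^sub>M borel) \<Otimes>\<^sub>M \<mu>). snd x \<in> {snd (fst x)<..snd (fst x) + fst (fst x)}} \<in> sets ((borel \<Otimes>\<^sub>M borel) \<Otimes>\<^sub>M \<mu>)" .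
  qed (use borel_UNIV in auto)
  have "boxfn \<mu> \<in> borel_measurable (borel \<Otimes>\<^sub>M borel)" unfolding boxfn_def by measurable
  then show ?thesis by (simp add: borel_prod)
qed

lemma boxfn_nonneg: "0 \<le> boxfn \<mu> p"
  by (simp add: boxfn_def)

lemma boxfn_nn_integral:
  assumes "finite_borel_measure \<mu>"
  shows "ennreal (boxfn \<mu> p) = (\<integral>\<^sup>+x. ennreal (box_ind x p) \<partial>\<mu>)"
proof -
  interpret finite_borel_measure \<mu> by fact
  show ?thesis
  proof (cases "fst p > 0")
    case True
    have "(\<integral>\<^sup>+x. ennreal (box_ind x p) \<partial>\<mu>) = (\<integral>\<^sup>+x. ennreal (1 / fst p) * indicator {snd p<..snd p + fst p} x \<partial>\<mu>)"
      using True by (intro nn_integral_cong) (auto simp: box_ind_def split: split_indicator)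
    also have "\<dots> = ennreal (1 / fst p) * emeasure \<mu> {snd p<..snd p + fst p}"
      by (subst nn_integral_cmult_indicator) (auto simp: M_is_borel)
    also have "\<dots> = ennreal (boxfn \<mu> p)"
      using True by (simp add: emeasure_eq_measure ennreal_mult'[symmetric] boxfn_def)
    finally show ?thesis ..
  qed (simp add: boxfn_def box_ind_def)
qed

text \<open>Fubini's theorem, applied to \<open>boxfn \<mu> p = \<integral> box_ind x p d\<mu>(x)\<close> in both factors.\<close>
lemma nn_integral_boxfn:
  assumes "finite_borel_measure \<alpha>" "finite_borel_measure \<beta>" "R > 0"
  shows "(\<integral>\<^sup>+p. ennreal (boxfn \<alpha> p * boxfn \<beta> p) * indicator {p. fst p < R} p \<partial>lborel)
    = (\<integral>\<^sup>+x. \<integral>\<^sup>+y. box_ekernel R x y \<partial>\<beta> \<partial>\<alpha>)"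
proof -
  interpret a: finite_borel_measure \<alpha> by fact
  interpret b: finite_borel_measure \<beta> by fact
  note [measurable_cong] = a.M_is_borel b.M_is_borel
  interpret pa: pair_sigma_finite "lborel :: (real \<times> real) measure" \<alpha> by unfold_locales
  interpret pb: pair_sigma_finite "lborel :: (real \<times> real) measure" \<beta> by unfold_locales
  let ?I = "indicator {p. fst p < R} :: real \<times> real \<Rightarrow> ennreal"
  have "(\<integral>\<^sup>+p. ennreal (boxfn \<alpha> p * boxfn \<beta> p) * ?I p \<partial>lborel) =
    (\<integral>\<^sup>+p. \<integral>\<^sup>+x. \<integral>\<^sup>+y. ennreal (box_ind x p * box_ind y p) * ?I p \<partial>\<beta> \<partial>\<alpha> \<partial>lborel)"
  proof (rule nn_integral_cong)
    fix p :: "real \<times> real"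
    have "(\<integral>\<^sup>+y. ennreal (box_ind x p * box_ind y p) * ?I p \<partial>\<beta>) = ennreal (box_ind x p) * (ennreal (boxfn \<beta> p) * ?I p)" for x
    proof -
      have "(\<integral>\<^sup>+y. ennreal (box_ind x p * box_ind y p) * ?I p \<partial>\<beta>) = (\<integral>\<^sup>+y. (ennreal (box_ind x p) * ?I p) * ennreal (box_ind y p) \<partial>\<beta>)"
        by (simp add: ennreal_mult box_ind_nonneg mult_ac)
      also have "\<dots> = (ennreal (box_ind x p) * ?I p) * ennreal (boxfn \<beta> p)"
        by (subst nn_integral_cmult) (auto simp: boxfn_nn_integral[OF assms(2)])
      finally show ?thesis by (simp add: mult_ac)
    qed
    then have "(\<integral>\<^sup>+x. \<integral>\<^sup>+y. ennreal (box_ind x p * box_ind y p) * ?I p \<partial>\<beta> \<partial>\<alpha>) =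
      (\<integral>\<^sup>+x. ennreal (box_ind x p) * (ennreal (boxfn \<beta> p) * ?I p) \<partial>\<alpha>)" by simp
    also have "\<dots> = ennreal (boxfn \<alpha> p) * (ennreal (boxfn \<beta> p) * ?I p)"
      by (subst nn_integral_multc) (auto simp: boxfn_nn_integral[OF assms(1)])
    finally show "ennreal (boxfn \<alpha> p * boxfn \<beta> p) * ?I p =
      (\<integral>\<^sup>+x. \<integral>\<^sup>+y. ennreal (box_ind x p * box_ind y p) * ?I p \<partial>\<beta> \<partial>\<alpha>)"
      by (simp add: ennreal_mult boxfn_nonneg mult_ac)
  qed
  also have "\<dots> = (\<integral>\<^sup>+x. \<integral>\<^sup>+p. \<integral>\<^sup>+y. ennreal (box_ind x p * box_ind y p) * ?I p \<partial>\<beta> \<partial>lborel \<partial>\<alpha>)"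
    by (rule pa.Fubini'[symmetric]) measurable
  also have "\<dots> = (\<integral>\<^sup>+x. \<integral>\<^sup>+y. \<integral>\<^sup>+p. ennreal (box_ind x p * box_ind y p) * ?I p \<partial>lborel \<partial>\<beta> \<partial>\<alpha>)"
    by (rule nn_integral_cong, rule pb.Fubini'[symmetric]) measurable
  also have "\<dots> = (\<integral>\<^sup>+x. \<integral>\<^sup>+y. box_ekernel R x y \<partial>\<beta> \<partial>\<alpha>)"
    using nn_integral_box_ind[OF assms(3)] by (simp add: lborel_prod)
  finally show ?thesis .
qed

text \<open>Only boxes of length less than one enter.  This controls the singularity of the kernel and, unlike
  finiteness of the logarithmic energy, requires nothing of the measure near infinity.\<close>
definition local_energy :: "real measure \<Rightarrow> bool" where
  "local_energy \<mu> \<longleftrightarrow> finite_borel_measure \<mu> \<and>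
     (\<integral>\<^sup>+p. ennreal ((boxfn \<mu> p)\<^sup>2) * indicator {p. fst p < 1} p \<partial>lborel) < \<infinity>"

lemma local_energyD: "local_energy \<mu> \<Longrightarrow> finite_borel_measure \<mu>"
  by (simp add: local_energy_def)

lemma local_energy_iff:
  assumes "finite_borel_measure \<mu>"
  shows "local_energy \<mu> \<longleftrightarrow> (\<integral>\<^sup>+x. \<integral>\<^sup>+y. box_ekernel 1 x y \<partial>\<mu> \<partial>\<mu>) < \<infinity>"
  unfolding local_energy_def using assms nn_integral_boxfn[OF assms assms, of 1]
  by (simp add: power2_eq_square)

lemma box_kernel_le:
  assumes "d > 0" "R \<ge> 1" shows "box_kernel R d \<le> box_kernel 1 d + ln R"
proof -
  consider "d < 1" | "1 \<le> d" "d < R" | "d \<ge> R" by linarith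
  then show ?thesis
  proof cases
    case 1
    have "d / R \<le> d" using assms by (simp add: field_simps mult_left_mono)
    then show ?thesis using 1 assms by (simp add: box_kernel_def ln_div)
  next
    case 2
    have "d / R \<le> 1" "ln d \<ge> 0" using assms 2 by auto
    moreover have "box_kernel R d = ln R - ln d - 1 + d / R" "box_kernel 1 d = 0"
      using 2 assms by (auto simp: box_kernel_def ln_div)
    ultimately show ?thesis by linarith
  next
    case 3
    then show ?thesis using assms by (simp add: box_kernel_def)
  qed
qed

lemma box_ekernel_le: "R \<ge> 1 \<Longrightarrow> box_ekernel R x y \<le> box_ekernel 1 x y + ennreal (ln R)"
  using box_kernel_le[of "\<bar>x - y\<bar>" R]
  by (auto simp: box_ekernel_def box_kernel_nonneg ennreal_plus[symmetric] simp del: ennreal_plus intro!: ennreal_leI)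

text \<open>Mixed energies are finite because \<open>x y \<le> x\<^sup>2 + y\<^sup>2\<close> holds under the integral over boxes;
  enlarging the range of boxes from one to \<open>R\<close> adds at most \<open>ln R\<close> to the kernel.\<close>
lemma box_ekernel_cross_finite:
  assumes a: "local_energy \<alpha>" and b: "local_energy \<beta>" and R: "R \<ge> 1"
  shows "(\<integral>\<^sup>+x. \<integral>\<^sup>+y. box_ekernel R x y \<partial>\<beta> \<partial>\<alpha>) < \<infinity>"
proof -
  note fa = local_energyD[OF a] and fb = local_energyD[OF b]
  interpret a: finite_borel_measure \<alpha> by fact
  interpret b: finite_borel_measure \<beta> by fact
  note [measurable_cong] = a.M_is_borel b.M_is_borel
  note [measurable] = boxfn_measurable[OF fa] boxfn_measurable[OF fb]
  let ?I = "indicator {p. fst p < 1} :: real \<times> real \<Rightarrow> ennreal"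
  have "(\<integral>\<^sup>+x. \<integral>\<^sup>+y. box_ekernel 1 x y \<partial>\<beta> \<partial>\<alpha>) = (\<integral>\<^sup>+p. ennreal (boxfn \<alpha> p * boxfn \<beta> p) * ?I p \<partial>lborel)"
    by (rule nn_integral_boxfn[symmetric]) (use fa fb in auto)
  also have "\<dots> \<le> (\<integral>\<^sup>+p. ennreal ((boxfn \<alpha> p)\<^sup>2) * ?I p + ennreal ((boxfn \<beta> p)\<^sup>2) * ?I p \<partial>lborel)"
  proof (rule nn_integral_mono)
    fix p
    have "boxfn \<alpha> p * boxfn \<beta> p \<le> (boxfn \<alpha> p)\<^sup>2 + (boxfn \<beta> p)\<^sup>2"
      using sum_squares_bound[of "boxfn \<alpha> p" "boxfn \<beta> p"]
        mult_nonneg_nonneg[OF boxfn_nonneg[of \<alpha> p] boxfn_nonneg[of \<beta> p]]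
      by linarith
    then show "ennreal (boxfn \<alpha> p * boxfn \<beta> p) * ?I p \<le> ennreal ((boxfn \<alpha> p)\<^sup>2) * ?I p + ennreal ((boxfn \<beta> p)\<^sup>2) * ?I p"
      by (auto simp: ennreal_plus[symmetric] simp del: ennreal_plus intro!: ennreal_leI split: split_indicator)
  qed
  also have "\<dots> = (\<integral>\<^sup>+p. ennreal ((boxfn \<alpha> p)\<^sup>2) * ?I p \<partial>lborel) + (\<integral>\<^sup>+p. ennreal ((boxfn \<beta> p)\<^sup>2) * ?I p \<partial>lborel)"
    by (rule nn_integral_add) measurable
  also have "\<dots> < \<infinity>" using a b by (auto simp: local_energy_def)
  finally have 1: "(\<integral>\<^sup>+x. \<integral>\<^sup>+y. box_ekernel 1 x y \<partial>\<beta> \<partial>\<alpha>) < \<infinity>" .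
  have "(\<integral>\<^sup>+x. \<integral>\<^sup>+y. box_ekernel R x y \<partial>\<beta> \<partial>\<alpha>) \<le> (\<integral>\<^sup>+x. \<integral>\<^sup>+y. (box_ekernel 1 x y + ennreal (ln R)) \<partial>\<beta> \<partial>\<alpha>)"
    by (intro nn_integral_mono box_ekernel_le R)
  also have "\<dots> = (\<integral>\<^sup>+x. \<integral>\<^sup>+y. box_ekernel 1 x y \<partial>\<beta> \<partial>\<alpha>) + ennreal (ln R) * emeasure \<beta> UNIV * emeasure \<alpha> UNIV"
    by (simp add: nn_integral_add a.borel_UNIV b.borel_UNIV)
  also have "\<dots> < \<infinity>"
    using 1 a.emeasure_finite[of UNIV] b.emeasure_finite[of UNIV]
    by (auto simp: less_top[symmetric] ennreal_mult_eq_top_iff)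
  finally show ?thesis .
qed

lemma box_kernel_integrable:
  assumes a: "local_energy \<alpha>" and b: "local_energy \<beta>" and R: "R \<ge> 1"
  shows "AE p in \<alpha> \<Otimes>\<^sub>M \<beta>. fst p \<noteq> snd p"
    and "integrable (\<alpha> \<Otimes>\<^sub>M \<beta>) (\<lambda>(x, y). box_kernel R \<bar>x - y\<bar>)"
    and "(\<integral>\<^sup>+p. ennreal (boxfn \<alpha> p * boxfn \<beta> p) * indicator {p. fst p < R} p \<partial>lborel) =
       ennreal (\<integral>(x, y). box_kernel R \<bar>x - y\<bar> \<partial>(\<alpha> \<Otimes>\<^sub>M \<beta>))"
proof -
  note fa = local_energyD[OF a] and fb = local_energyD[OF b]
  interpret a: finite_borel_measure \<alpha> by fact
  interpret b: finite_borel_measure \<beta> by fact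
  note [measurable_cong] = a.M_is_borel b.M_is_borel
  interpret pair_sigma_finite \<alpha> \<beta> by unfold_locales
  have eq: "(\<integral>\<^sup>+p. box_ekernel R (fst p) (snd p) \<partial>(\<alpha> \<Otimes>\<^sub>M \<beta>)) = (\<integral>\<^sup>+x. \<integral>\<^sup>+y. box_ekernel R x y \<partial>\<beta> \<partial>\<alpha>)"
    by (subst b.nn_integral_fst[symmetric]) (auto simp: split_def)
  then have fin: "(\<integral>\<^sup>+p. box_ekernel R (fst p) (snd p) \<partial>(\<alpha> \<Otimes>\<^sub>M \<beta>)) < \<infinity>"
    using box_ekernel_cross_finite[OF a b R] by simp
  have "AE p in \<alpha> \<Otimes>\<^sub>M \<beta>. box_ekernel R (fst p) (snd p) \<noteq> \<infinity>"
    by (rule nn_integral_PInf_AE) (use fin in auto)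
  then show ae: "AE p in \<alpha> \<Otimes>\<^sub>M \<beta>. fst p \<noteq> snd p"
    by eventually_elim (auto simp: box_ekernel_def)
  have pos: "AE p in \<alpha> \<Otimes>\<^sub>M \<beta>. 0 \<le> (\<lambda>(x, y). box_kernel R \<bar>x - y\<bar>) p"
    using ae by eventually_elim (use R in \<open>auto intro!: box_kernel_nonneg\<close>)
  have eq2: "(\<integral>\<^sup>+p. ennreal ((\<lambda>(x, y). box_kernel R \<bar>x - y\<bar>) p) \<partial>(\<alpha> \<Otimes>\<^sub>M \<beta>)) = (\<integral>\<^sup>+p. box_ekernel R (fst p) (snd p) \<partial>(\<alpha> \<Otimes>\<^sub>M \<beta>))"
    by (rule nn_integral_cong_AE, use ae in eventually_elim) (auto simp: box_ekernel_def)
  show i: "integrable (\<alpha> \<Otimes>\<^sub>M \<beta>) (\<lambda>(x, y). box_kernel R \<bar>x - y\<bar>)"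
    by (rule integrableI_nonneg) (use pos fin eq2 in auto)
  show "(\<integral>\<^sup>+p. ennreal (boxfn \<alpha> p * boxfn \<beta> p) * indicator {p. fst p < R} p \<partial>lborel) =
       ennreal (\<integral>(x, y). box_kernel R \<bar>x - y\<bar> \<partial>(\<alpha> \<Otimes>\<^sub>M \<beta>))"
    using nn_integral_eq_integral[OF i pos] nn_integral_boxfn[OF fa fb] eq eq2 R by simp
qed

lemma boxfn_product_integral:
  assumes a: "local_energy \<alpha>" and b: "local_energy \<beta>" and R: "R \<ge> 1"
  shows "has_bochner_integral lborel (\<lambda>p. boxfn \<alpha> p * boxfn \<beta> p * indicator {p. fst p < R} p)
     (\<integral>(x, y). box_kernel R \<bar>x - y\<bar> \<partial>(\<alpha> \<Otimes>\<^sub>M \<beta>))"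
proof (rule has_bochner_integral_nn_integral)
  note [measurable] = boxfn_measurable[OF local_energyD[OF a]] boxfn_measurable[OF local_energyD[OF b]]
  show "(\<lambda>p. boxfn \<alpha> p * boxfn \<beta> p * indicator {p. fst p < R} p) \<in> borel_measurable lborel" by measurable
  show "AE p in lborel. 0 \<le> boxfn \<alpha> p * boxfn \<beta> p * indicator {p. fst p < R} p"
    by (auto simp: boxfn_nonneg)
  show "0 \<le> (\<integral>(x, y). box_kernel R \<bar>x - y\<bar> \<partial>(\<alpha> \<Otimes>\<^sub>M \<beta>))"
    using box_kernel_integrable(1)[OF a b R] R
    by (intro integral_nonneg_AE) (auto elim!: eventually_mono intro!: box_kernel_nonneg)
  have "(\<integral>\<^sup>+p. ennreal (boxfn \<alpha> p * boxfn \<beta> p * indicator {p. fst p < R} p) \<partial>lborel) =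
    (\<integral>\<^sup>+p. ennreal (boxfn \<alpha> p * boxfn \<beta> p) * indicator {p. fst p < R} p \<partial>lborel)"
    by (rule nn_integral_cong) (auto split: split_indicator)
  then show "(\<integral>\<^sup>+p. ennreal (boxfn \<alpha> p * boxfn \<beta> p * indicator {p. fst p < R} p) \<partial>lborel) =
    ennreal (\<integral>(x, y). box_kernel R \<bar>x - y\<bar> \<partial>(\<alpha> \<Otimes>\<^sub>M \<beta>))"
    using box_kernel_integrable(3)[OF a b R] by simp
qed

section \<open>Measures of finite logarithmic energy\<close>

text \<open>Finite logarithmic energy together with a finite logarithmic moment.  The condition on short boxes
  suffices, since the moment controls the kernel at large distances; see \<open>fin_energy_iff\<close>.\<close>
definition fin_energy :: "real measure \<Rightarrow> bool" where
  "fin_energy \<mu> \<longleftrightarrow> local_energy \<mu> \<and> (\<integral>\<^sup>+x. ennreal (ln (1 + x\<^sup>2)) \<partial>\<mu>) < \<infinity>"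

definition energy :: "real measure \<Rightarrow> real measure \<Rightarrow> real" where
  "energy \<alpha> \<beta> = (\<integral>(x, y). - ln \<bar>x - y\<bar> \<partial>(\<alpha> \<Otimes>\<^sub>M \<beta>))"

text \<open>Since \<open>ln 0 = 0\<close> here, an atom at \<open>x\<close> itself would contribute nothing; the function is the potential
  only at points that carry no mass and where the kernel is integrable.\<close>
definition pot :: "real measure \<Rightarrow> real \<Rightarrow> real" where
  "pot \<mu> x = (\<integral>y. - ln \<bar>x - y\<bar> \<partial>\<mu>)"

lemma ln_one_plus_sq_nonneg: "0 \<le> ln (1 + x\<^sup>2 :: real)"
  by simp

lemma fin_energyD:
  assumes "fin_energy \<mu>"
  shows "finite_borel_measure \<mu>" "local_energy \<mu>" "integrable \<mu> (\<lambda>x. ln (1 + x\<^sup>2))"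
proof -
  show l: "local_energy \<mu>" and f: "finite_borel_measure \<mu>"
    using assms by (auto simp: fin_energy_def local_energyD)
  interpret finite_borel_measure \<mu> by fact
  note [measurable_cong] = M_is_borel
  show "integrable \<mu> (\<lambda>x. ln (1 + x\<^sup>2))"
    using assms by (intro integrableI_nonneg) (auto simp: fin_energy_def)
qed

text \<open>The Cauchy-Schwarz inequality in the form \<open>\<bar>x - y\<bar>\<^sup>2 \<le> (1 + x\<^sup>2) (1 + y\<^sup>2)\<close>.\<close>
lemma ln_dist_le: "ln \<bar>x - y\<bar> \<le> (ln (1 + x\<^sup>2) + ln (1 + y\<^sup>2)) / (2 :: real)"
proof (cases "x = y")
  case False
  have "\<bar>x - y\<bar>\<^sup>2 \<le> (1 + x\<^sup>2) * (1 + y\<^sup>2)"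
    using zero_le_power2[of "1 + x * y"] by (simp add: power2_eq_square algebra_simps)
  then have "ln (\<bar>x - y\<bar>\<^sup>2) \<le> ln ((1 + x\<^sup>2) * (1 + y\<^sup>2))"
    using False by (subst ln_le_cancel_iff) (auto intro!: mult_pos_pos add_pos_nonneg)
  also have "\<dots> = ln (1 + x\<^sup>2) + ln (1 + y\<^sup>2)"
    by (rule ln_mult_pos) (auto intro!: add_pos_nonneg)
  also have "ln (\<bar>x - y\<bar>\<^sup>2) = 2 * ln \<bar>x - y\<bar>"
    using False by (subst ln_realpow) auto
  finally show ?thesis by simp
qed simp

lemma abs_ln_dist_le:
  assumes "x \<noteq> y"
  shows "\<bar>ln \<bar>x - y\<bar>\<bar> \<le> box_kernel 1 \<bar>x - y\<bar> + 1 + (ln (1 + x\<^sup>2) + ln (1 + y\<^sup>2)) / (2 :: real)"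
proof (cases "\<bar>x - y\<bar> < 1")
  case True
  then show ?thesis using assms ln_one_plus_sq_nonneg[of x] ln_one_plus_sq_nonneg[of y]
    by (simp add: box_kernel_def ln_div)
next
  case False
  then have "ln \<bar>x - y\<bar> \<ge> 0" by simp
  moreover have "box_kernel 1 \<bar>x - y\<bar> = 0" using False by (simp add: box_kernel_def)
  ultimately show ?thesis using ln_dist_le[of x y] by linarith
qed

lemma integrable_pair_left:
  fixes f :: "real \<Rightarrow> real"
  assumes "finite_borel_measure \<alpha>" "finite_borel_measure \<beta>" and f: "integrable \<alpha> f"
  shows "integrable (\<alpha> \<Otimes>\<^sub>M \<beta>) (\<lambda>p. f (fst p))"
proof -
  interpret a: finite_borel_measure \<alpha> by fact
  interpret b: finite_borel_measure \<beta> by fact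
  interpret pair_sigma_finite \<alpha> \<beta> by unfold_locales
  have [measurable]: "f \<in> borel_measurable \<alpha>" using f by simp
  show ?thesis
    by (rule Fubini_integrable) (use f in \<open>auto intro!: integrable_mult_right integrable_norm\<close>)
qed

lemma integrable_pair_right:
  fixes f :: "real \<Rightarrow> real"
  assumes "finite_borel_measure \<alpha>" "finite_borel_measure \<beta>" and f: "integrable \<beta> f"
  shows "integrable (\<alpha> \<Otimes>\<^sub>M \<beta>) (\<lambda>p. f (snd p))"
proof -
  interpret a: finite_borel_measure \<alpha> by fact
  interpret b: finite_borel_measure \<beta> by fact
  interpret pair_sigma_finite \<beta> \<alpha> by unfold_locales
  show ?thesis
    using integrable_product_swap[OF integrable_pair_left[OF assms(2,1) f]] by (simp add: split_def)
qed

lemma log_kernel_integrable: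
  assumes a: "fin_energy \<alpha>" and b: "fin_energy \<beta>"
  shows "integrable (\<alpha> \<Otimes>\<^sub>M \<beta>) (\<lambda>(x, y). - ln \<bar>x - y\<bar>)"
    and "AE p in \<alpha> \<Otimes>\<^sub>M \<beta>. fst p \<noteq> snd p"
proof -
  interpret a: finite_borel_measure \<alpha> using fin_energyD[OF a] by simp
  interpret b: finite_borel_measure \<beta> using fin_energyD[OF b] by simp
  note [measurable_cong] = a.M_is_borel b.M_is_borel
  interpret pair_sigma_finite \<alpha> \<beta> by unfold_locales
  interpret finite_measure "\<alpha> \<Otimes>\<^sub>M \<beta>" using b.finite_measure_axioms a.finite_measure_axioms
    by (rule finite_measure_pair_measure)
  show ae: "AE p in \<alpha> \<Otimes>\<^sub>M \<beta>. fst p \<noteq> snd p"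
    using box_kernel_integrable(1)[OF fin_energyD(2)[OF a] fin_energyD(2)[OF b], of 1] by simp
  have i: "integrable (\<alpha> \<Otimes>\<^sub>M \<beta>) (\<lambda>p. box_kernel 1 \<bar>fst p - snd p\<bar>)"
    using box_kernel_integrable(2)[OF fin_energyD(2)[OF a] fin_energyD(2)[OF b], of 1] by (simp add: split_def)
  show "integrable (\<alpha> \<Otimes>\<^sub>M \<beta>) (\<lambda>(x, y). - ln \<bar>x - y\<bar>)"
  proof (rule Bochner_Integration.integrable_bound)
    show "integrable (\<alpha> \<Otimes>\<^sub>M \<beta>) (\<lambda>p. box_kernel 1 \<bar>fst p - snd p\<bar> + 1 +
       (ln (1 + (fst p)\<^sup>2) + ln (1 + (snd p)\<^sup>2)) / 2)"
      using i integrable_pair_left[OF fin_energyD(1)[OF a] fin_energyD(1)[OF b] fin_energyD(3)[OF a]]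
        integrable_pair_right[OF fin_energyD(1)[OF a] fin_energyD(1)[OF b] fin_energyD(3)[OF b]]
      by (intro Bochner_Integration.integrable_add integrable_divide) auto
    show "AE p in \<alpha> \<Otimes>\<^sub>M \<beta>. norm (case p of (x, y) \<Rightarrow> - ln \<bar>x - y\<bar>) \<le>
      norm (box_kernel 1 \<bar>fst p - snd p\<bar> + 1 + (ln (1 + (fst p)\<^sup>2) + ln (1 + (snd p)\<^sup>2)) / 2)"
      using ae
    proof eventually_elim
      case (elim p)
      then show ?case using abs_ln_dist_le[of "fst p" "snd p"] by (auto simp: split_def)
    qed
  qed measurable
qed

lemma energy_eq_integral_pot:
  assumes a: "fin_energy \<alpha>" and b: "fin_energy \<beta>"
  shows "integrable \<alpha> (pot \<beta>)" "energy \<alpha> \<beta> = (\<integral>x. pot \<beta> x \<partial>\<alpha>)"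
    "AE x in \<alpha>. integrable \<beta> (\<lambda>y. - ln \<bar>x - y\<bar>)"
proof -
  interpret a: finite_borel_measure \<alpha> using fin_energyD[OF a] by simp
  interpret b: finite_borel_measure \<beta> using fin_energyD[OF b] by simp
  interpret pair_sigma_finite \<alpha> \<beta> by unfold_locales
  have i: "integrable (\<alpha> \<Otimes>\<^sub>M \<beta>) (case_prod (\<lambda>x y. - ln \<bar>x - y\<bar>))"
    using log_kernel_integrable(1)[OF a b] by simp
  show "integrable \<alpha> (pot \<beta>)" using integrable_fst[OF i] by (simp add: pot_def[abs_def])
  show "energy \<alpha> \<beta> = (\<integral>x. pot \<beta> x \<partial>\<alpha>)" using integral_fst[OF i] by (simp add: pot_def[abs_def] energy_def)
  show "AE x in \<alpha>. integrable \<beta> (\<lambda>y. - ln \<bar>x - y\<bar>)" using AE_integrable_fst[OF i] .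
qed

lemma energy_commute:
  assumes a: "fin_energy \<alpha>" and b: "fin_energy \<beta>"
  shows "energy \<alpha> \<beta> = energy \<beta> \<alpha>"
proof -
  interpret a: finite_borel_measure \<alpha> using fin_energyD[OF a] by simp
  interpret b: finite_borel_measure \<beta> using fin_energyD[OF b] by simp
  interpret pair_sigma_finite \<alpha> \<beta> by unfold_locales
  show ?thesis
    using integral_product_swap[OF borel_measurable_integrable[OF log_kernel_integrable(1)[OF a b]]]
    by (simp add: energy_def split_def abs_minus_commute)
qed

lemma AE_no_atom:
  assumes a: "fin_energy \<alpha>" and b: "fin_energy \<beta>"
  shows "AE x in \<alpha>. measure \<beta> {x} = 0"
proof -
  interpret a: finite_borel_measure \<alpha> using fin_energyD[OF a] by simp
  interpret b: finite_borel_measure \<beta> using fin_energyD[OF b] by simp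
  note [measurable_cong] = a.M_is_borel b.M_is_borel
  interpret pair_sigma_finite \<alpha> \<beta> by unfold_locales
  have "AE p in \<alpha> \<Otimes>\<^sub>M \<beta>. (case p of (x, y) \<Rightarrow> x \<noteq> y)"
    using log_kernel_integrable(2)[OF a b] by (simp add: split_def)
  then have "AE x in \<alpha>. AE y in \<beta>. x \<noteq> y"
    by (rule AE_pair[of "\<lambda>p. case p of (x, y) \<Rightarrow> x \<noteq> y", simplified])
  then show ?thesis
  proof eventually_elim
    case (elim x)
    then have "emeasure \<beta> {x} = 0"
      using AE_iff_measurable[of "{x}" \<beta> "\<lambda>y. x \<noteq> y"] b.M_is_borel b.borel_UNIV by auto
    then show ?case by (simp add: measure_def)
  qed
qed

lemma fin_energy_no_atom:
  assumes b: "fin_energy \<beta>" shows "measure \<beta> {x} = 0"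
proof (rule ccontr)
  interpret b: finite_borel_measure \<beta> using fin_energyD[OF b] by simp
  assume n: "measure \<beta> {x} \<noteq> 0"
  have "AE y in \<beta>. y \<noteq> x" using AE_no_atom[OF b b] by eventually_elim (use n in auto)
  then have "emeasure \<beta> {x} = 0"
    using AE_iff_measurable[of "{x}" \<beta> "\<lambda>y. y \<noteq> x"] b.M_is_borel b.borel_UNIV by auto
  with n show False by (simp add: measure_def)
qed

lemma log_kernel_measurable[measurable]:
  "(\<lambda>(x, y). log_kernel x y) \<in> borel_measurable (borel \<Otimes>\<^sub>M borel :: (real \<times> real) measure)"
  unfolding log_kernel_def by measurable

lemma mutual_energy_eq:
  assumes a: "fin_energy \<alpha>" and b: "fin_energy \<beta>"
  shows "mutual_energy \<alpha> \<beta> = ereal (energy \<alpha> \<beta>)"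
  unfolding mutual_energy_def energy_def
proof (rule ext_integral_eq_real)
  show "AE p in \<alpha> \<Otimes>\<^sub>M \<beta>. (case p of (x, y) \<Rightarrow> log_kernel x y) = ereal (case p of (x, y) \<Rightarrow> - ln \<bar>x - y\<bar>)"
    using log_kernel_integrable(2)[OF a b]
    by eventually_elim (auto simp: log_kernel_def split_def dist_real_def ln_div)
qed (rule log_kernel_integrable(1)[OF a b])

text \<open>The logarithmic kernel is bounded below by an integrable function, so that finite energy means
  integrability of the kernel; and its absolute value dominates the box kernel of range one.\<close>
lemma fin_energy_iff:
  assumes f: "finite_borel_measure \<mu>"
  shows "finite_energy_log_moment \<mu> \<longleftrightarrow> fin_energy \<mu>"
proof
  assume n: "fin_energy \<mu>"
  then show "finite_energy_log_moment \<mu>"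
    by (simp add: finite_energy_log_moment_def log_energy_def mutual_energy_eq) (simp add: fin_energy_def)
next
  assume e: "finite_energy_log_moment \<mu>"
  interpret a: finite_borel_measure \<mu> by fact
  note [measurable_cong] = a.M_is_borel
  interpret pair_sigma_finite \<mu> \<mu> by unfold_locales
  have lm: "(\<integral>\<^sup>+x. ennreal (ln (1 + x\<^sup>2)) \<partial>\<mu>) < \<infinity>"
    using e by (simp add: finite_energy_log_moment_def)
  then have li: "integrable \<mu> (\<lambda>x. ln (1 + x\<^sup>2))" by (intro integrableI_nonneg) auto
  let ?h = "\<lambda>p. - ((ln (1 + (fst p)\<^sup>2) + ln (1 + (snd p)\<^sup>2)) / 2)"
  let ?k = "\<lambda>(x :: real, y :: real). log_kernel x y"
  have h: "integrable (\<mu> \<Otimes>\<^sub>M \<mu>) ?h"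
    using integrable_pair_left[OF f f li] integrable_pair_right[OF f f li]
    by (intro integrable_minus integrable_divide Bochner_Integration.integrable_add) auto
  have le: "AE p in \<mu> \<Otimes>\<^sub>M \<mu>. ereal (?h p) \<le> ?k p"
  proof (rule AE_I2)
    fix p :: "real \<times> real"
    show "ereal (?h p) \<le> ?k p"
      using ln_dist_le[of "fst p" "snd p"]
      by (auto simp: log_kernel_def split_def dist_real_def ln_div)
  qed
  have fin: "ext_integral (\<mu> \<Otimes>\<^sub>M \<mu>) ?k < \<infinity>"
    using e by (simp add: finite_energy_log_moment_def log_energy_def mutual_energy_def)
  have km: "?k \<in> borel_measurable (\<mu> \<Otimes>\<^sub>M \<mu>)" by measurable
  note r = ext_integral_lt_PInf[OF km h le fin]
  have "(\<integral>\<^sup>+x. \<integral>\<^sup>+y. box_ekernel 1 x y \<partial>\<mu> \<partial>\<mu>) = (\<integral>\<^sup>+p. box_ekernel 1 (fst p) (snd p) \<partial>(\<mu> \<Otimes>\<^sub>M \<mu>))"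
    by (subst a.nn_integral_fst[symmetric]) (auto simp: split_def)
  also have "\<dots> \<le> (\<integral>\<^sup>+p. ennreal (norm (real_of_ereal (?k p))) \<partial>(\<mu> \<Otimes>\<^sub>M \<mu>))"
  proof (rule nn_integral_mono_AE, use r(2) in eventually_elim)
    fix p assume p: "?k p = ereal (real_of_ereal (?k p))"
    then have ne: "fst p \<noteq> snd p" by (auto simp: log_kernel_def split_def)
    have "box_kernel 1 \<bar>fst p - snd p\<bar> \<le> \<bar>ln \<bar>fst p - snd p\<bar>\<bar>"
      using ne by (auto simp: box_kernel_def ln_div)
    then show "box_ekernel 1 (fst p) (snd p) \<le> ennreal (norm (real_of_ereal (?k p)))"
      using ne by (auto simp: box_ekernel_def log_kernel_def split_def dist_real_def ln_div intro!: ennreal_leI)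
  qed
  also have "\<dots> < \<infinity>" using r(1) unfolding integrable_iff_bounded by simp
  finally have "local_energy \<mu>" using local_energy_iff[OF f] by simp
  with lm show "fin_energy \<mu>" by (simp add: fin_energy_def)
qed

section \<open>Energy of a neutral difference\<close>

definition trunc_energy :: "real \<Rightarrow> real measure \<Rightarrow> real measure \<Rightarrow> real" where
  "trunc_energy R \<alpha> \<beta> = (\<integral>(x, y). box_kernel R \<bar>x - y\<bar> \<partial>(\<alpha> \<Otimes>\<^sub>M \<beta>))"

text \<open>Once \<open>ln R - 1\<close> is subtracted, the box kernel of range \<open>R\<close> differs from \<open>- ln d\<close> only by \<open>d / R\<close>
  for \<open>d < R\<close>, and it stays bounded by \<open>\<bar>ln d\<bar> + 1\<close> for all \<open>d\<close>.\<close>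
lemma trunc_energy_tendsto:
  assumes a: "fin_energy \<alpha>" and b: "fin_energy \<beta>"
  shows "(\<lambda>n. trunc_energy (real (Suc n)) \<alpha> \<beta> - (ln (real (Suc n)) - 1) * (measure \<alpha> UNIV * measure \<beta> UNIV))
    \<longlonglongrightarrow> energy \<alpha> \<beta>"
proof -
  interpret a: finite_borel_measure \<alpha> using fin_energyD[OF a] by simp
  interpret b: finite_borel_measure \<beta> using fin_energyD[OF b] by simp
  note [measurable_cong] = a.M_is_borel b.M_is_borel
  interpret pair_sigma_finite \<alpha> \<beta> by unfold_locales
  interpret ab: finite_measure "\<alpha> \<Otimes>\<^sub>M \<beta>" using b.finite_measure_axioms a.finite_measure_axioms
    by (rule finite_measure_pair_measure)
  let ?f = "\<lambda>n p. box_kernel (real (Suc n)) \<bar>fst p - snd p\<bar> - (ln (real (Suc n)) - 1)"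
  have sp: "space (\<alpha> \<Otimes>\<^sub>M \<beta>) = UNIV" by (simp add: space_pair_measure a.borel_UNIV b.borel_UNIV)
  have mm: "measure (\<alpha> \<Otimes>\<^sub>M \<beta>) UNIV = measure \<alpha> UNIV * measure \<beta> UNIV"
    using b.emeasure_pair_measure_Times[of UNIV \<alpha> UNIV] a.borel_UNIV b.borel_UNIV
    by (simp add: measure_def enn2real_mult)
  have 1: "trunc_energy (real (Suc n)) \<alpha> \<beta> - (ln (real (Suc n)) - 1) * (measure \<alpha> UNIV * measure \<beta> UNIV) =
     (\<integral>p. ?f n p \<partial>(\<alpha> \<Otimes>\<^sub>M \<beta>))" for n
  proof -
    have "integrable (\<alpha> \<Otimes>\<^sub>M \<beta>) (\<lambda>p. box_kernel (real (Suc n)) \<bar>fst p - snd p\<bar>)"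
      using box_kernel_integrable(2)[OF fin_energyD(2)[OF a] fin_energyD(2)[OF b], of "real (Suc n)"] by (simp add: split_def)
    then show ?thesis
      unfolding trunc_energy_def by (subst Bochner_Integration.integral_diff) (simp_all add: split_def sp mm mult_ac)
  qed
  have "(\<lambda>n. \<integral>p. ?f n p \<partial>(\<alpha> \<Otimes>\<^sub>M \<beta>)) \<longlonglongrightarrow> (\<integral>p. - ln \<bar>fst p - snd p\<bar> \<partial>(\<alpha> \<Otimes>\<^sub>M \<beta>))"
  proof (rule integral_dominated_convergence)
    show "integrable (\<alpha> \<Otimes>\<^sub>M \<beta>) (\<lambda>p. \<bar>ln \<bar>fst p - snd p\<bar>\<bar> + 1)"
      using integrable_norm[OF log_kernel_integrable(1)[OF a b]] by (auto simp: split_def)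
    show "AE p in \<alpha> \<Otimes>\<^sub>M \<beta>. (\<lambda>n. ?f n p) \<longlonglongrightarrow> - ln \<bar>fst p - snd p\<bar>"
      using log_kernel_integrable(2)[OF a b]
    proof eventually_elim
      case (elim p)
      define d where "d = \<bar>fst p - snd p\<bar>"
      have d: "d > 0" using elim by (simp add: d_def)
      have "(\<lambda>n. - ln d + d / real (Suc n)) \<longlonglongrightarrow> - ln d + 0"
        by (intro tendsto_add tendsto_const) (rule LIMSEQ_Suc, rule lim_const_over_n)
      moreover have "\<forall>\<^sub>F n in sequentially. - ln d + d / real (Suc n) = ?f n p"
        using eventually_gt_at_top[of "nat \<lceil>d\<rceil>"]
      proof eventually_elim
        case (elim n)
        then have "d < real (Suc n)" by linarith
        then show ?case using d unfolding d_def[symmetric] by (simp add: box_kernel_def ln_div)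
      qed
      ultimately show ?case
        unfolding d_def[symmetric] by (simp add: filterlim_cong)
    qed
    fix n
    show "AE p in \<alpha> \<Otimes>\<^sub>M \<beta>. norm (?f n p) \<le> \<bar>ln \<bar>fst p - snd p\<bar>\<bar> + 1"
      using log_kernel_integrable(2)[OF a b]
    proof eventually_elim
      case (elim p)
      define d where "d = \<bar>fst p - snd p\<bar>"
      have d: "d > 0" using elim by (simp add: d_def)
      show ?case
      proof (cases "d < real (Suc n)")
        case True
        then have f: "box_kernel (real (Suc n)) d - (ln (real (Suc n)) - 1) = - ln d + d / real (Suc n)"
          and "d / real (Suc n) \<le> 1" "d / real (Suc n) \<ge> 0"
          using d by (auto simp: box_kernel_def ln_div)
        then show ?thesis unfolding d_def[symmetric] real_norm_def f by linarith
      next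
        case False
        then have f: "box_kernel (real (Suc n)) d = 0"
          and "ln (real (Suc n)) \<le> ln d" "0 \<le> ln (real (Suc n))"
          using d by (auto simp: box_kernel_def)
        then show ?thesis unfolding d_def[symmetric] real_norm_def f by linarith
      qed
    qed
  qed measurable
  then show ?thesis unfolding 1 energy_def by (simp add: split_def)
qed

lemma boxfn_diff_sq_truncated:
  assumes a: "local_energy \<alpha>" and b: "local_energy \<beta>" and R: "R \<ge> 1"
  shows "(\<integral>\<^sup>+p. ennreal ((boxfn \<alpha> p - boxfn \<beta> p)\<^sup>2) * indicator {p. fst p < R} p \<partial>lborel) =
      ennreal (trunc_energy R \<alpha> \<alpha> - 2 * trunc_energy R \<alpha> \<beta> + trunc_energy R \<beta> \<beta>)" (is ?A)
    and "0 \<le> trunc_energy R \<alpha> \<alpha> - 2 * trunc_energy R \<alpha> \<beta> + trunc_energy R \<beta> \<beta>" (is ?B)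
proof -
  note [measurable] = boxfn_measurable[OF local_energyD[OF a]] boxfn_measurable[OF local_energyD[OF b]]
  let ?I = "indicator {p. fst p < R} :: real \<times> real \<Rightarrow> real"
  have "has_bochner_integral lborel (\<lambda>p. (boxfn \<alpha> p * boxfn \<alpha> p * ?I p - 2 * (boxfn \<alpha> p * boxfn \<beta> p * ?I p))
     + boxfn \<beta> p * boxfn \<beta> p * ?I p) (trunc_energy R \<alpha> \<alpha> - 2 * trunc_energy R \<alpha> \<beta> + trunc_energy R \<beta> \<beta>)"
    unfolding trunc_energy_def
    by (intro has_bochner_integral_add has_bochner_integral_diff has_bochner_integral_mult_right
        boxfn_product_integral a b R)
  also have "(\<lambda>p. (boxfn \<alpha> p * boxfn \<alpha> p * ?I p - 2 * (boxfn \<alpha> p * boxfn \<beta> p * ?I p))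
     + boxfn \<beta> p * boxfn \<beta> p * ?I p) = (\<lambda>p. (boxfn \<alpha> p - boxfn \<beta> p)\<^sup>2 * ?I p)"
    by (auto simp: fun_eq_iff power2_eq_square algebra_simps)
  finally have h: "has_bochner_integral lborel (\<lambda>p. (boxfn \<alpha> p - boxfn \<beta> p)\<^sup>2 * ?I p)
     (trunc_energy R \<alpha> \<alpha> - 2 * trunc_energy R \<alpha> \<beta> + trunc_energy R \<beta> \<beta>)" .
  then have i: "integrable lborel (\<lambda>p. (boxfn \<alpha> p - boxfn \<beta> p)\<^sup>2 * ?I p)"
    and e: "(\<integral>p. (boxfn \<alpha> p - boxfn \<beta> p)\<^sup>2 * ?I p \<partial>lborel) = trunc_energy R \<alpha> \<alpha> - 2 * trunc_energy R \<alpha> \<beta> + trunc_energy R \<beta> \<beta>"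
    by (auto simp: has_bochner_integral_iff)
  show ?B unfolding e[symmetric] by (intro integral_nonneg_AE) auto
  have "(\<integral>\<^sup>+p. ennreal ((boxfn \<alpha> p - boxfn \<beta> p)\<^sup>2) * indicator {p. fst p < R} p \<partial>lborel) =
    (\<integral>\<^sup>+p. ennreal ((boxfn \<alpha> p - boxfn \<beta> p)\<^sup>2 * ?I p) \<partial>lborel)"
    by (rule nn_integral_cong) (auto split: split_indicator)
  also have "\<dots> = ennreal (\<integral>p. (boxfn \<alpha> p - boxfn \<beta> p)\<^sup>2 * ?I p \<partial>lborel)"
    by (rule nn_integral_eq_integral[OF i]) auto
  finally show ?A unfolding e .
qed

text \<open>The divergent constants \<open>ln R - 1\<close> multiply products of total masses, and for equal masses their
  contributions to the three energies add up to zero.\<close>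
lemma energy_neutral:
  assumes a: "fin_energy \<alpha>" and b: "fin_energy \<beta>" and m: "measure \<alpha> UNIV = measure \<beta> UNIV"
  shows "(\<integral>\<^sup>+p. ennreal ((boxfn \<alpha> p - boxfn \<beta> p)\<^sup>2) \<partial>lborel) =
      ennreal (energy \<alpha> \<alpha> - 2 * energy \<alpha> \<beta> + energy \<beta> \<beta>)" (is ?A)
    and "0 \<le> energy \<alpha> \<alpha> - 2 * energy \<alpha> \<beta> + energy \<beta> \<beta>" (is ?B)
proof -
  note [measurable] = boxfn_measurable[OF fin_energyD(1)[OF a]] boxfn_measurable[OF fin_energyD(1)[OF b]]
  let ?T = "\<lambda>n. trunc_energy (real (Suc n)) \<alpha> \<alpha> - 2 * trunc_energy (real (Suc n)) \<alpha> \<beta> + trunc_energy (real (Suc n)) \<beta> \<beta>"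
  (* integrals over boxes of length less than n + 1, increasing in n *)
  let ?S = "\<lambda>n p. ennreal ((boxfn \<alpha> p - boxfn \<beta> p)\<^sup>2) * indicator {p. fst p < real (Suc n)} p"
  let ?c = "\<lambda>n. (ln (real (Suc n)) - 1) * (measure \<alpha> UNIV * measure \<alpha> UNIV)"
  have "(\<lambda>n. (trunc_energy (real (Suc n)) \<alpha> \<alpha> - ?c n) - 2 * (trunc_energy (real (Suc n)) \<alpha> \<beta> - ?c n)
     + (trunc_energy (real (Suc n)) \<beta> \<beta> - ?c n)) \<longlonglongrightarrow> energy \<alpha> \<alpha> - 2 * energy \<alpha> \<beta> + energy \<beta> \<beta>"
    by (intro tendsto_add tendsto_diff tendsto_mult tendsto_const)
       (use trunc_energy_tendsto[OF a a] trunc_energy_tendsto[OF a b] trunc_energy_tendsto[OF b b] m in auto)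
  then have lim: "?T \<longlonglongrightarrow> energy \<alpha> \<alpha> - 2 * energy \<alpha> \<beta> + energy \<beta> \<beta>" by (simp add: algebra_simps)
  have T0: "0 \<le> ?T n" for n by (rule boxfn_diff_sq_truncated(2)) (use fin_energyD a b in auto)
  show ?B by (rule LIMSEQ_le_const[OF lim]) (use T0 in auto)
  have "(\<lambda>n. \<integral>\<^sup>+p. ?S n p \<partial>lborel) \<longlonglongrightarrow> (\<integral>\<^sup>+p. ennreal ((boxfn \<alpha> p - boxfn \<beta> p)\<^sup>2) \<partial>lborel)"
  proof (rule nn_integral_LIMSEQ)
    show "incseq ?S"
      by (auto simp: incseq_def le_fun_def split: split_indicator)
    fix p
    have "\<forall>\<^sub>F n in sequentially. ?S n p = ennreal ((boxfn \<alpha> p - boxfn \<beta> p)\<^sup>2)"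
      using eventually_gt_at_top[of "nat \<lceil>fst p\<rceil>"]
    proof eventually_elim
      case (elim n)
      then have "fst p < real (Suc n)" by linarith
      then show ?case by simp
    qed
    then show "(\<lambda>n. ?S n p) \<longlonglongrightarrow> ennreal ((boxfn \<alpha> p - boxfn \<beta> p)\<^sup>2)"
      by (rule tendsto_eventually)
  qed measurable
  moreover have "(\<integral>\<^sup>+p. ?S n p \<partial>lborel) = ennreal (?T n)" for n
    by (rule boxfn_diff_sq_truncated(1)) (use fin_energyD a b in auto)
  moreover have "(\<lambda>n. ennreal (?T n)) \<longlonglongrightarrow> ennreal (energy \<alpha> \<alpha> - 2 * energy \<alpha> \<beta> + energy \<beta> \<beta>)"
    using lim by (rule tendsto_ennrealI)
  ultimately show ?A using LIMSEQ_unique by simp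
qed

text \<open>If an increment of the distribution functions differed, then by right-continuity so would the
  increments over all boxes from a nonempty open set, which is not negligible.\<close>
lemma eq_of_boxfn_eq:
  assumes fa: "finite_borel_measure \<alpha>" and fb: "finite_borel_measure \<beta>"
    and ae: "AE p in lborel. boxfn \<alpha> p = boxfn \<beta> p"
  shows "\<alpha> = \<beta>"
proof (rule cdf_unique'[OF fa fb])
  interpret a: finite_borel_measure \<alpha> by fact
  interpret b: finite_borel_measure \<beta> by fact
  define D where "D x = cdf \<alpha> x - cdf \<beta> x" for x
  have rc: "(D \<longlongrightarrow> D x) (at_right x)" for x
    using a.cdf_is_right_cont[of x] b.cdf_is_right_cont[of x]
    unfolding D_def continuous_within by (intro tendsto_diff)
  have const: "D a = D b" if ab: "a < b" for a b
  proof (rule ccontr)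
    assume ne: "D a \<noteq> D b"
    define \<eta> where "\<eta> = \<bar>D a - D b\<bar> / 2"
    have \<eta>: "\<eta> > 0" using ne by (simp add: \<eta>_def)
    obtain e1 where e1: "e1 > a" "\<And>u. a < u \<Longrightarrow> u < e1 \<Longrightarrow> \<bar>D u - D a\<bar> < \<eta>"
      using tendstoD[OF rc[of a] \<eta>] unfolding eventually_at_right_field dist_real_def by auto
    obtain e2 where e2: "e2 > b" "\<And>u. b < u \<Longrightarrow> u < e2 \<Longrightarrow> \<bar>D u - D b\<bar> < \<eta>"
      using tendstoD[OF rc[of b] \<eta>] unfolding eventually_at_right_field dist_real_def by auto
    (* boxes that start just after a and end just after b *)
    define O' where "O' = {p :: real \<times> real. a < snd p \<and> snd p < min e1 b \<and> b < snd p + fst p \<and> snd p + fst p < e2}"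
    have "open O'" unfolding O'_def
      by (intro open_Collect_conj open_Collect_less continuous_intros)
    moreover have "((b + e2) / 2 - (a + min e1 b) / 2, (a + min e1 b) / 2) \<in> O'"
      using e1(1) e2(1) ab by (auto simp: O'_def)
    ultimately have "\<not> negligible O'" using open_not_negligible by blast
    have "boxfn \<alpha> p \<noteq> boxfn \<beta> p" if p: "p \<in> O'" for p
    proof
      assume eq: "boxfn \<alpha> p = boxfn \<beta> p"
      define u v where "u = snd p" and "v = snd p + fst p"
      have r: "fst p > 0" using p by (auto simp: O'_def)
      have "measure \<alpha> {u<..v} = measure \<beta> {u<..v}"
        using eq r by (simp add: boxfn_def u_def v_def)
      moreover have "u < v" using r by (simp add: u_def v_def)
      ultimately have "D u = D v" using a.cdf_diff_eq[of u v] b.cdf_diff_eq[of u v] by (simp add: D_def)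
      moreover have "\<bar>D u - D a\<bar> < \<eta>" "\<bar>D v - D b\<bar> < \<eta>"
        using p e1(2)[of u] e2(2)[of v] by (auto simp: O'_def u_def v_def)
      moreover have "\<bar>D a - D b\<bar> \<le> \<bar>D u - D a\<bar> + \<bar>D u - D b\<bar>" by linarith
      ultimately show False unfolding \<eta>_def by (simp add: field_simps)
    qed
    then have sub: "O' \<subseteq> {p \<in> space lborel. \<not> boxfn \<alpha> p = boxfn \<beta> p}" by auto
    obtain N where N: "{p \<in> space lborel. \<not> boxfn \<alpha> p = boxfn \<beta> p} \<subseteq> N" "N \<in> null_sets lborel"
      using AE_E[OF ae] by (metis (no_types, lifting) null_setsI)
    have "negligible N" unfolding negligible_iff_null_sets by (rule null_sets_completionI[OF N(2)])
    then have "negligible O'" by (rule negligible_subset) (use sub N(1) in blast)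
    with \<open>\<not> negligible O'\<close> show False by simp
  qed
  have "((\<lambda>x. cdf \<alpha> x - cdf \<beta> x) \<longlongrightarrow> 0 - 0) at_bot"
    by (rule tendsto_diff[OF a.cdf_lim_at_bot b.cdf_lim_at_bot])
  then have "(D \<longlongrightarrow> 0) at_bot" by (simp add: D_def[abs_def])
  moreover have "(D \<longlongrightarrow> D 0) at_bot"
  proof (rule tendsto_eventually)
    show "\<forall>\<^sub>F x in at_bot. D x = D 0"
      using eventually_gt_at_bot[of 0] by eventually_elim (rule const)
  qed
  ultimately have "0 = D 0" by (rule tendsto_unique[OF trivial_limit_at_bot_linorder])
  then have "D x = 0" for x using const[of x 0] const[of 0 x] by (cases x "0::real" rule: linorder_cases) simp_all
  then show "cdf \<alpha> = cdf \<beta>" by (auto simp: D_def)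
qed

lemma energy_neutral_eq_0:
  assumes a: "fin_energy \<alpha>" and b: "fin_energy \<beta>" and m: "measure \<alpha> UNIV = measure \<beta> UNIV"
    and z: "energy \<alpha> \<alpha> - 2 * energy \<alpha> \<beta> + energy \<beta> \<beta> = 0"
  shows "\<alpha> = \<beta>"
proof (rule eq_of_boxfn_eq[OF fin_energyD(1)[OF a] fin_energyD(1)[OF b]])
  note [measurable] = boxfn_measurable[OF fin_energyD(1)[OF a]] boxfn_measurable[OF fin_energyD(1)[OF b]]
  have "(\<integral>\<^sup>+p. ennreal ((boxfn \<alpha> p - boxfn \<beta> p)\<^sup>2) \<partial>lborel) = 0"
    using energy_neutral(1)[OF a b m] z by simp
  then have "AE p in lborel. ennreal ((boxfn \<alpha> p - boxfn \<beta> p)\<^sup>2) = 0"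
    by (subst (asm) nn_integral_0_iff_AE) measurable
  then show "AE p in lborel. boxfn \<alpha> p = boxfn \<beta> p" by eventually_elim (simp add: ennreal_eq_0_iff)
qed

section \<open>Combinations and domination\<close>

lemma boxfn_mix:
  assumes "finite_borel_measure \<alpha>" "finite_borel_measure \<beta>" "a \<ge> 0" "b \<ge> 0"
  shows "boxfn (mix a \<alpha> b \<beta>) p = a * boxfn \<alpha> p + b * boxfn \<beta> p"
  using assms by (simp add: boxfn_def measure_mix add_divide_distrib)

lemma local_energy_mono:
  assumes b: "finite_borel_measure \<beta>" and a: "local_energy \<alpha>" and c: "c \<ge> 0"
    and le: "\<And>A. A \<in> sets borel \<Longrightarrow> measure \<beta> A \<le> c * measure \<alpha> A"
  shows "local_energy \<beta>"
proof -
  note [measurable] = boxfn_measurable[OF local_energyD[OF a]] boxfn_measurable[OF b]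
  have "boxfn \<beta> p \<le> c * boxfn \<alpha> p" for p
    using le[of "{snd p<..snd p + fst p}"] by (auto simp: boxfn_def divide_right_mono)
  then have "(boxfn \<beta> p)\<^sup>2 \<le> c\<^sup>2 * (boxfn \<alpha> p)\<^sup>2" for p
    using boxfn_nonneg[of \<beta> p] by (metis power_mono power_mult_distrib)
  then have "(\<integral>\<^sup>+p. ennreal ((boxfn \<beta> p)\<^sup>2) * indicator {p. fst p < 1} p \<partial>lborel) \<le>
     (\<integral>\<^sup>+p. ennreal (c\<^sup>2) * (ennreal ((boxfn \<alpha> p)\<^sup>2) * indicator {p. fst p < 1} p) \<partial>lborel)"
    by (intro nn_integral_mono) (auto split: split_indicator simp: ennreal_mult[symmetric] intro!: ennreal_leI)
  also have "\<dots> = ennreal (c\<^sup>2) * (\<integral>\<^sup>+p. ennreal ((boxfn \<alpha> p)\<^sup>2) * indicator {p. fst p < 1} p \<partial>lborel)"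
    by (rule nn_integral_cmult) measurable
  also have "\<dots> < \<infinity>" using a by (auto simp: local_energy_def ennreal_mult_less_top)
  finally show ?thesis using b by (simp add: local_energy_def)
qed

lemma nn_integral_le_of_le:
  assumes s: "sets \<alpha> = sets borel" "sets \<beta> = sets borel"
    and le: "\<And>A. A \<in> sets borel \<Longrightarrow> emeasure \<beta> A \<le> emeasure \<alpha> A"
  shows "(\<integral>\<^sup>+x. f x \<partial>\<beta>) \<le> (\<integral>\<^sup>+x. f x \<partial>\<alpha>)"
proof (rule nn_integral_mono_measure)
  show "sets \<beta> = sets \<alpha>" using s by simp
  have "emeasure \<beta> A \<le> emeasure \<alpha> A" for A
    by (cases "A \<in> sets borel") (use le s in \<open>auto simp: emeasure_notin_sets\<close>)
  then show "\<beta> \<le> \<alpha>"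
    using s by (intro less_eq_measure.intros(3)) (auto simp: le_fun_def intro!: sets_eq_imp_space_eq)
qed

lemma fin_energy_mono:
  assumes b: "finite_borel_measure \<beta>" and a: "fin_energy \<alpha>" and c: "c \<ge> 0"
    and le: "\<And>A. A \<in> sets borel \<Longrightarrow> measure \<beta> A \<le> c * measure \<alpha> A"
  shows "fin_energy \<beta>"
proof -
  interpret a: finite_borel_measure \<alpha> using fin_energyD[OF a] by simp
  interpret b: finite_borel_measure \<beta> by fact
  note [measurable_cong] = a.M_is_borel b.M_is_borel
  have "(\<integral>\<^sup>+x. ennreal (ln (1 + x\<^sup>2)) \<partial>\<beta>) \<le> (\<integral>\<^sup>+x. ennreal (ln (1 + x\<^sup>2)) \<partial>scale_measure (ennreal c) \<alpha>)"
    by (rule nn_integral_le_of_le)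
       (use le c in \<open>auto simp: a.M_is_borel b.M_is_borel a.emeasure_eq_measure b.emeasure_eq_measure ennreal_mult[symmetric] intro!: ennreal_leI\<close>)
  also have "\<dots> = ennreal c * (\<integral>\<^sup>+x. ennreal (ln (1 + x\<^sup>2)) \<partial>\<alpha>)"
    by (rule nn_integral_scale_measure) measurable
  also have "\<dots> < \<infinity>" using a by (auto simp: fin_energy_def ennreal_mult_less_top)
  finally show ?thesis
    using local_energy_mono[OF b fin_energyD(2)[OF a] c le] by (simp add: fin_energy_def)
qed

lemma local_energy_mix:
  assumes a: "local_energy \<alpha>" and b: "local_energy \<beta>" and ab: "a \<ge> 0" "b \<ge> 0"
  shows "local_energy (mix a \<alpha> b \<beta>)"
proof -
  note [measurable] = boxfn_measurable[OF local_energyD[OF a]] boxfn_measurable[OF local_energyD[OF b]]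
  let ?I = "indicator {p. fst p < 1} :: real \<times> real \<Rightarrow> ennreal"
  have sq: "(a * x + b * y)\<^sup>2 \<le> 2 * a\<^sup>2 * x\<^sup>2 + 2 * b\<^sup>2 * y\<^sup>2" for x y :: real
    using zero_le_power2[of "a * x - b * y"] by (simp add: power2_eq_square algebra_simps)
  have "(\<integral>\<^sup>+p. ennreal ((boxfn (mix a \<alpha> b \<beta>) p)\<^sup>2) * ?I p \<partial>lborel) \<le>
    (\<integral>\<^sup>+p. ennreal (2 * a\<^sup>2) * (ennreal ((boxfn \<alpha> p)\<^sup>2) * ?I p) + ennreal (2 * b\<^sup>2) * (ennreal ((boxfn \<beta> p)\<^sup>2) * ?I p) \<partial>lborel)"
    using sq ab
    by (intro nn_integral_mono)
       (auto split: split_indicator simp: boxfn_mix[OF local_energyD[OF a] local_energyD[OF b]] ennreal_mult[symmetric]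
          ennreal_plus[symmetric] mult.assoc simp del: ennreal_plus intro!: ennreal_leI)
  also have "\<dots> = ennreal (2 * a\<^sup>2) * (\<integral>\<^sup>+p. ennreal ((boxfn \<alpha> p)\<^sup>2) * ?I p \<partial>lborel) +
     ennreal (2 * b\<^sup>2) * (\<integral>\<^sup>+p. ennreal ((boxfn \<beta> p)\<^sup>2) * ?I p \<partial>lborel)"
    by (subst nn_integral_add) (auto simp: nn_integral_cmult)
  also have "\<dots> < \<infinity>" using a b by (auto simp: local_energy_def ennreal_mult_less_top)
  finally show ?thesis
    using finite_borel_mix[OF local_energyD[OF a] local_energyD[OF b]] by (simp add: local_energy_def)
qed

lemma fin_energy_mix:
  assumes a: "fin_energy \<alpha>" and b: "fin_energy \<beta>" and ab: "a \<ge> 0" "b \<ge> 0"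
  shows "fin_energy (mix a \<alpha> b \<beta>)"
proof -
  have "(\<integral>\<^sup>+x. ennreal (ln (1 + x\<^sup>2)) \<partial>mix a \<alpha> b \<beta>) < \<infinity>"
    using a b by (subst nn_integral_mix)
      (auto simp: fin_energy_def ennreal_mult_less_top finite_borel_measureD(1)[OF local_energyD])
  then show ?thesis using local_energy_mix[OF fin_energyD(2)[OF a] fin_energyD(2)[OF b] ab] by (simp add: fin_energy_def)
qed

lemma energy_mix_left:
  assumes a: "fin_energy \<alpha>" and b: "fin_energy \<beta>" and c: "fin_energy \<gamma>" and ab: "a \<ge> 0" "b \<ge> 0"
  shows "energy (mix a \<alpha> b \<beta>) \<gamma> = a * energy \<alpha> \<gamma> + b * energy \<beta> \<gamma>"
  using energy_eq_integral_pot(1,2)[OF a c] energy_eq_integral_pot(1,2)[OF b c]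
    energy_eq_integral_pot(2)[OF fin_energy_mix[OF a b ab] c] ab
    integral_mix(2)[of \<alpha> \<beta> a b "pot \<gamma>"]
    finite_borel_measureD(1)[OF fin_energyD(1)[OF a]] finite_borel_measureD(1)[OF fin_energyD(1)[OF b]]
  by simp

lemma energy_mix_right:
  assumes a: "fin_energy \<alpha>" and b: "fin_energy \<beta>" and c: "fin_energy \<gamma>" and ab: "a \<ge> 0" "b \<ge> 0"
  shows "energy \<gamma> (mix a \<alpha> b \<beta>) = a * energy \<gamma> \<alpha> + b * energy \<gamma> \<beta>"
  using energy_mix_left[OF assms] energy_commute[OF c fin_energy_mix[OF a b ab]]
    energy_commute[OF c a] energy_commute[OF c b] by simp

section \<open>Continuity of potentials\<close>

definition cpot :: "real measure \<Rightarrow> complex \<Rightarrow> real" where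
  "cpot \<mu> z = (\<integral>t. - ln (cmod (z - of_real t)) \<partial>\<mu>)"

definition trunc_log :: "real \<Rightarrow> complex \<Rightarrow> real \<Rightarrow> real" where
  "trunc_log \<delta> z t = - ln (max \<delta> (cmod (z - of_real t)))"

text \<open>The singular part of the kernel; it is used for \<open>\<bar>x - t\<bar> < 1\<close> only, where the logarithm is
  negative.\<close>
definition klog :: "real \<Rightarrow> real \<Rightarrow> ennreal" where
  "klog x t = (if x = t then \<infinity> else ennreal (- ln \<bar>x - t\<bar>))"

definition near_pot :: "real \<Rightarrow> real measure \<Rightarrow> real \<Rightarrow> ennreal" where
  "near_pot \<delta> \<mu> x = (\<integral>\<^sup>+t. klog x t * indicator {t. \<bar>x - t\<bar> < \<delta>} t \<partial>\<mu>)"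

text \<open>The local form of the Kato condition for the logarithmic kernel.\<close>
definition kato :: "real measure \<Rightarrow> bool" where
  "kato \<mu> \<longleftrightarrow> (\<forall>M \<epsilon>. 0 < \<epsilon> \<longrightarrow> (\<exists>\<delta>. 0 < \<delta> \<and> \<delta> < 1 \<and> (\<forall>x. \<bar>x\<bar> \<le> M \<longrightarrow> near_pot \<delta> \<mu> x \<le> ennreal \<epsilon>)))"

definition log_moment :: "real measure \<Rightarrow> bool" where
  "log_moment \<mu> \<longleftrightarrow> finite_borel_measure \<mu> \<and> integrable \<mu> (\<lambda>t. ln (1 + \<bar>t\<bar>))"

lemma cmod_diff_of_real: "cmod (of_real x - of_real t) = \<bar>x - t\<bar>"
  by (metis norm_of_real of_real_diff)

lemma cpot_of_real: "cpot \<mu> (of_real x) = pot \<mu> x"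
  by (simp add: cpot_def pot_def cmod_diff_of_real)

lemma klog_measurable[measurable]: "(\<lambda>t. klog x t) \<in> borel_measurable borel"
  unfolding klog_def by measurable

lemma trunc_log_measurable[measurable]: "(\<lambda>t. trunc_log \<delta> z t) \<in> borel_measurable borel"
  unfolding trunc_log_def by measurable

lemma near_set_measurable[measurable]: "{t. \<bar>x - t\<bar> < \<delta>} \<in> sets (borel :: real measure)"
  by (intro borel_open open_Collect_less continuous_intros)

lemma ln_one_plus_abs_le: "ln (1 + \<bar>t\<bar>) \<le> ln (1 + t\<^sup>2) / 2 + (ln 2 / 2 :: real)"
proof -
  have "(1 + \<bar>t\<bar>)\<^sup>2 \<le> 2 * (1 + t\<^sup>2)"
    using zero_le_power2[of "1 - \<bar>t\<bar>"] by (simp add: power2_eq_square algebra_simps)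
  then have "ln ((1 + \<bar>t\<bar>)\<^sup>2) \<le> ln (2 * (1 + t\<^sup>2))"
    by (subst ln_le_cancel_iff) (auto intro!: mult_pos_pos add_pos_nonneg)
  also have "\<dots> = ln 2 + ln (1 + t\<^sup>2)"
    by (rule ln_mult_pos) (auto intro!: add_pos_nonneg)
  also have "ln ((1 + \<bar>t\<bar>)\<^sup>2) = 2 * ln (1 + \<bar>t\<bar>)"
    by (subst ln_realpow) auto
  finally show ?thesis by simp
qed

lemma ln_one_plus_sq_le: "ln (1 + t\<^sup>2) \<le> 2 * ln (1 + \<bar>t\<bar> :: real)"
proof -
  have "ln (1 + t\<^sup>2) \<le> ln ((1 + \<bar>t\<bar>)\<^sup>2)"
    by (subst ln_le_cancel_iff) (auto intro!: add_pos_nonneg simp: power2_eq_square algebra_simps)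
  also have "\<dots> = 2 * ln (1 + \<bar>t\<bar>)" by (subst ln_realpow) auto
  finally show ?thesis .
qed

lemma log_moment_iff:
  assumes "finite_borel_measure \<mu>"
  shows "log_moment \<mu> \<longleftrightarrow> (\<integral>\<^sup>+t. ennreal (ln (1 + t\<^sup>2)) \<partial>\<mu>) < \<infinity>"
proof -
  interpret finite_borel_measure \<mu> by fact
  note [measurable_cong] = M_is_borel
  have "integrable \<mu> (\<lambda>t. ln (1 + \<bar>t\<bar>)) \<longleftrightarrow> integrable \<mu> (\<lambda>t. ln (1 + t\<^sup>2))"
  proof
    assume i: "integrable \<mu> (\<lambda>t. ln (1 + \<bar>t\<bar>))"
    show "integrable \<mu> (\<lambda>t. ln (1 + t\<^sup>2))"
      by (rule Bochner_Integration.integrable_bound[OF integrable_mult_right[OF i, of 2]])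
         (use ln_one_plus_sq_le in auto)
  next
    assume i: "integrable \<mu> (\<lambda>t. ln (1 + t\<^sup>2))"
    have "integrable \<mu> (\<lambda>t. ln (1 + t\<^sup>2) / 2 + (ln 2 / 2 :: real))" using i by auto
    then show "integrable \<mu> (\<lambda>t. ln (1 + \<bar>t\<bar>))"
      by (rule Bochner_Integration.integrable_bound)
         (use ln_one_plus_abs_le in \<open>auto intro!: AE_I2 simp: abs_of_nonneg\<close>)
  qed
  also have "\<dots> \<longleftrightarrow> (\<integral>\<^sup>+t. ennreal (ln (1 + t\<^sup>2)) \<partial>\<mu>) < \<infinity>"
    by (simp add: integrable_iff_bounded)
  finally show ?thesis using assms by (simp add: log_moment_def)
qed

lemma fin_energy_log_moment: "fin_energy \<mu> \<Longrightarrow> log_moment \<mu>"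
  using log_moment_iff[OF fin_energyD(1)] by (simp add: fin_energy_def)

lemma log_moment_fb: "log_moment \<mu> \<Longrightarrow> finite_borel_measure \<mu>"
  by (simp add: log_moment_def)

lemma log_moment_bounded:
  assumes "finite_borel_measure \<mu>" "AE t in \<mu>. \<bar>t\<bar> \<le> M"
  shows "log_moment \<mu>"
proof -
  interpret finite_borel_measure \<mu> by fact
  note [measurable_cong] = M_is_borel
  have "integrable \<mu> (\<lambda>t. ln (1 + \<bar>t\<bar>))"
  proof (rule integrable_const_bound[where B="ln (1 + \<bar>M\<bar>)"])
    show "AE t in \<mu>. norm (ln (1 + \<bar>t\<bar>)) \<le> ln (1 + \<bar>M\<bar>)"
      using assms(2) by eventually_elim auto
  qed measurable
  with assms show ?thesis by (simp add: log_moment_def)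
qed

lemma ln_cmod_le: "ln (cmod (z - of_real t)) \<le> ln (1 + cmod z) + ln (1 + \<bar>t\<bar>)"
proof (cases "z = of_real t")
  case False
  have "cmod (z - of_real t) \<le> cmod z + \<bar>t\<bar>" using norm_triangle_ineq4[of z "of_real t"] by simp
  also have "\<dots> \<le> (1 + cmod z) * (1 + \<bar>t\<bar>)" by (simp add: algebra_simps)
  finally have "ln (cmod (z - of_real t)) \<le> ln ((1 + cmod z) * (1 + \<bar>t\<bar>))"
    using False by (subst ln_le_cancel_iff) (auto intro!: mult_pos_pos add_pos_nonneg)
  also have "\<dots> = ln (1 + cmod z) + ln (1 + \<bar>t\<bar>)"
    by (rule ln_mult_pos) (auto intro!: add_pos_nonneg)
  finally show ?thesis .
qed simp

lemma abs_trunc_log_le: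
  assumes "0 < \<delta>" "\<delta> \<le> 1"
  shows "\<bar>trunc_log \<delta> z t\<bar> \<le> - ln \<delta> + ln (1 + cmod z) + ln (1 + \<bar>t\<bar>)"
proof (cases "cmod (z - of_real t) \<le> \<delta>")
  case True
  then show ?thesis using assms by (simp add: trunc_log_def max_def)
next
  case False
  then have t: "trunc_log \<delta> z t = - ln (cmod (z - of_real t))" by (simp add: trunc_log_def max_def)
  have "ln \<delta> \<le> ln (cmod (z - of_real t))" using False assms by (subst ln_le_cancel_iff) auto
  moreover have "ln \<delta> \<le> 0" "0 \<le> ln (1 + cmod z)" "0 \<le> ln (1 + \<bar>t\<bar>)" using assms by auto
  ultimately show ?thesis unfolding t using ln_cmod_le[of z t] by linarith
qed

lemma trunc_log_integrable:
  assumes l: "log_moment \<mu>" and d: "0 < \<delta>" "\<delta> \<le> 1"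
  shows "integrable \<mu> (trunc_log \<delta> z)"
proof -
  interpret finite_borel_measure \<mu> using l by (simp add: log_moment_def)
  note [measurable_cong] = M_is_borel
  show ?thesis
  proof (rule Bochner_Integration.integrable_bound)
    show "integrable \<mu> (\<lambda>t. - ln \<delta> + ln (1 + cmod z) + ln (1 + \<bar>t\<bar>))"
      using l by (auto simp: log_moment_def)
    show "AE t in \<mu>. norm (trunc_log \<delta> z t) \<le> norm (- ln \<delta> + ln (1 + cmod z) + ln (1 + \<bar>t\<bar>))"
      using abs_trunc_log_le[OF d, of z] by (auto intro!: AE_I2 order_trans[OF _ abs_ge_self])
  qed measurable
qed

lemma trunc_log_continuous:
  assumes l: "log_moment \<mu>" and d: "0 < \<delta>" "\<delta> \<le> 1"
  shows "continuous_on UNIV (\<lambda>z. \<integral>t. trunc_log \<delta> z t \<partial>\<mu>)"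
  unfolding continuous_on_sequentially
proof (intro ballI allI impI; elim conjE)
  interpret finite_borel_measure \<mu> using l by (simp add: log_moment_def)
  note [measurable_cong] = M_is_borel
  fix x :: "nat \<Rightarrow> complex" and a assume x: "x \<longlonglongrightarrow> a"
  obtain B where B: "\<And>n. cmod (x n) \<le> B" using convergent_imp_Bseq[OF convergentI[OF x]] by (auto simp: Bseq_def)
  have "(\<lambda>n. \<integral>t. trunc_log \<delta> (x n) t \<partial>\<mu>) \<longlonglongrightarrow> (\<integral>t. trunc_log \<delta> a t \<partial>\<mu>)"
  proof (rule integral_dominated_convergence)
    show "integrable \<mu> (\<lambda>t. - ln \<delta> + ln (1 + B) + ln (1 + \<bar>t\<bar>))" using l by (auto simp: log_moment_def)
    show "AE t in \<mu>. (\<lambda>n. trunc_log \<delta> (x n) t) \<longlonglongrightarrow> trunc_log \<delta> a t"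
      unfolding trunc_log_def using d by (intro AE_I2 tendsto_intros x) auto
    fix n
    have "ln (1 + cmod (x n)) \<le> ln (1 + B)" using B[of n] norm_ge_zero[of "x n"]
      by (subst ln_le_cancel_iff) (auto intro!: add_pos_nonneg simp del: norm_ge_zero)
    then show "AE t in \<mu>. norm (trunc_log \<delta> (x n) t) \<le> - ln \<delta> + ln (1 + B) + ln (1 + \<bar>t\<bar>)"
    proof (intro AE_I2)
      fix t
      show "norm (trunc_log \<delta> (x n) t) \<le> - ln \<delta> + ln (1 + B) + ln (1 + \<bar>t\<bar>)"
        using abs_trunc_log_le[OF d, of "x n" t] \<open>ln (1 + cmod (x n)) \<le> ln (1 + B)\<close>
        unfolding real_norm_def by linarith
    qed
  qed measurable
  then show "((\<lambda>z. \<integral>t. trunc_log \<delta> z t \<partial>\<mu>) \<circ> x) \<longlonglongrightarrow> (\<integral>t. trunc_log \<delta> a t \<partial>\<mu>)" by (simp add: o_def)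
qed

lemma log_potential_eq:
  assumes i: "integrable \<mu> (\<lambda>t. - ln (cmod (z - of_real t)))" and ae: "AE t in \<mu>. z \<noteq> of_real t"
  shows "log_potential \<mu> z = ereal (cpot \<mu> z)"
  unfolding log_potential_def cpot_def
  by (rule ext_integral_eq_real[OF _ i])
     (use ae in \<open>eventually_elim, auto simp: log_kernel_def dist_norm ln_div\<close>)

lemma log_potential_finite:
  assumes l: "log_moment \<mu>" and fin: "log_potential \<mu> z < \<infinity>"
  shows "integrable \<mu> (\<lambda>t. - ln (cmod (z - of_real t)))" "AE t in \<mu>. z \<noteq> of_real t"
proof -
  interpret finite_borel_measure \<mu> using l by (simp add: log_moment_def)
  note [measurable_cong] = M_is_borel
  let ?k = "\<lambda>t. log_kernel z (of_real t)"
  have km: "?k \<in> borel_measurable \<mu>" unfolding log_kernel_def by measurable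
  have h: "integrable \<mu> (\<lambda>t. - (ln (1 + cmod z) + ln (1 + \<bar>t\<bar>)))" using l by (auto simp: log_moment_def)
  have le: "AE t in \<mu>. ereal (- (ln (1 + cmod z) + ln (1 + \<bar>t\<bar>))) \<le> ?k t"
  proof (rule AE_I2)
    fix t show "ereal (- (ln (1 + cmod z) + ln (1 + \<bar>t\<bar>))) \<le> ?k t"
      using ln_cmod_le[of z t] by (auto simp: log_kernel_def dist_norm ln_div)
  qed
  have f: "ext_integral \<mu> ?k < \<infinity>" using fin by (simp add: log_potential_def)
  note r = ext_integral_lt_PInf[OF km h le f]
  show ae: "AE t in \<mu>. z \<noteq> of_real t" using r(2) by eventually_elim (auto simp: log_kernel_def)
  show "integrable \<mu> (\<lambda>t. - ln (cmod (z - of_real t)))"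
    by (rule integrable_cong_AE_imp[OF r(1)])
       (use ae in \<open>measurable, eventually_elim, auto simp: log_kernel_def dist_norm ln_div\<close>)
qed

text \<open>The kernel and its truncation differ only within distance \<open>\<delta>\<close> of \<open>z\<close>, and there the kernel is
  dominated by its value at \<open>Re z\<close>, which is no farther than \<open>z\<close> from any point of the line.\<close>
lemma near_pot_excess:
  assumes l: "log_moment \<mu>" and d: "0 < \<delta>" "\<delta> \<le> 1" and e: "near_pot \<delta> \<mu> (Re z) \<le> ennreal \<epsilon>" "\<epsilon> \<ge> 0"
  shows "integrable \<mu> (\<lambda>t. - ln (cmod (z - of_real t)))" "AE t in \<mu>. z \<noteq> of_real t"
    "(\<integral>t. trunc_log \<delta> z t \<partial>\<mu>) \<le> cpot \<mu> z" "cpot \<mu> z \<le> (\<integral>t. trunc_log \<delta> z t \<partial>\<mu>) + \<epsilon>"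
proof -
  interpret finite_borel_measure \<mu> using l by (simp add: log_moment_def)
  note [measurable_cong] = M_is_borel
  have "AE t in \<mu>. klog (Re z) t * indicator {t. \<bar>Re z - t\<bar> < \<delta>} t \<noteq> \<infinity>"
    by (rule nn_integral_PInf_AE) (use e in \<open>auto simp: near_pot_def top_unique\<close>)
  then have ae': "AE t in \<mu>. Re z \<noteq> t"
    by eventually_elim (use d in \<open>auto simp: klog_def split: split_indicator_asm\<close>)
  then show ae: "AE t in \<mu>. z \<noteq> of_real t" by eventually_elim auto
  let ?x = "\<lambda>t. - ln (cmod (z - of_real t)) - trunc_log \<delta> z t"
  have x0: "AE t in \<mu>. 0 \<le> ?x t"
    using ae
  proof eventually_elim
    case (elim t)
    have "ln (cmod (z - of_real t)) \<le> ln \<delta>" if "\<not> \<delta> \<le> cmod (z - of_real t)"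
      using that elim d by (subst ln_le_cancel_iff) auto
    then show ?case by (auto simp: trunc_log_def max_def)
  qed
  have xle: "AE t in \<mu>. ennreal (?x t) \<le> klog (Re z) t * indicator {t. \<bar>Re z - t\<bar> < \<delta>} t"
    using ae'
  proof eventually_elim
    case (elim t)
    have 1: "\<bar>Re z - t\<bar> \<le> cmod (z - of_real t)" using abs_Re_le_cmod[of "z - of_real t"] by simp
    show ?case
    proof (cases "cmod (z - of_real t) < \<delta>")
      case True
      then have "?x t = ln \<delta> - ln (cmod (z - of_real t))" by (simp add: trunc_log_def max_def)
      also have "\<dots> \<le> - ln \<bar>Re z - t\<bar>"
      proof -
        have "ln \<bar>Re z - t\<bar> \<le> ln (cmod (z - of_real t))" using 1 elim by (subst ln_le_cancel_iff) auto
        moreover have "ln \<delta> \<le> 0" using d by simp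
        ultimately show ?thesis by linarith
      qed
      finally show ?thesis using True 1 elim by (auto simp: klog_def intro!: ennreal_leI)
    next
      case False
      then show ?thesis by (simp add: trunc_log_def max_def)
    qed
  qed
  have "(\<integral>\<^sup>+t. ennreal (?x t) \<partial>\<mu>) \<le> ennreal \<epsilon>"
    using nn_integral_mono_AE[OF xle] e by (simp add: near_pot_def)
  moreover have xm: "?x \<in> borel_measurable \<mu>" by measurable
  ultimately have xi: "integrable \<mu> ?x"
    using x0 by (intro integrableI_nonneg) (auto simp: top.not_eq_extremum le_less_trans)
  have xe: "integral\<^sup>L \<mu> ?x \<le> \<epsilon>"
    using \<open>(\<integral>\<^sup>+t. ennreal (?x t) \<partial>\<mu>) \<le> ennreal \<epsilon>\<close> nn_integral_eq_integral[OF xi x0] e(2)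
    by simp
  have x00: "0 \<le> integral\<^sup>L \<mu> ?x" using x0 by (rule integral_nonneg_AE)
  note ti = trunc_log_integrable[OF l d, of z]
  have "integrable \<mu> (\<lambda>t. ?x t + trunc_log \<delta> z t)" using xi ti by (rule Bochner_Integration.integrable_add)
  then show i: "integrable \<mu> (\<lambda>t. - ln (cmod (z - of_real t)))" by simp
  have "integral\<^sup>L \<mu> ?x = cpot \<mu> z - (\<integral>t. trunc_log \<delta> z t \<partial>\<mu>)"
    unfolding cpot_def using i ti by (rule Bochner_Integration.integral_diff)
  with xe x00 show "(\<integral>t. trunc_log \<delta> z t \<partial>\<mu>) \<le> cpot \<mu> z" "cpot \<mu> z \<le> (\<integral>t. trunc_log \<delta> z t \<partial>\<mu>) + \<epsilon>"
    by linarith+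
qed

lemma continuous_on_approx:
  fixes f :: "'a::metric_space \<Rightarrow> real"
  assumes "\<And>\<epsilon>. \<epsilon> > 0 \<Longrightarrow> \<exists>g. continuous_on S g \<and> (\<forall>x\<in>S. \<bar>f x - g x\<bar> \<le> \<epsilon>)"
  shows "continuous_on S f"
  unfolding continuous_on_iff
proof (intro ballI allI impI)
  fix x e assume x: "x \<in> S" and e: "(0::real) < e"
  obtain g where g: "continuous_on S g" "\<And>x. x \<in> S \<Longrightarrow> \<bar>f x - g x\<bar> \<le> e / 3"
    using assms[of "e / 3"] e by auto
  obtain d where d: "d > 0" "\<And>y. y \<in> S \<Longrightarrow> dist y x < d \<Longrightarrow> dist (g y) (g x) < e / 3"
    using g(1) x e unfolding continuous_on_iff by (metis divide_pos_pos zero_less_numeral)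
  have "dist (f y) (f x) < e" if "y \<in> S" "dist y x < d" for y
    using d(2)[OF that] g(2)[OF that(1)] g(2)[OF x] unfolding dist_real_def by linarith
  with d show "\<exists>d>0. \<forall>x'\<in>S. dist x' x < d \<longrightarrow> dist (f x') (f x) < e" by blast
qed

text \<open>On every ball the potential is a uniform limit of its truncations, which are continuous.\<close>
lemma kato_cpot:
  assumes l: "log_moment \<mu>" and k: "kato \<mu>"
  shows "integrable \<mu> (\<lambda>t. - ln (cmod (z - of_real t)))" "AE t in \<mu>. z \<noteq> of_real t"
    "log_potential \<mu> z = ereal (cpot \<mu> z)" "continuous_on UNIV (cpot \<mu>)" "continuous_potential \<mu>"
proof -
  have *: "integrable \<mu> (\<lambda>t. - ln (cmod (z - of_real t)))" "AE t in \<mu>. z \<noteq> of_real t" for z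
  proof -
    obtain \<delta> where \<delta>: "0 < \<delta>" "\<delta> < 1" "near_pot \<delta> \<mu> (Re z) \<le> ennreal 1"
      using k unfolding kato_def by (metis zero_less_one order_refl)
    then show "integrable \<mu> (\<lambda>t. - ln (cmod (z - of_real t)))" "AE t in \<mu>. z \<noteq> of_real t"
      using near_pot_excess[OF l, of \<delta> z 1] by auto
  qed
  show "integrable \<mu> (\<lambda>t. - ln (cmod (z - of_real t)))" "AE t in \<mu>. z \<noteq> of_real t" by (rule *)+
  have lp: "log_potential \<mu> z = ereal (cpot \<mu> z)" for z by (rule log_potential_eq[OF *])
  then show "log_potential \<mu> z = ereal (cpot \<mu> z)" .
  have "continuous_on (ball 0 M) (cpot \<mu>)" for M
  proof (rule continuous_on_approx)
    fix \<epsilon> :: real assume \<epsilon>: "\<epsilon> > 0"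
    obtain \<delta> where \<delta>: "0 < \<delta>" "\<delta> < 1" "\<And>x. \<bar>x\<bar> \<le> M \<Longrightarrow> near_pot \<delta> \<mu> x \<le> ennreal \<epsilon>"
      using k \<epsilon> unfolding kato_def by blast
    have "\<bar>cpot \<mu> z - (\<integral>t. trunc_log \<delta> z t \<partial>\<mu>)\<bar> \<le> \<epsilon>" if "z \<in> ball 0 M" for z
    proof -
      have "\<bar>Re z\<bar> \<le> M" using that abs_Re_le_cmod[of z] by simp
      from near_pot_excess(3,4)[OF l \<delta>(1) _ \<delta>(3)[OF this]] \<delta> \<epsilon> show ?thesis by auto
    qed
    then show "\<exists>g. continuous_on (ball 0 M) g \<and> (\<forall>z\<in>ball 0 M. \<bar>cpot \<mu> z - g z\<bar> \<le> \<epsilon>)"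
      using continuous_on_subset[OF trunc_log_continuous[OF l \<delta>(1)], of "ball 0 M"] \<delta>(2) by auto
  qed
  then have "isCont (cpot \<mu>) z" for z
    using continuous_on_eq_continuous_at[of "ball 0 (cmod z + 1)" "cpot \<mu>"] by auto
  then show c: "continuous_on UNIV (cpot \<mu>)" by (simp add: continuous_at_imp_continuous_on)
  have "log_potential \<mu> = (\<lambda>z. ereal (cpot \<mu> z))" using lp by auto
  then show "continuous_potential \<mu>"
    unfolding continuous_potential_def using c by (auto intro!: continuous_on_ereal)
qed

lemma kato_pot:
  assumes l: "log_moment \<mu>" and k: "kato \<mu>"
  shows "integrable \<mu> (\<lambda>t. - ln \<bar>x - t\<bar>)" "AE t in \<mu>. t \<noteq> x"
    "log_potential \<mu> (of_real x) = ereal (pot \<mu> x)" "continuous_on A (pot \<mu>)"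
proof -
  show "integrable \<mu> (\<lambda>t. - ln \<bar>x - t\<bar>)" using kato_cpot(1)[OF assms, of "of_real x"] by (simp add: cmod_diff_of_real)
  show "AE t in \<mu>. t \<noteq> x" using kato_cpot(2)[OF assms, of "of_real x"] by (auto elim: eventually_mono)
  show "log_potential \<mu> (of_real x) = ereal (pot \<mu> x)"
    using kato_cpot(3)[OF assms, of "of_real x"] by (simp add: cpot_of_real)
  have "continuous_on A (\<lambda>x. cpot \<mu> (of_real x))"
    by (rule continuous_on_compose2[OF kato_cpot(4)[OF assms]]) (auto intro!: continuous_intros)
  then show "continuous_on A (pot \<mu>)" by (simp add: cpot_of_real)
qed

text \<open>Dini's theorem.\<close>
lemma dini_decseq:
  fixes g :: "nat \<Rightarrow> 'a::metric_space \<Rightarrow> real"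
  assumes S: "compact S" and g: "\<And>n. continuous_on S (g n)"
    and dec: "\<And>n m x. x \<in> S \<Longrightarrow> n \<le> m \<Longrightarrow> g m x \<le> g n x"
    and lim: "\<And>x. x \<in> S \<Longrightarrow> (\<lambda>n. g n x) \<longlonglongrightarrow> 0" and e: "e > 0"
  shows "\<exists>N. \<forall>x\<in>S. g N x < e"
proof -
  have "\<exists>T. open T \<and> T \<inter> S = {x \<in> S. g n x < e}" for n
    using continuous_on_open_invariant[THEN iffD1, OF g[of n], rule_format, of "{..<e}"]
    by (auto simp: Int_def vimage_def conj_commute)
  then obtain T where T: "\<And>n. open (T n)" "\<And>n. T n \<inter> S = {x \<in> S. g n x < e}" by metis
  have "S \<subseteq> (\<Union>n\<in>UNIV. T n)"
  proof
    fix x assume x: "x \<in> S"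
    have "\<forall>\<^sub>F n in sequentially. g n x < e" using order_tendstoD(2)[OF lim[OF x] e] .
    then obtain n where "g n x < e" by (auto simp: eventually_sequentially)
    with x T(2)[of n] show "x \<in> (\<Union>n\<in>UNIV. T n)" by blast
  qed
  then obtain F where F: "finite F" "S \<subseteq> (\<Union>n\<in>F. T n)"
    using compactE_image[OF S, of UNIV T] T(1) by auto
  have "g (Max F) x < e" if x: "x \<in> S" for x
  proof -
    obtain n where n: "n \<in> F" "x \<in> T n" using F x by auto
    then have "g n x < e" using T(2)[of n] x by blast
    moreover have "g (Max F) x \<le> g n x" using F n x by (intro dec) auto
    ultimately show ?thesis by simp
  qed
  then show ?thesis by blast
qed

text \<open>The potential exceeds its truncations by continuous functions that decrease to zero on \<open>S\<close>, hence
  uniformly by Dini's theorem; this bounds the near part on \<open>S\<close>.  A point \<open>x\<close> off \<open>S\<close> is compared with a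
  nearest point \<open>y\<close> of \<open>S\<close>: for \<open>t\<close> in \<open>S\<close> one has \<open>\<bar>y - t\<bar> \<le> 2 \<bar>x - t\<bar>\<close>, which at short distances
  costs at most a factor two in the kernel.  This is the continuity principle for logarithmic
  potentials in a quantitative form.\<close>
lemma kato_of_continuous:
  assumes fb: "finite_borel_measure \<mu>" and S: "compact S" and ae: "AE t in \<mu>. t \<in> S"
    and f: "continuous_on S f" and lp: "\<And>x. x \<in> S \<Longrightarrow> log_potential \<mu> (of_real x) = ereal (f x)"
  shows "kato \<mu>"
proof -
  interpret finite_borel_measure \<mu> by fact
  note [measurable_cong] = M_is_borel
  obtain M where M: "\<And>t. t \<in> S \<Longrightarrow> \<bar>t\<bar> \<le> M" using compact_imp_bounded[OF S] by (auto simp: bounded_iff)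
  have l: "log_moment \<mu>" by (rule log_moment_bounded[OF fb]) (use ae M in \<open>auto elim: eventually_mono\<close>)
  have i: "integrable \<mu> (\<lambda>t. - ln \<bar>x - t\<bar>)" and ne: "AE t in \<mu>. t \<noteq> x" and fx: "f x = pot \<mu> x" if "x \<in> S" for x
  proof -
    have lt: "log_potential \<mu> (of_real x) < \<infinity>" using lp[OF that] by simp
    show "integrable \<mu> (\<lambda>t. - ln \<bar>x - t\<bar>)"
      using log_potential_finite(1)[OF l lt] by (simp add: cmod_diff_of_real)
    show "AE t in \<mu>. t \<noteq> x" using log_potential_finite(2)[OF l lt] by (auto elim: eventually_mono)
    show "f x = pot \<mu> x" using log_potential_eq[OF log_potential_finite[OF l lt]] lp[OF that] by (simp add: cpot_of_real)
  qed
  define g where "g n x = f x - (\<integral>t. trunc_log (exp (- real n)) (of_real x) t \<partial>\<mu>)" for n x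
  have d: "0 < exp (- real n)" "exp (- real n) \<le> 1" for n by auto
  (* what truncation at distance exp (-n) removes from the kernel *)
  define ex where "ex n x t = max 0 (- ln \<bar>x - t\<bar> - real n)" for n and x t :: real
  have exm[measurable]: "ex n x \<in> borel_measurable borel" for n x unfolding ex_def by measurable
  have exi: "integrable \<mu> (ex n x)" and gex: "g n x = (\<integral>t. ex n x t \<partial>\<mu>)" if x: "x \<in> S" for n x
  proof -
    have eq: "AE t in \<mu>. ex n x t = - ln \<bar>x - t\<bar> - trunc_log (exp (- real n)) (of_real x) t"
      using ne[OF x]
    proof eventually_elim
      case (elim t)
      show ?case
      proof (cases "exp (- real n) \<le> \<bar>x - t\<bar>")
        case True
        then have "ln (exp (- real n)) \<le> ln \<bar>x - t\<bar>" using elim by (subst ln_le_cancel_iff) auto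
        with True show ?thesis by (simp add: ex_def trunc_log_def cmod_diff_of_real max_def)
      next
        case False
        then have "ln \<bar>x - t\<bar> \<le> ln (exp (- real n))" using elim by (subst ln_le_cancel_iff) auto
        with False show ?thesis by (simp add: ex_def trunc_log_def cmod_diff_of_real max_def)
      qed
    qed
    have i2: "integrable \<mu> (\<lambda>t. - ln \<bar>x - t\<bar> - trunc_log (exp (- real n)) (of_real x) t)"
      using i[OF x] trunc_log_integrable[OF l d] by (rule Bochner_Integration.integrable_diff)
    show "integrable \<mu> (ex n x)"
      by (rule integrable_cong_AE_imp[OF i2]) (use eq in \<open>auto simp: eq_commute\<close>)
    have "(\<integral>t. ex n x t \<partial>\<mu>) = (\<integral>t. - ln \<bar>x - t\<bar> - trunc_log (exp (- real n)) (of_real x) t \<partial>\<mu>)"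
      by (rule integral_cong_AE) (use eq in auto)
    also have "\<dots> = g n x"
      unfolding g_def fx[OF x] pot_def by (rule Bochner_Integration.integral_diff[OF i[OF x] trunc_log_integrable[OF l d]])
    finally show "g n x = (\<integral>t. ex n x t \<partial>\<mu>)" ..
  qed
  have unif: "\<exists>N. \<forall>x\<in>S. g N x < e" if e: "e > 0" for e
  proof (rule dini_decseq[OF S _ _ _ e])
    fix n
    have "continuous_on S (\<lambda>x. \<integral>t. trunc_log (exp (- real n)) (of_real x) t \<partial>\<mu>)"
      by (rule continuous_on_compose2[OF trunc_log_continuous[OF l d]]) (auto intro!: continuous_intros)
    then show "continuous_on S (g n)" unfolding g_def using f by (intro continuous_on_diff)
  next
    fix n m x assume "x \<in> S" "(n::nat) \<le> m"
    then show "g m x \<le> g n x" unfolding gex[OF \<open>x \<in> S\<close>] using exi[OF \<open>x \<in> S\<close>]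
      by (intro integral_mono) (auto simp: ex_def)
  next
    fix x assume x: "x \<in> S"
    have "(\<lambda>n. \<integral>t. ex n x t \<partial>\<mu>) \<longlonglongrightarrow> (\<integral>t. 0 \<partial>\<mu>)"
    proof (rule integral_dominated_convergence)
      show "integrable \<mu> (ex 0 x)" by (rule exi[OF x])
      show "AE t in \<mu>. (\<lambda>n. ex n x t) \<longlonglongrightarrow> 0"
      proof (rule AE_I2, rule tendsto_eventually)
        fix t
        show "\<forall>\<^sub>F n in sequentially. ex n x t = 0"
          using eventually_ge_at_top[of "nat \<lceil>- ln \<bar>x - t\<bar>\<rceil>"]
        proof eventually_elim
          case (elim n)
          then have "- ln \<bar>x - t\<bar> \<le> real n" by linarith
          then show ?case by (simp add: ex_def)
        qed
      qed
      show "AE t in \<mu>. norm (ex n x t) \<le> ex 0 x t" for n by (auto simp: ex_def)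
    qed measurable
    then show "(\<lambda>n. g n x) \<longlonglongrightarrow> 0" using gex[OF x] by simp
  qed
  have nearS: "\<exists>\<delta>. 0 < \<delta> \<and> \<delta> \<le> 1 \<and> (\<forall>x\<in>S. near_pot \<delta> \<mu> x \<le> ennreal (2 * e))" if e: "e > 0" for e
  proof -
    obtain N where N: "\<And>x. x \<in> S \<Longrightarrow> g N x < e" using unif[OF e] by auto
    (* within distance exp (-2 N) the excess over N is at least half of the kernel *)
    have "near_pot (exp (- 2 * real N)) \<mu> x \<le> ennreal (2 * e)" if x: "x \<in> S" for x
    proof -
      have "near_pot (exp (- 2 * real N)) \<mu> x \<le> (\<integral>\<^sup>+t. ennreal (2 * ex N x t) \<partial>\<mu>)"
        unfolding near_pot_def
      proof (rule nn_integral_mono_AE, use ne[OF x] in eventually_elim)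
        fix t assume t: "t \<noteq> x"
        show "klog x t * indicator {t. \<bar>x - t\<bar> < exp (- 2 * real N)} t \<le> ennreal (2 * ex N x t)"
        proof (cases "\<bar>x - t\<bar> < exp (- 2 * real N)")
          case True
          have "ln \<bar>x - t\<bar> < ln (exp (- 2 * real N))" using True t by (subst ln_less_cancel_iff) auto
          then have "- ln \<bar>x - t\<bar> \<le> 2 * ex N x t" by (simp add: ex_def)
          then show ?thesis using True t by (auto simp: klog_def intro!: ennreal_leI)
        qed simp
      qed
      also have "\<dots> = ennreal (\<integral>t. 2 * ex N x t \<partial>\<mu>)"
        by (intro nn_integral_eq_integral integrable_mult_right exi x) (simp add: ex_def)
      also have "(\<integral>t. 2 * ex N x t \<partial>\<mu>) = 2 * g N x" by (simp add: gex[OF x])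
      finally show ?thesis using N[OF x] by (auto elim!: order_trans intro!: ennreal_leI)
    qed
    then show ?thesis by (intro exI[of _ "exp (- 2 * real N)"]) auto
  qed
  show "kato \<mu>"
    unfolding kato_def
  proof (intro allI impI)
    fix M \<epsilon> :: real assume \<epsilon>: "0 < \<epsilon>"
    obtain \<delta> where \<delta>: "0 < \<delta>" "\<delta> \<le> 1" "\<And>x. x \<in> S \<Longrightarrow> near_pot \<delta> \<mu> x \<le> ennreal (2 * (\<epsilon> / 4))"
      using nearS[of "\<epsilon> / 4"] \<epsilon> by auto
    define \<delta>' where "\<delta>' = min (\<delta> / 2) (1 / 4)"
    have \<delta>': "0 < \<delta>'" "\<delta>' < 1" "2 * \<delta>' \<le> \<delta>" "2 * \<delta>' \<le> 1 / 2" using \<delta> by (auto simp: \<delta>'_def)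
    have "near_pot \<delta>' \<mu> x \<le> ennreal \<epsilon>" for x
    proof (cases "S = {}")
      case True
      then have "AE t in \<mu>. False" using ae by simp
      then have "near_pot \<delta>' \<mu> x = (\<integral>\<^sup>+t. 0 \<partial>\<mu>)"
        unfolding near_pot_def by (intro nn_integral_cong_AE) (auto elim: eventually_mono)
      then show ?thesis by simp
    next
      case False
      obtain y where y: "y \<in> S" "\<And>t. t \<in> S \<Longrightarrow> dist x y \<le> dist x t"
        using distance_attains_inf[OF compact_imp_closed[OF S] False, of x] by auto
      have "near_pot \<delta>' \<mu> x \<le> (\<integral>\<^sup>+t. 2 * (klog y t * indicator {t. \<bar>y - t\<bar> < \<delta>} t) \<partial>\<mu>)"
        unfolding near_pot_def
      proof (rule nn_integral_mono_AE, use ae in eventually_elim)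
        fix t assume t: "t \<in> S"
        show "klog x t * indicator {t. \<bar>x - t\<bar> < \<delta>'} t \<le> 2 * (klog y t * indicator {t. \<bar>y - t\<bar> < \<delta>} t)"
        proof (cases "\<bar>x - t\<bar> < \<delta>'")
          case True
          have yt: "\<bar>y - t\<bar> \<le> 2 * \<bar>x - t\<bar>" using y(2)[OF t] abs_triangle_ineq4[of "x - t" "x - y"] by (simp add: dist_real_def)
          then have less: "\<bar>y - t\<bar> < \<delta>" "\<bar>y - t\<bar> < 1 / 2" using True \<delta>' by auto
          show ?thesis
          proof (cases "y = t")
            case True
            then show ?thesis using less \<delta> by (simp add: klog_def ennreal_mult_top)
          next
            case F: False
            then have xt: "x \<noteq> t" using yt by auto
            have "ln (\<bar>y - t\<bar> / 2) \<le> ln \<bar>x - t\<bar>" using yt F xt by (subst ln_le_cancel_iff) auto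
            moreover have "ln (\<bar>y - t\<bar> / 2) = ln \<bar>y - t\<bar> - ln 2" using F by (simp add: ln_div)
            moreover have "ln \<bar>y - t\<bar> \<le> ln (1 / 2)" using F less by (subst ln_le_cancel_iff) auto
            moreover have "ln (1 / 2 :: real) = - ln 2" by (simp add: ln_div)
            moreover have "0 \<le> ln (2 :: real)" by simp
            ultimately have "- ln \<bar>x - t\<bar> \<le> 2 * - ln \<bar>y - t\<bar>" "0 \<le> - ln \<bar>y - t\<bar>" by linarith+
            then show ?thesis using less True xt F
              by (auto simp: klog_def ennreal_mult[symmetric] numeral_mult_ennreal intro!: ennreal_leI)
          qed
        qed simp
      qed
      also have "\<dots> = 2 * near_pot \<delta> \<mu> y" unfolding near_pot_def by (rule nn_integral_cmult) measurable
      also have "\<dots> \<le> 2 * ennreal (2 * (\<epsilon> / 4))" by (intro mult_left_mono \<delta> y) auto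
      also have "\<dots> = ennreal \<epsilon>" using \<epsilon> by (subst numeral_mult_ennreal) auto
      finally show ?thesis .
    qed
    with \<delta>' show "\<exists>\<delta>. 0 < \<delta> \<and> \<delta> < 1 \<and> (\<forall>x. \<bar>x\<bar> \<le> M \<longrightarrow> near_pot \<delta> \<mu> x \<le> ennreal \<epsilon>)" by blast
  qed
qed

lemma kato_mono:
  assumes k: "kato \<alpha>" and s: "sets \<alpha> = sets borel" "sets \<beta> = sets borel" and c: "c \<ge> 0"
    and le: "\<And>A. A \<in> sets borel \<Longrightarrow> emeasure \<beta> A \<le> ennreal c * emeasure \<alpha> A"
  shows "kato \<beta>"
  unfolding kato_def
proof (intro allI impI)
  note [measurable_cong] = s
  fix M \<epsilon> :: real assume \<epsilon>: "0 < \<epsilon>"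
  obtain \<delta> where \<delta>: "0 < \<delta>" "\<delta> < 1" "\<And>x. \<bar>x\<bar> \<le> M \<Longrightarrow> near_pot \<delta> \<alpha> x \<le> ennreal (\<epsilon> / (c + 1))"
    using k \<epsilon> c unfolding kato_def by (metis add_nonneg_pos divide_pos_pos zero_less_one)
  have "near_pot \<delta> \<beta> x \<le> ennreal \<epsilon>" if "\<bar>x\<bar> \<le> M" for x
  proof -
    have "near_pot \<delta> \<beta> x \<le> (\<integral>\<^sup>+t. klog x t * indicator {t. \<bar>x - t\<bar> < \<delta>} t \<partial>scale_measure (ennreal c) \<alpha>)"
      unfolding near_pot_def by (rule nn_integral_le_of_le) (use s le in auto)
    also have "\<dots> = ennreal c * near_pot \<delta> \<alpha> x"
      unfolding near_pot_def by (rule nn_integral_scale_measure) measurable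
    also have "\<dots> \<le> ennreal c * ennreal (\<epsilon> / (c + 1))" by (intro mult_left_mono \<delta> that) auto
    also have "\<dots> = ennreal (c * (\<epsilon> / (c + 1)))" using c \<epsilon> by (subst ennreal_mult) auto
    also have "\<dots> \<le> ennreal \<epsilon>" using c \<epsilon> by (intro ennreal_leI) (simp add: field_simps)
    finally show ?thesis .
  qed
  with \<delta> show "\<exists>\<delta>. 0 < \<delta> \<and> \<delta> < 1 \<and> (\<forall>x. \<bar>x\<bar> \<le> M \<longrightarrow> near_pot \<delta> \<beta> x \<le> ennreal \<epsilon>)" by blast
qed

lemma near_pot_bounded:
  assumes k: "kato \<mu>" and fb: "finite_borel_measure \<mu>"
  shows "\<exists>C\<ge>0. \<forall>x. \<bar>x\<bar> \<le> M \<longrightarrow> near_pot 1 \<mu> x \<le> ennreal C"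
proof -
  interpret finite_borel_measure \<mu> by fact
  note [measurable_cong] = M_is_borel
  obtain \<delta> where \<delta>: "0 < \<delta>" "\<delta> < 1" "\<And>x. \<bar>x\<bar> \<le> M \<Longrightarrow> near_pot \<delta> \<mu> x \<le> ennreal 1"
    using k unfolding kato_def by (metis zero_less_one)
  have "near_pot 1 \<mu> x \<le> ennreal (1 + - ln \<delta> * measure \<mu> UNIV)" if "\<bar>x\<bar> \<le> M" for x
  proof -
    have "near_pot 1 \<mu> x \<le> (\<integral>\<^sup>+t. klog x t * indicator {t. \<bar>x - t\<bar> < \<delta>} t + ennreal (- ln \<delta>) \<partial>\<mu>)"
      unfolding near_pot_def
    proof (rule nn_integral_mono)
      fix t
      have "ln \<delta> \<le> ln \<bar>x - t\<bar>" if "\<not> \<bar>x - t\<bar> < \<delta>" using that \<delta> by (subst ln_le_cancel_iff) auto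
      then show "klog x t * indicator {t. \<bar>x - t\<bar> < 1} t \<le> klog x t * indicator {t. \<bar>x - t\<bar> < \<delta>} t + ennreal (- ln \<delta>)"
        using \<delta> by (auto simp: klog_def split: split_indicator intro!: ennreal_leI)
    qed
    also have "\<dots> = near_pot \<delta> \<mu> x + ennreal (- ln \<delta>) * emeasure \<mu> UNIV"
      unfolding near_pot_def by (subst nn_integral_add) (auto simp: borel_UNIV)
    also have "ennreal (- ln \<delta>) * emeasure \<mu> UNIV = ennreal (- ln \<delta> * measure \<mu> UNIV)"
      unfolding emeasure_eq_measure using \<delta> by (subst ennreal_mult) auto
    also have "near_pot \<delta> \<mu> x + ennreal (- ln \<delta> * measure \<mu> UNIV) \<le> ennreal 1 + ennreal (- ln \<delta> * measure \<mu> UNIV)"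
      using \<delta>(3)[OF that] by (rule add_right_mono)
    also have "\<dots> = ennreal (1 + - ln \<delta> * measure \<mu> UNIV)"
      using \<delta> by (subst ennreal_plus[symmetric]) (auto simp: mult_nonpos_nonneg)
    finally show ?thesis .
  qed
  moreover have "0 \<le> 1 + - ln \<delta> * measure \<mu> UNIV" using \<delta> mult_nonneg_nonneg[of "- ln \<delta>" "measure \<mu> UNIV"] by simp
  ultimately show ?thesis by blast
qed

lemma box_ekernel_le_klog: "box_ekernel 1 x y \<le> klog x y * indicator {t. \<bar>x - t\<bar> < 1} y"
  by (auto simp: box_ekernel_def klog_def box_kernel_def ln_div split: split_indicator intro!: ennreal_leI)

lemma fin_energy_of_kato_bounded:
  assumes k: "kato \<mu>" and fb: "finite_borel_measure \<mu>" and b: "AE t in \<mu>. \<bar>t\<bar> \<le> M"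
  shows "fin_energy \<mu>"
proof -
  interpret finite_borel_measure \<mu> by fact
  obtain C where C: "\<And>x. \<bar>x\<bar> \<le> M \<Longrightarrow> near_pot 1 \<mu> x \<le> ennreal C" using near_pot_bounded[OF k fb] by blast
  have "(\<integral>\<^sup>+x. \<integral>\<^sup>+y. box_ekernel 1 x y \<partial>\<mu> \<partial>\<mu>) \<le> (\<integral>\<^sup>+x. near_pot 1 \<mu> x \<partial>\<mu>)"
    unfolding near_pot_def by (intro nn_integral_mono box_ekernel_le_klog)
  also have "\<dots> \<le> (\<integral>\<^sup>+x. ennreal C \<partial>\<mu>)"
    by (rule nn_integral_mono_AE, use b in eventually_elim) (use C in auto)
  also have "\<dots> < \<infinity>" by (auto simp: ennreal_mult_less_top emeasure_eq_measure)
  finally have "local_energy \<mu>" using local_energy_iff[OF fb] by simp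
  with log_moment_iff[OF fb] log_moment_bounded[OF fb b] show ?thesis by (simp add: fin_energy_def)
qed

section \<open>The quadratic structure of the functional\<close>

lemma AE_log_potential:
  assumes a: "fin_energy \<alpha>" and b: "fin_energy \<beta>"
  shows "AE x in \<alpha>. log_potential \<beta> (of_real x) = ereal (pot \<beta> x)"
  using energy_eq_integral_pot(3)[OF a b]
proof eventually_elim
  case (elim x)
  interpret b: finite_borel_measure \<beta> using fin_energyD[OF b] by simp
  have "emeasure \<beta> {x} = 0" using fin_energy_no_atom[OF b, of x] b.emeasure_eq_measure by simp
  then have "{x} \<in> null_sets \<beta>" using b.M_is_borel by (auto simp: null_sets_def)
  then have "AE t in \<beta>. t \<notin> {x}" by (rule AE_not_in)
  then have ae: "AE t in \<beta>. complex_of_real x \<noteq> of_real t" by (auto elim: eventually_mono)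
  have "integrable \<beta> (\<lambda>t. - ln (cmod (of_real x - of_real t)))" using elim by (simp add: cmod_diff_of_real)
  from log_potential_eq[OF this ae] show ?case by (simp add: cpot_of_real)
qed

text \<open>The interaction form \<open>x\<^sup>2 - x y + y\<^sup>2\<close> evaluated at the differences \<open>\<nu>1 - \<kappa>1\<close> and \<open>\<nu>2 - \<kappa>2\<close>.\<close>
definition quad_form :: "real measure \<Rightarrow> real measure \<Rightarrow> real measure \<Rightarrow> real measure \<Rightarrow> real" where
  "quad_form \<kappa>1 \<kappa>2 \<nu>1 \<nu>2 =
     (energy \<nu>1 \<nu>1 - 2 * energy \<nu>1 \<kappa>1 + energy \<kappa>1 \<kappa>1)
     - (energy \<nu>1 \<nu>2 - energy \<nu>1 \<kappa>2 - energy \<kappa>1 \<nu>2 + energy \<kappa>1 \<kappa>2)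
     + (energy \<nu>2 \<nu>2 - 2 * energy \<nu>2 \<kappa>2 + energy \<kappa>2 \<kappa>2)"

text \<open>The form is \<open>\<parallel>y - x / 2\<parallel>\<^sup>2 + 3 / 4 \<parallel>x\<parallel>\<^sup>2\<close> for the energy norm of neutral differences.\<close>
lemma quad_form:
  assumes n: "fin_energy \<kappa>1" "fin_energy \<kappa>2" "fin_energy \<nu>1" "fin_energy \<nu>2"
    and m: "measure \<nu>1 UNIV = measure \<kappa>1 UNIV" "measure \<nu>2 UNIV = measure \<kappa>2 UNIV"
  shows quad_form_nonneg: "0 \<le> quad_form \<kappa>1 \<kappa>2 \<nu>1 \<nu>2"
    and quad_form_eq_0: "quad_form \<kappa>1 \<kappa>2 \<nu>1 \<nu>2 = 0 \<Longrightarrow> \<nu>1 = \<kappa>1 \<and> \<nu>2 = \<kappa>2"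
proof -
  note comm = energy_commute
  (* the neutral difference \<alpha> - \<beta> = (\<nu>2 - \<kappa>2) - (\<nu>1 - \<kappa>1) / 2 is the first square *)
  define \<alpha> where "\<alpha> = mix 1 \<nu>2 (1/2) \<kappa>1"
  define \<beta> where "\<beta> = mix 1 \<kappa>2 (1/2) \<nu>1"
  define N1 where "N1 = energy \<nu>1 \<nu>1 - 2 * energy \<nu>1 \<kappa>1 + energy \<kappa>1 \<kappa>1"
  have na: "fin_energy \<alpha>" and nb: "fin_energy \<beta>" using n by (auto simp: \<alpha>_def \<beta>_def intro!: fin_energy_mix)
  have mab: "measure \<alpha> UNIV = measure \<beta> UNIV"
    using n m by (simp add: \<alpha>_def \<beta>_def measure_mix fin_energyD(1))
  have el: "energy (mix 1 a (1/2) b) c = energy a c + energy b c / 2"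
     "energy c (mix 1 a (1/2) b) = energy c a + energy c b / 2" if "fin_energy a" "fin_energy b" "fin_energy c" for a b c
    using energy_mix_left[of a b c 1 "1/2"] energy_mix_right[of a b c 1 "1/2"] that by auto
  have N1: "0 \<le> N1" unfolding N1_def by (rule energy_neutral(2)) (use n m in auto)
  have Q: "quad_form \<kappa>1 \<kappa>2 \<nu>1 \<nu>2 = (energy \<alpha> \<alpha> - 2 * energy \<alpha> \<beta> + energy \<beta> \<beta>) + 3 / 4 * N1"
    unfolding \<alpha>_def \<beta>_def N1_def quad_form_def using n
    by (simp add: el fin_energy_mix comm[of \<nu>2 \<kappa>1] comm[of \<nu>2 \<nu>1] comm[of \<kappa>2 \<kappa>1] comm[of \<kappa>2 \<nu>1] comm[of \<kappa>1 \<nu>1] comm[of \<kappa>2 \<nu>2],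
        simp add: field_simps)
  have E: "0 \<le> energy \<alpha> \<alpha> - 2 * energy \<alpha> \<beta> + energy \<beta> \<beta>" by (rule energy_neutral(2)[OF na nb mab])
  show "0 \<le> quad_form \<kappa>1 \<kappa>2 \<nu>1 \<nu>2" using Q N1 E by simp
  assume z: "quad_form \<kappa>1 \<kappa>2 \<nu>1 \<nu>2 = 0"
  then have "N1 = 0" using Q N1 E by linarith
  then have e1: "\<nu>1 = \<kappa>1" unfolding N1_def by (rule energy_neutral_eq_0[rotated -1]) (use n m in auto)
  have "energy \<nu>2 \<nu>2 - 2 * energy \<nu>2 \<kappa>2 + energy \<kappa>2 \<kappa>2 = 0" using z unfolding quad_form_def e1 by simp
  then have "\<nu>2 = \<kappa>2" by (rule energy_neutral_eq_0[rotated -1]) (use n m in auto)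
  with e1 show "\<nu>1 = \<kappa>1 \<and> \<nu>2 = \<kappa>2" by simp
qed

section \<open>The constrained problem\<close>

locale constrained_problem =
  fixes \<sigma> :: "real measure" and \<phi> :: "real \<Rightarrow> real"
  assumes sets_sigma: "sets \<sigma> = sets borel"
    and supp_sigma: "measure_support \<sigma> = {..0}"
    and mass_sigma: "emeasure \<sigma> UNIV > 1"
    and cont_sigma: "\<And>K. compact K \<Longrightarrow> K \<subseteq> {..0} \<Longrightarrow> continuous_potential (measure_restrict \<sigma> K)"
    and phi_cont: "continuous_on {0..} \<phi>"
    and phi_lim: "filterlim (\<lambda>x. \<phi> x - 4 * ln x) at_top at_top"
begin

lemma AE_sigma: "AE x in \<sigma>. x \<le> 0"
  using AE_support[OF sets_sigma] supp_sigma by simp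

lemmas emeasure_restrict = emeasure_measure_restrict[OF sets_sigma]

lemma sets_restrict[simp]: "sets (measure_restrict \<sigma> K) = sets borel"
  by (simp add: measure_restrict_def sets_sigma)

text \<open>If the restriction to a compact set had infinite mass, its potential would be \<open>-\<infinity>\<close> at
  every point whose distance from that set exceeds one.\<close>
lemma sigma_finite_compact: "emeasure \<sigma> {-n..0} < \<infinity>"
proof -
  let ?K = "{-n..0} :: real set"
  let ?r = "measure_restrict \<sigma> ?K"
  have cp: "continuous_potential ?r" by (rule cont_sigma) auto
  note [measurable_cong] = sets_restrict[of ?K]
  have ae: "AE t in ?r. t \<in> ?K"
    unfolding measure_restrict_def by (subst AE_density) (auto simp: sets_sigma split: split_indicator cong: measurable_cong_sets)
  (* any point with ln (z - t) \<ge> 1 for all t \<le> 0 would do *)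
  define z where "z = complex_of_real 3"
  have k: "log_kernel z (of_real t) = ereal (- ln (3 - t))" if "t \<le> 0" for t
  proof -
    have d: "dist z (of_real t) = 3 - t" unfolding z_def dist_norm cmod_diff_of_real using that by simp
    moreover have "z \<noteq> of_real t" using d that by auto
    ultimately show ?thesis using that by (simp add: log_kernel_def ln_div)
  qed
  have one: "1 \<le> ln (3 - t)" if "t \<le> 0" for t :: real
  proof -
    have "exp 1 \<le> 3 - t" using exp_le that by linarith
    then show ?thesis by (metis exp_gt_zero ln_exp ln_mono order_less_le_trans)
  qed
  have "(\<integral>\<^sup>+t. e2ennreal (log_kernel z (of_real t)) \<partial>?r) = (\<integral>\<^sup>+t. 0 \<partial>?r)"
    by (rule nn_integral_cong_AE, use ae in eventually_elim) (use k one in \<open>auto simp: e2ennreal_ereal intro!: ennreal_neg dest: order_trans[OF zero_le_one]\<close>)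
  moreover have "emeasure ?r UNIV \<le> (\<integral>\<^sup>+t. e2ennreal (- log_kernel z (of_real t)) \<partial>?r)"
  proof -
    have "emeasure ?r UNIV = (\<integral>\<^sup>+t. 1 \<partial>?r)"
      using sets_eq_imp_space_eq[OF sets_restrict[of ?K]] by simp
    also have "\<dots> \<le> (\<integral>\<^sup>+t. e2ennreal (- log_kernel z (of_real t)) \<partial>?r)"
    proof (rule nn_integral_mono_AE, use ae in eventually_elim)
      fix t assume "t \<in> ?K"
      then have "t \<le> 0" by simp
      then have "e2ennreal (- log_kernel z (of_real t)) = ennreal (ln (3 - t))" by (simp add: k e2ennreal_ereal)
      then show "1 \<le> e2ennreal (- log_kernel z (of_real t))"
        using one[OF \<open>t \<le> 0\<close>] by (simp add: ennreal_ge_1)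
    qed
    finally show ?thesis .
  qed
  ultimately have "log_potential ?r z = 0 - enn2ereal (\<integral>\<^sup>+t. e2ennreal (- log_kernel z (of_real t)) \<partial>?r)"
    by (simp add: log_potential_def ext_integral_def zero_ennreal.rep_eq)
  moreover have "\<bar>log_potential ?r z\<bar> \<noteq> \<infinity>" using cp by (simp add: continuous_potential_def)
  ultimately have "(\<integral>\<^sup>+t. e2ennreal (- log_kernel z (of_real t)) \<partial>?r) \<noteq> top" by auto
  with \<open>emeasure ?r UNIV \<le> _\<close> have "emeasure ?r UNIV < top" by (metis less_top order_le_less_trans)
  then show ?thesis by (simp add: emeasure_restrict)
qed

lemma finite_borel_restrict: "finite_borel_measure (measure_restrict \<sigma> {-n..0})"
  using sigma_finite_compact[of n] by (intro finite_borel_measureI) (auto simp: emeasure_restrict)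

lemma AE_restrict: "AE t in measure_restrict \<sigma> {-n..0}. t \<in> {-n..0}"
  unfolding measure_restrict_def
  by (subst AE_density) (auto simp: sets_sigma split: split_indicator cong: measurable_cong_sets)

lemma kato_restrict: "kato (measure_restrict \<sigma> {-n..0})"
proof (rule kato_of_continuous[OF finite_borel_restrict compact_Icc AE_restrict])
  let ?r = "measure_restrict \<sigma> {-n..0}"
  have cp: "continuous_potential ?r" by (rule cont_sigma) auto
  then show "log_potential ?r (of_real x) = ereal (real_of_ereal (log_potential ?r (of_real x)))" for x
    by (simp add: continuous_potential_def ereal_real')
  have "continuous_on UNIV (\<lambda>z. real_of_ereal (log_potential ?r z))"
    using cp continuous_on_iff_real[of UNIV "log_potential ?r"]
    by (simp add: continuous_potential_def comp_def)
  then show "continuous_on {-n..0} (\<lambda>x. real_of_ereal (log_potential ?r (of_real x)))"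
    by (rule continuous_on_compose2) (auto intro!: continuous_intros)
qed

lemma kato_sigma: "kato \<sigma>"
  unfolding kato_def
proof (intro allI impI)
  note [measurable_cong] = sets_sigma
  fix M \<epsilon> :: real assume \<epsilon>: "0 < \<epsilon>"
  let ?r = "measure_restrict \<sigma> {-(M+1)..0}"
  obtain \<delta> where \<delta>: "0 < \<delta>" "\<delta> < 1" "\<And>x. \<bar>x\<bar> \<le> M \<Longrightarrow> near_pot \<delta> ?r x \<le> ennreal \<epsilon>"
    using kato_restrict[of "M+1"] \<epsilon> unfolding kato_def by blast
  have "near_pot \<delta> \<sigma> x \<le> ennreal \<epsilon>" if x: "\<bar>x\<bar> \<le> M" for x
  proof -
    have "near_pot \<delta> \<sigma> x \<le> (\<integral>\<^sup>+t. indicator {-(M+1)..0} t * (klog x t * indicator {t. \<bar>x - t\<bar> < \<delta>} t) \<partial>\<sigma>)"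
      unfolding near_pot_def
      by (rule nn_integral_mono_AE, use AE_sigma in eventually_elim)
         (use x \<delta> in \<open>auto split: split_indicator\<close>)
    also have "\<dots> = near_pot \<delta> ?r x"
      unfolding near_pot_def measure_restrict_def by (subst nn_integral_density) measurable
    finally show ?thesis using \<delta>(3)[OF x] by simp
  qed
  with \<delta> show "\<exists>\<delta>. 0 < \<delta> \<and> \<delta> < 1 \<and> (\<forall>x. \<bar>x\<bar> \<le> M \<longrightarrow> near_pot \<delta> \<sigma> x \<le> ennreal \<epsilon>)" by blast
qed

lemma ex_compact_mass_gt_1: "\<exists>n>0. emeasure \<sigma> {-n..0} > 1"
proof -
  have "(\<lambda>n. emeasure \<sigma> {-real n..0}) \<longlonglongrightarrow> emeasure \<sigma> (\<Union>n. {-real n..0})"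
    by (rule Lim_emeasure_incseq) (auto simp: sets_sigma incseq_def)
  moreover have "(\<Union>n. {-real n..0}) = {..0}"
  proof (intro set_eqI iffI)
    fix x :: real assume "x \<in> {..0}"
    moreover obtain n where "- x \<le> real n" using real_arch_simple by blast
    ultimately show "x \<in> (\<Union>n. {-real n..0})" by (auto intro!: exI[of _ n])
  qed auto
  moreover have "emeasure \<sigma> {..0} = emeasure \<sigma> UNIV"
    using AE_sigma by (intro emeasure_eq_AE) (auto simp: sets_sigma)
  ultimately have "\<forall>\<^sub>F n in sequentially. 1 < emeasure \<sigma> {-real n..0}"
    using order_tendstoD(1)[of _ "emeasure \<sigma> UNIV"] mass_sigma by auto
  then have "\<forall>\<^sub>F n in sequentially. 1 < emeasure \<sigma> {-real n..0} \<and> n > 0"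
    using eventually_gt_at_top[of 0] by eventually_elim auto
  then obtain n :: nat where "1 < emeasure \<sigma> {-real n..0}" "n > 0" by (auto simp: eventually_sequentially)
  then show ?thesis by (intro exI[of _ "real n"]) auto
qed

text \<open>The restriction of \<open>\<sigma>\<close> to an interval of mass greater than one, normalized.\<close>
lemma ex_reference_left:
  "\<exists>\<beta> M. finite_borel_measure \<beta> \<and> measure \<beta> UNIV = 1 \<and> kato \<beta> \<and> M \<ge> 0 \<and> (AE t in \<beta>. -M \<le> t \<and> t \<le> 0)
     \<and> (\<forall>A\<in>sets borel. emeasure \<beta> A \<le> emeasure \<sigma> A)"
proof -
  obtain n where n: "n > 0" "emeasure \<sigma> {-n..0} > 1" using ex_compact_mass_gt_1 by blast
  let ?r = "measure_restrict \<sigma> {-n..0}"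
  interpret r: finite_borel_measure ?r by (rule finite_borel_restrict)
  define m where "m = measure ?r UNIV"
  have em: "emeasure ?r UNIV = emeasure \<sigma> {-n..0}" by (simp add: emeasure_restrict)
  have m: "m > 1" using n(2) unfolding em[symmetric] m_def by (simp add: r.emeasure_eq_measure)
  let ?b = "mix (1/m) ?r 0 ?r"
  have fb: "finite_borel_measure ?b" by (intro finite_borel_mix finite_borel_restrict)
  have e: "emeasure ?b A = ennreal (1/m) * emeasure ?r A" if "A \<in> sets borel" for A
    using that by (simp add: emeasure_mix)
  have "measure ?b UNIV = 1" using m by (simp add: measure_mix finite_borel_restrict m_def)
  moreover have "kato ?b" by (rule kato_mono[OF kato_restrict[of n], of _ "1/m"]) (use m e in auto)
  moreover have "AE t in ?b. -n \<le> t \<and> t \<le> 0"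
  proof (rule AE_I[of _ _ "- {-n..0}"])
    have "emeasure ?r (- {-n..0}) = 0" by (simp add: emeasure_restrict Compl_disjoint)
    then show "emeasure ?b (- {-n..0}) = 0" by (simp add: e)
  qed auto
  moreover have "emeasure ?b A \<le> emeasure \<sigma> A" if A: "A \<in> sets borel" for A
  proof -
    have "emeasure ?b A \<le> 1 * emeasure ?r A" unfolding e[OF A] using m
      by (intro mult_right_mono) (auto simp: ennreal_le_1)
    also have "\<dots> \<le> emeasure \<sigma> A" using A by (auto simp: emeasure_restrict sets_sigma intro!: emeasure_mono)
    finally show ?thesis .
  qed
  ultimately show ?thesis using fb n by (intro exI[of _ ?b] exI[of _ n]) auto
qed

text \<open>The reflection of a normalized restriction of \<open>\<sigma>\<close>: this spares the computation of a concrete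
  continuous potential on the right half line.\<close>
lemma ex_reference_right:
  "\<exists>\<tau> M. finite_borel_measure \<tau> \<and> measure \<tau> UNIV = 1 \<and> kato \<tau> \<and> M \<ge> 0 \<and> (AE t in \<tau>. 0 \<le> t \<and> t \<le> M)"
proof -
  obtain \<beta> M where b: "finite_borel_measure \<beta>" "measure \<beta> UNIV = 1" "kato \<beta>" "M \<ge> 0" "AE t in \<beta>. -M \<le> t \<and> t \<le> 0"
    using ex_reference_left by blast
  interpret b: finite_borel_measure \<beta> by fact
  note [measurable_cong] = b.M_is_borel
  let ?t = "distr \<beta> borel uminus"
  have "finite_borel_measure ?t" 
    by (intro finite_borel_measureI) (auto simp: emeasure_distr b.borel_UNIV b.emeasure_eq_measure)
  moreover have "measure ?t UNIV = 1" using b(2) by (simp add: measure_distr b.borel_UNIV)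
  moreover have np: "near_pot \<delta> ?t x = near_pot \<delta> \<beta> (- x)" for \<delta> x
  proof -
    have "near_pot \<delta> ?t x = (\<integral>\<^sup>+t. klog x (- t) * indicator {t. \<bar>x - t\<bar> < \<delta>} (- t) \<partial>\<beta>)"
      unfolding near_pot_def by (subst nn_integral_distr) auto
    also have "\<dots> = near_pot \<delta> \<beta> (- x)"
      unfolding near_pot_def by (rule nn_integral_cong) (auto simp: klog_def abs_minus_commute minus_equation_iff algebra_simps split: split_indicator)
    finally show ?thesis .
  qed
  moreover from b(3) have "kato ?t" unfolding kato_def np by (metis abs_minus_cancel)
  moreover have "AE t in ?t. 0 \<le> t \<and> t \<le> M"
    using b(5) by (subst AE_distr_iff) (auto elim: eventually_mono)
  ultimately show ?thesis using b(4) by blast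
qed

subsection \<open>The external field\<close>

text \<open>The external field, continued by a constant so as to be continuous on the whole line.\<close>
definition phi0 :: "real \<Rightarrow> real" where "phi0 x = \<phi> (max 0 x)"

lemma phi0_eq: "x \<ge> 0 \<Longrightarrow> phi0 x = \<phi> x"
  by (simp add: phi0_def max_def)

lemma phi0_cont: "continuous_on UNIV phi0"
  unfolding phi0_def by (rule continuous_on_compose2[OF phi_cont]) (auto intro!: continuous_intros)

lemma phi0_measurable[measurable]: "phi0 \<in> borel_measurable borel"
  using phi0_cont by (rule borel_measurable_continuous_onI)

lemma phi0_lower: "\<exists>C. \<forall>x\<ge>0. 2 * ln (1 + x\<^sup>2) - C \<le> phi0 x"
proof -
  obtain X where X: "\<And>x. x \<ge> X \<Longrightarrow> 0 \<le> \<phi> x - 4 * ln x"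
    using phi_lim unfolding filterlim_at_top eventually_at_top_linorder by blast
  define Y where "Y = max X 1"
  have "\<exists>B. \<forall>x\<in>{0..Y}. B \<le> phi0 x - 2 * ln (1 + x\<^sup>2)"
  proof -
    have ne: "{0..Y} \<noteq> {}" by (auto simp: Y_def)
    have "continuous_on {0..Y} (\<lambda>x. phi0 x - 2 * ln (1 + x\<^sup>2))"
      by (intro continuous_intros continuous_on_subset[OF phi0_cont]) (auto simp: add_nonneg_eq_0_iff)
    then obtain x where "\<forall>y\<in>{0..Y}. phi0 x - 2 * ln (1 + x\<^sup>2) \<le> phi0 y - 2 * ln (1 + y\<^sup>2)"
      using continuous_attains_inf[OF compact_Icc ne] by blast
    then show ?thesis by blast
  qed
  then obtain B where "\<forall>x\<in>{0..Y}. B \<le> phi0 x - 2 * ln (1 + x\<^sup>2)" by blast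
  then have B: "\<And>x. 0 \<le> x \<Longrightarrow> x \<le> Y \<Longrightarrow> B \<le> phi0 x - 2 * ln (1 + x\<^sup>2)" by simp
  have "2 * ln (1 + x\<^sup>2) - max (- B) (2 * ln 2) \<le> phi0 x" if x: "x \<ge> 0" for x
  proof (cases "x \<le> Y")
    case True
    then show ?thesis using B[OF x True] by linarith
  next
    case False
    then have x1: "x \<ge> 1" "x \<ge> X" by (auto simp: Y_def)
    have "ln (1 + x\<^sup>2) \<le> ln (2 * x\<^sup>2)" using x1 by (subst ln_le_cancel_iff) (auto simp: add_pos_nonneg one_le_power)
    also have "\<dots> = ln 2 + 2 * ln x" using x1 by (simp add: ln_mult ln_realpow)
    finally show ?thesis using X[OF x1(2)] x1 by (simp add: phi0_eq)
  qed
  then show ?thesis by blast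
qed

subsection \<open>Admissible pairs\<close>

definition adm :: "real measure \<Rightarrow> real measure \<Rightarrow> bool" where
  "adm \<mu>1 \<mu>2 \<longleftrightarrow> finite_borel_measure \<mu>1 \<and> measure \<mu>1 UNIV = 2 \<and> (AE x in \<mu>1. 0 \<le> x)
     \<and> finite_borel_measure \<mu>2 \<and> measure \<mu>2 UNIV = 1 \<and> (AE x in \<mu>2. x \<le> 0)
     \<and> (\<forall>A\<in>sets borel. emeasure \<mu>2 A \<le> emeasure \<sigma> A)"

text \<open>The pairs at which the functional is finite.\<close>
definition feas :: "real measure \<Rightarrow> real measure \<Rightarrow> bool" where
  "feas \<mu>1 \<mu>2 \<longleftrightarrow> adm \<mu>1 \<mu>2 \<and> fin_energy \<mu>1 \<and> fin_energy \<mu>2 \<and> integrable \<mu>1 phi0"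

text \<open>Half of the functional, as a real number.\<close>
definition J_real :: "real measure \<Rightarrow> real measure \<Rightarrow> real" where
  "J_real \<mu>1 \<mu>2 = energy \<mu>1 \<mu>1 - energy \<mu>1 \<mu>2 + energy \<mu>2 \<mu>2 + (\<integral>x. phi0 x \<partial>\<mu>1)"

text \<open>The left-hand side of the variational inequality, expressed by mutual energies.\<close>
definition slope :: "real measure \<Rightarrow> real measure \<Rightarrow> real measure \<Rightarrow> real measure \<Rightarrow> real" where
  "slope \<kappa>1 \<kappa>2 \<nu>1 \<nu>2 =
     ((2 * energy \<nu>1 \<kappa>1 - energy \<nu>1 \<kappa>2 + (\<integral>x. phi0 x \<partial>\<nu>1)) - (2 * energy \<kappa>1 \<kappa>1 - energy \<kappa>1 \<kappa>2 + (\<integral>x. phi0 x \<partial>\<kappa>1)))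
     + ((2 * energy \<nu>2 \<kappa>2 - energy \<nu>2 \<kappa>1) - (2 * energy \<kappa>2 \<kappa>2 - energy \<kappa>2 \<kappa>1))"

lemma measures_mass_iff:
  assumes "closed D" "c \<ge> 0"
  shows "\<mu> \<in> measures_mass c D \<longleftrightarrow> finite_borel_measure \<mu> \<and> measure \<mu> UNIV = c \<and> (AE x in \<mu>. x \<in> D)"
proof
  assume m: "\<mu> \<in> measures_mass c D"
  then have s: "sets \<mu> = sets borel" "measure_support \<mu> \<subseteq> D" "emeasure \<mu> UNIV = ennreal c"
    by (auto simp: measures_mass_def)
  then have "finite_borel_measure \<mu>" by (intro finite_borel_measureI) auto
  moreover have "measure \<mu> UNIV = c" using s(3) assms by (simp add: measure_def)
  ultimately show "finite_borel_measure \<mu> \<and> measure \<mu> UNIV = c \<and> (AE x in \<mu>. x \<in> D)"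
    using support_subset_iff[OF s(1) assms(1)] s(2) by simp
next
  assume m: "finite_borel_measure \<mu> \<and> measure \<mu> UNIV = c \<and> (AE x in \<mu>. x \<in> D)"
  then interpret finite_borel_measure \<mu> by simp
  show "\<mu> \<in> measures_mass c D"
    using m support_subset_iff[OF M_is_borel assms(1)] by (auto simp: measures_mass_def M_is_borel emeasure_eq_measure)
qed

lemma le_sigma_iff: "sets \<mu> = sets borel \<Longrightarrow> \<mu> \<le> \<sigma> \<longleftrightarrow> (\<forall>A\<in>sets borel. emeasure \<mu> A \<le> emeasure \<sigma> A)"
proof
  assume s: "sets \<mu> = sets borel" and "\<mu> \<le> \<sigma>"
  then show "\<forall>A\<in>sets borel. emeasure \<mu> A \<le> emeasure \<sigma> A" using le_measureD3[of \<mu> \<sigma>] sets_sigma by simp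
next
  assume s: "sets \<mu> = sets borel" and le: "\<forall>A\<in>sets borel. emeasure \<mu> A \<le> emeasure \<sigma> A"
  have "emeasure \<mu> A \<le> emeasure \<sigma> A" for A
    by (cases "A \<in> sets borel") (use le s in \<open>auto simp: emeasure_notin_sets\<close>)
  then show "\<mu> \<le> \<sigma>"
    using s sets_sigma by (intro less_eq_measure.intros(3)) (auto simp: le_fun_def intro!: sets_eq_imp_space_eq)
qed

lemma admissible_iff: "(\<mu>1, \<mu>2) \<in> admissible \<sigma> \<longleftrightarrow> adm \<mu>1 \<mu>2"
  using le_sigma_iff[of \<mu>2] finite_borel_measureD(1)[of \<mu>2]
  by (auto simp: admissible_def adm_def measures_mass_iff)

lemma admissible_star_iff: "(\<mu>1, \<mu>2) \<in> admissible_star \<sigma> \<longleftrightarrow> adm \<mu>1 \<mu>2 \<and> fin_energy \<mu>1 \<and> fin_energy \<mu>2"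
  using fin_energy_iff[of \<mu>1] fin_energy_iff[of \<mu>2] by (auto simp: admissible_star_def admissible_iff adm_def)

lemma adm_mix:
  assumes a: "adm \<mu>1 \<mu>2" and b: "adm \<nu>1 \<nu>2" and t: "0 \<le> t" "t \<le> 1"
  shows "adm (mix (1 - t) \<mu>1 t \<nu>1) (mix (1 - t) \<mu>2 t \<nu>2)"
proof -
  have f: "finite_borel_measure \<mu>1" "finite_borel_measure \<mu>2" "finite_borel_measure \<nu>1" "finite_borel_measure \<nu>2"
    using a b by (auto simp: adm_def)
  note s = f[THEN finite_borel_measureD(1)]
  have ae: "AE x in mix (1 - t) \<alpha> t \<beta>. x \<in> D"
    if "AE x in \<alpha>. x \<in> D" "AE x in \<beta>. x \<in> D" and D: "closed D" and fab: "finite_borel_measure \<alpha>" "finite_borel_measure \<beta>"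
    for \<alpha> \<beta> and D :: "real set"
  proof -
    note d = finite_borel_measureD[OF fab(1)] finite_borel_measureD[OF fab(2)]
    have "emeasure \<alpha> (- D) = 0" "emeasure \<beta> (- D) = 0"
      using that d AE_iff_measurable[of "- D" \<alpha> "\<lambda>x. x \<in> D"] AE_iff_measurable[of "- D" \<beta> "\<lambda>x. x \<in> D"] by auto
    then have "emeasure (mix (1 - t) \<alpha> t \<beta>) (- D) = 0" using d D by (subst emeasure_mix) auto
    then show ?thesis using AE_iff_measurable[of "- D" "mix (1 - t) \<alpha> t \<beta>" "\<lambda>x. x \<in> D"] D by auto
  qed
  have "AE x in mix (1 - t) \<mu>1 t \<nu>1. 0 \<le> x"
    using ae[where \<alpha>=\<mu>1 and \<beta>=\<nu>1 and D="{0..}"] a b f by (simp add: adm_def)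
  moreover have "AE x in mix (1 - t) \<mu>2 t \<nu>2. x \<le> 0"
    using ae[where \<alpha>=\<mu>2 and \<beta>=\<nu>2 and D="{..0}"] a b f by (simp add: adm_def)
  moreover have "emeasure (mix (1 - t) \<mu>2 t \<nu>2) A \<le> emeasure \<sigma> A" if A: "A \<in> sets borel" for A
  proof -
    have "emeasure (mix (1 - t) \<mu>2 t \<nu>2) A \<le> ennreal (1 - t) * emeasure \<sigma> A + ennreal t * emeasure \<sigma> A"
      using a b A s by (subst emeasure_mix) (auto simp: adm_def intro!: add_mono mult_left_mono)
    also have "\<dots> = emeasure \<sigma> A" using t by (simp add: distrib_right[symmetric] ennreal_plus[symmetric] del: ennreal_plus)
    finally show ?thesis .
  qed
  ultimately show ?thesis
    using a b t f by (auto simp: adm_def measure_mix finite_borel_mix)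
qed

lemma feasD:
  assumes "feas \<mu>1 \<mu>2"
  shows "adm \<mu>1 \<mu>2" "fin_energy \<mu>1" "fin_energy \<mu>2" "integrable \<mu>1 phi0" "measure \<mu>1 UNIV = 2" "measure \<mu>2 UNIV = 1"
    "finite_borel_measure \<mu>1" "finite_borel_measure \<mu>2" "sets \<mu>1 = sets borel" "sets \<mu>2 = sets borel"
  using assms by (auto simp: feas_def adm_def fin_energyD finite_borel_measureD(1))

lemma feas_mix:
  assumes a: "feas \<mu>1 \<mu>2" and b: "feas \<nu>1 \<nu>2" and t: "0 \<le> t" "t \<le> 1"
  shows "feas (mix (1 - t) \<mu>1 t \<nu>1) (mix (1 - t) \<mu>2 t \<nu>2)"
  using adm_mix[of \<mu>1 \<mu>2 \<nu>1 \<nu>2 t] feasD[OF a] feasD[OF b] t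
  by (auto simp: feas_def intro!: fin_energy_mix integral_mix(1))

text \<open>The functional is a quadratic polynomial in the parameter of a segment.\<close>
lemma J_real_mix:
  assumes a: "feas \<kappa>1 \<kappa>2" and b: "feas \<nu>1 \<nu>2" and t: "0 \<le> t" "t \<le> 1"
  shows "J_real (mix (1 - t) \<kappa>1 t \<nu>1) (mix (1 - t) \<kappa>2 t \<nu>2) =
    J_real \<kappa>1 \<kappa>2 + t * slope \<kappa>1 \<kappa>2 \<nu>1 \<nu>2 + t\<^sup>2 * quad_form \<kappa>1 \<kappa>2 \<nu>1 \<nu>2"
proof -
  note n = feasD(2,3)[OF a] feasD(2,3)[OF b]
  note comm = energy_commute
  have el: "energy (mix (1 - t) \<alpha> t \<beta>) \<gamma> = (1 - t) * energy \<alpha> \<gamma> + t * energy \<beta> \<gamma>"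
     "energy \<gamma> (mix (1 - t) \<alpha> t \<beta>) = (1 - t) * energy \<gamma> \<alpha> + t * energy \<gamma> \<beta>" if "fin_energy \<alpha>" "fin_energy \<beta>" "fin_energy \<gamma>" for \<alpha> \<beta> \<gamma>
    using energy_mix_left[of \<alpha> \<beta> \<gamma> "1 - t" t] energy_mix_right[of \<alpha> \<beta> \<gamma> "1 - t" t] that t by auto
  have p: "(\<integral>x. phi0 x \<partial>mix (1 - t) \<kappa>1 t \<nu>1) = (1 - t) * (\<integral>x. phi0 x \<partial>\<kappa>1) + t * (\<integral>x. phi0 x \<partial>\<nu>1)"
    using feasD[OF a] feasD[OF b] t by (intro integral_mix(2)) auto
  have nm: "fin_energy (mix (1 - t) \<kappa>1 t \<nu>1)" "fin_energy (mix (1 - t) \<kappa>2 t \<nu>2)" using n t by (auto intro!: fin_energy_mix)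
  show ?thesis
    unfolding J_real_def slope_def quad_form_def p using n nm
    by (simp add: el comm[of \<kappa>2 \<kappa>1] comm[of \<nu>2 \<nu>1] comm[of \<nu>2 \<kappa>1] comm[of \<kappa>2 \<nu>1] comm[of \<kappa>1 \<nu>1] comm[of \<kappa>2 \<nu>2])
       (simp add: algebra_simps power2_eq_square)
qed

lemma mix_0_1:
  assumes "sets \<alpha> = sets borel" "sets \<beta> = sets borel" shows "mix 0 \<alpha> 1 \<beta> = \<beta>"
  by (rule measure_eqI) (use assms in \<open>auto simp: emeasure_mix\<close>)

lemma J_real_expand:
  assumes a: "feas \<kappa>1 \<kappa>2" and b: "feas \<nu>1 \<nu>2"
  shows "J_real \<nu>1 \<nu>2 = J_real \<kappa>1 \<kappa>2 + slope \<kappa>1 \<kappa>2 \<nu>1 \<nu>2 + quad_form \<kappa>1 \<kappa>2 \<nu>1 \<nu>2"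
  using J_real_mix[OF a b, of 1] feasD[OF a] feasD[OF b] by (simp add: mix_0_1)

text \<open>The parameter \<open>t = 1\<close> gives one direction, letting \<open>t\<close> tend to zero the other.\<close>
lemma slope_nonneg_iff_min:
  assumes a: "feas \<kappa>1 \<kappa>2"
  shows "(\<forall>\<nu>1 \<nu>2. feas \<nu>1 \<nu>2 \<longrightarrow> 0 \<le> slope \<kappa>1 \<kappa>2 \<nu>1 \<nu>2) \<longleftrightarrow> (\<forall>\<nu>1 \<nu>2. feas \<nu>1 \<nu>2 \<longrightarrow> J_real \<kappa>1 \<kappa>2 \<le> J_real \<nu>1 \<nu>2)"
proof (intro iffI allI impI)
  fix \<nu>1 \<nu>2 assume h: "\<forall>\<nu>1 \<nu>2. feas \<nu>1 \<nu>2 \<longrightarrow> 0 \<le> slope \<kappa>1 \<kappa>2 \<nu>1 \<nu>2" and b: "feas \<nu>1 \<nu>2"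
  have "0 \<le> quad_form \<kappa>1 \<kappa>2 \<nu>1 \<nu>2" using feasD[OF a] feasD[OF b] by (intro quad_form_nonneg) auto
  with h b show "J_real \<kappa>1 \<kappa>2 \<le> J_real \<nu>1 \<nu>2" using J_real_expand[OF a b] by auto
next
  fix \<nu>1 \<nu>2 assume h: "\<forall>\<nu>1 \<nu>2. feas \<nu>1 \<nu>2 \<longrightarrow> J_real \<kappa>1 \<kappa>2 \<le> J_real \<nu>1 \<nu>2" and b: "feas \<nu>1 \<nu>2"
  let ?s = "slope \<kappa>1 \<kappa>2 \<nu>1 \<nu>2" and ?q = "quad_form \<kappa>1 \<kappa>2 \<nu>1 \<nu>2"
  show "0 \<le> ?s"
  proof (rule ccontr)
    assume "\<not> 0 \<le> ?s"
    then have s: "?s < 0" by simp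
    have q: "0 \<le> ?q" using feasD[OF a] feasD[OF b] by (intro quad_form_nonneg) auto
    (* so small that the linear term outweighs the quadratic one *)
    define t where "t = min 1 (- ?s / (2 * (?q + 1)))"
    have "0 < - ?s / (2 * (?q + 1))" using s q by (intro divide_pos_pos) auto
    then have t: "0 < t" "t \<le> 1" unfolding t_def by linarith+
    have "t * ?q \<le> (- ?s / (2 * (?q + 1))) * ?q" using q by (intro mult_right_mono) (auto simp: t_def)
    also have "\<dots> = - ?s * (?q / (2 * (?q + 1)))" by simp
    also have "\<dots> \<le> - ?s * (1 / 2)" using s q by (intro mult_left_mono) (auto simp: field_simps)
    finally have "?s + t * ?q < 0" using s by linarith
    then have "t * (?s + t * ?q) < 0" using t by (simp add: mult_pos_neg)
    moreover have "J_real \<kappa>1 \<kappa>2 \<le> J_real (mix (1 - t) \<kappa>1 t \<nu>1) (mix (1 - t) \<kappa>2 t \<nu>2)"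
      using h feas_mix[OF a b, of t] t by auto
    ultimately show False using J_real_mix[OF a b, of t] t by (simp add: algebra_simps power2_eq_square)
  qed
qed

lemma min_unique:
  assumes a: "feas \<kappa>1 \<kappa>2" and b: "feas \<nu>1 \<nu>2"
    and ma: "\<And>\<nu>1 \<nu>2. feas \<nu>1 \<nu>2 \<Longrightarrow> J_real \<kappa>1 \<kappa>2 \<le> J_real \<nu>1 \<nu>2" and mb: "J_real \<nu>1 \<nu>2 \<le> J_real \<kappa>1 \<kappa>2"
  shows "\<nu>1 = \<kappa>1 \<and> \<nu>2 = \<kappa>2"
proof -
  have "0 \<le> slope \<kappa>1 \<kappa>2 \<nu>1 \<nu>2" using slope_nonneg_iff_min[OF a] ma b by blast
  moreover have "0 \<le> quad_form \<kappa>1 \<kappa>2 \<nu>1 \<nu>2" using feasD[OF a] feasD[OF b] by (intro quad_form_nonneg) auto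
  ultimately have "quad_form \<kappa>1 \<kappa>2 \<nu>1 \<nu>2 = 0" using J_real_expand[OF a b] mb by linarith
  then show ?thesis using feasD[OF a] feasD[OF b] by (intro quad_form_eq_0) auto
qed

lemma ext_integral_phi:
  assumes a: "adm \<mu>1 \<mu>2"
  shows "ext_integral \<mu>1 (\<lambda>x. ereal (\<phi> x)) = (if integrable \<mu>1 phi0 then ereal (\<integral>x. phi0 x \<partial>\<mu>1) else \<infinity>)"
proof -
  interpret finite_borel_measure \<mu>1 using a by (simp add: adm_def)
  note [measurable_cong] = M_is_borel
  have pos: "AE x in \<mu>1. 0 \<le> x" using a by (simp add: adm_def)
  then have ae: "AE x in \<mu>1. ereal (\<phi> x) = ereal (phi0 x)" by eventually_elim (simp add: phi0_eq)
  obtain C where C: "\<And>x. x \<ge> 0 \<Longrightarrow> 2 * ln (1 + x\<^sup>2) - C \<le> phi0 x" using phi0_lower by blast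
  have le: "AE x in \<mu>1. - C \<le> phi0 x"
    using pos
  proof eventually_elim
    case (elim x) then show ?case using C[OF elim] ln_one_plus_sq_nonneg[of x] by linarith
  qed
  show ?thesis
  proof (cases "integrable \<mu>1 phi0")
    case True
    then show ?thesis using ext_integral_eq_real[OF ae True] by simp
  next
    case False
    then show ?thesis using ext_integral_PInf[OF ae _ _ le False] by simp
  qed
qed

lemma J_functional_eq:
  assumes a: "adm \<mu>1 \<mu>2" "fin_energy \<mu>1" "fin_energy \<mu>2"
  shows "J_functional \<phi> (\<mu>1, \<mu>2) = (if integrable \<mu>1 phi0 then ereal (2 * J_real \<mu>1 \<mu>2) else \<infinity>)"
  using assms
  by (simp add: log_energy_def mutual_energy_eq ext_integral_phi J_real_def)

text \<open>The potentials are integrable against a measure of finite energy and the field is bounded below,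
  so the integral is well defined and only the field can make it infinite.\<close>
lemma ext_integral_W1:
  assumes l: "fin_energy \<kappa>1" "fin_energy \<kappa>2" and n: "adm \<nu>1 \<nu>2" "fin_energy \<nu>1"
  shows "ext_integral \<nu>1 (W1 \<phi> (\<kappa>1, \<kappa>2)) =
    (if integrable \<nu>1 phi0 then ereal (2 * energy \<nu>1 \<kappa>1 - energy \<nu>1 \<kappa>2 + (\<integral>x. phi0 x \<partial>\<nu>1)) else \<infinity>)"
proof -
  interpret finite_borel_measure \<nu>1 using n by (simp add: adm_def)
  note [measurable_cong] = M_is_borel
  have pos: "AE x in \<nu>1. 0 \<le> x" using n by (simp add: adm_def)
  let ?g = "\<lambda>x. 2 * pot \<kappa>1 x - pot \<kappa>2 x + phi0 x"
  have ae: "AE x in \<nu>1. W1 \<phi> (\<kappa>1, \<kappa>2) x = ereal (?g x)"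
    using pos AE_log_potential[OF n(2) l(1)] AE_log_potential[OF n(2) l(2)]
    by eventually_elim (simp add: phi0_eq)
  note i = energy_eq_integral_pot(1)[OF n(2) l(1)] energy_eq_integral_pot(1)[OF n(2) l(2)]
  have im: "integrable \<nu>1 (\<lambda>x. 2 * pot \<kappa>1 x - pot \<kappa>2 x)" using i by auto
  show ?thesis
  proof (cases "integrable \<nu>1 phi0")
    case True
    have "ext_integral \<nu>1 (W1 \<phi> (\<kappa>1, \<kappa>2)) = ereal (\<integral>x. ?g x \<partial>\<nu>1)"
      by (rule ext_integral_eq_real[OF ae]) (use im True in auto)
    also have "(\<integral>x. ?g x \<partial>\<nu>1) = 2 * energy \<nu>1 \<kappa>1 - energy \<nu>1 \<kappa>2 + (\<integral>x. phi0 x \<partial>\<nu>1)"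
      using i True im by (simp add: energy_eq_integral_pot(2)[OF n(2) l(1)] energy_eq_integral_pot(2)[OF n(2) l(2)])
    finally show ?thesis using True by (simp del: W1.simps)
  next
    case False
    obtain C where C: "\<And>x. x \<ge> 0 \<Longrightarrow> 2 * ln (1 + x\<^sup>2) - C \<le> phi0 x" using phi0_lower by blast
    have "ext_integral \<nu>1 (W1 \<phi> (\<kappa>1, \<kappa>2)) = \<infinity>"
    proof (rule ext_integral_PInf[OF ae])
      show "?g \<in> borel_measurable \<nu>1" using borel_measurable_integrable[OF im] by measurable
      show "integrable \<nu>1 (\<lambda>x. 2 * pot \<kappa>1 x - pot \<kappa>2 x + - C)" using im by auto
      show "AE x in \<nu>1. 2 * pot \<kappa>1 x - pot \<kappa>2 x + - C \<le> ?g x"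
        using pos
      proof eventually_elim
        case (elim x) then show ?case using C[OF elim] ln_one_plus_sq_nonneg[of x] by linarith
      qed
      show "\<not> integrable \<nu>1 ?g"
      proof
        assume "integrable \<nu>1 ?g"
        then have "integrable \<nu>1 (\<lambda>x. ?g x - (2 * pot \<kappa>1 x - pot \<kappa>2 x))" using im by (rule Bochner_Integration.integrable_diff)
        with False show False by simp
      qed
    qed
    then show ?thesis using False by (simp del: W1.simps)
  qed
qed

lemma ext_integral_W2:
  assumes l: "fin_energy \<kappa>1" "fin_energy \<kappa>2" and n: "fin_energy \<nu>2"
  shows "ext_integral \<nu>2 (W2 (\<kappa>1, \<kappa>2)) = ereal (2 * energy \<nu>2 \<kappa>2 - energy \<nu>2 \<kappa>1)"
proof -
  have ae: "AE x in \<nu>2. W2 (\<kappa>1, \<kappa>2) x = ereal (2 * pot \<kappa>2 x - pot \<kappa>1 x)"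
    using AE_log_potential[OF n l(1)] AE_log_potential[OF n l(2)]
    by eventually_elim simp
  note i = energy_eq_integral_pot(1)[OF n l(1)] energy_eq_integral_pot(1)[OF n l(2)]
  have "ext_integral \<nu>2 (W2 (\<kappa>1, \<kappa>2)) = ereal (\<integral>x. 2 * pot \<kappa>2 x - pot \<kappa>1 x \<partial>\<nu>2)"
    by (rule ext_integral_eq_real[OF ae]) (use i in auto)
  also have "(\<integral>x. 2 * pot \<kappa>2 x - pot \<kappa>1 x \<partial>\<nu>2) = 2 * energy \<nu>2 \<kappa>2 - energy \<nu>2 \<kappa>1"
    using i by (simp add: energy_eq_integral_pot(2)[OF n l(1)] energy_eq_integral_pot(2)[OF n l(2)])
  finally show ?thesis .
qed

text \<open>Both components are multiples of the two compactly supported measures found above.\<close>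
lemma ex_feas: "\<exists>\<nu>1 \<nu>2. feas \<nu>1 \<nu>2"
proof -
  obtain \<beta> M where b: "finite_borel_measure \<beta>" "measure \<beta> UNIV = 1" "kato \<beta>" "AE t in \<beta>. -M \<le> t \<and> t \<le> 0"
    "\<forall>A\<in>sets borel. emeasure \<beta> A \<le> emeasure \<sigma> A"
    using ex_reference_left by blast
  obtain \<tau> N where t: "finite_borel_measure \<tau>" "measure \<tau> UNIV = 1" "kato \<tau>" "N \<ge> 0" "AE t in \<tau>. 0 \<le> t \<and> t \<le> N"
    using ex_reference_right by blast
  interpret t: finite_borel_measure \<tau> by fact
  note [measurable_cong] = t.M_is_borel
  have nb: "fin_energy \<beta>" by (rule fin_energy_of_kato_bounded[OF b(3,1), of M]) (use b(4) in \<open>auto elim: eventually_mono\<close>)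
  have nt: "fin_energy \<tau>" by (rule fin_energy_of_kato_bounded[OF t(3,1), of N]) (use t(5) in \<open>auto elim: eventually_mono\<close>)
  let ?t = "mix 1 \<tau> 1 \<tau>"
  have "bounded (phi0 ` {0..N})"
    by (intro compact_imp_bounded compact_continuous_image continuous_on_subset[OF phi0_cont]) auto
  then obtain B where "\<forall>y\<in>phi0 ` {0..N}. norm y \<le> B" unfolding bounded_iff by blast
  then have B: "\<And>x. 0 \<le> x \<Longrightarrow> x \<le> N \<Longrightarrow> \<bar>phi0 x\<bar> \<le> B" by auto
  have i: "integrable \<tau> phi0"
    by (rule t.integrable_const_bound[where B=B]) (use t(5) B in \<open>auto elim: eventually_mono\<close>)
  have "AE x in ?t. 0 \<le> x"
  proof -
    have "emeasure \<tau> {..<0} = 0"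
      using t(5) AE_iff_measurable[of "{..<0}" \<tau> "\<lambda>x. 0 \<le> x"] t.M_is_borel t.borel_UNIV
      by (auto simp: not_le elim: eventually_mono)
    then have "emeasure ?t {..<0} = 0" by (simp add: emeasure_mix t.M_is_borel)
    then show ?thesis using AE_iff_measurable[of "{..<0}" ?t "\<lambda>x. 0 \<le> x"] by (auto simp: not_le)
  qed
  then have "feas ?t \<beta>"
    unfolding feas_def adm_def using b t nb nt i
    by (auto simp: measure_mix finite_borel_mix t.M_is_borel intro!: fin_energy_mix integral_mix(1) elim: eventually_mono)
  then show ?thesis by blast
qed

definition is_min :: "real measure \<Rightarrow> real measure \<Rightarrow> bool" where
  "is_min \<kappa>1 \<kappa>2 \<longleftrightarrow> feas \<kappa>1 \<kappa>2 \<and> (\<forall>\<nu>1 \<nu>2. feas \<nu>1 \<nu>2 \<longrightarrow> J_real \<kappa>1 \<kappa>2 \<le> J_real \<nu>1 \<nu>2)"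

lemma is_min_unique: "is_min \<kappa>1 \<kappa>2 \<Longrightarrow> is_min \<nu>1 \<nu>2 \<Longrightarrow> \<nu>1 = \<kappa>1 \<and> \<nu>2 = \<kappa>2"
  unfolding is_min_def by (rule min_unique) auto

text \<open>A competitor with infinite integral of the field satisfies the inequality trivially, and a
  solution with infinite integral of the field would violate it for any competitor where it is
  finite.\<close>
lemma variational_inequality_iff: "variational_inequality \<sigma> \<phi> (\<kappa>1, \<kappa>2) \<longleftrightarrow> is_min \<kappa>1 \<kappa>2"
proof -
  have "variational_inequality \<sigma> \<phi> (\<kappa>1, \<kappa>2) \<longleftrightarrow> feas \<kappa>1 \<kappa>2 \<and> (\<forall>\<nu>1 \<nu>2. feas \<nu>1 \<nu>2 \<longrightarrow> 0 \<le> slope \<kappa>1 \<kappa>2 \<nu>1 \<nu>2)"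
  proof
    assume v: "variational_inequality \<sigma> \<phi> (\<kappa>1, \<kappa>2)"
    then have l: "adm \<kappa>1 \<kappa>2" "fin_energy \<kappa>1" "fin_energy \<kappa>2" by (auto simp: variational_inequality_def admissible_star_iff)
    have v': "ext_integral \<nu>1 (W1 \<phi> (\<kappa>1, \<kappa>2)) - ext_integral \<kappa>1 (W1 \<phi> (\<kappa>1, \<kappa>2)) +
         (ext_integral \<nu>2 (W2 (\<kappa>1, \<kappa>2)) - ext_integral \<kappa>2 (W2 (\<kappa>1, \<kappa>2))) \<ge> 0" if "feas \<nu>1 \<nu>2" for \<nu>1 \<nu>2
    proof -
      have "(\<nu>1, \<nu>2) \<in> admissible_star \<sigma>" using feasD[OF that] by (simp add: admissible_star_iff)
      then show ?thesis using v unfolding variational_inequality_def ext_integral_diff_def by fastforce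
    qed
    have i: "integrable \<kappa>1 phi0"
    proof (rule ccontr)
      assume ni: "\<not> integrable \<kappa>1 phi0"
      obtain \<nu>1 \<nu>2 where n: "feas \<nu>1 \<nu>2" using ex_feas by blast
      from v'[OF n] show False using ni feasD[OF n] l by (simp add: ext_integral_W1 ext_integral_W2 del: W1.simps W2.simps)
    qed
    then have f: "feas \<kappa>1 \<kappa>2" using l by (simp add: feas_def)
    moreover have "0 \<le> slope \<kappa>1 \<kappa>2 \<nu>1 \<nu>2" if n: "feas \<nu>1 \<nu>2" for \<nu>1 \<nu>2
      using v'[OF n] i feasD[OF n] l by (simp add: ext_integral_W1 ext_integral_W2 slope_def del: W1.simps W2.simps)
    ultimately show "feas \<kappa>1 \<kappa>2 \<and> (\<forall>\<nu>1 \<nu>2. feas \<nu>1 \<nu>2 \<longrightarrow> 0 \<le> slope \<kappa>1 \<kappa>2 \<nu>1 \<nu>2)" by blast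
  next
    assume h: "feas \<kappa>1 \<kappa>2 \<and> (\<forall>\<nu>1 \<nu>2. feas \<nu>1 \<nu>2 \<longrightarrow> 0 \<le> slope \<kappa>1 \<kappa>2 \<nu>1 \<nu>2)"
    then have l: "adm \<kappa>1 \<kappa>2" "fin_energy \<kappa>1" "fin_energy \<kappa>2" "integrable \<kappa>1 phi0" by (auto simp: feas_def)
    show "variational_inequality \<sigma> \<phi> (\<kappa>1, \<kappa>2)"
      unfolding variational_inequality_def ext_integral_diff_def
    proof (intro conjI ballI)
      show "(\<kappa>1, \<kappa>2) \<in> admissible_star \<sigma>" using l by (simp add: admissible_star_iff)
      fix \<nu> assume "\<nu> \<in> admissible_star \<sigma>"
      then obtain \<nu>1 \<nu>2 where n: "\<nu> = (\<nu>1, \<nu>2)" "adm \<nu>1 \<nu>2" "fin_energy \<nu>1" "fin_energy \<nu>2"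
        by (cases \<nu>) (auto simp: admissible_star_iff)
      show "0 \<le> ext_integral (fst \<nu>) (W1 \<phi> (\<kappa>1, \<kappa>2)) - ext_integral (fst (\<kappa>1, \<kappa>2)) (W1 \<phi> (\<kappa>1, \<kappa>2)) +
         (ext_integral (snd \<nu>) (W2 (\<kappa>1, \<kappa>2)) - ext_integral (snd (\<kappa>1, \<kappa>2)) (W2 (\<kappa>1, \<kappa>2)))"
      proof (cases "integrable \<nu>1 phi0")
        case True
        then have "feas \<nu>1 \<nu>2" using n by (simp add: feas_def)
        with h have "0 \<le> slope \<kappa>1 \<kappa>2 \<nu>1 \<nu>2" by blast
        then show ?thesis using True n l by (simp add: ext_integral_W1 ext_integral_W2 slope_def del: W1.simps W2.simps)
      next
        case False
        then show ?thesis using n l by (simp add: ext_integral_W1 ext_integral_W2 del: W1.simps W2.simps)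
      qed
    qed
  qed
  then show ?thesis unfolding is_min_def using slope_nonneg_iff_min by blast
qed

lemma minimizes_energy_iff: "minimizes_energy \<sigma> \<phi> (\<kappa>1, \<kappa>2) \<longleftrightarrow> is_min \<kappa>1 \<kappa>2"
proof
  assume m: "minimizes_energy \<sigma> \<phi> (\<kappa>1, \<kappa>2)"
  then have l: "adm \<kappa>1 \<kappa>2" "fin_energy \<kappa>1" "fin_energy \<kappa>2" by (auto simp: minimizes_energy_def admissible_star_iff)
  have J: "J_functional \<phi> (\<kappa>1, \<kappa>2) \<le> ereal (2 * J_real \<nu>1 \<nu>2)" if n: "feas \<nu>1 \<nu>2" for \<nu>1 \<nu>2
  proof -
    have "(\<nu>1, \<nu>2) \<in> admissible_star \<sigma>" using feasD[OF n] by (simp add: admissible_star_iff)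
    then have "J_inf \<sigma> \<phi> \<le> J_functional \<phi> (\<nu>1, \<nu>2)" unfolding J_inf_def by (rule INF_lower)
    also have "\<dots> = ereal (2 * J_real \<nu>1 \<nu>2)" using feasD[OF n] by (subst J_functional_eq) auto
    finally show ?thesis using m by (simp add: minimizes_energy_def)
  qed
  obtain \<nu>1 \<nu>2 where "feas \<nu>1 \<nu>2" using ex_feas by blast
  from J[OF this] have i: "integrable \<kappa>1 phi0" using J_functional_eq[OF l] by (auto split: if_splits)
  then have "feas \<kappa>1 \<kappa>2" using l by (simp add: feas_def)
  with J i show "is_min \<kappa>1 \<kappa>2" unfolding is_min_def by (auto simp: J_functional_eq[OF l] simp del: J_functional.simps)
next
  assume m: "is_min \<kappa>1 \<kappa>2"
  then have l: "adm \<kappa>1 \<kappa>2" "fin_energy \<kappa>1" "fin_energy \<kappa>2" "integrable \<kappa>1 phi0" by (auto simp: feas_def is_min_def)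
  have s: "(\<kappa>1, \<kappa>2) \<in> admissible_star \<sigma>" using l by (simp add: admissible_star_iff)
  have J: "J_functional \<phi> (\<kappa>1, \<kappa>2) = ereal (2 * J_real \<kappa>1 \<kappa>2)" using l J_functional_eq[OF l(1,2,3)] by simp
  have "J_inf \<sigma> \<phi> = ereal (2 * J_real \<kappa>1 \<kappa>2)"
  proof (rule antisym)
    show "J_inf \<sigma> \<phi> \<le> ereal (2 * J_real \<kappa>1 \<kappa>2)" unfolding J[symmetric] J_inf_def by (rule INF_lower[OF s])
    show "ereal (2 * J_real \<kappa>1 \<kappa>2) \<le> J_inf \<sigma> \<phi>" unfolding J_inf_def
    proof (rule INF_greatest)
      fix \<nu> assume "\<nu> \<in> admissible_star \<sigma>"
      then obtain \<nu>1 \<nu>2 where n: "\<nu> = (\<nu>1, \<nu>2)" "adm \<nu>1 \<nu>2" "fin_energy \<nu>1" "fin_energy \<nu>2"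
        by (cases \<nu>) (auto simp: admissible_star_iff)
      show "ereal (2 * J_real \<kappa>1 \<kappa>2) \<le> J_functional \<phi> \<nu>"
      proof (cases "integrable \<nu>1 phi0")
        case True
        then have "feas \<nu>1 \<nu>2" using n by (simp add: feas_def)
        then show ?thesis using m n True J_functional_eq[OF n(2-4)] by (simp add: is_min_def del: J_functional.simps)
      next
        case False
        then show ?thesis using J_functional_eq[OF n(2-4)] n(1) by (simp del: J_functional.simps)
      qed
    qed
  qed
  then show "minimizes_energy \<sigma> \<phi> (\<kappa>1, \<kappa>2)" using s J by (simp add: minimizes_energy_def)
qed

end

section \<open>Semicontinuity under weak convergence\<close>

lemma nn_integral_lin:
  assumes [measurable]: "u \<in> borel_measurable M" "v \<in> borel_measurable M"
  shows "(\<integral>\<^sup>+x. c * u x + d * v x \<partial>M) = c * (\<integral>\<^sup>+x. u x \<partial>M) + d * (\<integral>\<^sup>+x. v x \<partial>M)"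
  by (subst nn_integral_add) (auto simp: nn_integral_cmult)

lemma liminf_add_le:
  fixes f g :: "nat \<Rightarrow> ennreal"
  shows "liminf f + liminf g \<le> liminf (\<lambda>n. f n + g n)"
proof -
  have inc: "incseq (\<lambda>n. INF m\<in>{n..}. h m)" for h :: "nat \<Rightarrow> ennreal"
    by (auto simp: incseq_def intro!: INF_superset_mono)
  have "liminf f + liminf g = (SUP n. (INF m\<in>{n..}. f m) + (INF m\<in>{n..}. g m))"
    unfolding liminf_SUP_INF by (rule ennreal_SUP_add[symmetric]) (rule inc)+
  also have "\<dots> \<le> (SUP n. (INF m\<in>{n..}. f m + g m))"
    by (intro SUP_mono') (auto intro!: INF_greatest add_mono INF_lower)
  also have "\<dots> = liminf (\<lambda>n. f n + g n)" unfolding liminf_SUP_INF ..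
  finally show ?thesis .
qed

text \<open>Weak convergence handles the bounded functions \<open>min f N\<close>; monotone convergence lets \<open>N\<close> grow.\<close>
lemma weak_conv_nn_integral_le_liminf:
  fixes f :: "real \<Rightarrow> real"
  assumes h: "\<And>n. real_distribution (h n)" and M: "real_distribution M" and w: "weak_conv_m h M"
    and f: "continuous_on UNIV f" and f0: "\<And>x. 0 \<le> f x"
  shows "(\<integral>\<^sup>+x. ennreal (f x) \<partial>M) \<le> liminf (\<lambda>n. \<integral>\<^sup>+x. ennreal (f x) \<partial>h n)"
proof -
  interpret M: real_distribution M by fact
  have [measurable]: "f \<in> borel_measurable borel" using f by (rule borel_measurable_continuous_onI)
  have le: "(\<integral>\<^sup>+x. ennreal (min (f x) (real N)) \<partial>M) \<le> liminf (\<lambda>n. \<integral>\<^sup>+x. ennreal (f x) \<partial>h n)" for N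
  proof -
    let ?g = "\<lambda>x. min (f x) (real N)"
    have int: "integrable D ?g" if "real_distribution D" for D
    proof -
      interpret real_distribution D by fact
      show ?thesis by (rule integrable_const_bound[where B="real N"]) (use f0 in auto)
    qed
    have nn: "(\<integral>\<^sup>+x. ennreal (?g x) \<partial>D) = ennreal (\<integral>x. ?g x \<partial>D)" if "real_distribution D" for D
      by (rule nn_integral_eq_integral[OF int[OF that]]) (use f0 in auto)
    have cont: "isCont ?g x" for x
    proof -
      have "continuous_on UNIV ?g" using f by (intro continuous_intros)
      then show ?thesis by (simp add: continuous_on_eq_continuous_at)
    qed
    have "(\<lambda>n. \<integral>x. ?g x \<partial>h n) \<longlonglongrightarrow> (\<integral>x. ?g x \<partial>M)"
      by (rule weak_conv_imp_integral_bdd_continuous_conv[OF h M w, of _ "real N"]) (use cont f0 in auto)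
    then have "(\<lambda>n. \<integral>\<^sup>+x. ennreal (?g x) \<partial>h n) \<longlonglongrightarrow> (\<integral>\<^sup>+x. ennreal (?g x) \<partial>M)"
      unfolding nn[OF h] nn[OF M] by (rule tendsto_ennrealI)
    then have "(\<integral>\<^sup>+x. ennreal (?g x) \<partial>M) = liminf (\<lambda>n. \<integral>\<^sup>+x. ennreal (?g x) \<partial>h n)"
      by (intro lim_imp_Liminf[symmetric]) auto
    also have "\<dots> \<le> liminf (\<lambda>n. \<integral>\<^sup>+x. ennreal (f x) \<partial>h n)"
      by (intro Liminf_mono always_eventually allI nn_integral_mono ennreal_leI) auto
    finally show ?thesis .
  qed
  have "(\<lambda>N. \<integral>\<^sup>+x. ennreal (min (f x) (real N)) \<partial>M) \<longlonglongrightarrow> (\<integral>\<^sup>+x. ennreal (f x) \<partial>M)"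
  proof (rule nn_integral_LIMSEQ)
    show "incseq (\<lambda>N x. ennreal (min (f x) (real N)))"
      by (auto simp: incseq_def le_fun_def intro!: ennreal_leI)
    fix x
    have "\<forall>\<^sub>F N in sequentially. ennreal (min (f x) (real N)) = ennreal (f x)"
      using eventually_ge_at_top[of "nat \<lceil>f x\<rceil>"]
    proof eventually_elim
      case (elim N)
      then have "f x \<le> real N" by linarith
      then show ?case by simp
    qed
    then show "(\<lambda>N. ennreal (min (f x) (real N))) \<longlonglongrightarrow> ennreal (f x)" by (rule tendsto_eventually)
  qed measurable
  then show ?thesis by (rule LIMSEQ_le_const2) (use le in auto)
qed

text \<open>Convergence can fail only if an end of the box is one of the countably many atoms of the limit.\<close>
lemma weak_conv_boxfn:
  assumes h: "\<And>n. real_distribution (h n)" and M: "real_distribution M" and w: "weak_conv_m h M"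
  shows "AE p in lborel. (\<lambda>n. boxfn (h n) p) \<longlonglongrightarrow> boxfn M p"
proof -
  interpret M: real_distribution M by fact
  define C where "C = {x. measure M {x} > 0}"
  have C: "countable C" unfolding C_def by (rule M.countable_atoms)
  have Cb[measurable]: "C \<in> sets borel" using C by (rule sets.countable[rotated]) auto
  have "AE p in lborel \<Otimes>\<^sub>M lborel. (snd p :: real) \<notin> C \<and> snd p + fst p \<notin> C"
  proof (rule lborel_pair.AE_pair_measure)
    show "{p \<in> space (lborel \<Otimes>\<^sub>M lborel). (snd p :: real) \<notin> C \<and> snd p + fst p \<notin> C} \<in> sets (lborel \<Otimes>\<^sub>M lborel)"
      by measurable
    show "AE r in lborel. AE u in lborel. snd (r, u) \<notin> C \<and> snd (r, u) + fst (r, u) \<notin> C"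
    proof (rule AE_I2)
      fix r :: real
      have "countable (C \<union> (\<lambda>x. x - r) ` C)" using C by auto
      then have "C \<union> (\<lambda>x. x - r) ` C \<in> null_sets lborel" by (rule countable_imp_null_set_lborel)
      then have "AE u in lborel. u \<notin> C \<union> (\<lambda>x. x - r) ` C" by (rule AE_not_in)
      then show "AE u in lborel. snd (r, u) \<notin> C \<and> snd (r, u) + fst (r, u) \<notin> C"
        by eventually_elim (auto simp: image_iff algebra_simps)
    qed
  qed
  then have "AE p in lborel. (snd p :: real) \<notin> C \<and> snd p + fst p \<notin> C" by (simp only: lborel_prod)
  then show ?thesis
  proof eventually_elim
    case (elim p)
    have cont: "isCont (cdf M) (snd p)" "isCont (cdf M) (snd p + fst p)"
      using elim unfolding M.isCont_cdf by (auto simp: C_def zero_less_measure_iff)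
    then have lim: "(\<lambda>n. cdf (h n) (snd p)) \<longlonglongrightarrow> cdf M (snd p)"
      "(\<lambda>n. cdf (h n) (snd p + fst p)) \<longlonglongrightarrow> cdf M (snd p + fst p)"
      using w by (auto simp: weak_conv_m_def weak_conv_def)
    show ?case
    proof (cases "fst p > 0")
      case True
      have "boxfn D p = (cdf D (snd p + fst p) - cdf D (snd p)) / fst p" if "real_distribution D" for D
      proof -
        interpret real_distribution D by fact
        show ?thesis using True cdf_diff_eq[of "snd p" "snd p + fst p"] by (simp add: boxfn_def)
      qed
      with h M show ?thesis using lim True by (auto intro!: tendsto_intros)
    qed (simp add: boxfn_def)
  qed
qed

lemma weak_conv_subseq: "weak_conv_m h M \<Longrightarrow> strict_mono r \<Longrightarrow> weak_conv_m (h \<circ> r) M"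
  unfolding weak_conv_m_def weak_conv_def
  using LIMSEQ_subseq_LIMSEQ by (fastforce simp: o_def)

section \<open>Existence of a minimizer in the enlarged class\<close>

context constrained_problem
begin

text \<open>A fixed probability measure of finite energy on the right half line; twice this measure makes the
  second square of the functional neutral.\<close>
definition reference :: "real measure" where
  "reference = (SOME \<tau>. \<exists>M. finite_borel_measure \<tau> \<and> measure \<tau> UNIV = 1 \<and> kato \<tau> \<and> M \<ge> 0 \<and> (AE t in \<tau>. 0 \<le> t \<and> t \<le> M))"

lemma reference:
  "finite_borel_measure reference" "measure reference UNIV = 1" "kato reference" "fin_energy reference"
  "\<exists>M\<ge>0. AE t in reference. 0 \<le> t \<and> t \<le> M"
proof -
  have "\<exists>M. finite_borel_measure reference \<and> measure reference UNIV = 1 \<and> kato reference \<and> M \<ge> 0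
     \<and> (AE t in reference. 0 \<le> t \<and> t \<le> M)"
    unfolding reference_def by (rule someI_ex) (rule ex_reference_right)
  then show r: "finite_borel_measure reference" "measure reference UNIV = 1" "kato reference"
    and ex: "\<exists>M\<ge>0. AE t in reference. 0 \<le> t \<and> t \<le> M" by auto
  from ex obtain M where M: "AE t in reference. 0 \<le> t \<and> t \<le> M" by blast
  show "fin_energy reference" by (rule fin_energy_of_kato_bounded[OF r(3,1), of M]) (use M in \<open>auto elim: eventually_mono\<close>)
qed

text \<open>The potential of \<open>reference\<close> loses at most \<open>3 / 2 ln (1 + x\<^sup>2)\<close> of the growth \<open>2 ln (1 + x\<^sup>2)\<close>
  of the field, and \<open>1 / 2 ln (1 + x\<^sup>2)\<close> remains.\<close>
lemma psi_lower: "\<exists>C. \<forall>x\<ge>0. ln (1 + x\<^sup>2) / 2 - C \<le> phi0 x + 3 * pot reference x"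
proof -
  obtain C where C: "\<And>x. x \<ge> 0 \<Longrightarrow> 2 * ln (1 + x\<^sup>2) - C \<le> phi0 x" using phi0_lower by blast
  interpret finite_borel_measure reference by (rule reference)
  note i = fin_energyD(3)[OF reference(4)]
  let ?L = "\<integral>t. ln (1 + t\<^sup>2) \<partial>reference"
  have potx: "- (ln (1 + x\<^sup>2) + ?L) / 2 \<le> pot reference x" for x
  proof -
    have "(\<integral>t. - ((ln (1 + x\<^sup>2) + ln (1 + t\<^sup>2)) / 2) \<partial>reference) \<le> pot reference x"
      unfolding pot_def
      by (rule integral_mono[OF _ kato_pot(1)[OF fin_energy_log_moment[OF reference(4)] reference(3)]])
         (use i ln_dist_le[of x] in auto)
    also have "(\<integral>t. - ((ln (1 + x\<^sup>2) + ln (1 + t\<^sup>2)) / 2) \<partial>reference) = - (ln (1 + x\<^sup>2) + ?L) / 2"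
      using i reference(2) by (simp add: borel_UNIV, simp add: field_simps)
    finally show ?thesis .
  qed
  then have "ln (1 + x\<^sup>2) / 2 - (C + 3 / 2 * ?L) \<le> phi0 x + 3 * pot reference x" if "x \<ge> 0" for x
    using C[OF that] potx[of x] by argo
  then show ?thesis by blast
qed

definition psi_const :: real where
  "psi_const = (SOME C. \<forall>x\<ge>0. ln (1 + x\<^sup>2) / 2 - C \<le> phi0 x + 3 * pot reference x)"

text \<open>The linear term that remains when the squares of the functional are completed.  The argument is
  clipped at zero to make the function continuous and nonnegative on the whole line, as weak lower
  semicontinuity requires.\<close>
definition psi :: "real \<Rightarrow> real" where
  "psi x = phi0 (max 0 x) + 3 * pot reference (max 0 x) + psi_const"

lemma psi_ge: "ln (1 + (max 0 x)\<^sup>2) / 2 \<le> psi x"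
proof -
  have "\<forall>x\<ge>0. ln (1 + x\<^sup>2) / 2 - psi_const \<le> phi0 x + 3 * pot reference x"
    unfolding psi_const_def by (rule someI_ex) (rule psi_lower)
  from this[rule_format, of "max 0 x"] show ?thesis by (simp add: psi_def)
qed

lemma psi_nonneg: "0 \<le> psi x"
  using psi_ge[of x] ln_one_plus_sq_nonneg[of "max 0 x"] by linarith

lemma psi_cont: "continuous_on UNIV psi"
  unfolding psi_def
  by (intro continuous_intros continuous_on_compose2[OF phi0_cont, of UNIV "\<lambda>x. max 0 x"]
      continuous_on_compose2[OF kato_pot(4)[OF fin_energy_log_moment[OF reference(4)] reference(3), of UNIV], of UNIV "\<lambda>x. max 0 x"]) auto

lemma psi_measurable[measurable]: "psi \<in> borel_measurable borel"
  using psi_cont by (rule borel_measurable_continuous_onI)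

text \<open>With \<open>\<tau>\<close> for \<open>reference\<close>, this is \<open>\<parallel>\<nu>2 - \<nu>1 / 2\<parallel>\<^sup>2 + 3 / 4 \<parallel>\<nu>1 - 2 \<tau>\<parallel>\<^sup>2 + \<integral> psi d\<nu>1\<close> for the
  energy norm of neutral differences.  It is defined for all admissible pairs, without any condition
  on moments.\<close>
definition shifted_J :: "real measure \<Rightarrow> real measure \<Rightarrow> ennreal" where
  "shifted_J \<nu>1 \<nu>2 = (\<integral>\<^sup>+p. ennreal ((boxfn \<nu>2 p - boxfn \<nu>1 p / 2)\<^sup>2 + 3 / 4 * (boxfn \<nu>1 p - 2 * boxfn reference p)\<^sup>2) \<partial>lborel)
     + (\<integral>\<^sup>+x. ennreal (psi x) \<partial>\<nu>1)"

definition shifted_const :: real where "shifted_const = 3 * energy reference reference + 2 * psi_const"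

lemma boxfn_scale:
  assumes "finite_borel_measure \<alpha>" "a \<ge> 0" shows "boxfn (mix a \<alpha> 0 \<alpha>) p = a * boxfn \<alpha> p"
  using boxfn_mix[OF assms(1,1,2), of 0 p] by simp

text \<open>Expanding the two squares gives the quadratic part of the functional, a constant, and a multiple of
  the potential of \<open>reference\<close> that is compensated in \<open>psi\<close>.\<close>
lemma shifted_J_eq:
  assumes f: "feas \<nu>1 \<nu>2"
  shows "shifted_J \<nu>1 \<nu>2 = ennreal (J_real \<nu>1 \<nu>2 + shifted_const)" "0 \<le> J_real \<nu>1 \<nu>2 + shifted_const"
proof -
  note d = feasD[OF f]
  note r = reference
  note [measurable] = boxfn_measurable[OF d(7)] boxfn_measurable[OF d(8)] boxfn_measurable[OF r(1)]
  interpret finite_borel_measure \<nu>1 by (rule d)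
  note [measurable_cong] = M_is_borel
  (* both squares compare measures of equal mass: one in the first, two in the second *)
  let ?h = "mix (1/2) \<nu>1 0 \<nu>1" and ?t = "mix 2 reference 0 reference"
  have nh: "fin_energy ?h" and nt: "fin_energy ?t" using d r by (auto intro!: fin_energy_mix)
  have el: "energy (mix a \<alpha> 0 \<alpha>) \<gamma> = a * energy \<alpha> \<gamma>" "energy \<gamma> (mix a \<alpha> 0 \<alpha>) = a * energy \<gamma> \<alpha>"
    if "fin_energy \<alpha>" "fin_energy \<gamma>" "a \<ge> 0" for \<alpha> \<gamma> a
    using energy_mix_left[of \<alpha> \<alpha> \<gamma> a 0] energy_mix_right[of \<alpha> \<alpha> \<gamma> a 0] that by auto
  let ?A = "energy \<nu>2 \<nu>2 - 2 * energy \<nu>2 ?h + energy ?h ?h"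
  let ?B = "energy \<nu>1 \<nu>1 - 2 * energy \<nu>1 ?t + energy ?t ?t"
  have A: "(\<integral>\<^sup>+p. ennreal ((boxfn \<nu>2 p - boxfn \<nu>1 p / 2)\<^sup>2) \<partial>lborel) = ennreal ?A" "0 \<le> ?A"
    using energy_neutral[OF d(3) nh] d by (auto simp: boxfn_scale measure_mix)
  have B: "(\<integral>\<^sup>+p. ennreal ((boxfn \<nu>1 p - 2 * boxfn reference p)\<^sup>2) \<partial>lborel) = ennreal ?B" "0 \<le> ?B"
    using energy_neutral[OF d(2) nt] d r by (auto simp: boxfn_scale measure_mix)
  have Aeq: "?A = energy \<nu>2 \<nu>2 - energy \<nu>1 \<nu>2 + energy \<nu>1 \<nu>1 / 4"
    using d nh by (simp add: el energy_commute[of \<nu>2 \<nu>1])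
  have Beq: "?B = energy \<nu>1 \<nu>1 - 4 * energy \<nu>1 reference + 4 * energy reference reference"
    using d r nt by (simp add: el)
  have pos: "AE x in \<nu>1. 0 \<le> x" using d(1) by (simp add: adm_def)
  note ip = energy_eq_integral_pot(1)[OF d(2) r(4)]
  have ipsi: "integrable \<nu>1 (\<lambda>x. phi0 x + 3 * pot reference x + psi_const)" using ip d(4) by auto
  have aepsi: "AE x in \<nu>1. psi x = phi0 x + 3 * pot reference x + psi_const"
    using pos by eventually_elim (simp add: psi_def max_def)
  have psi1: "integrable \<nu>1 psi" by (rule integrable_cong_AE_imp[OF ipsi]) (use aepsi in \<open>auto simp: eq_commute\<close>)
  have "(\<integral>x. psi x \<partial>\<nu>1) = (\<integral>x. phi0 x + 3 * pot reference x + psi_const \<partial>\<nu>1)"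
    by (rule integral_cong_AE) (use aepsi borel_measurable_integrable[OF ipsi] in auto)
  also have "\<dots> = (\<integral>x. phi0 x \<partial>\<nu>1) + 3 * energy \<nu>1 reference + 2 * psi_const"
    using ip d(4,5) by (simp add: energy_eq_integral_pot(2)[OF d(2) r(4)] borel_UNIV)
  finally have Peq: "(\<integral>x. psi x \<partial>\<nu>1) = (\<integral>x. phi0 x \<partial>\<nu>1) + 3 * energy \<nu>1 reference + 2 * psi_const" .
  have P: "(\<integral>\<^sup>+x. ennreal (psi x) \<partial>\<nu>1) = ennreal (\<integral>x. psi x \<partial>\<nu>1)" "0 \<le> (\<integral>x. psi x \<partial>\<nu>1)"
    using nn_integral_eq_integral[OF psi1] psi_nonneg by (auto intro!: integral_nonneg_AE)
  have "shifted_J \<nu>1 \<nu>2 = (ennreal ?A + ennreal (3/4) * ennreal ?B) + ennreal (\<integral>x. psi x \<partial>\<nu>1)"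
    unfolding shifted_J_def P(1) A(1)[symmetric] B(1)[symmetric]
    by (subst nn_integral_cmult[symmetric], measurable, subst nn_integral_add[symmetric])
       (auto simp: ennreal_mult[symmetric])
  also have "\<dots> = ennreal (?A + 3 / 4 * ?B + (\<integral>x. psi x \<partial>\<nu>1))"
    using A(2) B(2) P(2) by (simp add: ennreal_mult[symmetric] ennreal_plus[symmetric] del: ennreal_plus)
  also have eq: "?A + 3 / 4 * ?B + (\<integral>x. psi x \<partial>\<nu>1) = J_real \<nu>1 \<nu>2 + shifted_const"
    unfolding Aeq Beq Peq J_real_def shifted_const_def by (simp add: algebra_simps)
  finally show "shifted_J \<nu>1 \<nu>2 = ennreal (J_real \<nu>1 \<nu>2 + shifted_const)" .
  show "0 \<le> J_real \<nu>1 \<nu>2 + shifted_const" unfolding eq[symmetric] using A(2) B(2) P(2) by simp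
qed

text \<open>The densities of \<open>\<nu>1\<close> and \<open>\<nu>2\<close> in short boxes are controlled by the two squares and the density of
  \<open>reference\<close>.  Nothing is gained here about the logarithmic moment of \<open>\<nu>2\<close>.\<close>
lemma shifted_J_finite:
  assumes a: "adm \<nu>1 \<nu>2" and fin: "shifted_J \<nu>1 \<nu>2 < \<infinity>"
  shows "fin_energy \<nu>1" "integrable \<nu>1 phi0" "local_energy \<nu>2"
proof -
  have f1: "finite_borel_measure \<nu>1" and f2: "finite_borel_measure \<nu>2" and pos: "AE x in \<nu>1. 0 \<le> x"
    using a by (auto simp: adm_def)
  note r = reference
  note [measurable] = boxfn_measurable[OF f1] boxfn_measurable[OF f2] boxfn_measurable[OF r(1)]
  interpret finite_borel_measure \<nu>1 by (rule f1)
  note [measurable_cong] = M_is_borel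
  let ?g = "\<lambda>p. ennreal ((boxfn \<nu>2 p - boxfn \<nu>1 p / 2)\<^sup>2 + 3 / 4 * (boxfn \<nu>1 p - 2 * boxfn reference p)\<^sup>2)"
  let ?I = "indicator {p. fst p < 1} :: real \<times> real \<Rightarrow> ennreal"
  have gfin: "(\<integral>\<^sup>+p. ?g p \<partial>lborel) < \<infinity>" and pfin: "(\<integral>\<^sup>+x. ennreal (psi x) \<partial>\<nu>1) < \<infinity>"
    using fin by (auto simp: shifted_J_def less_top[symmetric])
  (* the factor 8 is large enough for both uses, s1 and s2 below *)
  have dom: "(\<integral>\<^sup>+p. ennreal ((boxfn \<alpha> p)\<^sup>2) * ?I p \<partial>lborel) < \<infinity>"
    if fb: "local_energy \<beta>" and le: "\<And>p. (boxfn \<alpha> p)\<^sup>2 \<le> 8 * ((boxfn \<nu>2 p - boxfn \<nu>1 p / 2)\<^sup>2 + 3 / 4 * (boxfn \<nu>1 p - 2 * boxfn reference p)\<^sup>2) + 8 * (boxfn \<beta> p)\<^sup>2"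
    for \<alpha> \<beta>
  proof -
    note [measurable] = boxfn_measurable[OF local_energyD[OF fb]]
    have "(\<integral>\<^sup>+p. ennreal ((boxfn \<alpha> p)\<^sup>2) * ?I p \<partial>lborel) \<le> (\<integral>\<^sup>+p. ennreal 8 * ?g p + ennreal 8 * (ennreal ((boxfn \<beta> p)\<^sup>2) * ?I p) \<partial>lborel)"
    proof (rule nn_integral_mono)
      fix p
      have e: "ennreal (8 * X + 8 * Y) = ennreal 8 * ennreal X + ennreal 8 * ennreal Y" if "0 \<le> X" "0 \<le> Y" for X Y
        using that by (simp add: ennreal_mult)
      show "ennreal ((boxfn \<alpha> p)\<^sup>2) * ?I p \<le> ennreal 8 * ?g p + ennreal 8 * (ennreal ((boxfn \<beta> p)\<^sup>2) * ?I p)"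
        using ennreal_leI[OF le[of p]] by (subst (asm) e) (auto split: split_indicator)
    qed
    also have "\<dots> = ennreal 8 * (\<integral>\<^sup>+p. ?g p \<partial>lborel) + ennreal 8 * (\<integral>\<^sup>+p. ennreal ((boxfn \<beta> p)\<^sup>2) * ?I p \<partial>lborel)"
      by (rule nn_integral_lin) measurable
    also have "\<dots> < \<infinity>" using gfin fb by (auto simp: local_energy_def ennreal_mult_less_top)
    finally show ?thesis .
  qed
  have s1: "(b::real)\<^sup>2 \<le> 8 * ((c - b / 2)\<^sup>2 + 3 / 4 * (b - 2 * t)\<^sup>2) + 8 * t\<^sup>2" for b c t
  proof -
    have "b\<^sup>2 \<le> 2 * (b - 2 * t)\<^sup>2 + 8 * t\<^sup>2" using zero_le_power2[of "b - 4 * t"] by (simp add: power2_eq_square algebra_simps)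
    moreover have "2 * (b - 2 * t)\<^sup>2 \<le> 8 * ((c - b / 2)\<^sup>2 + 3 / 4 * (b - 2 * t)\<^sup>2)" by simp
    ultimately show ?thesis by linarith
  qed
  have s2: "(c::real)\<^sup>2 \<le> 8 * ((c - b / 2)\<^sup>2 + 3 / 4 * (b - 2 * t)\<^sup>2) + 8 * b\<^sup>2" for b c t
  proof -
    have "c\<^sup>2 \<le> 2 * (c - b / 2)\<^sup>2 + b\<^sup>2 / 2" using zero_le_power2[of "c - b"] by (simp add: power2_eq_square algebra_simps)
    moreover have "2 * (c - b / 2)\<^sup>2 \<le> 8 * ((c - b / 2)\<^sup>2 + 3 / 4 * (b - 2 * t)\<^sup>2)" by simp
    moreover have "b\<^sup>2 / 2 \<le> 8 * b\<^sup>2" by simp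
    ultimately show ?thesis by linarith
  qed
  have l1: "local_energy \<nu>1"
    using dom[OF fin_energyD(2)[OF r(4)], of \<nu>1] s1 f1 by (simp add: local_energy_def)
  then show "local_energy \<nu>2"
    using dom[of \<nu>1 \<nu>2] s2 f2 by (simp add: local_energy_def)
  have "(\<integral>\<^sup>+x. ennreal (ln (1 + x\<^sup>2)) \<partial>\<nu>1) \<le> (\<integral>\<^sup>+x. ennreal 2 * ennreal (psi x) \<partial>\<nu>1)"
  proof (rule nn_integral_mono_AE, use pos in eventually_elim)
    fix x :: real assume "0 \<le> x"
    then have "ln (1 + x\<^sup>2) \<le> 2 * psi x" using psi_ge[of x] by (simp add: max_def)
    then show "ennreal (ln (1 + x\<^sup>2)) \<le> ennreal 2 * ennreal (psi x)"
      using psi_nonneg[of x] by (subst ennreal_mult[symmetric]) (auto intro!: ennreal_leI)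
  qed
  also have "\<dots> = ennreal 2 * (\<integral>\<^sup>+x. ennreal (psi x) \<partial>\<nu>1)" by (rule nn_integral_cmult) measurable
  also have "\<dots> < \<infinity>" using pfin by (auto simp: ennreal_mult_less_top)
  finally show n1: "fin_energy \<nu>1" using l1 by (simp add: fin_energy_def)
  have ipsi: "integrable \<nu>1 psi" using pfin psi_nonneg by (intro integrableI_nonneg) auto
  note ip = energy_eq_integral_pot(1)[OF n1 r(4)]
  have "integrable \<nu>1 (\<lambda>x. psi x - 3 * pot reference x - psi_const)" using ipsi ip by auto
  then show "integrable \<nu>1 phi0"
    by (rule integrable_cong_AE_imp) (use pos in \<open>measurable, eventually_elim, simp add: psi_def max_def\<close>)
qed

text \<open>A box that covers \<open>{-T<..T}\<close> and is shorter than \<open>R\<close> sees almost all of \<open>\<nu>1\<close>, that is, at least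
  mass \<open>1 - \<eta> / 2\<close> of \<open>\<nu>1 / 2\<close>, but at most mass \<open>1 - \<eta>\<close> of \<open>\<nu>2\<close> if mass \<open>\<eta>\<close> lies beyond \<open>-R\<close>.  These
  boxes have total weight \<open>box_kernel R (2 T)\<close>, so the square \<open>(\<eta> / 2)\<^sup>2\<close> times this weight is
  bounded by \<open>C\<close>; the value of \<open>R\<close> violates this bound.\<close>
lemma escape_bound:
  assumes a: "adm \<nu>1 \<nu>2" and fin: "shifted_J \<nu>1 \<nu>2 \<le> ennreal C" and C: "C \<ge> 0"
    and T: "T > 0" and m: "measure \<nu>1 {T<..} \<le> \<eta>" and \<eta>: "\<eta> > 0"
    and R: "R = 2 * T * exp (1 + (C + 1) / (\<eta> / 2)\<^sup>2)"
  shows "measure \<nu>2 {..-R} < \<eta>"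
proof (rule ccontr)
  assume "\<not> measure \<nu>2 {..-R} < \<eta>"
  then have esc: "measure \<nu>2 {..-R} \<ge> \<eta>" by simp
  have f1: "finite_borel_measure \<nu>1" and f2: "finite_borel_measure \<nu>2" and pos: "AE x in \<nu>1. 0 \<le> x"
    and m1: "measure \<nu>1 UNIV = 2" and m2: "measure \<nu>2 UNIV = 1"
    using a by (auto simp: adm_def)
  interpret n1: finite_borel_measure \<nu>1 by (rule f1)
  interpret n2: finite_borel_measure \<nu>2 by (rule f2)
  note [measurable] = boxfn_measurable[OF f1] boxfn_measurable[OF f2]
  have e1: "exp (1 + (C + 1) / (\<eta> / 2)\<^sup>2) > 1" using C \<eta> by (simp add: add_pos_nonneg)
  then have RT: "R > 2 * T" unfolding R using T by simp
  have z: "measure \<nu>1 {..<0} = 0"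
    using pos AE_nonneg_iff[OF n1.M_is_borel] by (simp add: measure_def)
  (* almost all of \<nu>1 lies in {-T<..T}, and at most 1 - \<eta> of \<nu>2 to the right of -R *)
  have big: "2 - \<eta> \<le> measure \<nu>1 {-T<..T}"
  proof -
    have U: "UNIV = {..<0} \<union> ({-T<..T} \<union> {T<..})" using T by auto
    have "measure \<nu>1 UNIV \<le> measure \<nu>1 {..<0} + measure \<nu>1 ({-T<..T} \<union> {T<..})"
      unfolding U by (rule measure_Un_le) auto
    also have "measure \<nu>1 ({-T<..T} \<union> {T<..}) \<le> measure \<nu>1 {-T<..T} + measure \<nu>1 {T<..}"
      by (rule measure_Un_le) auto
    finally show ?thesis using m1 z m by linarith
  qed
  have small: "measure \<nu>2 {-R<..} \<le> 1 - \<eta>"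
  proof -
    have "{-R<..} = UNIV - {..-R}" by auto
    then have "measure \<nu>2 {-R<..} = measure \<nu>2 UNIV - measure \<nu>2 {..-R}"
      using n2.finite_measure_compl[of "{..-R}"] n2.borel_UNIV n2.M_is_borel by auto
    then show ?thesis using m2 esc by linarith
  qed
  (* box_ind (-T) p * box_ind T p singles out the boxes that contain both -T and T *)
  have pt: "ennreal ((\<eta> / 2)\<^sup>2) * (ennreal (box_ind (-T) p * box_ind T p) * indicator {p. fst p < R} p) \<le>
     ennreal ((boxfn \<nu>2 p - boxfn \<nu>1 p / 2)\<^sup>2 + 3 / 4 * (boxfn \<nu>1 p - 2 * boxfn reference p)\<^sup>2)" for p
  proof (cases "fst p > 0 \<and> snd p < -T \<and> T \<le> snd p + fst p \<and> fst p < R")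
    case True
    then have r: "fst p > 0" "snd p < - T" "T \<le> snd p + fst p" "fst p < R" by auto
    let ?b = "{snd p<..snd p + fst p}"
    have "measure \<nu>1 {-T<..T} \<le> measure \<nu>1 ?b" using r by (intro n1.finite_measure_mono) auto
    moreover have "measure \<nu>2 ?b \<le> measure \<nu>2 {-R<..}" using r T by (intro n2.finite_measure_mono) auto
    ultimately have "\<eta> / 2 \<le> measure \<nu>1 ?b / 2 - measure \<nu>2 ?b" using big small by linarith
    then have "(\<eta> / 2)\<^sup>2 \<le> (measure \<nu>1 ?b / 2 - measure \<nu>2 ?b)\<^sup>2" using \<eta> by (intro power_mono) auto
    then have "(\<eta> / 2)\<^sup>2 / (fst p)\<^sup>2 \<le> (measure \<nu>1 ?b / 2 - measure \<nu>2 ?b)\<^sup>2 / (fst p)\<^sup>2" by (intro divide_right_mono) auto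
    also have "\<dots> = (boxfn \<nu>2 p - boxfn \<nu>1 p / 2)\<^sup>2"
      using r by (simp add: boxfn_def power2_eq_square field_simps)
    also have "\<dots> \<le> (boxfn \<nu>2 p - boxfn \<nu>1 p / 2)\<^sup>2 + 3 / 4 * (boxfn \<nu>1 p - 2 * boxfn reference p)\<^sup>2" by simp
    finally have le: "(\<eta> / 2)\<^sup>2 / (fst p)\<^sup>2 \<le> (boxfn \<nu>2 p - boxfn \<nu>1 p / 2)\<^sup>2 + 3 / 4 * (boxfn \<nu>1 p - 2 * boxfn reference p)\<^sup>2" .
    have "box_ind (-T) p * box_ind T p = 1 / (fst p)\<^sup>2" using r T by (simp add: box_ind_def power2_eq_square)
    then have "ennreal ((\<eta> / 2)\<^sup>2) * (ennreal (box_ind (-T) p * box_ind T p) * indicator {p. fst p < R} p) = ennreal ((\<eta> / 2)\<^sup>2 / (fst p)\<^sup>2)"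
      using r by (simp add: ennreal_mult[symmetric])
    with ennreal_leI[OF le] show ?thesis by simp
  next
    case False
    then have "box_ind (-T) p * box_ind T p * indicator {p. fst p < R} p = 0" by (auto simp: box_ind_def)
    then have z: "ennreal (box_ind (-T) p * box_ind T p) * indicator {p. fst p < R} p = 0" by (auto split: split_indicator_asm)
    show ?thesis unfolding z by simp
  qed
  have "ennreal ((\<eta> / 2)\<^sup>2) * box_ekernel R (-T) T =
     ennreal ((\<eta> / 2)\<^sup>2) * (\<integral>\<^sup>+p. ennreal (box_ind (-T) p * box_ind T p) * indicator {p. fst p < R} p \<partial>lborel)"
    using nn_integral_box_ind[of R "-T" T] RT T by (simp add: lborel_prod)
  also have "\<dots> = (\<integral>\<^sup>+p. ennreal ((\<eta> / 2)\<^sup>2) * (ennreal (box_ind (-T) p * box_ind T p) * indicator {p. fst p < R} p) \<partial>lborel)"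
    by (rule nn_integral_cmult[symmetric]) measurable
  also have "\<dots> \<le> (\<integral>\<^sup>+p. ennreal ((boxfn \<nu>2 p - boxfn \<nu>1 p / 2)\<^sup>2 + 3 / 4 * (boxfn \<nu>1 p - 2 * boxfn reference p)\<^sup>2) \<partial>lborel)"
    by (rule nn_integral_mono) (rule pt)
  also have "\<dots> \<le> shifted_J \<nu>1 \<nu>2" by (simp add: shifted_J_def)
  also have "\<dots> \<le> ennreal C" by (rule fin)
  finally have le: "ennreal ((\<eta> / 2)\<^sup>2) * box_ekernel R (-T) T \<le> ennreal C" .
  have "box_kernel R (2 * T) = ln (exp (1 + (C + 1) / (\<eta> / 2)\<^sup>2)) - 1 + 2 * T / R"
    using RT T by (simp add: box_kernel_def R)
  also have "\<dots> \<ge> (C + 1) / (\<eta> / 2)\<^sup>2" using RT T by simp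
  finally have "(\<eta> / 2)\<^sup>2 * ((C + 1) / (\<eta> / 2)\<^sup>2) \<le> (\<eta> / 2)\<^sup>2 * box_kernel R (2 * T)" by (intro mult_left_mono) auto
  then have "C + 1 \<le> (\<eta> / 2)\<^sup>2 * box_kernel R (2 * T)" using \<eta> by simp
  moreover have "ennreal ((\<eta> / 2)\<^sup>2 * box_kernel R (2 * T)) \<le> ennreal C"
    using le T RT box_kernel_nonneg[of "2 * T" R] by (simp add: box_ekernel_def ennreal_mult[symmetric])
  ultimately show False using C by (simp add: ennreal_le_iff)
qed

text \<open>Markov's inequality, since \<open>psi\<close> is at least \<open>ln T\<close> on \<open>{T<..}\<close>.\<close>
lemma tail_bound:
  assumes a: "adm \<nu>1 \<nu>2" and fin: "shifted_J \<nu>1 \<nu>2 \<le> ennreal C" and C: "C \<ge> 0" and \<eta>: "\<eta> > 0"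
    and T: "T = exp ((C + 1) / \<eta>)"
  shows "measure \<nu>1 {T<..} \<le> \<eta>"
proof -
  have f1: "finite_borel_measure \<nu>1" using a by (simp add: adm_def)
  interpret finite_borel_measure \<nu>1 by (rule f1)
  note [measurable_cong] = M_is_borel
  have T0: "T > 0" "ln T = (C + 1) / \<eta>" by (auto simp: T)
  have "ennreal ((C + 1) / \<eta>) * emeasure \<nu>1 {T<..} = (\<integral>\<^sup>+x. ennreal ((C + 1) / \<eta>) * indicator {T<..} x \<partial>\<nu>1)"
    by (rule nn_integral_cmult_indicator[symmetric]) measurable
  also have "\<dots> \<le> (\<integral>\<^sup>+x. ennreal (psi x) \<partial>\<nu>1)"
  proof (rule nn_integral_mono)
    fix x
    have "(C + 1) / \<eta> \<le> psi x" if "x > T"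
    proof -
      have "ln (T\<^sup>2) \<le> ln (1 + x\<^sup>2)" using that T0
        by (subst ln_le_cancel_iff) (auto intro!: add_pos_nonneg order_trans[OF power_mono[of T x 2]])
      moreover have "ln (T\<^sup>2) = 2 * ln T" using T0 by (subst ln_realpow) auto
      ultimately have "(C + 1) / \<eta> \<le> ln (1 + x\<^sup>2) / 2" using T0(2) by linarith
      also have "\<dots> \<le> psi x" using psi_ge[of x] that T0 by (simp add: max_def)
      finally show ?thesis .
    qed
    then show "ennreal ((C + 1) / \<eta>) * indicator {T<..} x \<le> ennreal (psi x)"
      by (auto split: split_indicator intro!: ennreal_leI)
  qed
  also have "\<dots> \<le> ennreal C" using fin order_trans[OF _ fin] by (simp add: shifted_J_def)
  finally have "ennreal ((C + 1) / \<eta> * measure \<nu>1 {T<..}) \<le> ennreal C"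
    using C \<eta> by (simp add: emeasure_eq_measure ennreal_mult[symmetric])
  then have "(C + 1) / \<eta> * measure \<nu>1 {T<..} \<le> C" using C by (simp add: ennreal_le_iff)
  then have "(C + 1) * measure \<nu>1 {T<..} \<le> C * \<eta>" using \<eta> by (simp add: field_simps)
  also have "\<dots> \<le> (C + 1) * \<eta>" using \<eta> by simp
  finally show ?thesis using C by simp
qed

text \<open>On compact sets the inequality follows by testing with continuous functions that decrease to the
  indicator; \<open>\<sigma>\<close> is finite there.  Inner regularity of the limit does the rest.\<close>
lemma le_sigma_of_weak_limit:
  assumes h: "\<And>n. real_distribution (h n)" and M: "real_distribution M" and w: "weak_conv_m h M"
    and le: "\<And>n A. A \<in> sets borel \<Longrightarrow> emeasure (h n) A \<le> emeasure \<sigma> A" and A: "A \<in> sets borel"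
  shows "emeasure M A \<le> emeasure \<sigma> A"
proof -
  interpret M: real_distribution M by fact
  note [measurable_cong] = sets_sigma
  have cpt: "emeasure M K \<le> emeasure \<sigma> K" if K: "compact K" for K
  proof (cases "K = {}")
    case False
    have Kb[measurable]: "K \<in> sets borel" using K by (simp add: compact_imp_closed)
    obtain B where B: "\<And>x. x \<in> K \<Longrightarrow> \<bar>x\<bar> \<le> B" using compact_imp_bounded[OF K] by (auto simp: bounded_iff)
    (* continuous functions that decrease to the indicator of K *)
    define f where "f k x = max 0 (1 - real k * infdist x K)" for k x
    have fc: "continuous_on UNIV (f k)" for k
      unfolding f_def by (intro continuous_intros continuous_on_infdist)
    have [measurable]: "f k \<in> borel_measurable borel" for k using fc by (rule borel_measurable_continuous_onI)
    have step: "emeasure M K \<le> (\<integral>\<^sup>+x. ennreal (f k x) \<partial>\<sigma>)" for k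
    proof -
      have "emeasure M K = (\<integral>\<^sup>+x. indicator K x \<partial>M)" by simp
      also have "\<dots> \<le> (\<integral>\<^sup>+x. ennreal (f k x) \<partial>M)"
        by (intro nn_integral_mono) (auto simp: f_def split: split_indicator)
      also have "\<dots> \<le> liminf (\<lambda>n. \<integral>\<^sup>+x. ennreal (f k x) \<partial>h n)"
        by (rule weak_conv_nn_integral_le_liminf[OF h M w fc]) (simp add: f_def)
      also have "\<dots> \<le> liminf (\<lambda>n. \<integral>\<^sup>+x. ennreal (f k x) \<partial>\<sigma>)"
        using le by (intro Liminf_mono always_eventually allI nn_integral_le_of_le)
          (auto simp: sets_sigma real_distribution.axioms(2)[OF h, unfolded real_distribution_axioms_def])
      finally show ?thesis by (simp add: Liminf_const)
    qed
    have "(\<lambda>k. \<integral>\<^sup>+x. ennreal (f (Suc k) x) \<partial>\<sigma>) \<longlonglongrightarrow> (\<integral>\<^sup>+x. indicator K x \<partial>\<sigma>)"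
    proof (rule nn_integral_dominated_convergence)
      show "AE x in \<sigma>. ennreal (f (Suc k) x) \<le> indicator {-(B+1)..0} x" for k
        using AE_sigma
      proof eventually_elim
        case (elim x)
        show ?case
        proof (cases "x < -(B+1)")
          case True
          obtain y where y: "y \<in> K" "infdist x K = dist x y"
            using infdist_attains_inf[OF compact_imp_closed[OF K] False] by metis
          have "1 \<le> infdist x K" using B[OF y(1)] True unfolding y(2) dist_real_def by linarith
          then have "1 \<le> real (Suc k) * infdist x K" using mult_mono[of 1 "real (Suc k)" 1 "infdist x K"] by simp
          then show ?thesis by (simp add: f_def)
        next
          case False
          have "f (Suc k) x \<le> 1" by (simp add: f_def infdist_nonneg)
          then show ?thesis using False elim by (auto simp: ennreal_le_1)
        qed
      qed
      show "(\<integral>\<^sup>+x. indicator {-(B+1)..0} x \<partial>\<sigma>) < \<infinity>" using sigma_finite_compact[of "B+1"] by simp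
      show "AE x in \<sigma>. (\<lambda>k. ennreal (f (Suc k) x)) \<longlonglongrightarrow> indicator K x"
      proof (rule AE_I2)
        fix x
        show "(\<lambda>k. ennreal (f (Suc k) x)) \<longlonglongrightarrow> indicator K x"
        proof (cases "x \<in> K")
          case True
          then show ?thesis by (simp add: f_def)
        next
          case F: False
          then have "infdist x K > 0" using K False infdist_pos_not_in_closed[OF compact_imp_closed[OF K]] by auto
          then obtain N where N: "1 < real N * infdist x K" using reals_Archimedean3 by blast
          have "\<forall>\<^sub>F k in sequentially. ennreal (f (Suc k) x) = 0"
            using eventually_ge_at_top[of N]
          proof eventually_elim
            case (elim k)
            then have "real N * infdist x K \<le> real (Suc k) * infdist x K" by (intro mult_right_mono infdist_nonneg) auto
            with N show ?case by (simp add: f_def)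
          qed
          then show ?thesis using F by (simp add: tendsto_eventually)
        qed
      qed
    qed measurable
    then show ?thesis using step by (intro LIMSEQ_le_const) auto
  qed simp
  have "emeasure M A = (SUP K \<in> {K. K \<subseteq> A \<and> compact K}. emeasure M K)"
    using A by (intro inner_regular) auto
  also have "\<dots> \<le> emeasure \<sigma> A"
  proof (rule SUP_least)
    fix K assume "K \<in> {K. K \<subseteq> A \<and> compact K}"
    then have K: "K \<subseteq> A" "compact K" by auto
    have "emeasure \<sigma> K \<le> emeasure \<sigma> A" using K A by (intro emeasure_mono) (auto simp: sets_sigma)
    with cpt[OF K(2)] show "emeasure M K \<le> emeasure \<sigma> A" by (rule order_trans)
  qed
  finally show ?thesis .
qed

text \<open>The direct method: a minimizing sequence is tight, and all terms are lower semicontinuous along a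
  weakly convergent subsequence, the squares by Fatou's lemma.\<close>
lemma shifted_J_min_exists: "\<exists>\<kappa>1 \<kappa>2. adm \<kappa>1 \<kappa>2 \<and> shifted_J \<kappa>1 \<kappa>2 < \<infinity> \<and> (\<forall>\<nu>1 \<nu>2. adm \<nu>1 \<nu>2 \<longrightarrow> shifted_J \<kappa>1 \<kappa>2 \<le> shifted_J \<nu>1 \<nu>2)"
proof -
  define m where "m = (INF \<nu>\<in>{(\<nu>1, \<nu>2). adm \<nu>1 \<nu>2}. case \<nu> of (\<nu>1, \<nu>2) \<Rightarrow> shifted_J \<nu>1 \<nu>2)"
  have m_le: "m \<le> shifted_J \<nu>1 \<nu>2" if "adm \<nu>1 \<nu>2" for \<nu>1 \<nu>2
    unfolding m_def by (rule INF_lower2[of "(\<nu>1, \<nu>2)"]) (use that in auto)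
  obtain \<nu>1 \<nu>2 where n: "feas \<nu>1 \<nu>2" using ex_feas by blast
  have "shifted_J \<nu>1 \<nu>2 < top" using shifted_J_eq(1)[OF n] by simp
  then have mfin: "m < top" using m_le[OF feasD(1)[OF n]] by (rule le_less_trans[rotated])
  define C where "C = enn2real m + 1"
  have C0: "C \<ge> 0" and mC: "m + 1 = ennreal C" using mfin by (auto simp: C_def)
  have "\<exists>a b. adm a b \<and> shifted_J a b < m + ennreal (1 / real (Suc n))" for n
  proof -
    obtain x where x: "m = ennreal x" "x \<ge> 0" using mfin by (cases m) auto
    have "m < m + ennreal (1 / real (Suc n))" unfolding x(1)
      using x(2) by (subst ennreal_plus[symmetric]) (auto simp: ennreal_less_iff)
    then show ?thesis unfolding m_def INF_less_iff by auto
  qed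
  then obtain a b where ab: "\<And>n. adm (a n) (b n)" "\<And>n. shifted_J (a n) (b n) < m + ennreal (1 / real (Suc n))" by metis
  have FC: "shifted_J (a n) (b n) \<le> ennreal C" for n
  proof -
    have "ennreal (1 / real (Suc n)) \<le> 1" by (simp add: ennreal_le_1)
    then have "m + ennreal (1 / real (Suc n)) \<le> m + 1" by (rule add_left_mono)
    with ab(2)[of n] have "shifted_J (a n) (b n) < m + 1" by (rule less_le_trans)
    then show ?thesis unfolding mC[symmetric] by (rule less_imp_le)
  qed
  (* half of the first component is a probability measure, to which Helly's theorem applies *)
  define h where "h n = mix (1/2) (a n) 0 (a n)" for n
  have fa: "finite_borel_measure (a n)" and ma: "measure (a n) UNIV = 2" and apos: "AE x in a n. 0 \<le> x"
    and fb: "finite_borel_measure (b n)" and mb: "measure (b n) UNIV = 1" and bneg: "AE x in b n. x \<le> 0"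
    and bs: "\<And>A. A \<in> sets borel \<Longrightarrow> emeasure (b n) A \<le> emeasure \<sigma> A" for n
    using ab(1)[of n] by (auto simp: adm_def)
  have rd: "real_distribution D" if "finite_borel_measure D" "measure D UNIV = 1" for D
  proof -
    interpret finite_borel_measure D by fact
    show ?thesis
      by (rule real_distribution.intro, rule prob_spaceI)
         (use that in \<open>auto simp: real_distribution_axioms_def borel_UNIV emeasure_eq_measure M_is_borel\<close>)
  qed
  have mh: "measure (h n) A = measure (a n) A / 2" if "A \<in> sets borel" for n A
    using that fa by (simp add: h_def measure_mix)
  have h: "real_distribution (h n)" for n
    by (rule rd) (simp_all add: mh ma, simp add: h_def finite_borel_mix fa)
  have b: "real_distribution (b n)" for n by (rule rd[OF fb mb])
  have tail: "\<exists>T>0. \<forall>n. measure (a n) {T<..} \<le> \<eta>" if "\<eta> > 0" for \<eta>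
    using tail_bound[OF ab(1) FC C0 that refl] by (intro exI[of _ "exp ((C + 1) / \<eta>)"]) auto
  have tight_h: "tight h"
    unfolding tight_def
  proof (intro conjI allI impI h)
    fix \<epsilon> :: real assume \<epsilon>: "\<epsilon> > 0"
    obtain T where T: "T > 0" "\<And>n. measure (a n) {T<..} \<le> \<epsilon>" using tail[OF \<epsilon>] by blast
    have "measure (h n) {-1<..T} > 1 - \<epsilon>" for n
    proof -
      interpret finite_borel_measure "a n" by (rule fa)
      have "emeasure (a n) {-1<..} = emeasure (a n) UNIV"
        using apos[of n] by (intro emeasure_eq_AE) (auto simp: M_is_borel elim!: eventually_mono)
      then have "2 = measure (a n) {-1<..}" using ma[of n] by (simp add: measure_def)
      also have "{-1<..} = {-1<..T} \<union> {T<..}" using T by auto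
      also have "measure (a n) \<dots> \<le> measure (a n) {-1<..T} + measure (a n) {T<..}"
        by (rule measure_Un_le) (auto simp: M_is_borel)
      finally show ?thesis using T(2)[of n] \<epsilon> by (simp add: mh)
    qed
    with T show "\<exists>a b. a < b \<and> (\<forall>n. 1 - \<epsilon> < measure (h n) {a<..b})"
      by (intro exI[of _ "-1"] exI[of _ T]) auto
  qed
  have tight_b: "tight b"
    unfolding tight_def
  proof (intro conjI allI impI b)
    fix \<epsilon> :: real assume \<epsilon>: "\<epsilon> > 0"
    obtain T where T: "T > 0" "\<And>n. measure (a n) {T<..} \<le> \<epsilon>" using tail[OF \<epsilon>] by blast
    define R where "R = 2 * T * exp (1 + (C + 1) / (\<epsilon> / 2)\<^sup>2)"
    have R: "measure (b n) {..-R} < \<epsilon>" for n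
      by (rule escape_bound[OF ab(1) FC C0 T(1) T(2) \<epsilon>]) (simp add: R_def)
    have R0: "R > 0" using T by (simp add: R_def)
    have "measure (b n) {-R<..0} > 1 - \<epsilon>" for n
    proof -
      interpret finite_borel_measure "b n" by (rule fb)
      have "emeasure (b n) {..0} = emeasure (b n) UNIV"
        using bneg[of n] by (intro emeasure_eq_AE) (auto simp: M_is_borel elim!: eventually_mono)
      then have "1 = measure (b n) {..0}" using mb[of n] by (simp add: measure_def)
      also have "{..0} = {-R<..0} \<union> {..-R}" using R0 by auto
      also have "measure (b n) \<dots> \<le> measure (b n) {-R<..0} + measure (b n) {..-R}"
        by (rule measure_Un_le) (auto simp: M_is_borel)
      finally show ?thesis using R[of n] by simp
    qed
    with R0 show "\<exists>a c. a < c \<and> (\<forall>n. 1 - \<epsilon> < measure (b n) {a<..c})"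
      by (intro exI[of _ "-R"] exI[of _ 0]) auto
  qed
  obtain r M1 where r: "strict_mono r" "real_distribution M1" "weak_conv_m (h \<circ> id \<circ> r) M1"
    using tight_imp_convergent_subsubsequence[OF tight_h strict_mono_id] by blast
  obtain s M2 where s: "strict_mono s" "real_distribution M2" "weak_conv_m (b \<circ> r \<circ> s) M2"
    using tight_imp_convergent_subsubsequence[OF tight_b r(1)] by blast
  define k where "k = r \<circ> s"
  have k: "strict_mono k" unfolding k_def using r(1) s(1) by (rule strict_mono_o)
  have w1: "weak_conv_m (\<lambda>n. h (k n)) M1" using weak_conv_subseq[OF r(3) s(1)] by (simp add: k_def o_def)
  have w2: "weak_conv_m (\<lambda>n. b (k n)) M2" using s(3) by (simp add: k_def o_def)
  interpret M1: real_distribution M1 by fact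
  interpret M2: real_distribution M2 by fact
  have fM1: "finite_borel_measure M1" and fM2: "finite_borel_measure M2" by unfold_locales
  define \<kappa>1 where "\<kappa>1 = mix 2 M1 0 M1"
  have fk: "finite_borel_measure \<kappa>1" unfolding \<kappa>1_def by (intro finite_borel_mix fM1)
  have nnh: "(\<integral>\<^sup>+x. f x \<partial>h n) = ennreal (1/2) * (\<integral>\<^sup>+x. f x \<partial>a n)" if "f \<in> borel_measurable borel" for f n
    using that finite_borel_measureD(1)[OF fa] by (simp add: h_def nn_integral_mix)
  have nnk: "(\<integral>\<^sup>+x. f x \<partial>\<kappa>1) = ennreal 2 * (\<integral>\<^sup>+x. f x \<partial>M1)" if "f \<in> borel_measurable borel" for f
    using that by (simp add: \<kappa>1_def nn_integral_mix)
  (* used with c = 1 for the first and c = -1 for the second component *)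
  have zero: "AE x in D. 0 \<le> c * x" if D: "real_distribution D" and w: "weak_conv_m q D" and q: "\<And>n. real_distribution (q n)"
    and ae: "\<And>n. AE x in q n. 0 \<le> c * x" for D q and c :: real
  proof -
    interpret real_distribution D by fact
    have "(\<integral>\<^sup>+x. ennreal (max 0 (- (c * x))) \<partial>D) \<le> liminf (\<lambda>n. \<integral>\<^sup>+x. ennreal (max 0 (- (c * x))) \<partial>q n)"
      by (rule weak_conv_nn_integral_le_liminf[OF q D w]) (auto intro!: continuous_intros)
    also have "(\<lambda>n. \<integral>\<^sup>+x. ennreal (max 0 (- (c * x))) \<partial>q n) = (\<lambda>n. 0)"
    proof
      fix n
      have "(\<integral>\<^sup>+x. ennreal (max 0 (- (c * x))) \<partial>q n) = (\<integral>\<^sup>+x. 0 \<partial>q n)"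
        by (rule nn_integral_cong_AE, use ae[of n] in eventually_elim) auto
      then show "(\<integral>\<^sup>+x. ennreal (max 0 (- (c * x))) \<partial>q n) = 0" by simp
    qed
    finally have "(\<integral>\<^sup>+x. ennreal (max 0 (- (c * x))) \<partial>D) = 0" by (simp add: Liminf_const)
    then have "AE x in D. ennreal (max 0 (- (c * x))) = 0" by (subst (asm) nn_integral_0_iff_AE) auto
    then show ?thesis by eventually_elim (auto simp: ennreal_eq_0_iff)
  qed
  have hpos: "AE x in h n. 0 \<le> 1 * x" for n
  proof -
    have "emeasure (a n) {..<0} = 0"
      using apos[of n] AE_nonneg_iff[of "a n"] finite_borel_measureD[OF fa[of n]] by simp
    then have "emeasure (h n) {..<0} = 0" using finite_borel_measureD(1)[OF fa] by (simp add: h_def emeasure_mix)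
    then show ?thesis using AE_nonneg_iff[of "h n"] by (simp add: h_def)
  qed
  have M1pos: "AE x in M1. 0 \<le> 1 * x" by (rule zero[OF r(2) w1 h hpos])
  have k1pos: "AE x in \<kappa>1. 0 \<le> x"
  proof -
    have "emeasure M1 {..<0} = 0"
      using M1pos AE_nonneg_iff[of M1] by simp
    then have "emeasure \<kappa>1 {..<0} = 0" by (simp add: \<kappa>1_def emeasure_mix)
    then show ?thesis using AE_nonneg_iff[of \<kappa>1] by (simp add: \<kappa>1_def)
  qed
  have k2neg: "AE x in M2. 0 \<le> -1 * x"
    by (rule zero[OF s(2) w2 b]) (use bneg in \<open>auto elim: eventually_mono\<close>)
  have adm: "adm \<kappa>1 M2"
    unfolding adm_def
  proof (intro conjI ballI)
    show "measure \<kappa>1 UNIV = 2" using M1.prob_space by (simp add: \<kappa>1_def measure_mix fM1)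
    show "measure M2 UNIV = 1" using M2.prob_space by simp
    show "AE x in M2. x \<le> 0" using k2neg by (auto elim: eventually_mono)
    fix A :: "real set" assume "A \<in> sets borel"
    then show "emeasure M2 A \<le> emeasure \<sigma> A"
      by (intro le_sigma_of_weak_limit[where h="\<lambda>n. b (k n)", OF b s(2) w2]) (auto intro: bs)
  qed (use fk fM2 k1pos in auto)
  have box: "AE p in lborel. (\<lambda>n. boxfn (a (k n)) p) \<longlonglongrightarrow> boxfn \<kappa>1 p"
    using weak_conv_boxfn[where h="\<lambda>n. h (k n)", OF h r(2) w1]
  proof eventually_elim
    case (elim p)
    have half: "boxfn (h n) p = 1 / 2 * boxfn (a n) p" for n unfolding h_def by (rule boxfn_scale[OF fa]) simp
    have "boxfn (a n) p = 2 * boxfn (h n) p" for n unfolding half by simp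
    moreover have "boxfn \<kappa>1 p = 2 * boxfn M1 p" unfolding \<kappa>1_def by (rule boxfn_scale[OF fM1]) simp
    ultimately show ?case using tendsto_mult_left[OF elim, of 2] by (simp only:)
  qed
  let ?g = "\<lambda>a b p. ennreal ((boxfn b p - boxfn a p / 2)\<^sup>2 + 3 / 4 * (boxfn a p - 2 * boxfn reference p)\<^sup>2)"
  have gm: "?g (a n) (b n) \<in> borel_measurable lborel" for n
    using boxfn_measurable[OF fa[of n]] boxfn_measurable[OF fb[of n]] boxfn_measurable[OF reference(1)] by measurable
  have A: "(\<integral>\<^sup>+p. ?g \<kappa>1 M2 p \<partial>lborel) \<le> liminf (\<lambda>n. \<integral>\<^sup>+p. ?g (a (k n)) (b (k n)) p \<partial>lborel)"
  proof -
    have "(\<integral>\<^sup>+p. ?g \<kappa>1 M2 p \<partial>lborel) = (\<integral>\<^sup>+p. liminf (\<lambda>n. ?g (a (k n)) (b (k n)) p) \<partial>lborel)"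
    proof (rule nn_integral_cong_AE, use box weak_conv_boxfn[where h="\<lambda>n. b (k n)", OF b s(2) w2] in eventually_elim)
      case (elim p)
      have "(\<lambda>n. ?g (a (k n)) (b (k n)) p) \<longlonglongrightarrow> ?g \<kappa>1 M2 p"
        by (intro tendsto_ennrealI tendsto_intros elim) auto
      then show ?case by (intro lim_imp_Liminf[symmetric]) auto
    qed
    also have "\<dots> \<le> liminf (\<lambda>n. \<integral>\<^sup>+p. ?g (a (k n)) (b (k n)) p \<partial>lborel)"
      by (rule nn_integral_liminf) (rule gm)
    finally show ?thesis .
  qed
  have P: "(\<integral>\<^sup>+x. ennreal (psi x) \<partial>\<kappa>1) \<le> liminf (\<lambda>n. \<integral>\<^sup>+x. ennreal (psi x) \<partial>a (k n))"
  proof -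
    have psi2: "(\<integral>\<^sup>+x. ennreal (2 * psi x) \<partial>D) = ennreal 2 * (\<integral>\<^sup>+x. ennreal (psi x) \<partial>D)" if "sets D = sets borel" for D
    proof -
      note [measurable_cong] = that
      show ?thesis by (subst nn_integral_cmult[symmetric]) (auto simp: ennreal_mult psi_nonneg)
    qed
    have "(\<integral>\<^sup>+x. ennreal (psi x) \<partial>\<kappa>1) = (\<integral>\<^sup>+x. ennreal (2 * psi x) \<partial>M1)"
      by (subst nnk) (auto simp: psi2)
    also have "\<dots> \<le> liminf (\<lambda>n. \<integral>\<^sup>+x. ennreal (2 * psi x) \<partial>h (k n))"
      by (rule weak_conv_nn_integral_le_liminf[where h="\<lambda>n. h (k n)", OF h r(2) w1]) (auto intro!: continuous_intros psi_cont psi_nonneg mult_nonneg_nonneg)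
    also have "(\<lambda>n. \<integral>\<^sup>+x. ennreal (2 * psi x) \<partial>h (k n)) = (\<lambda>n. \<integral>\<^sup>+x. ennreal (psi x) \<partial>a (k n))"
    proof
      fix n
      have "(\<integral>\<^sup>+x. ennreal (2 * psi x) \<partial>h (k n)) = ennreal 2 * (ennreal (1/2) * (\<integral>\<^sup>+x. ennreal (psi x) \<partial>a (k n)))"
        by (subst psi2, simp add: h_def, subst nnh, simp_all)
      also have "\<dots> = (\<integral>\<^sup>+x. ennreal (psi x) \<partial>a (k n))"
      proof -
        have "ennreal 2 * ennreal (1/2) = 1" by (subst ennreal_mult[symmetric]) auto
        then show ?thesis by (simp only: mult.assoc[symmetric] mult_1)
      qed
      finally show "(\<integral>\<^sup>+x. ennreal (2 * psi x) \<partial>h (k n)) = (\<integral>\<^sup>+x. ennreal (psi x) \<partial>a (k n))" .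
    qed
    finally show ?thesis .
  qed
  have "shifted_J \<kappa>1 M2 \<le> liminf (\<lambda>n. shifted_J (a (k n)) (b (k n)))"
    unfolding shifted_J_def by (rule order_trans[OF add_mono[OF A P] liminf_add_le])
  also have "\<dots> \<le> liminf (\<lambda>n. m + ennreal (1 / real (Suc n)))"
  proof (intro Liminf_mono always_eventually allI)
    fix n
    have "shifted_J (a (k n)) (b (k n)) \<le> m + ennreal (1 / real (Suc (k n)))" using ab(2)[of "k n"] by simp
    also have "\<dots> \<le> m + ennreal (1 / real (Suc n))"
      using seq_suble[OF k, of n] by (intro add_left_mono ennreal_leI divide_left_mono) auto
    finally show "shifted_J (a (k n)) (b (k n)) \<le> m + ennreal (1 / real (Suc n))" .
  qed
  also have "\<dots> = m"
  proof -
    have "(\<lambda>n. ennreal (1 / real (Suc n))) \<longlonglongrightarrow> ennreal 0"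
      by (intro tendsto_ennrealI) (rule LIMSEQ_Suc, rule lim_const_over_n)
    then have "(\<lambda>n. m + ennreal (1 / real (Suc n))) \<longlonglongrightarrow> m + ennreal 0" by (rule tendsto_add[OF tendsto_const])
    then show ?thesis by (simp add: lim_imp_Liminf)
  qed
  finally have "shifted_J \<kappa>1 M2 \<le> m" .
  with adm m_le mfin show ?thesis by (intro exI[of _ \<kappa>1] exI[of _ M2]) (auto intro: order_trans le_less_trans)
qed

end

section \<open>Moving mass within the constraint\<close>

text \<open>The difference of set functions is countably additive, as the finite mass of \<open>N\<close> can be cancelled.\<close>
lemma emeasure_diff_of_le:
  assumes s: "sets M = sets borel" and n: "finite_borel_measure N"
    and le: "\<And>A. A \<in> sets borel \<Longrightarrow> emeasure N A \<le> emeasure M A" and A: "A \<in> sets borel"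
  shows "emeasure (diff_measure M N) A = emeasure M A - emeasure N A"
  unfolding diff_measure_def
proof (rule emeasure_measure_of_sigma)
  note sN = finite_borel_measureD[OF n]
  show "sigma_algebra (space M) (sets M)" ..
  show "positive (sets M) (\<lambda>A. emeasure M A - emeasure N A)" by (simp add: positive_def)
  show "countably_additive (sets M) (\<lambda>A. emeasure M A - emeasure N A)"
  proof (rule countably_additiveI)
    fix A :: "nat \<Rightarrow> _" assume A: "range A \<subseteq> sets M" "disjoint_family A"
    then have Ai: "A i \<in> sets borel" for i using s by auto
    have 1: "(\<Sum>i. emeasure M (A i)) = emeasure M (\<Union>i. A i)" "(\<Sum>i. emeasure N (A i)) = emeasure N (\<Union>i. A i)"
      using A s sN by (auto intro!: suminf_emeasure)
    have "(\<Sum>i. emeasure M (A i) - emeasure N (A i)) + (\<Sum>i. emeasure N (A i)) =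
        (\<Sum>i. (emeasure M (A i) - emeasure N (A i)) + emeasure N (A i))"
      by (rule suminf_add) auto
    also have "\<dots> = (\<Sum>i. emeasure M (A i))"
      using le[OF Ai] by (simp add: diff_add_cancel_ennreal)
    finally have "(\<Sum>i. emeasure M (A i) - emeasure N (A i)) + emeasure N (\<Union>i. A i) = emeasure M (\<Union>i. A i)"
      unfolding 1 .
    moreover have "emeasure N (\<Union>i. A i) \<noteq> top" using sN(4)[of "\<Union>i. A i"] by (simp add: less_top)
    ultimately show "(\<Sum>i. emeasure M (A i) - emeasure N (A i)) = emeasure M (\<Union>i. A i) - emeasure N (\<Union>i. A i)"
      by (metis ennreal_add_diff_cancel_right)
  qed
  show "A \<in> sets M" using A s by simp
qed

text \<open>Some of the mass of \<open>\<kappa>\<close> on \<open>A\<close> is removed and the same amount of \<open>\<sigma> - \<kappa>\<close> on \<open>B\<close> is added; \<open>\<alpha>\<close> and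
  \<open>\<beta>\<close> are the normalized restrictions.  The balance \<open>\<nu> = \<kappa> + m (\<beta> - \<alpha>)\<close> is stated without a
  difference of measures.\<close>
lemma transfer_mass:
  fixes \<sigma> \<kappa> :: "real measure" and A B :: "real set"
  assumes s: "sets \<sigma> = sets borel" and k: "finite_borel_measure \<kappa>"
    and le: "\<And>S. S \<in> sets borel \<Longrightarrow> emeasure \<kappa> S \<le> emeasure \<sigma> S"
    and A: "A \<in> sets borel" "measure \<kappa> A > 0"
    and B: "B \<in> sets borel" "emeasure \<sigma> B < \<infinity>" "emeasure (diff_measure \<sigma> \<kappa>) B > 0"
  obtains \<nu> \<alpha> \<beta> m where "m > 0" "finite_borel_measure \<nu>" "finite_borel_measure \<alpha>" "finite_borel_measure \<beta>"
    "measure \<nu> UNIV = measure \<kappa> UNIV" "measure \<alpha> UNIV = 1" "measure \<beta> UNIV = 1"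
    "AE x in \<alpha>. x \<in> A" "AE x in \<beta>. x \<in> B"
    "\<And>S. S \<in> sets borel \<Longrightarrow> emeasure \<nu> S \<le> emeasure \<sigma> S"
    "\<And>S. S \<in> sets borel \<Longrightarrow> measure \<alpha> S \<le> 1 / measure \<kappa> A * measure \<kappa> S"
    "\<And>S. S \<in> sets borel \<Longrightarrow> emeasure \<beta> S \<le> ennreal (1 / measure (diff_measure \<sigma> \<kappa>) B) * emeasure (measure_restrict \<sigma> B) S"
    "mix 1 \<nu> m \<alpha> = mix 1 \<kappa> m \<beta>"
proof -
  interpret k: finite_borel_measure \<kappa> by fact
  define \<rho> where "\<rho> = diff_measure \<sigma> \<kappa>"
  have rho: "emeasure \<rho> S = emeasure \<sigma> S - emeasure \<kappa> S" if "S \<in> sets borel" for S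
    unfolding \<rho>_def by (rule emeasure_diff_of_le[OF s k le that])
  have srho: "sets \<rho> = sets borel" using s by (simp add: \<rho>_def)
  have rho_add: "emeasure \<rho> S + emeasure \<kappa> S = emeasure \<sigma> S" if "S \<in> sets borel" for S
    unfolding rho[OF that] by (rule diff_add_cancel_ennreal[OF le[OF that]])
  have rho_le: "emeasure \<rho> S \<le> emeasure \<sigma> S" if "S \<in> sets borel" for S
    using rho_add[OF that] by (metis le_iff_add)
  have rB: "emeasure \<rho> B < \<infinity>" using rho_le[OF B(1)] B(2) by (rule le_less_trans)
  define a where "a = measure \<kappa> A"
  define b where "b = measure \<rho> B"
  have a: "a > 0" using A by (simp add: a_def)
  have b: "b > 0" using B(3) rB unfolding b_def \<rho>_def[symmetric] measure_def by (simp add: enn2real_positive_iff)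
  (* the largest amount that both restrictions allow *)
  define m where "m = min a b"
  have m: "m > 0" "m \<le> a" "m \<le> b" using a b by (auto simp: m_def)
  let ?kA = "measure_restrict \<kappa> A" and ?kA' = "measure_restrict \<kappa> (- A)" and ?rB = "measure_restrict \<rho> B"
  have e: "emeasure ?kA S = emeasure \<kappa> (A \<inter> S)" "emeasure ?kA' S = emeasure \<kappa> (- A \<inter> S)" "emeasure ?rB S = emeasure \<rho> (B \<inter> S)"
    if "S \<in> sets borel" for S
    by (rule emeasure_measure_restrict, use that A(1) B(1) k.M_is_borel srho in simp_all)+
  have f: "finite_borel_measure ?kA" "finite_borel_measure ?kA'" "finite_borel_measure ?rB"
    using e[of UNIV] rB finite_borel_measureD(4)[OF k, of A] finite_borel_measureD(4)[OF k, of "- A"]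
    by (auto intro!: finite_borel_measureI simp: sets_measure_restrict k.M_is_borel srho)
  have mm: "measure ?kA S = measure \<kappa> (A \<inter> S)" "measure ?kA' S = measure \<kappa> (- A \<inter> S)" "measure ?rB S = measure \<rho> (B \<inter> S)"
    if "S \<in> sets borel" for S
    using e[OF that] by (auto simp: measure_def)
  define \<alpha> where "\<alpha> = mix (1 / a) ?kA 0 ?kA"
  define \<beta> where "\<beta> = mix (1 / b) ?rB 0 ?rB"
  define \<nu>' where "\<nu>' = mix (1 - m / a) ?kA 1 ?kA'"
  define \<nu> where "\<nu> = mix 1 \<nu>' (m / b) ?rB"
  have fin: "finite_borel_measure \<alpha>" "finite_borel_measure \<beta>" "finite_borel_measure \<nu>'" "finite_borel_measure \<nu>"
    using f by (auto simp: \<alpha>_def \<beta>_def \<nu>_def \<nu>'_def intro!: finite_borel_mix)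
  have ma: "m / a \<le> 1" "m / b \<le> 1" using m a b by auto
  have M\<alpha>: "measure \<alpha> S = 1 / a * measure \<kappa> (A \<inter> S)" if "S \<in> sets borel" for S
    using that a f by (simp add: \<alpha>_def measure_mix mm)
  have M\<beta>: "measure \<beta> S = 1 / b * measure \<rho> (B \<inter> S)" if "S \<in> sets borel" for S
    using that b f by (simp add: \<beta>_def measure_mix mm)
  have split: "measure \<kappa> S = measure \<kappa> (A \<inter> S) + measure \<kappa> (- A \<inter> S)" if "S \<in> sets borel" for S
  proof -
    have "S = (A \<inter> S) \<union> (- A \<inter> S)" by auto
    then have "measure \<kappa> S = measure \<kappa> ((A \<inter> S) \<union> (- A \<inter> S))" by simp
    also have "\<dots> = measure \<kappa> (A \<inter> S) + measure \<kappa> (- A \<inter> S)"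
      using that A by (intro k.finite_measure_Union) auto
    finally show ?thesis .
  qed
  have M\<nu>': "measure \<nu>' S = measure \<kappa> S - m / a * measure \<kappa> (A \<inter> S)" if "S \<in> sets borel" for S
    using that ma f split[OF that] by (simp add: \<nu>'_def measure_mix mm algebra_simps)
  have M\<nu>: "measure \<nu> S = measure \<kappa> S - m / a * measure \<kappa> (A \<inter> S) + m / b * measure \<rho> (B \<inter> S)" if "S \<in> sets borel" for S
    using that m b f fin M\<nu>'[OF that] by (simp add: \<nu>_def measure_mix mm)
  have mix_eq: "mix 1 \<nu> m \<alpha> = mix 1 \<kappa> m \<beta>"
  proof (rule measure_eqI)
    fix S assume "S \<in> sets (mix 1 \<nu> m \<alpha>)"
    then have S: "S \<in> sets borel" by simp
    interpret L: finite_borel_measure "mix 1 \<nu> m \<alpha>" using fin by (intro finite_borel_mix) auto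
    interpret R: finite_borel_measure "mix 1 \<kappa> m \<beta>" using fin k by (intro finite_borel_mix) auto
    have "measure (mix 1 \<nu> m \<alpha>) S = measure (mix 1 \<kappa> m \<beta>) S"
      using S m fin k by (simp add: measure_mix M\<nu> M\<alpha> M\<beta>)
    then show "emeasure (mix 1 \<nu> m \<alpha>) S = emeasure (mix 1 \<kappa> m \<beta>) S"
      by (simp add: L.emeasure_eq_measure R.emeasure_eq_measure)
  qed simp
  show thesis
  proof (rule that[OF m(1) fin(4) fin(1) fin(2) _ _ _ _ _ _ _ _ mix_eq])
    have "measure \<rho> (B \<inter> UNIV) = b" "measure \<kappa> (A \<inter> UNIV) = a" by (auto simp: a_def b_def)
    then show "measure \<nu> UNIV = measure \<kappa> UNIV" using a b by (simp add: M\<nu>)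
    show "measure \<alpha> UNIV = 1" using a by (simp add: M\<alpha> a_def)
    show "measure \<beta> UNIV = 1" using b by (simp add: M\<beta> b_def)
    have "measure \<alpha> (- A) = 0" "measure \<beta> (- B) = 0" using A B by (auto simp: M\<alpha> M\<beta> Compl_disjoint)
    then show "AE x in \<alpha>. x \<in> A" "AE x in \<beta>. x \<in> B"
      using fin A B by (auto simp: AE_mem_iff finite_borel_measureD(1) finite_measure.emeasure_eq_measure[OF finite_borel_measureD(3)])
    fix S :: "real set" assume S: "S \<in> sets borel"
    show "measure \<alpha> S \<le> 1 / measure \<kappa> A * measure \<kappa> S"
      unfolding a_def[symmetric] M\<alpha>[OF S] using a S k.M_is_borel by (intro mult_left_mono k.finite_measure_mono) auto
    have "emeasure \<beta> S = ennreal (1 / b) * emeasure \<rho> (B \<inter> S)"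
      unfolding \<beta>_def using S f by (simp add: emeasure_mix finite_borel_measureD(1) e)
    also have "\<dots> \<le> ennreal (1 / b) * emeasure \<sigma> (B \<inter> S)" using S B by (intro mult_left_mono rho_le) auto
    finally show "emeasure \<beta> S \<le> ennreal (1 / measure (diff_measure \<sigma> \<kappa>) B) * emeasure (measure_restrict \<sigma> B) S"
      using S B s by (simp add: emeasure_measure_restrict b_def \<rho>_def)
    have "emeasure \<nu> S = emeasure \<nu>' S + ennreal (m / b) * emeasure \<rho> (B \<inter> S)"
      unfolding \<nu>_def using S f fin by (simp add: emeasure_mix finite_borel_measureD(1) e)
    also have "\<dots> \<le> emeasure \<kappa> S + 1 * emeasure \<rho> S"
    proof (rule add_mono)
      interpret n: finite_borel_measure \<nu>' by (rule fin)
      have "0 \<le> m / a * measure \<kappa> (A \<inter> S)" using m(1) a by simp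
      then have "measure \<nu>' S \<le> measure \<kappa> S" unfolding M\<nu>'[OF S] by linarith
      then show "emeasure \<nu>' S \<le> emeasure \<kappa> S"
        unfolding n.emeasure_eq_measure k.emeasure_eq_measure by (rule ennreal_leI)
      have "ennreal (m / b) \<le> 1" using ma(2) by (simp add: ennreal_le_1)
      moreover have "emeasure \<rho> (B \<inter> S) \<le> emeasure \<rho> S" using S srho by (intro emeasure_mono) auto
      ultimately show "ennreal (m / b) * emeasure \<rho> (B \<inter> S) \<le> 1 * emeasure \<rho> S" by (rule mult_mono) auto
    qed
    also have "\<dots> = emeasure \<sigma> S" using rho_add[OF S] by (simp add: add.commute)
    finally show "emeasure \<nu> S \<le> emeasure \<sigma> S" .
  qed
qed

section \<open>The logarithmic moment of the minimizer\<close>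

lemma box_kernel_bounds:
  assumes d: "d > 0" and R: "R \<ge> 1"
  shows "ln R - 1 - ln (min d R) \<le> box_kernel R d" "box_kernel R d \<le> ln R - ln (min d R)"
proof -
  have "0 \<le> d / R" "d < R \<Longrightarrow> d / R \<le> 1" using d R by auto
  then show "ln R - 1 - ln (min d R) \<le> box_kernel R d" "box_kernel R d \<le> ln R - ln (min d R)"
    using d R by (auto simp: box_kernel_def ln_div min_def)
qed

lemma trunc_energy_fst:
  assumes a: "local_energy \<alpha>" and b: "local_energy \<beta>" and R: "R \<ge> 1"
  shows "integrable \<alpha> (\<lambda>y. \<integral>x. box_kernel R \<bar>y - x\<bar> \<partial>\<beta>)"
    "trunc_energy R \<alpha> \<beta> = (\<integral>y. (\<integral>x. box_kernel R \<bar>y - x\<bar> \<partial>\<beta>) \<partial>\<alpha>)"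
    "AE y in \<alpha>. integrable \<beta> (\<lambda>x. box_kernel R \<bar>y - x\<bar>)"
proof -
  interpret a: finite_borel_measure \<alpha> using local_energyD[OF a] .
  interpret b: finite_borel_measure \<beta> using local_energyD[OF b] .
  interpret pair_sigma_finite \<alpha> \<beta> by unfold_locales
  note i = box_kernel_integrable(2)[OF a b R]
  show "integrable \<alpha> (\<lambda>y. \<integral>x. box_kernel R \<bar>y - x\<bar> \<partial>\<beta>)" using integrable_fst[OF i] by simp
  show "trunc_energy R \<alpha> \<beta> = (\<integral>y. (\<integral>x. box_kernel R \<bar>y - x\<bar> \<partial>\<beta>) \<partial>\<alpha>)"
    using integral_fst[OF i] by (simp add: trunc_energy_def)
  show "AE y in \<alpha>. integrable \<beta> (\<lambda>x. box_kernel R \<bar>y - x\<bar>)" using AE_integrable_fst[OF i] .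
qed

lemma near_part_integral:
  assumes l: "log_moment \<beta>" and k: "kato \<beta>" and C: "near_pot 1 \<beta> y \<le> ennreal C" "C \<ge> 0"
  shows "integrable \<beta> (\<lambda>x. max 0 (- ln \<bar>y - x\<bar>))" "(\<integral>x. max 0 (- ln \<bar>y - x\<bar>) \<partial>\<beta>) \<le> C"
proof -
  note i = kato_pot(1)[OF l k, of y]
  show im: "integrable \<beta> (\<lambda>x. max 0 (- ln \<bar>y - x\<bar>))" using i by auto
  have "ennreal (\<integral>x. max 0 (- ln \<bar>y - x\<bar>) \<partial>\<beta>) = (\<integral>\<^sup>+x. ennreal (max 0 (- ln \<bar>y - x\<bar>)) \<partial>\<beta>)"
    by (rule nn_integral_eq_integral[OF im, symmetric]) auto
  also have "\<dots> \<le> near_pot 1 \<beta> y"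
    unfolding near_pot_def
  proof (rule nn_integral_mono)
    fix x
    have "ln \<bar>y - x\<bar> \<ge> 0" if "\<not> \<bar>y - x\<bar> < 1" using that by simp
    then show "ennreal (max 0 (- ln \<bar>y - x\<bar>)) \<le> klog y x * indicator {t. \<bar>y - t\<bar> < 1} x"
      by (auto simp: klog_def max_def split: split_indicator)
  qed
  also have "\<dots> \<le> ennreal C" by (rule C)
  finally show "(\<integral>x. max 0 (- ln \<bar>y - x\<bar>) \<partial>\<beta>) \<le> C" using C(2) by (simp add: ennreal_le_iff)
qed

context constrained_problem
begin

text \<open>Only the first square depends on the second component, and it is a quadratic polynomial along a
  segment.  The change of the component must be square integrable over boxes, but the second
  component itself need not have a finite logarithmic moment.\<close>
lemma shifted_J_first_variation:
  assumes k: "adm \<kappa>1 \<kappa>2" "shifted_J \<kappa>1 \<kappa>2 < \<infinity>" "\<And>\<nu>1 \<nu>2. adm \<nu>1 \<nu>2 \<Longrightarrow> shifted_J \<kappa>1 \<kappa>2 \<le> shifted_J \<nu>1 \<nu>2"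
    and n: "adm \<kappa>1 \<nu>2" and h2: "integrable lborel (\<lambda>p. (boxfn \<nu>2 p - boxfn \<kappa>2 p)\<^sup>2)"
  shows "integrable lborel (\<lambda>p. (boxfn \<kappa>2 p - boxfn \<kappa>1 p / 2) * (boxfn \<nu>2 p - boxfn \<kappa>2 p))"
    and "0 \<le> (\<integral>p. (boxfn \<kappa>2 p - boxfn \<kappa>1 p / 2) * (boxfn \<nu>2 p - boxfn \<kappa>2 p) \<partial>lborel)"
proof -
  have f: "finite_borel_measure \<kappa>1" "finite_borel_measure \<kappa>2" "finite_borel_measure \<nu>2"
    using k(1) n by (auto simp: adm_def)
  note [measurable] = f[THEN boxfn_measurable] boxfn_measurable[OF reference(1)]
  define g where "g p = boxfn \<kappa>2 p - boxfn \<kappa>1 p / 2" for p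
  define h where "h p = boxfn \<nu>2 p - boxfn \<kappa>2 p" for p
  define q where "q p = 3 / 4 * (boxfn \<kappa>1 p - 2 * boxfn reference p)\<^sup>2" for p
  have [measurable]: "g \<in> borel_measurable borel" "h \<in> borel_measurable borel" "q \<in> borel_measurable borel"
    unfolding g_def h_def q_def by measurable
  have q0: "0 \<le> q p" for p by (simp add: q_def)
  have fin: "(\<integral>\<^sup>+p. ennreal ((g p)\<^sup>2 + q p) \<partial>lborel) < \<infinity>" and pfin: "(\<integral>\<^sup>+x. ennreal (psi x) \<partial>\<kappa>1) < \<infinity>"
    using k(2) by (auto simp: shifted_J_def g_def q_def less_top[symmetric])
  have igq: "integrable lborel (\<lambda>p. (g p)\<^sup>2 + q p)"
    by (rule integrableI_nonneg) (use fin q0 in auto)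
  have ig: "integrable lborel (\<lambda>p. (g p)\<^sup>2)"
    by (rule Bochner_Integration.integrable_bound[OF igq]) (use q0 in auto)
  have ih: "integrable lborel (\<lambda>p. (h p)\<^sup>2)" using h2 by (simp add: h_def)
  have igh: "integrable lborel (\<lambda>p. g p * h p)"
  proof (rule Bochner_Integration.integrable_bound)
    show "integrable lborel (\<lambda>p. (g p)\<^sup>2 + (h p)\<^sup>2)" using ig ih by simp
    show "AE p in lborel. norm (g p * h p) \<le> norm ((g p)\<^sup>2 + (h p)\<^sup>2)"
    proof (rule AE_I2)
      fix p
      have "2 * \<bar>g p\<bar> * \<bar>h p\<bar> \<le> \<bar>g p\<bar>\<^sup>2 + \<bar>h p\<bar>\<^sup>2" by (rule sum_squares_bound)
      moreover have "0 \<le> \<bar>g p\<bar> * \<bar>h p\<bar>" by simp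
      ultimately have "\<bar>g p\<bar> * \<bar>h p\<bar> \<le> \<bar>g p\<bar>\<^sup>2 + \<bar>h p\<bar>\<^sup>2" by linarith
      then show "norm (g p * h p) \<le> norm ((g p)\<^sup>2 + (h p)\<^sup>2)" by (simp add: abs_mult)
    qed
  qed measurable
  then show "integrable lborel (\<lambda>p. (boxfn \<kappa>2 p - boxfn \<kappa>1 p / 2) * (boxfn \<nu>2 p - boxfn \<kappa>2 p))"
    by (simp add: g_def h_def)
  have t: "0 \<le> 2 * (\<integral>p. g p * h p \<partial>lborel) + t * (\<integral>p. (h p)\<^sup>2 \<partial>lborel)" if t: "0 < t" "t \<le> 1" for t
  proof -
    let ?\<nu> = "mix (1 - t) \<kappa>2 t \<nu>2"
    have k1: "mix (1 - t) \<kappa>1 t \<kappa>1 = \<kappa>1"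
      by (rule measure_eqI)
         (use t finite_borel_measureD(1)[OF f(1)] in \<open>auto simp: emeasure_mix distrib_right[symmetric] ennreal_plus[symmetric] simp del: ennreal_plus\<close>)
    have "adm \<kappa>1 ?\<nu>" using adm_mix[OF k(1) n, of t] t k1 by simp
    from k(3)[OF this] have le: "shifted_J \<kappa>1 \<kappa>2 \<le> shifted_J \<kappa>1 ?\<nu>" .
    have bx: "boxfn ?\<nu> p - boxfn \<kappa>1 p / 2 = g p + t * h p" for p
      using t f by (simp add: boxfn_mix g_def h_def algebra_simps)
    have e: "(g p + t * h p)\<^sup>2 + q p = ((g p)\<^sup>2 + q p) + (2 * t * (g p * h p) + t\<^sup>2 * (h p)\<^sup>2)" for p
      by (simp add: power2_eq_square algebra_simps)
    have i2: "integrable lborel (\<lambda>p. 2 * t * (g p * h p) + t\<^sup>2 * (h p)\<^sup>2)" using igh ih by simp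
    have it: "integrable lborel (\<lambda>p. (g p + t * h p)\<^sup>2 + q p)" unfolding e using igq i2 by (rule Bochner_Integration.integrable_add)
    have "(\<integral>\<^sup>+p. ennreal ((g p)\<^sup>2 + q p) \<partial>lborel) \<le> (\<integral>\<^sup>+p. ennreal ((g p + t * h p)\<^sup>2 + q p) \<partial>lborel)"
    proof -
      have "(\<integral>\<^sup>+x. ennreal (psi x) \<partial>\<kappa>1) + (\<integral>\<^sup>+p. ennreal ((g p)\<^sup>2 + q p) \<partial>lborel) \<le>
        (\<integral>\<^sup>+x. ennreal (psi x) \<partial>\<kappa>1) + (\<integral>\<^sup>+p. ennreal ((g p + t * h p)\<^sup>2 + q p) \<partial>lborel)"
        using le unfolding shifted_J_def bx by (simp add: g_def q_def add.commute)
      then show ?thesis using pfin unfolding ennreal_add_left_cancel_le by auto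
    qed
    then have "ennreal (\<integral>p. (g p)\<^sup>2 + q p \<partial>lborel) \<le> ennreal (\<integral>p. (g p + t * h p)\<^sup>2 + q p \<partial>lborel)"
    proof -
      have "(\<integral>\<^sup>+p. ennreal ((g p)\<^sup>2 + q p) \<partial>lborel) = ennreal (\<integral>p. (g p)\<^sup>2 + q p \<partial>lborel)"
        by (rule nn_integral_eq_integral[OF igq]) (simp add: q0)
      moreover have "(\<integral>\<^sup>+p. ennreal ((g p + t * h p)\<^sup>2 + q p) \<partial>lborel) = ennreal (\<integral>p. (g p + t * h p)\<^sup>2 + q p \<partial>lborel)"
        by (rule nn_integral_eq_integral[OF it]) (simp add: q0)
      ultimately show ?thesis
        using \<open>(\<integral>\<^sup>+p. ennreal ((g p)\<^sup>2 + q p) \<partial>lborel) \<le> (\<integral>\<^sup>+p. ennreal ((g p + t * h p)\<^sup>2 + q p) \<partial>lborel)\<close>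
        by (simp only:)
    qed
    moreover have "0 \<le> (\<integral>p. (g p + t * h p)\<^sup>2 + q p \<partial>lborel)" using q0 by (intro integral_nonneg_AE) auto
    ultimately have "(\<integral>p. (g p)\<^sup>2 + q p \<partial>lborel) \<le> (\<integral>p. (g p + t * h p)\<^sup>2 + q p \<partial>lborel)"
      by (simp add: ennreal_le_iff)
    also have "\<dots> = (\<integral>p. (g p)\<^sup>2 + q p \<partial>lborel) + (\<integral>p. 2 * t * (g p * h p) + t\<^sup>2 * (h p)\<^sup>2 \<partial>lborel)"
      unfolding e by (rule Bochner_Integration.integral_add[OF igq i2])
    also have "(\<integral>p. 2 * t * (g p * h p) + t\<^sup>2 * (h p)\<^sup>2 \<partial>lborel) = t * (2 * (\<integral>p. g p * h p \<partial>lborel) + t * (\<integral>p. (h p)\<^sup>2 \<partial>lborel))"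
    proof -
      have "(\<integral>p. 2 * t * (g p * h p) + t\<^sup>2 * (h p)\<^sup>2 \<partial>lborel) = 2 * t * (\<integral>p. g p * h p \<partial>lborel) + t\<^sup>2 * (\<integral>p. (h p)\<^sup>2 \<partial>lborel)"
        using igh ih by simp
      then show ?thesis by (simp add: power2_eq_square[of t] algebra_simps)
    qed
    finally have "0 \<le> t * (2 * (\<integral>p. g p * h p \<partial>lborel) + t * (\<integral>p. (h p)\<^sup>2 \<partial>lborel))" by simp
    then show ?thesis using t by (simp add: zero_le_mult_iff)
  qed
  have "0 \<le> (\<integral>p. g p * h p \<partial>lborel)"
  proof (rule ccontr)
    assume "\<not> 0 \<le> (\<integral>p. g p * h p \<partial>lborel)"
    then have G: "(\<integral>p. g p * h p \<partial>lborel) < 0" by simp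
    define H where "H = (\<integral>p. (h p)\<^sup>2 \<partial>lborel)"
    have H: "0 \<le> H" unfolding H_def by (intro integral_nonneg_AE) auto
    (* so small that the linear term outweighs the quadratic one *)
    define s where "s = min 1 (- (\<integral>p. g p * h p \<partial>lborel) / (H + 1))"
    have "0 < - (\<integral>p. g p * h p \<partial>lborel) / (H + 1)" using G H by (intro divide_pos_pos) auto
    then have s: "0 < s" "s \<le> 1" unfolding s_def by linarith+
    have "s * H \<le> (- (\<integral>p. g p * h p \<partial>lborel) / (H + 1)) * H" using H by (intro mult_right_mono) (auto simp: s_def)
    also have "\<dots> = - (\<integral>p. g p * h p \<partial>lborel) * (H / (H + 1))" by simp
    also have "\<dots> \<le> - (\<integral>p. g p * h p \<partial>lborel) * 1" using G H by (intro mult_left_mono) auto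
    finally show False using t[OF s] G unfolding H_def by linarith
  qed
  then show "0 \<le> (\<integral>p. (boxfn \<kappa>2 p - boxfn \<kappa>1 p / 2) * (boxfn \<nu>2 p - boxfn \<kappa>2 p) \<partial>lborel)"
    by (simp add: g_def h_def)
qed

text \<open>Apart from nearby points, whose contribution is bounded by \<open>C\<close>, the points of \<open>\<beta>\<close> are at distance at
  least \<open>(1 + \<bar>y\<bar>) / (n + 2)\<close> from \<open>y\<close>.\<close>
lemma compact_kernel_upper:
  assumes b: "log_moment \<beta>" "kato \<beta>" "measure \<beta> UNIV = 1" and n: "n \<ge> 0" and ae: "AE x in \<beta>. -n \<le> x \<and> x \<le> 0"
    and C: "near_pot 1 \<beta> y \<le> ennreal C" "C \<ge> 0" and R: "R \<ge> 1" and y: "y \<le> 0"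
    and i: "integrable \<beta> (\<lambda>x. box_kernel R \<bar>y - x\<bar>)"
  shows "(\<integral>x. box_kernel R \<bar>y - x\<bar> \<partial>\<beta>) \<le> ln R + C + ln (n + 2) - ln (min (1 + \<bar>y\<bar>) R)"
proof -
  interpret finite_borel_measure \<beta> using b(1) by (rule log_moment_fb)
  note m = near_part_integral[OF b(1,2) C]
  let ?c = "ln R + ln (n + 2) - ln (min (1 + \<bar>y\<bar>) R)"
  have "(\<integral>x. box_kernel R \<bar>y - x\<bar> \<partial>\<beta>) \<le> (\<integral>x. max 0 (- ln \<bar>y - x\<bar>) + ?c \<partial>\<beta>)"
  proof (rule integral_mono_AE[OF i])
    show "integrable \<beta> (\<lambda>x. max 0 (- ln \<bar>y - x\<bar>) + ?c)" using m(1) by simp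
    show "AE x in \<beta>. box_kernel R \<bar>y - x\<bar> \<le> max 0 (- ln \<bar>y - x\<bar>) + ?c"
      using ae kato_pot(2)[OF b(1,2), of y]
    proof eventually_elim
      case (elim x)
      define d where "d = \<bar>y - x\<bar>"
      have d: "d > 0" using elim by (simp add: d_def)
      have "box_kernel R d \<le> ln R - ln (min d R)" by (rule box_kernel_bounds(2)[OF d R])
      moreover have "- ln (min d R) \<le> max 0 (- ln d) + ln (n + 2) - ln (min (1 + \<bar>y\<bar>) R)"
      proof (cases "d \<ge> 1")
        case True
        have "\<bar>y\<bar> \<le> d + n" using elim y unfolding d_def by (simp add: abs_if)
        also have "1 + (d + n) \<le> (n + 2) * d" using True n mult_left_mono[of 1 d n] by (simp add: algebra_simps)
        finally have "1 + \<bar>y\<bar> \<le> (n + 2) * d" by simp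
        moreover have "R \<le> (n + 2) * R" using R n by (simp add: algebra_simps)
        ultimately have "min (1 + \<bar>y\<bar>) R \<le> (n + 2) * min d R" by (auto simp: min_le_iff_disj min_mult_distrib_left)
        then have "ln (min (1 + \<bar>y\<bar>) R) \<le> ln ((n + 2) * min d R)" using d R n by (subst ln_le_cancel_iff) auto
        also have "\<dots> = ln (n + 2) + ln (min d R)" using d R n by (intro ln_mult_pos) auto
        finally show ?thesis by argo
      next
        case False
        have "1 + \<bar>y\<bar> \<le> n + 2" using False elim y unfolding d_def by (simp add: abs_if split: if_splits)
        then have "ln (min (1 + \<bar>y\<bar>) R) \<le> ln (n + 2)" using R n by (subst ln_le_cancel_iff) auto
        moreover have "min d R = d" using False R by simp
        ultimately show ?thesis by simp
      qed
      ultimately show ?case unfolding d_def[symmetric] by argo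
    qed
  qed
  also have "\<dots> = (\<integral>x. max 0 (- ln \<bar>y - x\<bar>) \<partial>\<beta>) + ?c"
    using m(1) b(3) by (simp add: borel_UNIV)
  finally show ?thesis using m(2) by argo
qed

text \<open>The distance of \<open>x\<close> and \<open>y\<close> is at most \<open>\<bar>x\<bar> + \<bar>y\<bar>\<close>.  As \<open>\<bar>x\<bar> \<ge> T\<close>, this is smaller than the product
  \<open>\<bar>x\<bar> (1 + \<bar>y\<bar>)\<close> by a factor of at least \<open>min (1 + \<bar>y\<bar>) T / 2\<close>, and the logarithm of this gain is the
  source of the moment bound.\<close>
lemma far_kernel_lower:
  assumes a: "finite_borel_measure \<alpha>" "measure \<alpha> UNIV = 1" and T: "T \<ge> 1" and ae: "AE x in \<alpha>. -R \<le> x \<and> x \<le> -T"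
    and R: "R \<ge> 1" and y: "y \<le> 0" and na: "AE x in \<alpha>. x \<noteq> y"
    and i: "integrable \<alpha> (\<lambda>x. box_kernel R \<bar>y - x\<bar>)" and li: "integrable \<alpha> (\<lambda>x. ln \<bar>x\<bar>)"
  shows "ln R - 1 - ln 2 - (\<integral>x. ln \<bar>x\<bar> \<partial>\<alpha>) + ln (min (1 + \<bar>y\<bar>) T) - ln (min (1 + \<bar>y\<bar>) R) \<le> (\<integral>x. box_kernel R \<bar>y - x\<bar> \<partial>\<alpha>)"
proof -
  interpret finite_borel_measure \<alpha> using a(1) .
  let ?c = "ln R - 1 - ln 2 + ln (min (1 + \<bar>y\<bar>) T) - ln (min (1 + \<bar>y\<bar>) R)"
  have "(\<integral>x. - ln \<bar>x\<bar> + ?c \<partial>\<alpha>) \<le> (\<integral>x. box_kernel R \<bar>y - x\<bar> \<partial>\<alpha>)"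
  proof (rule integral_mono_AE[OF _ i])
    show "integrable \<alpha> (\<lambda>x. - ln \<bar>x\<bar> + ?c)" using li by simp
    show "AE x in \<alpha>. - ln \<bar>x\<bar> + ?c \<le> box_kernel R \<bar>y - x\<bar>"
      using ae na
    proof eventually_elim
      case (elim x)
      define d X Y where "d = \<bar>y - x\<bar>" and "X = \<bar>x\<bar>" and "Y = \<bar>y\<bar>"
      have d: "d > 0" "d \<le> X + Y" using elim by (auto simp: d_def X_def Y_def)
      have X: "X \<ge> T" "X \<le> R" "Y \<ge> 0" using elim T by (auto simp: X_def Y_def)
      have k: "ln R - 1 - ln (min d R) \<le> box_kernel R d" by (rule box_kernel_bounds(1)[OF d(1) R])
      have "ln (min d R) \<le> ln (min (X + Y) R)" using d X R by (subst ln_le_cancel_iff) auto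
      moreover have "ln (min (X + Y) R) + ln (min (1 + Y) T) \<le> ln 2 + ln X + ln (min (1 + Y) R)"
      proof -
        have "min (X + Y) R * min (1 + Y) T \<le> 2 * X * min (1 + Y) R"
        proof (cases "1 + Y \<le> R")
          case True
          have "min (X + Y) R * min (1 + Y) T \<le> (X + Y) * min (1 + Y) T"
            using X T by (intro mult_right_mono) auto
          also have "\<dots> \<le> 2 * X * (1 + Y)"
          proof (cases "1 + Y \<le> T")
            case True
            have "(X + Y) * (1 + Y) \<le> (2 * X) * (1 + Y)" using True X by (intro mult_right_mono) auto
            then show ?thesis using True by (simp add: min_def)
          next
            case False
            have "Y * T \<le> Y * X" "X * T \<le> X * (1 + Y)" using False X T by (auto intro!: mult_left_mono)
            then have "(X + Y) * T \<le> 2 * X * (1 + Y)" using X T by (simp add: algebra_simps)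
            then show ?thesis using False by (simp add: min_def)
          qed
          finally show ?thesis using True by (simp add: min_def)
        next
          case False
          have "min (X + Y) R * min (1 + Y) T \<le> R * X" using X T R by (intro mult_mono) auto
          also have "\<dots> \<le> 2 * X * R" using X T R by simp
          finally show ?thesis using False by (simp add: min_def)
        qed
        then have "ln (min (X + Y) R * min (1 + Y) T) \<le> ln (2 * X * min (1 + Y) R)"
          using X T R by (subst ln_le_cancel_iff) auto
        moreover have "ln (min (X + Y) R * min (1 + Y) T) = ln (min (X + Y) R) + ln (min (1 + Y) T)"
          using X T R by (intro ln_mult_pos) auto
        moreover have "ln (2 * X * min (1 + Y) R) = ln (2 * X) + ln (min (1 + Y) R)" "ln (2 * X) = ln 2 + ln X"
          using X T R by (auto intro!: ln_mult_pos)
        ultimately show ?thesis by argo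
      qed
      ultimately show ?case using k unfolding d_def[symmetric] X_def[symmetric] Y_def[symmetric] by argo
    qed
  qed
  moreover have "(\<integral>x. - ln \<bar>x\<bar> + ?c \<partial>\<alpha>) = - (\<integral>x. ln \<bar>x\<bar> \<partial>\<alpha>) + ?c"
    using li a(2) by (simp add: borel_UNIV)
  ultimately show ?thesis by argo
qed

text \<open>From a point \<open>y\<close> of the right half line, the points of \<open>\<beta>\<close> are at distance at most
  \<open>(n + 1) (1 + y)\<close> and a point \<open>x\<close> of \<open>\<alpha>\<close> is at distance at least \<open>\<bar>x\<bar>\<close>.\<close>
lemma right_kernel_bounds:
  assumes R: "R \<ge> 1" and y: "y \<ge> 0"
    and b: "finite_borel_measure \<beta>" "measure \<beta> UNIV = 1" and n: "n \<ge> 0" and bae: "AE x in \<beta>. -n \<le> x \<and> x \<le> 0" and nb: "AE x in \<beta>. x \<noteq> y"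
    and bi: "integrable \<beta> (\<lambda>x. box_kernel R \<bar>y - x\<bar>)"
    and a: "finite_borel_measure \<alpha>" "measure \<alpha> UNIV = 1" and aae: "AE x in \<alpha>. -R \<le> x \<and> x \<le> -1"
    and ai: "integrable \<alpha> (\<lambda>x. box_kernel R \<bar>y - x\<bar>)" and li: "integrable \<alpha> (\<lambda>x. ln \<bar>x\<bar>)"
  shows "(\<integral>x. ln \<bar>x\<bar> \<partial>\<alpha>) - 1 - ln (n + 1) - ln (1 + \<bar>y\<bar>) \<le> (\<integral>x. box_kernel R \<bar>y - x\<bar> \<partial>\<beta>) - (\<integral>x. box_kernel R \<bar>y - x\<bar> \<partial>\<alpha>)"
proof -
  interpret b: finite_borel_measure \<beta> by fact
  interpret a: finite_borel_measure \<alpha> by fact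
  have "(\<integral>x. ln R - 1 - ln (n + 1) - ln (1 + \<bar>y\<bar>) \<partial>\<beta>) \<le> (\<integral>x. box_kernel R \<bar>y - x\<bar> \<partial>\<beta>)"
  proof (rule integral_mono_AE[OF _ bi])
    show "AE x in \<beta>. ln R - 1 - ln (n + 1) - ln (1 + \<bar>y\<bar>) \<le> box_kernel R \<bar>y - x\<bar>"
      using bae nb
    proof eventually_elim
      case (elim x)
      define d where "d = \<bar>y - x\<bar>"
      have d: "d > 0" "d \<le> y + n" using elim y by (auto simp: d_def)
      have "0 \<le> n * y" using n y by simp
      moreover have "(n + 1) * (1 + y) = n * y + n + y + 1" by (simp add: algebra_simps)
      ultimately have "d \<le> (n + 1) * (1 + y)" using d by argo
      then have "min d R \<le> (n + 1) * (1 + y)" by (rule min.coboundedI1)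
      then have "ln (min d R) \<le> ln ((n + 1) * (1 + y))" using d R y n by (subst ln_le_cancel_iff) (auto intro!: mult_pos_pos)
      also have "\<dots> = ln (n + 1) + ln (1 + y)" using y n by (intro ln_mult_pos) auto
      finally show ?case using box_kernel_bounds(1)[OF d(1) R] y unfolding d_def[symmetric] by simp
    qed
  qed simp
  moreover have "(\<integral>x. box_kernel R \<bar>y - x\<bar> \<partial>\<alpha>) \<le> (\<integral>x. ln R - ln \<bar>x\<bar> \<partial>\<alpha>)"
  proof (rule integral_mono_AE[OF ai])
    show "integrable \<alpha> (\<lambda>x. ln R - ln \<bar>x\<bar>)" using li by simp
    show "AE x in \<alpha>. box_kernel R \<bar>y - x\<bar> \<le> ln R - ln \<bar>x\<bar>"
      using aae
    proof eventually_elim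
      case (elim x)
      define d where "d = \<bar>y - x\<bar>"
      have d: "d > 0" "\<bar>x\<bar> \<le> d" using elim y by (auto simp: d_def)
      have "ln \<bar>x\<bar> \<le> ln (min d R)" using d elim by (subst ln_le_cancel_iff) auto
      then show ?case using box_kernel_bounds(2)[OF d(1) R] unfolding d_def[symmetric] by argo
    qed
  qed
  ultimately show ?thesis using b(2) a(2) li by (simp add: a.borel_UNIV b.borel_UNIV)
qed

end

context constrained_problem
begin

lemma kato_of_le_sigma:
  assumes "sets \<mu> = sets borel" "\<And>S. S \<in> sets borel \<Longrightarrow> emeasure \<mu> S \<le> emeasure \<sigma> S"
  shows "kato \<mu>"
  by (rule kato_mono[OF kato_sigma sets_sigma assms(1), of 1]) (use assms(2) in auto)

lemma AE_nonpos_of_le_sigma: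
  assumes s: "sets \<mu> = sets borel" and le: "\<And>S. S \<in> sets borel \<Longrightarrow> emeasure \<mu> S \<le> emeasure \<sigma> S"
  shows "AE x in \<mu>. x \<le> 0"
proof -
  have "emeasure \<sigma> (- {..0}) = 0" using AE_sigma AE_mem_iff[OF sets_sigma, of "{..0}"] by simp
  then have "emeasure \<mu> (- {..0}) = 0" using le[of "- {..0}"] by simp
  then show ?thesis using AE_mem_iff[OF s, of "{..0}"] by simp
qed

lemma admD:
  assumes "adm \<mu>1 \<mu>2"
  shows "finite_borel_measure \<mu>1" "finite_borel_measure \<mu>2" "measure \<mu>1 UNIV = 2" "measure \<mu>2 UNIV = 1"
    "AE x in \<mu>1. 0 \<le> x" "AE x in \<mu>2. x \<le> 0" "\<And>S. S \<in> sets borel \<Longrightarrow> emeasure \<mu>2 S \<le> emeasure \<sigma> S"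
    "kato \<mu>2" "sets \<mu>1 = sets borel" "sets \<mu>2 = sets borel"
  using assms by (auto simp: adm_def finite_borel_measureD(1) intro!: kato_of_le_sigma)

lemma near_pot_uniform:
  assumes b: "finite_borel_measure \<beta>" and c: "c \<ge> 0" and ae: "AE x in \<beta>. x \<in> {-N..0}"
    and le: "\<And>S. S \<in> sets borel \<Longrightarrow> emeasure \<beta> S \<le> ennreal c * emeasure (measure_restrict \<sigma> {-N..0}) S"
    and C: "\<And>y. \<bar>y\<bar> \<le> N + 1 \<Longrightarrow> near_pot 1 (measure_restrict \<sigma> {-N..0}) y \<le> ennreal C"
    and C0: "C \<ge> 0"
  shows "near_pot 1 \<beta> y \<le> ennreal (c * C)"
proof (cases "\<bar>y\<bar> \<le> N + 1")
  case True
  let ?r = "measure_restrict \<sigma> {-N..0}"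
  note [measurable_cong] = sets_restrict[of "{-N..0}"]
  have "near_pot 1 \<beta> y \<le> (\<integral>\<^sup>+t. klog y t * indicator {t. \<bar>y - t\<bar> < 1} t \<partial>scale_measure (ennreal c) ?r)"
    unfolding near_pot_def by (rule nn_integral_le_of_le) (use finite_borel_measureD(1)[OF b] le in auto)
  also have "\<dots> = ennreal c * near_pot 1 ?r y"
    unfolding near_pot_def by (rule nn_integral_scale_measure) measurable
  also have "\<dots> \<le> ennreal c * ennreal C" by (intro mult_left_mono C True) auto
  finally show ?thesis using c C0 by (simp add: ennreal_mult)
next
  case False
  have "near_pot 1 \<beta> y = (\<integral>\<^sup>+t. 0 \<partial>\<beta>)"
    unfolding near_pot_def
    by (rule nn_integral_cong_AE, use ae in eventually_elim) (use False in \<open>auto split: split_indicator\<close>)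
  then show ?thesis by simp
qed

text \<open>Mass of \<open>\<kappa>2\<close> is moved from \<open>{-T'..-T}\<close> into \<open>{-N..0}\<close>, where \<open>\<sigma> - \<kappa>2\<close> has mass.  With \<open>V\<close> the
  potential of \<open>\<beta> - \<alpha>\<close> for the box kernel of a large range, the first variation gives
  \<open>\<integral> V d\<kappa>2 - 1 / 2 \<integral> V d\<kappa>1 \<ge> -1\<close>.  Let \<open>l\<close> be the mean of \<open>ln \<bar>x\<bar>\<close> over \<open>\<alpha>\<close>.  On the left half line
  \<open>V y \<le> l + K - ln (min (1 + \<bar>y\<bar>) T)\<close> for a constant \<open>K\<close>, and on the right half line
  \<open>V y \<ge> l - K - ln (1 + y)\<close>.  As \<open>\<kappa>2\<close> and \<open>\<kappa>1 / 2\<close> have mass one, the unbounded quantity \<open>l\<close> cancels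
  and a bound for the truncated moment remains that depends neither on \<open>T\<close> nor on the range.\<close>
lemma minimizer_truncated_moment:
  assumes k: "adm \<kappa>1 \<kappa>2" "shifted_J \<kappa>1 \<kappa>2 < \<infinity>" "\<And>\<nu>1 \<nu>2. adm \<nu>1 \<nu>2 \<Longrightarrow> shifted_J \<kappa>1 \<kappa>2 \<le> shifted_J \<nu>1 \<nu>2"
    and N: "N > 0" "emeasure (diff_measure \<sigma> \<kappa>2) {-N..0} > 0"
    and C: "\<And>y. \<bar>y\<bar> \<le> N + 1 \<Longrightarrow> near_pot 1 (measure_restrict \<sigma> {-N..0}) y \<le> ennreal C" "C \<ge> 0"
    and T: "T \<ge> 1" and far: "emeasure \<kappa>2 {..<-T} > 0"
  shows "(\<integral>y. ln (min (1 + \<bar>y\<bar>) T) \<partial>\<kappa>2) \<le>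
    1 / measure (diff_measure \<sigma> \<kappa>2) {-N..0} * C + ln (N + 2) + 3 + ln 2 + ln (N + 1) + (\<integral>y. ln (1 + \<bar>y\<bar>) \<partial>\<kappa>1) / 2"
proof -
  note d = admD[OF k(1)]
  note n1 = shifted_J_finite[OF k(1,2)]
  interpret k1: finite_borel_measure \<kappa>1 by (rule d)
  interpret k2: finite_borel_measure \<kappa>2 by (rule d)
  note [measurable_cong] = k2.M_is_borel
  let ?B = "{-N..0}"
  define c where "c = 1 / measure (diff_measure \<sigma> \<kappa>2) ?B"
  have c0: "c \<ge> 0" by (simp add: c_def)
  (* the far mass is taken from a bounded set, so that \<alpha> has finite energy *)
  obtain T' where T': "measure \<kappa>2 {-T'..-T} > 0" "T' \<ge> T"
  proof -
    have "(\<lambda>n. emeasure \<kappa>2 {- real n..-T}) \<longlonglongrightarrow> emeasure \<kappa>2 (\<Union>n. {- real n..-T})"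
      by (rule Lim_emeasure_incseq) (auto simp: incseq_def)
    moreover have "(\<Union>n. {- real n..-T}) = {..-T}"
    proof (intro set_eqI iffI)
      fix x assume "x \<in> {..-T}"
      moreover obtain n where "- x \<le> real n" using real_arch_simple by blast
      ultimately show "x \<in> (\<Union>n. {- real n..-T})" by (auto intro!: exI[of _ n])
    qed auto
    moreover have "0 < emeasure \<kappa>2 {..-T}"
      by (rule less_le_trans[OF far emeasure_mono]) (auto simp: k2.M_is_borel)
    ultimately have "\<forall>\<^sub>F n in sequentially. 0 < emeasure \<kappa>2 {- real n..-T}"
      using order_tendstoD(1)[of _ "emeasure \<kappa>2 {..-T}"] by auto
    then obtain n where n: "0 < emeasure \<kappa>2 {- real n..-T}" by (auto simp: eventually_sequentially)
    then have "0 < measure \<kappa>2 {- real n..-T}" by (simp add: k2.emeasure_eq_measure)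
    moreover have "real n \<ge> T"
    proof (rule ccontr)
      assume "\<not> real n \<ge> T"
      then have "{- real n..-T} = {}" by auto
      then show False using n by simp
    qed
    ultimately show ?thesis by (rule that)
  qed
  have sB: "emeasure \<sigma> ?B < \<infinity>" by (rule sigma_finite_compact)
  obtain \<nu> \<alpha> \<beta> m where tr: "m > 0" "finite_borel_measure \<nu>" "finite_borel_measure \<alpha>" "finite_borel_measure \<beta>"
    "measure \<nu> UNIV = measure \<kappa>2 UNIV" "measure \<alpha> UNIV = 1" "measure \<beta> UNIV = 1"
    "AE x in \<alpha>. x \<in> {-T'..-T}" "AE x in \<beta>. x \<in> ?B"
    "\<And>S. S \<in> sets borel \<Longrightarrow> emeasure \<nu> S \<le> emeasure \<sigma> S"
    "\<And>S. S \<in> sets borel \<Longrightarrow> measure \<alpha> S \<le> 1 / measure \<kappa>2 {-T'..-T} * measure \<kappa>2 S"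
    "\<And>S. S \<in> sets borel \<Longrightarrow> emeasure \<beta> S \<le> ennreal c * emeasure (measure_restrict \<sigma> ?B) S"
    "mix 1 \<nu> m \<alpha> = mix 1 \<kappa>2 m \<beta>"
    unfolding c_def
    by (rule transfer_mass[OF sets_sigma d(2) d(7) _ T'(1) _ sB N(2)]) (assumption | simp)+
  interpret al: finite_borel_measure \<alpha> by (rule tr)
  interpret be: finite_borel_measure \<beta> by (rule tr)
  note [measurable_cong] = al.M_is_borel be.M_is_borel
  have kb: "kato \<beta>"
    by (rule kato_mono[OF kato_restrict _ _ c0 tr(12)]) (auto simp: be.M_is_borel)
  have ka: "kato \<alpha>"
  proof (rule kato_mono[OF d(8,10) al.M_is_borel])
    fix S :: "real set" assume "S \<in> sets borel"
    from tr(11)[OF this] show "emeasure \<alpha> S \<le> ennreal (1 / measure \<kappa>2 {-T'..-T}) * emeasure \<kappa>2 S"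
      by (simp add: al.emeasure_eq_measure k2.emeasure_eq_measure ennreal_mult[symmetric] ennreal_leI)
  qed simp
  have nb: "fin_energy \<beta>" by (rule fin_energy_of_kato_bounded[OF kb tr(4), of N]) (use tr(9) in \<open>eventually_elim, auto\<close>)
  have na: "fin_energy \<alpha>"
    by (rule fin_energy_of_kato_bounded[OF ka tr(3), of T']) (use tr(8) in \<open>eventually_elim, use T T' in auto\<close>)
  note le = fin_energyD(2)[OF na] fin_energyD(2)[OF nb]
  have lb: "log_moment \<beta>" and la: "log_moment \<alpha>" using na nb by (auto intro: fin_energy_log_moment)
  have adm\<nu>: "adm \<kappa>1 \<nu>"
    unfolding adm_def using d tr(2,5,10) AE_nonpos_of_le_sigma[OF finite_borel_measureD(1)[OF tr(2)] tr(10)] by auto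
  have bx: "boxfn \<nu> p - boxfn \<kappa>2 p = m * (boxfn \<beta> p - boxfn \<alpha> p)" for p
  proof -
    have "boxfn (mix 1 \<nu> m \<alpha>) p = boxfn (mix 1 \<kappa>2 m \<beta>) p" using tr(13) by simp
    then show ?thesis using tr(1,2,3,4) d by (simp add: boxfn_mix algebra_simps)
  qed
  note [measurable] = boxfn_measurable[OF tr(3)] boxfn_measurable[OF tr(4)] boxfn_measurable[OF d(1)] boxfn_measurable[OF d(2)]
  have isq: "integrable lborel (\<lambda>p. (boxfn \<beta> p - boxfn \<alpha> p)\<^sup>2)"
    using energy_neutral(1)[OF nb na] tr(6,7) by (intro integrableI_nonneg) auto
  then have "integrable lborel (\<lambda>p. (boxfn \<nu> p - boxfn \<kappa>2 p)\<^sup>2)"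
    unfolding bx by (simp add: power_mult_distrib)
  note fv = shifted_J_first_variation[OF k adm\<nu> this]
  (* the integrand of the first variation; cutting off long boxes turns it into truncated energies *)
  define u where "u p = (boxfn \<kappa>2 p - boxfn \<kappa>1 p / 2) * (boxfn \<beta> p - boxfn \<alpha> p)" for p
  have um: "(boxfn \<kappa>2 p - boxfn \<kappa>1 p / 2) * (boxfn \<nu> p - boxfn \<kappa>2 p) = m * u p" for p
    unfolding bx u_def by simp
  have iu: "integrable lborel u"
    using fv(1) tr(1) unfolding um by simp
  have u0: "0 \<le> integral\<^sup>L lborel u"
    using fv(2) tr(1) unfolding um by (simp add: zero_le_mult_iff)
  have [measurable]: "u \<in> borel_measurable lborel" using iu by (rule borel_measurable_integrable)
  have "(\<lambda>n. \<integral>p. u p * indicator {p. fst p < real n} p \<partial>lborel) \<longlonglongrightarrow> integral\<^sup>L lborel u"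
  proof (rule integral_dominated_convergence)
    show "integrable lborel (\<lambda>p. \<bar>u p\<bar>)" using iu by simp
    show "AE p in lborel. norm (u p * indicator {p. fst p < real n} p) \<le> \<bar>u p\<bar>" for n
      by (auto split: split_indicator)
    show "AE p in lborel. (\<lambda>n. u p * indicator {p. fst p < real n} p) \<longlonglongrightarrow> u p"
    proof (rule AE_I2, rule tendsto_eventually)
      fix p :: "real \<times> real"
      show "\<forall>\<^sub>F n in sequentially. u p * indicator {p. fst p < real n} p = u p"
        using eventually_gt_at_top[of "nat \<lceil>fst p\<rceil>"]
      proof eventually_elim
        case (elim n)
        then have "fst p < real n" by linarith
        then show ?case by simp
      qed
    qed
  qed measurable
  then have "\<forall>\<^sub>F n in sequentially. -1 < (\<integral>p. u p * indicator {p. fst p < real n} p \<partial>lborel)"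
    using u0 by (intro order_tendstoD(1)) auto
  then have "\<forall>\<^sub>F n in sequentially. -1 < (\<integral>p. u p * indicator {p. fst p < real n} p \<partial>lborel) \<and> T' \<le> real n"
    using eventually_ge_at_top[of "nat \<lceil>T'\<rceil>"] by eventually_elim linarith
  then obtain n where n: "-1 < (\<integral>p. u p * indicator {p. fst p < real n} p \<partial>lborel)" "T' \<le> real n"
    by (auto simp: eventually_sequentially)
  define R where "R = real n"
  have R: "R \<ge> T'" "R \<ge> 1" using n(2) T'(2) T by (auto simp: R_def)
  define V where "V y = (\<integral>x. box_kernel R \<bar>y - x\<bar> \<partial>\<beta>) - (\<integral>x. box_kernel R \<bar>y - x\<bar> \<partial>\<alpha>)" for y
  have l1: "local_energy \<kappa>1" and l2: "local_energy \<kappa>2" using n1 fin_energyD(2) by auto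
  have iV: "integrable \<kappa>2 V" "integrable \<kappa>1 V"
    unfolding V_def using trunc_energy_fst(1)[OF l1 _ R(2)] trunc_energy_fst(1)[OF l2 _ R(2)] le by auto
  have V2: "trunc_energy R \<kappa>2 \<beta> - trunc_energy R \<kappa>2 \<alpha> = (\<integral>y. V y \<partial>\<kappa>2)"
    and V1: "trunc_energy R \<kappa>1 \<beta> - trunc_energy R \<kappa>1 \<alpha> = (\<integral>y. V y \<partial>\<kappa>1)"
    unfolding V_def using trunc_energy_fst(1,2)[OF l1 _ R(2)] trunc_energy_fst(1,2)[OF l2 _ R(2)] le by auto
  let ?I = "indicator {p. fst p < R} :: real \<times> real \<Rightarrow> real"
  have "has_bochner_integral lborel (\<lambda>p. (boxfn \<kappa>2 p * boxfn \<beta> p * ?I p - boxfn \<kappa>2 p * boxfn \<alpha> p * ?I p)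
     - (1/2) * (boxfn \<kappa>1 p * boxfn \<beta> p * ?I p - boxfn \<kappa>1 p * boxfn \<alpha> p * ?I p))
     ((trunc_energy R \<kappa>2 \<beta> - trunc_energy R \<kappa>2 \<alpha>) - (1/2) * (trunc_energy R \<kappa>1 \<beta> - trunc_energy R \<kappa>1 \<alpha>))"
    unfolding trunc_energy_def
    by (intro has_bochner_integral_diff has_bochner_integral_mult_right boxfn_product_integral le l1 l2 R)
  also have "(\<lambda>p. (boxfn \<kappa>2 p * boxfn \<beta> p * ?I p - boxfn \<kappa>2 p * boxfn \<alpha> p * ?I p)
     - (1/2) * (boxfn \<kappa>1 p * boxfn \<beta> p * ?I p - boxfn \<kappa>1 p * boxfn \<alpha> p * ?I p)) = (\<lambda>p. u p * ?I p)"
    by (rule ext) (simp add: u_def field_simps)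
  finally have "(\<integral>p. u p * ?I p \<partial>lborel) = (\<integral>y. V y \<partial>\<kappa>2) - (1/2) * (\<integral>y. V y \<partial>\<kappa>1)"
    unfolding V1 V2 by (simp add: has_bochner_integral_iff)
  with n(1) have main: "-1 \<le> (\<integral>y. V y \<partial>\<kappa>2) - (1/2) * (\<integral>y. V y \<partial>\<kappa>1)" by (simp add: R_def)
  define lmean where "lmean = (\<integral>x. ln \<bar>x\<bar> \<partial>\<alpha>)"
  have li: "integrable \<alpha> (\<lambda>x. ln \<bar>x\<bar>)"
  proof (rule al.integrable_const_bound[where B="ln T'"])
    show "AE x in \<alpha>. norm (ln \<bar>x\<bar>) \<le> ln T'" using tr(8) by eventually_elim (use T in auto)
  qed measurable
  have np: "near_pot 1 \<beta> y \<le> ennreal (c * C)" for y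
    by (rule near_pot_uniform[OF tr(4) c0 tr(9) tr(12) C])
  have cC: "c * C \<ge> 0" using c0 C(2) by simp
  have bint: "AE x in \<beta>. -N \<le> x \<and> x \<le> 0" using tr(9) by eventually_elim auto
  have aint: "AE x in \<alpha>. -R \<le> x \<and> x \<le> -T" using tr(8) by eventually_elim (use R in auto)
  have aint1: "AE x in \<alpha>. -R \<le> x \<and> x \<le> -1" using aint by eventually_elim (use T in auto)
  have imin: "integrable \<kappa>2 (\<lambda>y. ln (min (1 + \<bar>y\<bar>) T))"
  proof (rule k2.integrable_const_bound[where B="ln T"])
    show "AE y in \<kappa>2. norm (ln (min (1 + \<bar>y\<bar>) T)) \<le> ln T" using T by (auto simp: min_def)
  qed measurable
  define K where "K = c * C + ln (N + 2) + 1 + ln 2 + lmean"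
  have "(\<integral>y. V y \<partial>\<kappa>2) \<le> (\<integral>y. K - ln (min (1 + \<bar>y\<bar>) T) \<partial>\<kappa>2)"
  proof (rule integral_mono_AE[OF iV(1)])
    show "integrable \<kappa>2 (\<lambda>y. K - ln (min (1 + \<bar>y\<bar>) T))" using imin by simp
    show "AE y in \<kappa>2. V y \<le> K - ln (min (1 + \<bar>y\<bar>) T)"
      using d(6) trunc_energy_fst(3)[OF l2 le(1) R(2)] trunc_energy_fst(3)[OF l2 le(2) R(2)]
    proof eventually_elim
      case (elim y)
      have "(\<integral>x. box_kernel R \<bar>y - x\<bar> \<partial>\<beta>) \<le> ln R + c * C + ln (N + 2) - ln (min (1 + \<bar>y\<bar>) R)"
        by (rule compact_kernel_upper[OF lb kb tr(7) _ bint np cC R(2) elim(1) elim(3)]) (use N in simp)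
      moreover have "ln R - 1 - ln 2 - lmean + ln (min (1 + \<bar>y\<bar>) T) - ln (min (1 + \<bar>y\<bar>) R) \<le> (\<integral>x. box_kernel R \<bar>y - x\<bar> \<partial>\<alpha>)"
        unfolding lmean_def by (rule far_kernel_lower[OF tr(3,6) T aint R(2) elim(1) kato_pot(2)[OF la ka] elim(2) li])
      ultimately show ?case unfolding V_def K_def by argo
    qed
  qed
  also have "\<dots> = K - (\<integral>y. ln (min (1 + \<bar>y\<bar>) T) \<partial>\<kappa>2)"
    using imin d(4) by (simp add: k2.borel_UNIV)
  finally have up: "(\<integral>y. V y \<partial>\<kappa>2) \<le> K - (\<integral>y. ln (min (1 + \<bar>y\<bar>) T) \<partial>\<kappa>2)" .
  have il1: "integrable \<kappa>1 (\<lambda>y. ln (1 + \<bar>y\<bar>))" using fin_energy_log_moment[OF n1(1)] by (simp add: log_moment_def)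
  have "(\<integral>y. (lmean - 1 - ln (N + 1)) - ln (1 + \<bar>y\<bar>) \<partial>\<kappa>1) \<le> (\<integral>y. V y \<partial>\<kappa>1)"
  proof (rule integral_mono_AE[OF _ iV(2)])
    show "integrable \<kappa>1 (\<lambda>y. (lmean - 1 - ln (N + 1)) - ln (1 + \<bar>y\<bar>))" using il1 by simp
    show "AE y in \<kappa>1. (lmean - 1 - ln (N + 1)) - ln (1 + \<bar>y\<bar>) \<le> V y"
      using d(5) trunc_energy_fst(3)[OF l1 le(1) R(2)] trunc_energy_fst(3)[OF l1 le(2) R(2)]
    proof eventually_elim
      case (elim y)
      show ?case unfolding V_def lmean_def
        by (rule right_kernel_bounds[OF R(2) elim(1) tr(4,7) _ bint kato_pot(2)[OF lb kb] elim(3) tr(3,6) aint1 elim(2) li])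
           (use N in simp)
    qed
  qed
  moreover have "(\<integral>y. (lmean - 1 - ln (N + 1)) - ln (1 + \<bar>y\<bar>) \<partial>\<kappa>1) = 2 * (lmean - 1 - ln (N + 1)) - (\<integral>y. ln (1 + \<bar>y\<bar>) \<partial>\<kappa>1)"
    using il1 d(3) by (simp add: k1.borel_UNIV)
  ultimately show ?thesis using main up unfolding K_def c_def by argo
qed

text \<open>Unless \<open>\<kappa>2\<close> has compact support, the preceding bound holds for all \<open>T\<close>.\<close>
lemma minimizer_fin_energy:
  assumes k: "adm \<kappa>1 \<kappa>2" "shifted_J \<kappa>1 \<kappa>2 < \<infinity>" "\<And>\<nu>1 \<nu>2. adm \<nu>1 \<nu>2 \<Longrightarrow> shifted_J \<kappa>1 \<kappa>2 \<le> shifted_J \<nu>1 \<nu>2"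
  shows "fin_energy \<kappa>2"
proof -
  note d = admD[OF k(1)]
  note n1 = shifted_J_finite[OF k(1,2)]
  interpret k2: finite_borel_measure \<kappa>2 by (rule d)
  note [measurable_cong] = k2.M_is_borel
  have "log_moment \<kappa>2"
  proof (cases "\<exists>T\<ge>1. emeasure \<kappa>2 {..<-T} = 0")
    case True
    then obtain T where T: "T \<ge> 1" "emeasure \<kappa>2 {..<-T} = 0" by blast
    have "- {-T..} = {..<-T}" by auto
    then have "AE x in \<kappa>2. x \<in> {-T..}" using T AE_mem_iff[OF d(10), of "{-T..}"] by simp
    with d(6) have "AE x in \<kappa>2. \<bar>x\<bar> \<le> T" by eventually_elim auto
    then show ?thesis by (rule log_moment_bounded[OF d(2)])
  next
    case False
    obtain N where N: "N > 0" "emeasure \<sigma> {-N..0} > 1" using ex_compact_mass_gt_1 by blast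
    have "emeasure \<kappa>2 {-N..0} \<le> emeasure \<kappa>2 UNIV" by (rule emeasure_mono) (auto simp: d)
    also have "\<dots> = 1" using d(4) by (simp add: k2.emeasure_eq_measure)
    finally have "emeasure \<kappa>2 {-N..0} < emeasure \<sigma> {-N..0}" using N(2) by (rule le_less_trans)
    then have dN: "emeasure (diff_measure \<sigma> \<kappa>2) {-N..0} > 0"
      using emeasure_diff_of_le[OF sets_sigma d(2) d(7), of "{-N..0}"] by (simp add: diff_gt_0_iff_gt_ennreal)
    obtain C where C: "C \<ge> 0" "\<And>y. \<bar>y\<bar> \<le> N + 1 \<Longrightarrow> near_pot 1 (measure_restrict \<sigma> {-N..0}) y \<le> ennreal C"
      using near_pot_bounded[OF kato_restrict finite_borel_restrict, of "N+1" N] by blast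
    define K where "K = 1 / measure (diff_measure \<sigma> \<kappa>2) {-N..0} * C + ln (N + 2) + 3 + ln 2 + ln (N + 1) + (\<integral>y. ln (1 + \<bar>y\<bar>) \<partial>\<kappa>1) / 2"
    have bd: "(\<integral>\<^sup>+y. ennreal (ln (min (1 + \<bar>y\<bar>) (real (Suc n)))) \<partial>\<kappa>2) \<le> ennreal K" for n
    proof -
      have T1: "real (Suc n) \<ge> 1" by simp
      have "emeasure \<kappa>2 {..<-real (Suc n)} > 0" using False T1 by (metis gr_zeroI)
      from minimizer_truncated_moment[OF k N(1) dN C(2,1) T1 this]
      have le: "(\<integral>y. ln (min (1 + \<bar>y\<bar>) (real (Suc n))) \<partial>\<kappa>2) \<le> K" by (simp only: K_def)
      have imin: "integrable \<kappa>2 (\<lambda>y. ln (min (1 + \<bar>y\<bar>) (real (Suc n))))"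
      proof (rule k2.integrable_const_bound[where B="ln (real (Suc n))"])
        show "AE y in \<kappa>2. norm (ln (min (1 + \<bar>y\<bar>) (real (Suc n)))) \<le> ln (real (Suc n))" using T1 by (auto simp: min_def)
      qed measurable
      have "(\<integral>\<^sup>+y. ennreal (ln (min (1 + \<bar>y\<bar>) (real (Suc n)))) \<partial>\<kappa>2) = ennreal (\<integral>y. ln (min (1 + \<bar>y\<bar>) (real (Suc n))) \<partial>\<kappa>2)"
        by (rule nn_integral_eq_integral[OF imin]) (auto simp: min_def)
      then show ?thesis using le by (simp add: ennreal_leI)
    qed
    have "(\<lambda>n. \<integral>\<^sup>+y. ennreal (ln (min (1 + \<bar>y\<bar>) (real (Suc n)))) \<partial>\<kappa>2) \<longlonglongrightarrow> (\<integral>\<^sup>+y. ennreal (ln (1 + \<bar>y\<bar>)) \<partial>\<kappa>2)"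
    proof (rule nn_integral_LIMSEQ)
      show "incseq (\<lambda>n y. ennreal (ln (min (1 + \<bar>y\<bar>) (real (Suc n)))))"
        unfolding incseq_def le_fun_def
      proof (intro allI impI ennreal_leI)
        fix m n :: nat and y :: real assume "m \<le> n"
        then show "ln (min (1 + \<bar>y\<bar>) (real (Suc m))) \<le> ln (min (1 + \<bar>y\<bar>) (real (Suc n)))"
          by (subst ln_le_cancel_iff) (auto simp: min_def)
      qed
      fix y :: real
      have "\<forall>\<^sub>F n in sequentially. ennreal (ln (min (1 + \<bar>y\<bar>) (real (Suc n)))) = ennreal (ln (1 + \<bar>y\<bar>))"
        using eventually_ge_at_top[of "nat \<lceil>\<bar>y\<bar>\<rceil>"]
      proof eventually_elim
        case (elim n)
        then have "1 + \<bar>y\<bar> \<le> real (Suc n)" by linarith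
        then show ?case by (simp only: min_absorb1)
      qed
      then show "(\<lambda>n. ennreal (ln (min (1 + \<bar>y\<bar>) (real (Suc n))))) \<longlonglongrightarrow> ennreal (ln (1 + \<bar>y\<bar>))" by (rule tendsto_eventually)
    qed measurable
    then have "(\<integral>\<^sup>+y. ennreal (ln (1 + \<bar>y\<bar>)) \<partial>\<kappa>2) \<le> ennreal K"
      by (rule LIMSEQ_le_const2) (use bd in auto)
    then have "integrable \<kappa>2 (\<lambda>y. ln (1 + \<bar>y\<bar>))"
      by (intro integrableI_nonneg) (auto simp: top.not_eq_extremum le_less_trans)
    with d(2) show ?thesis by (simp add: log_moment_def)
  qed
  then show ?thesis using n1(3) log_moment_iff[OF d(2)] by (simp add: fin_energy_def)
qed

lemma ex_is_min: "\<exists>\<kappa>1 \<kappa>2. is_min \<kappa>1 \<kappa>2"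
proof -
  obtain \<kappa>1 \<kappa>2 where k: "adm \<kappa>1 \<kappa>2" "shifted_J \<kappa>1 \<kappa>2 < \<infinity>" "\<And>\<nu>1 \<nu>2. adm \<nu>1 \<nu>2 \<Longrightarrow> shifted_J \<kappa>1 \<kappa>2 \<le> shifted_J \<nu>1 \<nu>2"
    using shifted_J_min_exists by blast
  have f: "feas \<kappa>1 \<kappa>2" using k(1) shifted_J_finite[OF k(1,2)] minimizer_fin_energy[OF k] by (simp add: feas_def)
  have "J_real \<kappa>1 \<kappa>2 \<le> J_real \<nu>1 \<nu>2" if n: "feas \<nu>1 \<nu>2" for \<nu>1 \<nu>2
    using k(3)[OF feasD(1)[OF n]] shifted_J_eq[OF f] shifted_J_eq[OF n] by (simp add: ennreal_le_iff)
  with f show ?thesis unfolding is_min_def by blast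
qed

end

section \<open>Pointwise conditions for the minimizer\<close>

lemma box_ekernel_scale_le:
  assumes r: "0 < r" "r \<le> 1"
  shows "box_ekernel 1 (c + r * s) (c + r * t) \<le> klog s t * indicator {u. \<bar>s - u\<bar> < 1} t + ennreal (- ln r)"
proof (cases "s = t")
  case True
  then show ?thesis by (simp add: klog_def)
next
  case False
  define d where "d = \<bar>s - t\<bar>"
  have d: "d > 0" using False by (simp add: d_def)
  have e: "\<bar>(c + r * s) - (c + r * t)\<bar> = r * d" using r by (simp add: d_def abs_mult right_diff_distrib[symmetric])
  have lr: "ln r \<le> 0" using r by simp
  have ne: "c + r * s \<noteq> c + r * t" using False r by simp
  show ?thesis
  proof (cases "d < 1")
    case True
    have "r * d < 1" using mult_left_le_one_le[of d r] r d True by linarith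
    then have "box_kernel 1 (r * d) \<le> - ln d + - ln r" using r d by (simp add: box_kernel_def ln_div ln_mult)
    then have "ennreal (box_kernel 1 (r * d)) \<le> ennreal (- ln d + - ln r)" by (rule ennreal_leI)
    also have "\<dots> = ennreal (- ln d) + ennreal (- ln r)" using True d lr by (intro ennreal_plus) auto
    finally show ?thesis using False True ne e by (simp add: box_ekernel_def klog_def d_def)
  next
    case F: False
    have "box_kernel 1 (r * d) \<le> - ln r"
    proof (cases "r * d < 1")
      case True
      have "0 \<le> ln d" using F by simp
      moreover have "box_kernel 1 (r * d) = - ln r - ln d - 1 + r * d"
        using True r d by (simp add: box_kernel_def ln_div ln_mult)
      ultimately show ?thesis using True by linarith
    next
      case False
      then show ?thesis using lr by (simp add: box_kernel_def)
    qed
    then show ?thesis using False F ne e by (auto simp: box_ekernel_def d_def intro!: ennreal_leI)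
  qed
qed

text \<open>Monotone convergence of the truncated potentials.\<close>
lemma pot_le_of_trunc_le:
  assumes n: "fin_energy \<mu>" and c: "\<And>n. (\<integral>t. trunc_log (exp (- real n)) (of_real x) t \<partial>\<mu>) \<le> c"
  shows "integrable \<mu> (\<lambda>t. - ln \<bar>x - t\<bar>)" "pot \<mu> x \<le> c" "log_potential \<mu> (of_real x) = ereal (pot \<mu> x)"
proof -
  have l: "log_moment \<mu>" using n by (rule fin_energy_log_moment)
  interpret finite_borel_measure \<mu> using l by (rule log_moment_fb)
  note [measurable_cong] = M_is_borel
  let ?f = "\<lambda>n t. trunc_log (exp (- real n)) (of_real x) t"
  have i: "integrable \<mu> (?f n)" for n by (rule trunc_log_integrable[OF l]) auto
  have "emeasure \<mu> {x} = 0" using fin_energy_no_atom[OF n, of x] by (simp add: emeasure_eq_measure)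
  then have "{x} \<in> null_sets \<mu>" by (auto simp: null_sets_def)
  then have ne: "AE t in \<mu>. t \<noteq> x" using AE_not_in[of "{x}" \<mu>] by (auto elim: eventually_mono)
  have mono: "mono (\<lambda>n. ?f n t)" for t
    unfolding mono_def trunc_log_def
  proof (intro allI impI)
    fix a b :: nat assume "a \<le> b"
    then have "max (exp (- real b)) (cmod (of_real x - of_real t)) \<le> max (exp (- real a)) (cmod (of_real x - of_real t))"
      by (intro max.mono) auto
    then show "- ln (max (exp (- real a)) (cmod (of_real x - of_real t))) \<le> - ln (max (exp (- real b)) (cmod (of_real x - of_real t)))"
      by (simp add: less_max_iff_disj)
  qed
  have lim: "AE t in \<mu>. (\<lambda>n. ?f n t) \<longlonglongrightarrow> - ln \<bar>x - t\<bar>"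
    using ne
  proof eventually_elim
    case (elim t)
    have d: "\<bar>x - t\<bar> > 0" using elim by simp
    have "\<forall>\<^sub>F n in sequentially. ?f n t = - ln \<bar>x - t\<bar>"
      using eventually_ge_at_top[of "nat \<lceil>- ln \<bar>x - t\<bar>\<rceil>"]
    proof eventually_elim
      case (elim n)
      then have "- real n \<le> ln \<bar>x - t\<bar>" by linarith
      then have "exp (- real n) \<le> \<bar>x - t\<bar>" using d by (simp add: ln_ge_iff)
      then show ?case by (simp add: trunc_log_def cmod_diff_of_real max_absorb2)
    qed
    then show ?case by (rule tendsto_eventually)
  qed
  have inc: "incseq (\<lambda>n. \<integral>t. ?f n t \<partial>\<mu>)"
    using mono by (auto simp: incseq_def mono_def intro!: integral_mono i)
  obtain L where L: "(\<lambda>n. \<integral>t. ?f n t \<partial>\<mu>) \<longlonglongrightarrow> L" "\<forall>n. (\<integral>t. ?f n t \<partial>\<mu>) \<le> L"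
    using incseq_convergent[OF inc, of c] c by auto
  have um: "(\<lambda>t. - ln \<bar>x - t\<bar>) \<in> borel_measurable \<mu>" by measurable
  show ii: "integrable \<mu> (\<lambda>t. - ln \<bar>x - t\<bar>)"
    by (rule integrable_monotone_convergence[OF i _ lim L(1) um]) (use mono in auto)
  have "pot \<mu> x = L" unfolding pot_def
    by (rule integral_monotone_convergence[OF i _ lim L(1) um]) (use mono in auto)
  moreover have "L \<le> c" using L(1) c by (intro LIMSEQ_le_const2) auto
  ultimately show "pot \<mu> x \<le> c" by simp
  have "integrable \<mu> (\<lambda>t. - ln (cmod (of_real x - of_real t)))" using ii by (simp add: cmod_diff_of_real)
  moreover have "AE t in \<mu>. complex_of_real x \<noteq> of_real t" using ne by (auto elim: eventually_mono)
  ultimately show "log_potential \<mu> (of_real x) = ereal (pot \<mu> x)" by (subst log_potential_eq) (auto simp: cpot_of_real)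
qed

locale equilibrium = constrained_problem +
  fixes \<kappa>1 \<kappa>2 :: "real measure"
  assumes minimal: "is_min \<kappa>1 \<kappa>2"
begin

lemma feas_k: "feas \<kappa>1 \<kappa>2"
  using minimal by (simp add: is_min_def)

lemmas kD = feasD[OF feas_k]
lemmas kA = admD[OF kD(1)]

lemma log_moment_k: "log_moment \<kappa>1" "log_moment \<kappa>2"
  using kD by (auto intro: fin_energy_log_moment)

lemmas pot2 = kato_pot[OF log_moment_k(2) kA(8)]

lemma slope_nonneg: "feas \<nu>1 \<nu>2 \<Longrightarrow> 0 \<le> slope \<kappa>1 \<kappa>2 \<nu>1 \<nu>2"
  using slope_nonneg_iff_min[OF feas_k] minimal by (auto simp: is_min_def)

text \<open>The mean of \<open>2 U\<^sup>\<kappa>\<^sup>1 - U\<^sup>\<kappa>\<^sup>2 + \<phi>\<close> over \<open>\<kappa>1\<close>, whose mass is two.\<close>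
definition w1 :: real where
  "w1 = (2 * energy \<kappa>1 \<kappa>1 - energy \<kappa>1 \<kappa>2 + (\<integral>x. phi0 x \<partial>\<kappa>1)) / 2"

definition W1r :: "real \<Rightarrow> real" where "W1r x = 2 * pot \<kappa>1 x - pot \<kappa>2 x + phi0 x"
definition W2r :: "real \<Rightarrow> real" where "W2r x = 2 * pot \<kappa>2 x - pot \<kappa>1 x"

text \<open>The variational inequality for the competitor \<open>(2 \<nu>, \<kappa>2)\<close>.\<close>
lemma w1_le_test:
  assumes n: "fin_energy \<nu>" "measure \<nu> UNIV = 1" "AE x in \<nu>. 0 \<le> x" "integrable \<nu> phi0"
  shows "w1 \<le> 2 * energy \<kappa>1 \<nu> + (\<integral>x. phi0 x - pot \<kappa>2 x \<partial>\<nu>)"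
proof -
  let ?n = "mix 2 \<nu> 0 \<nu>"
  have fb: "finite_borel_measure \<nu>" using n by (simp add: fin_energyD)
  note s = finite_borel_measureD(1)[OF fb]
  have ae: "AE x in ?n. 0 \<le> x"
    using n(3) AE_nonneg_iff[OF s] AE_nonneg_iff[of ?n] s by (simp add: emeasure_mix)
  have nn: "fin_energy ?n" using n by (auto intro!: fin_energy_mix)
  have p: "integrable ?n phi0" "(\<integral>x. phi0 x \<partial>?n) = 2 * (\<integral>x. phi0 x \<partial>\<nu>)"
    using integral_mix[OF s s _ _ n(4) n(4), of 2 0] by auto
  have f: "feas ?n \<kappa>2"
    using kD kA ae nn p n fb by (auto simp: feas_def adm_def measure_mix finite_borel_mix)
  have e: "energy ?n \<kappa>1 = 2 * energy \<nu> \<kappa>1" "energy ?n \<kappa>2 = 2 * energy \<nu> \<kappa>2"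
    using energy_mix_left[OF n(1) n(1) kD(2), of 2 0] energy_mix_left[OF n(1) n(1) kD(3), of 2 0] by auto
  have "(\<integral>x. phi0 x - pot \<kappa>2 x \<partial>\<nu>) = (\<integral>x. phi0 x \<partial>\<nu>) - energy \<nu> \<kappa>2"
    using n(4) energy_eq_integral_pot[OF n(1) kD(3)] by simp
  moreover have "0 \<le> slope \<kappa>1 \<kappa>2 ?n \<kappa>2" by (rule slope_nonneg[OF f])
  ultimately show ?thesis
    unfolding slope_def w1_def e p(2) energy_commute[OF kD(2) n(1)] by argo
qed

text \<open>The test measure is the image of \<open>reference\<close> under \<open>s \<mapsto> x0 + q s\<close>, which stays on the right half line
  and shrinks to the point mass at \<open>x0\<close> as \<open>q\<close> tends to zero.  Its potential is bounded, uniformly in \<open>q\<close>,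
  by that of the point mass plus a constant, so the energies converge by dominated convergence.\<close>
lemma W1r_ge:
  assumes x0: "0 \<le> x0" and i: "integrable \<kappa>1 (\<lambda>t. - ln \<bar>x0 - t\<bar>)"
  shows "w1 \<le> W1r x0"
proof -
  note r = reference
  obtain M' where M': "M' \<ge> 0" "AE t in reference. 0 \<le> t \<and> t \<le> M'" using r(5) by blast
  define M where "M = M' + 1"
  have M: "M \<ge> 1" "AE t in reference. 0 \<le> t \<and> t \<le> M"
    using M' by (auto simp: M_def elim: eventually_mono)
  interpret t: finite_borel_measure reference by (rule r)
  note [measurable_cong] = t.M_is_borel
  have lt: "log_moment reference" using r(4) by (rule fin_energy_log_moment)
  obtain C where C: "C \<ge> 0" "\<And>x. \<bar>x\<bar> \<le> 2 * M \<Longrightarrow> near_pot 1 reference x \<le> ennreal C"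
    using near_pot_bounded[OF r(3,1), of "2 * M"] by blast
  (* copies of the reference measure that shrink to x0 *)
  define \<tau> where "\<tau> q = distr reference borel (\<lambda>s. x0 + q * s)" for q
  have int\<tau>: "(\<integral>x. f x \<partial>\<tau> q) = (\<integral>s. f (x0 + q * s) \<partial>reference)" if "f \<in> borel_measurable borel" for f :: "real \<Rightarrow> real" and q
    unfolding \<tau>_def using that by (subst integral_distr) auto
  have fb: "finite_borel_measure (\<tau> q)" for q
    unfolding \<tau>_def by (intro finite_borel_measureI) (auto simp: emeasure_distr t.borel_UNIV t.emeasure_eq_measure)
  have m1: "measure (\<tau> q) UNIV = 1" for q
    unfolding \<tau>_def using r(2) by (simp add: measure_distr t.borel_UNIV)
  have supp: "AE x in \<tau> q. x0 \<le> x \<and> x \<le> x0 + M" if q: "0 < q" "q \<le> 1" for q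
  proof -
    have "AE s in reference. x0 \<le> x0 + q * s \<and> x0 + q * s \<le> x0 + M"
      using M(2)
    proof eventually_elim
      case (elim s)
      then have "0 \<le> q * s" "q * s \<le> M" using q mult_left_le_one_le[of s q] by auto
      then show ?case by simp
    qed
    then show ?thesis unfolding \<tau>_def by (subst AE_distr_iff) auto
  qed
  have fin_energy\<tau>: "fin_energy (\<tau> q)" if q: "0 < q" "q \<le> 1" for q
  proof -
    have "(\<integral>\<^sup>+x. \<integral>\<^sup>+y. box_ekernel 1 x y \<partial>\<tau> q \<partial>\<tau> q) = (\<integral>\<^sup>+s. \<integral>\<^sup>+t. box_ekernel 1 (x0 + q * s) (x0 + q * t) \<partial>reference \<partial>reference)"
    proof -
      have "(\<integral>\<^sup>+y. box_ekernel 1 x y \<partial>\<tau> q) = (\<integral>\<^sup>+t. box_ekernel 1 x (x0 + q * t) \<partial>reference)" for x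
        unfolding \<tau>_def by (subst nn_integral_distr) auto
      then show ?thesis unfolding \<tau>_def by (subst nn_integral_distr) auto
    qed
    also have "\<dots> \<le> (\<integral>\<^sup>+s. \<integral>\<^sup>+t. klog s t * indicator {u. \<bar>s - u\<bar> < 1} t + ennreal (- ln q) \<partial>reference \<partial>reference)"
      by (intro nn_integral_mono box_ekernel_scale_le q)
    also have "\<dots> = (\<integral>\<^sup>+s. near_pot 1 reference s + ennreal (- ln q) \<partial>reference)"
    proof (rule nn_integral_cong)
      fix s
      show "(\<integral>\<^sup>+t. klog s t * indicator {u. \<bar>s - u\<bar> < 1} t + ennreal (- ln q) \<partial>reference) = near_pot 1 reference s + ennreal (- ln q)"
        unfolding near_pot_def
        by (subst nn_integral_add) (use r(2) in \<open>auto simp: t.borel_UNIV t.emeasure_eq_measure\<close>)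
    qed
    also have "\<dots> \<le> (\<integral>\<^sup>+s. ennreal C + ennreal (- ln q) \<partial>reference)"
      by (rule nn_integral_mono_AE, use M(2) in eventually_elim) (use C(2) M(1) in \<open>auto intro!: add_right_mono\<close>)
    also have "\<dots> < \<infinity>" by (simp add: t.emeasure_eq_measure ennreal_mult_less_top)
    finally have "local_energy (\<tau> q)" using local_energy_iff[OF fb] by simp
    moreover have "AE x in \<tau> q. \<bar>x\<bar> \<le> x0 + M" using supp[OF q] by eventually_elim (use x0 M in auto)
    ultimately show ?thesis using log_moment_iff[OF fb] log_moment_bounded[OF fb] by (simp add: fin_energy_def)
  qed
  have pot\<tau>: "pot (\<tau> q) t = (\<integral>s. - ln \<bar>(t - x0) - q * s\<bar> \<partial>reference)" for q t
    unfolding pot_def by (subst int\<tau>) (auto simp: algebra_simps)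
  have ip: "integrable reference (\<lambda>s. - ln \<bar>(t - x0) - q * s\<bar>)" and sc: "pot (\<tau> q) t = - ln q + pot reference ((t - x0) / q)"
    if q: "0 < q" for q t
  proof -
    have e: "AE s in reference. - ln \<bar>(t - x0) - q * s\<bar> = - ln q + - ln \<bar>(t - x0) / q - s\<bar>"
      using kato_pot(2)[OF lt r(3), of "(t - x0) / q"]
    proof eventually_elim
      case (elim s)
      have "(t - x0) - q * s = q * ((t - x0) / q - s)" using q by (simp add: field_simps)
      then have "\<bar>(t - x0) - q * s\<bar> = q * \<bar>(t - x0) / q - s\<bar>" using q by (simp add: abs_mult)
      moreover have "\<bar>(t - x0) / q - s\<bar> > 0" using elim by auto
      ultimately show ?case using q by (simp add: ln_mult_pos)
    qed
    note k = kato_pot(1)[OF lt r(3), of "(t - x0) / q"]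
    have i': "integrable reference (\<lambda>s. - ln q + - ln \<bar>(t - x0) / q - s\<bar>)" using k by simp
    show "integrable reference (\<lambda>s. - ln \<bar>(t - x0) - q * s\<bar>)"
      by (rule integrable_cong_AE_imp[OF i']) (use e in \<open>auto simp: eq_commute\<close>)
    have "pot (\<tau> q) t = (\<integral>s. - ln q + - ln \<bar>(t - x0) / q - s\<bar> \<partial>reference)"
      unfolding pot\<tau> by (rule integral_cong_AE) (use e in auto)
    also have "\<dots> = - ln q + pot reference ((t - x0) / q)"
      unfolding pot_def using k r(2) by (subst Bochner_Integration.integral_add) (auto simp: t.borel_UNIV)
    finally show "pot (\<tau> q) t = - ln q + pot reference ((t - x0) / q)" .
  qed
  have between: "- ln (d + q * M) \<le> pot (\<tau> q) t \<and> pot (\<tau> q) t \<le> - ln (d - q * M)"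
    if q: "0 < q" and d: "d = \<bar>x0 - t\<bar>" "q * M < d" for q t d
  proof
    have bounds: "AE s in reference. d - q * M \<le> \<bar>(t - x0) - q * s\<bar> \<and> \<bar>(t - x0) - q * s\<bar> \<le> d + q * M"
      using M(2)
    proof eventually_elim
      case (elim s)
      then have "0 \<le> q * s" "q * s \<le> q * M" using q by auto
      then show ?case unfolding d(1) by (auto simp: abs_if)
    qed
    have "(\<integral>s. - ln (d + q * M) \<partial>reference) \<le> pot (\<tau> q) t"
      unfolding pot\<tau>
      by (rule integral_mono_AE[OF _ ip[OF q]], simp, use bounds in eventually_elim) (use d q M in \<open>auto intro!: ln_mono\<close>)
    then show "- ln (d + q * M) \<le> pot (\<tau> q) t" using r(2) by (simp add: t.borel_UNIV)
    have "pot (\<tau> q) t \<le> (\<integral>s. - ln (d - q * M) \<partial>reference)"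
      unfolding pot\<tau>
      by (rule integral_mono_AE[OF ip[OF q]], simp, use bounds in eventually_elim) (use d q M in \<open>auto intro!: ln_mono\<close>)
    then show "pot (\<tau> q) t \<le> - ln (d - q * M)" using r(2) by (simp add: t.borel_UNIV)
  qed
  (* if t is far from the copy, the copy is seen at distance at least d / 2; otherwise rescale *)
  define K where "K = ln (2 * M) + C + ln 2"
  have upper: "pot (\<tau> q) t \<le> - ln \<bar>x0 - t\<bar> + K" if q: "0 < q" "q \<le> 1" and ne: "t \<noteq> x0" for q t
  proof -
    define d where "d = \<bar>x0 - t\<bar>"
    have d: "d > 0" using ne by (simp add: d_def)
    have l2: "0 \<le> ln (2 * M)" "0 \<le> ln (2::real)" using M by auto
    show ?thesis
    proof (cases "q * M \<le> d / 2")
      case True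
      have "pot (\<tau> q) t \<le> - ln (d - q * M)" using between[OF q(1) d_def] True d by simp
      also have "\<dots> \<le> - ln (d / 2)" using True d by (simp add: ln_mono)
      also have "\<dots> = - ln d + ln 2" using d by (simp add: ln_div)
      finally show ?thesis using l2 C unfolding K_def d_def[symmetric] by linarith
    next
      case False
      have x': "\<bar>(t - x0) / q\<bar> = d / q" using q by (simp add: d_def abs_minus_commute)
      have "d / q \<le> 2 * M" using False q by (simp add: field_simps)
      then have np: "near_pot 1 reference ((t - x0) / q) \<le> ennreal C" using x' C by simp
      have "pot reference ((t - x0) / q) \<le> (\<integral>s. max 0 (- ln \<bar>(t - x0) / q - s\<bar>) \<partial>reference)"
        unfolding pot_def
        by (rule integral_mono[OF kato_pot(1)[OF lt r(3)] near_part_integral(1)[OF lt r(3) np C(1)]]) auto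
      also have "\<dots> \<le> C" by (rule near_part_integral(2)[OF lt r(3) np C(1)])
      finally have "pot (\<tau> q) t \<le> - ln q + C" using sc[OF q(1), of t] by simp
      moreover have "ln (d / (2 * M)) \<le> ln q" using False d M q by (intro ln_mono) (auto simp: field_simps)
      moreover have "ln (d / (2 * M)) = ln d - ln (2 * M)" using d M by (simp add: ln_div)
      ultimately show ?thesis using l2 unfolding K_def d_def[symmetric] by linarith
    qed
  qed
  have lower: "- ln (1 + \<bar>t\<bar>) - ln (1 + x0 + M) \<le> pot (\<tau> q) t" if q: "0 < q" "q \<le> 1" for q t
  proof -
    have "(\<integral>s. - ln (1 + \<bar>t\<bar>) - ln (1 + x0 + M) \<partial>reference) \<le> pot (\<tau> q) t"
      unfolding pot\<tau>
    proof (rule integral_mono_AE[OF _ ip[OF q(1)]], simp)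
      show "AE s in reference. - ln (1 + \<bar>t\<bar>) - ln (1 + x0 + M) \<le> - ln \<bar>(t - x0) - q * s\<bar>"
        using M(2)
      proof eventually_elim
        case (elim s)
        have qs: "0 \<le> q * s" "q * s \<le> M" using elim q mult_left_le_one_le[of s q] by auto
        show ?case
        proof (cases "(t - x0) - q * s = 0")
          case True
          have "0 \<le> ln (1 + \<bar>t\<bar>)" "0 \<le> ln (1 + x0 + M)" using x0 M(1) by auto
          then have "- ln (1 + \<bar>t\<bar>) - ln (1 + x0 + M) \<le> 0" by linarith
          then show ?thesis unfolding True by simp
        next
          case False
          have "\<bar>(t - x0) - q * s\<bar> \<le> \<bar>t\<bar> + (x0 + M)" using qs x0 by (auto simp: abs_if)
          also have "\<dots> \<le> (1 + \<bar>t\<bar>) * (1 + x0 + M)" 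
          proof -
            have "0 \<le> \<bar>t\<bar> * (x0 + M)" using x0 M by simp
            moreover have "(1 + \<bar>t\<bar>) * (1 + x0 + M) = 1 + \<bar>t\<bar> + (x0 + M) + \<bar>t\<bar> * (x0 + M)" by (simp add: algebra_simps)
            ultimately show ?thesis by linarith
          qed
          finally have "ln \<bar>(t - x0) - q * s\<bar> \<le> ln ((1 + \<bar>t\<bar>) * (1 + x0 + M))" using False by (intro ln_mono) auto
          also have "\<dots> = ln (1 + \<bar>t\<bar>) + ln (1 + x0 + M)" using x0 M by (intro ln_mult_pos) auto
          finally show ?thesis by linarith
        qed
      qed
    qed
    then show ?thesis using r(2) by (simp add: t.borel_UNIV)
  qed
  define q where "q n = 1 / real (Suc n)" for n
  have q: "0 < q n" "q n \<le> 1" for n by (auto simp: q_def)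
  have q0: "q \<longlonglongrightarrow> 0" unfolding q_def by (rule LIMSEQ_Suc, rule lim_const_over_n)
  interpret k1: finite_borel_measure \<kappa>1 by (rule kA)
  note [measurable_cong] = k1.M_is_borel
  have "emeasure \<kappa>1 {x0} = 0" using fin_energy_no_atom[OF kD(2), of x0] by (simp add: k1.emeasure_eq_measure)
  then have "{x0} \<in> null_sets \<kappa>1" by (auto simp: null_sets_def)
  then have ne: "AE t in \<kappa>1. t \<noteq> x0" using AE_not_in[of "{x0}" \<kappa>1] by (auto elim: eventually_mono)
  have lim1: "(\<lambda>n. energy \<kappa>1 (\<tau> (q n))) \<longlonglongrightarrow> pot \<kappa>1 x0"
    unfolding energy_eq_integral_pot(2)[OF kD(2) fin_energy\<tau>[OF q]] pot_def[of \<kappa>1 x0]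
  proof (rule integral_dominated_convergence)
    show "integrable \<kappa>1 (\<lambda>t. \<bar>- ln \<bar>x0 - t\<bar>\<bar> + \<bar>K\<bar> + ln (1 + \<bar>t\<bar>) + \<bar>ln (1 + x0 + M)\<bar>)"
      using i log_moment_k(1) by (auto simp: log_moment_def)
    show "AE t in \<kappa>1. norm (pot (\<tau> (q n)) t) \<le> \<bar>- ln \<bar>x0 - t\<bar>\<bar> + \<bar>K\<bar> + ln (1 + \<bar>t\<bar>) + \<bar>ln (1 + x0 + M)\<bar>" for n
      using ne
    proof eventually_elim
      case (elim t)
      have "0 \<le> ln (1 + \<bar>t\<bar>)" by simp
      with upper[OF q elim, of n] lower[OF q, of t n] show ?case unfolding real_norm_def by linarith
    qed
    show "AE t in \<kappa>1. (\<lambda>n. pot (\<tau> (q n)) t) \<longlonglongrightarrow> - ln \<bar>x0 - t\<bar>"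
      using ne
    proof eventually_elim
      case (elim t)
      define d where "d = \<bar>x0 - t\<bar>"
      have d: "d > 0" using elim by (simp add: d_def)
      have l0: "(\<lambda>n. q n * M) \<longlonglongrightarrow> 0 * M" by (intro tendsto_intros q0)
      then have small: "\<forall>\<^sub>F n in sequentially. q n * M < d" using d by (intro order_tendstoD(2)) auto
      show ?case unfolding d_def[symmetric]
      proof (rule tendsto_sandwich)
        show "\<forall>\<^sub>F n in sequentially. - ln (d + q n * M) \<le> pot (\<tau> (q n)) t"
          using small by eventually_elim (use between[OF q(1) d_def] in auto)
        show "\<forall>\<^sub>F n in sequentially. pot (\<tau> (q n)) t \<le> - ln (d - q n * M)"
          using small by eventually_elim (use between[OF q(1) d_def] in auto)
        have "(\<lambda>n. - ln (d + q n * M)) \<longlonglongrightarrow> - ln (d + 0 * M)" using d by (intro tendsto_minus tendsto_ln tendsto_add[OF tendsto_const l0]) auto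
        then show "(\<lambda>n. - ln (d + q n * M)) \<longlonglongrightarrow> - ln d" by simp
        have "(\<lambda>n. - ln (d - q n * M)) \<longlonglongrightarrow> - ln (d - 0 * M)" using d by (intro tendsto_minus tendsto_ln tendsto_diff[OF tendsto_const l0]) auto
        then show "(\<lambda>n. - ln (d - q n * M)) \<longlonglongrightarrow> - ln d" by simp
      qed
    qed
    show "(\<lambda>t. - ln \<bar>x0 - t\<bar>) \<in> borel_measurable \<kappa>1" by measurable
    show "pot (\<tau> (q n)) \<in> borel_measurable \<kappa>1" for n
      using energy_eq_integral_pot(1)[OF kD(2) fin_energy\<tau>[OF q]] by (rule borel_measurable_integrable)
  qed
  define v where "v x = phi0 x - pot \<kappa>2 x" for x
  have vc: "continuous_on UNIV v" unfolding v_def by (intro continuous_intros phi0_cont pot2(4))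
  have vm[measurable]: "v \<in> borel_measurable borel" using vc by (rule borel_measurable_continuous_onI)
  have "bounded (v ` {x0..x0 + M})" "bounded (phi0 ` {x0..x0 + M})"
    by (auto intro!: compact_imp_bounded compact_continuous_image continuous_on_subset[OF vc] continuous_on_subset[OF phi0_cont])
  then obtain B B' where B: "\<And>x. x0 \<le> x \<Longrightarrow> x \<le> x0 + M \<Longrightarrow> \<bar>v x\<bar> \<le> B" and B': "\<And>x. x0 \<le> x \<Longrightarrow> x \<le> x0 + M \<Longrightarrow> \<bar>phi0 x\<bar> \<le> B'"
    unfolding bounded_iff by (metis atLeastAtMost_iff imageI real_norm_def)
  have lim2: "(\<lambda>n. \<integral>x. v x \<partial>\<tau> (q n)) \<longlonglongrightarrow> v x0"
  proof -
    have "(\<lambda>n. \<integral>s. v (x0 + q n * s) \<partial>reference) \<longlonglongrightarrow> (\<integral>s. v x0 \<partial>reference)"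
    proof (rule integral_dominated_convergence)
      show "integrable reference (\<lambda>s. B)" by simp
      show "AE s in reference. norm (v (x0 + q n * s)) \<le> B" for n
        using M(2)
      proof eventually_elim
        case (elim s)
        then have "0 \<le> q n * s" "q n * s \<le> M" using q[of n] mult_left_le_one_le[of s "q n"] by auto
        then show ?case using B[of "x0 + q n * s"] by simp
      qed
      show "AE s in reference. (\<lambda>n. v (x0 + q n * s)) \<longlonglongrightarrow> v x0"
      proof (rule AE_I2)
        fix s
        have "(\<lambda>n. x0 + q n * s) \<longlonglongrightarrow> x0 + 0 * s" by (intro tendsto_intros q0)
        then have "(\<lambda>n. x0 + q n * s) \<longlonglongrightarrow> x0" by simp
        moreover have "isCont v x0" using vc by (simp add: continuous_on_eq_continuous_at)
        ultimately show "(\<lambda>n. v (x0 + q n * s)) \<longlonglongrightarrow> v x0" by (rule isCont_tendsto_compose[rotated])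
      qed
    qed measurable
    then show ?thesis using r(2) by (simp add: int\<tau> t.borel_UNIV)
  qed
  have "w1 \<le> 2 * energy \<kappa>1 (\<tau> (q n)) + (\<integral>x. v x \<partial>\<tau> (q n))" for n
    unfolding v_def
  proof (rule w1_le_test[OF fin_energy\<tau>[OF q] m1])
    show "AE x in \<tau> (q n). 0 \<le> x" using supp[OF q, of n] by eventually_elim (use x0 in auto)
    interpret n: finite_borel_measure "\<tau> (q n)" by (rule fb)
    note [measurable_cong] = n.M_is_borel
    show "integrable (\<tau> (q n)) phi0"
    proof (rule n.integrable_const_bound[where B=B'])
      show "AE x in \<tau> (q n). norm (phi0 x) \<le> B'" using supp[OF q, of n] by eventually_elim (use B' in auto)
    qed measurable
  qed
  then have "w1 \<le> 2 * pot \<kappa>1 x0 + v x0"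
    by (intro LIMSEQ_le_const[OF tendsto_add[OF tendsto_mult[OF tendsto_const lim1] lim2]]) auto
  then show ?thesis by (simp add: W1r_def v_def)
qed

lemma AE_W1r_ge: "AE x in \<kappa>1. w1 \<le> W1r x"
  using kA(5) energy_eq_integral_pot(3)[OF kD(2,2)] by eventually_elim (rule W1r_ge)

lemma integrable_W1r: "integrable \<kappa>1 W1r" and integral_W1r: "(\<integral>x. W1r x \<partial>\<kappa>1) = 2 * w1"
proof -
  note i = energy_eq_integral_pot(1)[OF kD(2,2)] energy_eq_integral_pot(1)[OF kD(2,3)] kD(4)
  show "integrable \<kappa>1 W1r" unfolding W1r_def using i by auto
  show "(\<integral>x. W1r x \<partial>\<kappa>1) = 2 * w1"
    unfolding W1r_def w1_def energy_eq_integral_pot(2)[OF kD(2,2)] energy_eq_integral_pot(2)[OF kD(2,3)]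
    using i by simp
qed

text \<open>A function that is bounded below by its mean equals it almost everywhere.\<close>
lemma AE_W1r_eq: "AE x in \<kappa>1. W1r x = w1"
proof -
  interpret k1: finite_borel_measure \<kappa>1 by (rule kA)
  have i: "integrable \<kappa>1 (\<lambda>x. W1r x - w1)" using integrable_W1r by simp
  have "(\<integral>x. W1r x - w1 \<partial>\<kappa>1) = 0" using integrable_W1r integral_W1r kA(3) by (simp add: k1.borel_UNIV)
  then have "AE x in \<kappa>1. W1r x - w1 = 0"
    using integral_nonneg_eq_0_iff_AE[OF i] AE_W1r_ge by (auto elim: eventually_mono)
  then show ?thesis by eventually_elim simp
qed

text \<open>Truncation of the kernel gives continuous functions that are at most \<open>w1\<close> almost everywhere, hence
  on the support; then the truncation is removed by monotone convergence.\<close>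
lemma W1r_le_on_support:
  assumes x: "x \<in> measure_support \<kappa>1"
  shows "integrable \<kappa>1 (\<lambda>t. - ln \<bar>x - t\<bar>)" "W1r x \<le> w1" "log_potential \<kappa>1 (of_real x) = ereal (pot \<kappa>1 x)"
proof -
  interpret k1: finite_borel_measure \<kappa>1 by (rule kA)
  define F where "F n x = 2 * (\<integral>t. trunc_log (exp (- real n)) (of_real x) t \<partial>\<kappa>1) - pot \<kappa>2 x + phi0 x" for n x
  have le: "F n x \<le> w1" for n
  proof (rule ccontr)
    assume gt: "\<not> F n x \<le> w1"
    have "continuous_on UNIV (F n)" unfolding F_def
      by (intro continuous_intros phi0_cont pot2(4) continuous_on_compose2[OF trunc_log_continuous[OF log_moment_k(1)], of _ UNIV "\<lambda>x. of_real x"]) auto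
    then have o: "open {y. w1 < F n y}" by (intro open_Collect_less continuous_intros)
    have "AE y in \<kappa>1. F n y \<le> w1"
      using AE_W1r_eq energy_eq_integral_pot(3)[OF kD(2,2)]
    proof eventually_elim
      case (elim y)
      have "emeasure \<kappa>1 {y} = 0" using fin_energy_no_atom[OF kD(2), of y] by (simp add: k1.emeasure_eq_measure)
      then have "{y} \<in> null_sets \<kappa>1" using k1.M_is_borel by (auto simp: null_sets_def)
      then have ne: "AE t in \<kappa>1. t \<notin> {y}" by (rule AE_not_in)
      have "(\<integral>t. trunc_log (exp (- real n)) (of_real y) t \<partial>\<kappa>1) \<le> pot \<kappa>1 y"
        unfolding pot_def
      proof (rule integral_mono_AE[OF trunc_log_integrable[OF log_moment_k(1)] elim(2)])
        show "AE t in \<kappa>1. trunc_log (exp (- real n)) (of_real y) t \<le> - ln \<bar>y - t\<bar>"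
          using ne
        proof eventually_elim
          case (elim t)
          then have "0 < \<bar>y - t\<bar>" by auto
          then show ?case unfolding trunc_log_def cmod_diff_of_real
            by (subst neg_le_iff_le, subst ln_le_cancel_iff) auto
        qed
      qed auto
      with elim(1) show ?case by (simp add: F_def W1r_def)
    qed
    then have "emeasure \<kappa>1 (- {y. F n y \<le> w1}) = 0"
      using AE_mem_iff[OF kA(9), of "{y. F n y \<le> w1}"] borel_closed[of "{y. F n y \<le> w1}"] o
      by (simp add: closed_def Collect_neg_eq[symmetric] not_le)
    moreover have "- {y. F n y \<le> w1} = {y. w1 < F n y}" by auto
    ultimately have "emeasure \<kappa>1 {y. w1 < F n y} = 0" by simp
    moreover have "emeasure \<kappa>1 {y. w1 < F n y} > 0"
    proof -
      have "\<forall>S. open S \<longrightarrow> x \<in> S \<longrightarrow> emeasure \<kappa>1 S > 0" using x by (simp only: measure_support_def mem_Collect_eq)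
      from this[rule_format, OF o] show ?thesis using gt by simp
    qed
    ultimately show False by simp
  qed
  have c: "(\<integral>t. trunc_log (exp (- real n)) (of_real x) t \<partial>\<kappa>1) \<le> (w1 + pot \<kappa>2 x - phi0 x) / 2" for n
    using le[of n] by (simp add: F_def field_simps)
  show "integrable \<kappa>1 (\<lambda>t. - ln \<bar>x - t\<bar>)" "log_potential \<kappa>1 (of_real x) = ereal (pot \<kappa>1 x)"
    by (rule pot_le_of_trunc_le[OF kD(2) c])+
  show "W1r x \<le> w1" using pot_le_of_trunc_le(2)[OF kD(2) c] by (simp add: W1r_def field_simps)
qed

lemma support_k1_subset: "measure_support \<kappa>1 \<subseteq> {0..}"
  using support_subset_iff[OF kA(9), of "{0..}"] kA(5) by simp

lemma support_k2_subset: "measure_support \<kappa>2 \<subseteq> {..0}"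
  using support_subset_iff[OF kA(10), of "{..0}"] kA(6) by simp

lemma W1r_eq_on_support: "x \<in> measure_support \<kappa>1 \<Longrightarrow> W1r x = w1"
  using W1r_le_on_support[of x] W1r_ge[of x] support_k1_subset by force

text \<open>At a point \<open>x\<close> of the support, \<open>2 U\<^sup>\<kappa>\<^sup>1 + \<phi>\<close> is bounded below and \<open>- U\<^sup>\<kappa>\<^sup>2 \<ge> ln x\<close>, while the sum
  is at most \<open>w1\<close>.\<close>
lemma compact_support_k1: "compact (measure_support \<kappa>1)"
proof -
  interpret k1: finite_borel_measure \<kappa>1 by (rule kA)
  interpret k2: finite_borel_measure \<kappa>2 by (rule kA)
  obtain C where C: "\<And>x. x \<ge> 0 \<Longrightarrow> 2 * ln (1 + x\<^sup>2) - C \<le> phi0 x" using phi0_lower by blast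
  define L where "L = (\<integral>t. ln (1 + t\<^sup>2) \<partial>\<kappa>1)"
  have "x \<le> max 1 (exp (w1 + L + C))" if x: "x \<in> measure_support \<kappa>1" for x
  proof (cases "x \<le> 1")
    case False
    then have x1: "x > 1" by simp
    note s = W1r_le_on_support[OF x]
    note i = fin_energyD(3)[OF kD(2)]
    have "(\<integral>t. - ((ln (1 + x\<^sup>2) + ln (1 + t\<^sup>2)) / 2) \<partial>\<kappa>1) \<le> pot \<kappa>1 x"
      unfolding pot_def by (rule integral_mono[OF _ s(1)]) (use i ln_dist_le[of x] in auto)
    moreover have "(\<integral>t. - ((ln (1 + x\<^sup>2) + ln (1 + t\<^sup>2)) / 2) \<partial>\<kappa>1) = - ln (1 + x\<^sup>2) - L / 2"
      using i kA(3) by (simp add: k1.borel_UNIV L_def, simp add: field_simps)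
    ultimately have p1: "- 2 * ln (1 + x\<^sup>2) - L \<le> 2 * pot \<kappa>1 x" by linarith
    have "pot \<kappa>2 x \<le> (\<integral>t. - ln x \<partial>\<kappa>2)"
      unfolding pot_def
    proof (rule integral_mono_AE[OF pot2(1)])
      show "AE t in \<kappa>2. - ln \<bar>x - t\<bar> \<le> - ln x" using kA(6)
      proof eventually_elim
        case (elim t)
        then have "x \<le> \<bar>x - t\<bar>" by simp
        then show ?case using x1 by simp
      qed
    qed simp
    then have p2: "pot \<kappa>2 x \<le> - ln x" using kA(4) by (simp add: k2.borel_UNIV)
    have "ln x \<le> w1 + L + C" using p1 p2 s(2) C[of x] x1 unfolding W1r_def by linarith
    then have "x \<le> exp (w1 + L + C)" using x1 by (metis exp_le_cancel_iff exp_ln less_trans zero_less_one)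
    then show ?thesis by simp
  qed simp
  then have "measure_support \<kappa>1 \<subseteq> {0..max 1 (exp (w1 + L + C))}" using support_k1_subset by auto
  then show ?thesis
    using closed_measure_support bounded_subset[OF bounded_closed_interval] by (metis compact_eq_bounded_closed)
qed

lemma kato_k1: "kato \<kappa>1"
proof (rule kato_of_continuous[OF kA(1) compact_support_k1 AE_support[OF kA(9)]])
  show "continuous_on (measure_support \<kappa>1) (\<lambda>x. (w1 + pot \<kappa>2 x - phi0 x) / 2)"
    by (intro continuous_intros pot2(4) continuous_on_subset[OF phi0_cont]) auto
  fix x assume x: "x \<in> measure_support \<kappa>1"
  have "pot \<kappa>1 x = (w1 + pot \<kappa>2 x - phi0 x) / 2" using W1r_eq_on_support[OF x] by (simp add: W1r_def field_simps)
  then show "log_potential \<kappa>1 (of_real x) = ereal ((w1 + pot \<kappa>2 x - phi0 x) / 2)"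
    using W1r_le_on_support(3)[OF x] by simp
qed

lemmas pot1 = kato_pot[OF log_moment_k(1) kato_k1]

lemma W1r_cont: "continuous_on A W1r"
  unfolding W1r_def by (intro continuous_intros pot1(4) pot2(4) continuous_on_subset[OF phi0_cont]) auto

lemma W2r_cont: "continuous_on A W2r"
  unfolding W2r_def by (intro continuous_intros pot1(4) pot2(4))

lemma W1r_lower: "0 \<le> x \<Longrightarrow> w1 \<le> W1r x"
  using W1r_ge pot1(1) by blast

lemma W1_eq: "0 \<le> x \<Longrightarrow> W1 \<phi> (\<kappa>1, \<kappa>2) x = ereal (W1r x)"
  by (simp add: pot1(3) pot2(3) W1r_def phi0_eq)

lemma W2_eq: "W2 (\<kappa>1, \<kappa>2) x = ereal (W2r x)"
  by (simp add: pot1(3) pot2(3) W2r_def)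

text \<open>The unused part of the constraint.\<close>
definition rest :: "real measure" where "rest = diff_measure \<sigma> \<kappa>2"

lemma emeasure_rest: "S \<in> sets borel \<Longrightarrow> emeasure rest S = emeasure \<sigma> S - emeasure \<kappa>2 S"
  unfolding rest_def by (rule emeasure_diff_of_le[OF sets_sigma kA(2) kA(7)])

lemma sets_rest: "sets rest = sets borel"
  by (simp add: rest_def sets_sigma)

text \<open>If \<open>W2 x\<close> were larger than \<open>W2 y\<close>, moving mass of \<open>\<kappa>2\<close> from a neighbourhood of \<open>x\<close> to a neighbourhood
  of \<open>y\<close>, where \<open>\<sigma> - \<kappa>2\<close> has mass to spare, would contradict the variational inequality.\<close>
lemma exchange:
  assumes x: "x \<in> measure_support \<kappa>2" and y: "y \<in> measure_support rest"
  shows "W2r x \<le> W2r y"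
proof (rule ccontr)
  assume "\<not> W2r x \<le> W2r y"
  then have lt: "W2r y < W2r x" by simp
  (* two levels strictly between the two values *)
  define c1 where "c1 = (W2r y + 2 * W2r x) / 3"
  define c2 where "c2 = (2 * W2r y + W2r x) / 3"
  have c: "W2r y < c2" "c2 < c1" "c1 < W2r x" using lt by (auto simp: c1_def c2_def)
  have cont: "continuous_on UNIV W2r" by (rule W2r_cont)
  let ?A = "{z. c1 < W2r z}" and ?B = "{z. W2r z < c2} \<inter> ball y 1"
  have oA: "open ?A" and oB: "open ?B"
    by (intro open_Collect_less open_Int open_ball continuous_intros cont)+
  interpret k2: finite_borel_measure \<kappa>2 by (rule kA)
  have "emeasure \<kappa>2 ?A > 0" by (rule support_pos[OF x oA]) (use c in simp)
  then have mA: "measure \<kappa>2 ?A > 0" by (simp add: k2.emeasure_eq_measure)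
  have mB: "emeasure (diff_measure \<sigma> \<kappa>2) ?B > 0"
    unfolding rest_def[symmetric] by (rule support_pos[OF y oB]) (use c in simp)
  have Bb: "?A \<in> sets borel" "?B \<in> sets borel" using oA oB by (blast intro: borel_open)+
  have sub: "?B \<inter> {..0} \<subseteq> {-(\<bar>y\<bar> + 1)..0}" by (auto simp: dist_real_def)
  have "emeasure \<sigma> ?B = emeasure \<sigma> (?B \<inter> {..0})"
    by (rule emeasure_eq_AE) (use AE_sigma Bb sets_sigma in \<open>auto elim: eventually_mono\<close>)
  also have "\<dots> \<le> emeasure \<sigma> {-(\<bar>y\<bar> + 1)..0}" by (rule emeasure_mono[OF sub]) (simp add: sets_sigma)
  also have "\<dots> < \<infinity>" by (rule sigma_finite_compact)
  finally have sB: "emeasure \<sigma> ?B < \<infinity>" .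
  obtain \<nu> \<alpha> \<beta> m where tr: "m > 0" "finite_borel_measure \<nu>" "finite_borel_measure \<alpha>" "finite_borel_measure \<beta>"
    "measure \<nu> UNIV = measure \<kappa>2 UNIV" "measure \<alpha> UNIV = 1" "measure \<beta> UNIV = 1"
    "AE x in \<alpha>. x \<in> ?A" "AE x in \<beta>. x \<in> ?B"
    "\<And>S. S \<in> sets borel \<Longrightarrow> emeasure \<nu> S \<le> emeasure \<sigma> S"
    "\<And>S. S \<in> sets borel \<Longrightarrow> measure \<alpha> S \<le> 1 / measure \<kappa>2 ?A * measure \<kappa>2 S"
    "\<And>S. S \<in> sets borel \<Longrightarrow> emeasure \<beta> S \<le> ennreal (1 / measure (diff_measure \<sigma> \<kappa>2) ?B) * emeasure (measure_restrict \<sigma> ?B) S"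
    "mix 1 \<nu> m \<alpha> = mix 1 \<kappa>2 m \<beta>"
    by (rule transfer_mass[OF sets_sigma kA(2) kA(7) Bb(1) mA Bb(2) sB mB]) (assumption | simp)+
  interpret al: finite_borel_measure \<alpha> by (rule tr)
  interpret be: finite_borel_measure \<beta> by (rule tr)
  interpret nu: finite_borel_measure \<nu> by (rule tr)
  have na: "fin_energy \<alpha>" by (rule fin_energy_mono[OF tr(3) kD(3) _ tr(11)]) simp
  have kb: "kato \<beta>"
  proof (rule kato_mono[OF kato_sigma sets_sigma be.M_is_borel])
    fix S :: "real set" assume S: "S \<in> sets borel"
    have "emeasure (measure_restrict \<sigma> ?B) S \<le> emeasure \<sigma> S"
      using S Bb by (auto simp: emeasure_measure_restrict[OF sets_sigma] sets_sigma intro!: emeasure_mono)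
    then show "emeasure \<beta> S \<le> ennreal (1 / measure (diff_measure \<sigma> \<kappa>2) ?B) * emeasure \<sigma> S"
      using order_trans[OF tr(12)[OF S] mult_left_mono[of "emeasure (measure_restrict \<sigma> ?B) S" "emeasure \<sigma> S"]] by simp
  qed simp
  have nb: "fin_energy \<beta>"
  proof (rule fin_energy_of_kato_bounded[OF kb tr(4)])
    show "AE t in \<beta>. \<bar>t\<bar> \<le> \<bar>y\<bar> + 1" using tr(9) by eventually_elim (auto simp: dist_real_def)
  qed
  have nm: "fin_energy (mix 1 \<kappa>2 m \<beta>)" using kD(3) nb tr(1) by (intro fin_energy_mix) auto
  have nn: "fin_energy \<nu>"
  proof (rule fin_energy_mono[OF tr(2) nm, of 1])
    fix S :: "real set" assume S: "S \<in> sets borel"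
    have "measure (mix 1 \<kappa>2 m \<beta>) S = measure \<nu> S + m * measure \<alpha> S"
      unfolding tr(13)[symmetric] using S tr by (subst measure_mix) auto
    then show "measure \<nu> S \<le> 1 * measure (mix 1 \<kappa>2 m \<beta>) S" using tr(1) by simp
  qed simp
  have adm: "adm \<kappa>1 \<nu>"
    unfolding adm_def using kA tr(2,5,10) AE_nonpos_of_le_sigma[OF nu.M_is_borel tr(10)] by auto
  then have f: "feas \<kappa>1 \<nu>" using nn kD by (simp add: feas_def)
  have iW: "integrable \<mu> W2r" and eW: "(\<integral>z. W2r z \<partial>\<mu>) = 2 * energy \<mu> \<kappa>2 - energy \<mu> \<kappa>1" if "fin_energy \<mu>" for \<mu>
    unfolding W2r_def using energy_eq_integral_pot(1,2)[OF that kD(2)] energy_eq_integral_pot(1,2)[OF that kD(3)] by auto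
  have "0 \<le> (\<integral>z. W2r z \<partial>\<nu>) - (\<integral>z. W2r z \<partial>\<kappa>2)"
    using slope_nonneg[OF f] unfolding slope_def eW[OF nn] eW[OF kD(3)] by simp
  moreover have "(\<integral>z. W2r z \<partial>\<nu>) + m * (\<integral>z. W2r z \<partial>\<alpha>) = (\<integral>z. W2r z \<partial>\<kappa>2) + m * (\<integral>z. W2r z \<partial>\<beta>)"
  proof -
    have "(\<integral>z. W2r z \<partial>mix 1 \<nu> m \<alpha>) = 1 * (\<integral>z. W2r z \<partial>\<nu>) + m * (\<integral>z. W2r z \<partial>\<alpha>)"
      by (rule integral_mix(2)) (use tr(1) nu.M_is_borel al.M_is_borel iW nn na in auto)
    moreover have "(\<integral>z. W2r z \<partial>mix 1 \<kappa>2 m \<beta>) = 1 * (\<integral>z. W2r z \<partial>\<kappa>2) + m * (\<integral>z. W2r z \<partial>\<beta>)"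
      by (rule integral_mix(2)) (use tr(1) k2.M_is_borel be.M_is_borel iW kD(3) nb in auto)
    ultimately show ?thesis using tr(13) by simp
  qed
  ultimately have "m * (\<integral>z. W2r z \<partial>\<alpha>) \<le> m * (\<integral>z. W2r z \<partial>\<beta>)" by linarith
  then have le: "(\<integral>z. W2r z \<partial>\<alpha>) \<le> (\<integral>z. W2r z \<partial>\<beta>)" using tr(1) by simp
  have "(\<integral>z. c1 \<partial>\<alpha>) \<le> (\<integral>z. W2r z \<partial>\<alpha>)"
    by (rule integral_mono_AE[OF _ iW[OF na]], simp, use tr(8) in eventually_elim) auto
  moreover have "(\<integral>z. W2r z \<partial>\<beta>) \<le> (\<integral>z. c2 \<partial>\<beta>)"
    by (rule integral_mono_AE[OF iW[OF nb]], simp, use tr(9) in eventually_elim) auto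
  ultimately show False using le c tr(6,7) by (simp add: al.borel_UNIV be.borel_UNIV)
qed

end

section \<open>Convexity along geometric means\<close>

text \<open>Once \<open>x\<close>, \<open>y\<close>, \<open>z\<close> lie on a fixed half line, the sign of \<open>t (x + y - 2 z)\<close> depends only on the half line
  that contains \<open>t\<close>.  For \<open>t\<close> outside the interval between \<open>x\<close> and \<open>y\<close>, it decides whether \<open>ln \<bar>z - t\<bar>\<close> is
  above or below the mean of \<open>ln \<bar>x - t\<bar>\<close> and \<open>ln \<bar>y - t\<bar>\<close>.\<close>
lemma geo_mean_identity:
  fixes x y z t :: real
  assumes "x * y = z\<^sup>2"
  shows "(z - t)\<^sup>2 = (x - t) * (y - t) + t * (x + y - 2 * z)"
  using assms by (simp add: power2_eq_square algebra_simps)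

lemma ln_geo_le:
  fixes x y z t :: real
  assumes z: "x * y = z\<^sup>2" and p: "0 < (x - t) * (y - t)" and s: "0 \<le> t * (x + y - 2 * z)"
  shows "ln \<bar>x - t\<bar> + ln \<bar>y - t\<bar> \<le> 2 * ln \<bar>z - t\<bar>"
proof -
  have n: "x \<noteq> t" "y \<noteq> t" using p by auto
  have le: "\<bar>x - t\<bar> * \<bar>y - t\<bar> \<le> \<bar>z - t\<bar>\<^sup>2"
    using geo_mean_identity[OF z, of t] p s by (simp add: abs_mult[symmetric])
  have pos: "0 < \<bar>x - t\<bar> * \<bar>y - t\<bar>" using n by simp
  have nz: "z \<noteq> t" using le pos by auto
  have "ln \<bar>x - t\<bar> + ln \<bar>y - t\<bar> = ln (\<bar>x - t\<bar> * \<bar>y - t\<bar>)" using n by (simp add: ln_mult_pos)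
  also have "\<dots> \<le> ln (\<bar>z - t\<bar>\<^sup>2)" using le pos by (intro ln_mono) auto
  also have "\<dots> = 2 * ln \<bar>z - t\<bar>" using nz by (subst ln_realpow) auto
  finally show ?thesis .
qed

lemma ln_geo_less:
  fixes x y z t :: real
  assumes z: "x * y = z\<^sup>2" and n: "z \<noteq> t" and s: "t * (x + y - 2 * z) < 0"
  shows "2 * ln \<bar>z - t\<bar> < ln \<bar>x - t\<bar> + ln \<bar>y - t\<bar>"
proof -
  have "0 < (z - t)\<^sup>2" using n by simp
  then have p: "0 < (x - t) * (y - t)" "(z - t)\<^sup>2 < (x - t) * (y - t)"
    using geo_mean_identity[OF z, of t] s by linarith+
  have lt: "\<bar>z - t\<bar>\<^sup>2 < \<bar>x - t\<bar> * \<bar>y - t\<bar>"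
    using p by (simp add: abs_mult[symmetric])
  have xy: "x \<noteq> t" "y \<noteq> t" using p(1) by auto
  have "2 * ln \<bar>z - t\<bar> = ln (\<bar>z - t\<bar>\<^sup>2)" using n by (subst ln_realpow) auto
  also have "\<dots> < ln (\<bar>x - t\<bar> * \<bar>y - t\<bar>)" using lt n xy by (subst ln_less_cancel_iff) auto
  also have "\<dots> = ln \<bar>x - t\<bar> + ln \<bar>y - t\<bar>" using xy by (simp add: ln_mult_pos)
  finally show ?thesis .
qed

lemma pot_geo_le:
  assumes z: "x * y = z\<^sup>2"
    and i: "\<And>x. integrable \<mu> (\<lambda>t. - ln \<bar>x - t\<bar>)"
    and ae: "AE t in \<mu>. 0 < (x - t) * (y - t) \<and> 0 \<le> t * (x + y - 2 * z)"
  shows "2 * pot \<mu> z \<le> pot \<mu> x + pot \<mu> y"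
proof -
  have "(\<integral>t. 2 * - ln \<bar>z - t\<bar> \<partial>\<mu>) \<le> (\<integral>t. - ln \<bar>x - t\<bar> + - ln \<bar>y - t\<bar> \<partial>\<mu>)"
  proof (rule integral_mono_AE)
    show "AE t in \<mu>. 2 * - ln \<bar>z - t\<bar> \<le> - ln \<bar>x - t\<bar> + - ln \<bar>y - t\<bar>"
      using ae
    proof eventually_elim
      case (elim t)
      then show ?case using ln_geo_le[OF z, of t] by simp
    qed
  qed (intro integrable_mult_right Bochner_Integration.integrable_add i)+
  then show ?thesis
    unfolding pot_def Bochner_Integration.integral_add[OF i i] integral_mult_right_zero .
qed

lemma pot_geo_less:
  assumes z: "x * y = z\<^sup>2" and fin: "finite_measure \<mu>" and pos: "emeasure \<mu> (space \<mu>) \<noteq> 0"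
    and i: "\<And>x. integrable \<mu> (\<lambda>t. - ln \<bar>x - t\<bar>)"
    and ae: "AE t in \<mu>. z \<noteq> t \<and> t * (x + y - 2 * z) < 0"
  shows "pot \<mu> x + pot \<mu> y < 2 * pot \<mu> z"
proof -
  have "(\<integral>t. - ln \<bar>x - t\<bar> + - ln \<bar>y - t\<bar> \<partial>\<mu>) < (\<integral>t. 2 * - ln \<bar>z - t\<bar> \<partial>\<mu>)"
  proof (rule finite_measure.integral_less_AE_space[OF fin _ _ _ pos])
    show "AE t in \<mu>. - ln \<bar>x - t\<bar> + - ln \<bar>y - t\<bar> < 2 * - ln \<bar>z - t\<bar>"
      using ae
    proof eventually_elim
      case (elim t)
      then show ?case using ln_geo_less[OF z, of t] by simp
    qed
  qed (intro integrable_mult_right Bochner_Integration.integrable_add i)+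
  then show ?thesis
    unfolding pot_def Bochner_Integration.integral_add[OF i i] integral_mult_right_zero .
qed

text \<open>The supremum of \<open>D\<close> would be at most half of itself, although it is positive.\<close>
lemma no_doubling_orbit:
  fixes D :: "'a \<Rightarrow> real"
  assumes ne: "X \<noteq> {}" and D: "\<And>c. c \<in> X \<Longrightarrow> 0 \<le> D c" "\<And>c. c \<in> X \<Longrightarrow> D c \<le> B"
    and step: "\<And>c. c \<in> X \<Longrightarrow> \<exists>c'\<in>X. D c < D c' / 2"
  shows False
proof -
  have bdd: "bdd_above (D ` X)" by (rule bdd_aboveI2[OF D(2)])
  define S where "S = (SUP c\<in>X. D c)"
  have up: "D c \<le> S" if "c \<in> X" for c unfolding S_def by (rule cSUP_upper[OF that bdd])
  have "S \<le> S / 2"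
    unfolding S_def
  proof (rule cSUP_least[OF ne])
    fix c assume "c \<in> X"
    then obtain c' where "c' \<in> X" "D c < D c' / 2" using step by blast
    then show "D c \<le> (SUP c\<in>X. D c) / 2" using up[OF \<open>c' \<in> X\<close>] unfolding S_def by linarith
  qed
  obtain c where c: "c \<in> X" using ne by blast
  then obtain c' where c': "c' \<in> X" "D c < D c' / 2" using step by blast
  show False using D(1)[OF c] c'(2) up[OF c'(1)] \<open>S \<le> S / 2\<close> by linarith
qed

lemma closed_gap:
  fixes S :: "real set"
  assumes S: "closed S" and x: "x \<notin> S" and l: "l \<in> S" "l < x" and r: "r \<in> S" "x < r"
  obtains a b where "a \<in> S" "b \<in> S" "a < x" "x < b" "\<And>t. t \<in> S \<Longrightarrow> t \<le> a \<or> b \<le> t"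
proof -
  define L where "L = S \<inter> {..x}"
  define U where "U = S \<inter> {x..}"
  have cl: "closed L" "closed U" using S by (auto simp: L_def U_def)
  have ne: "L \<noteq> {}" "U \<noteq> {}" using l r by (auto simp: L_def U_def)
  have bd: "bdd_above L" "bdd_below U" by (auto simp: L_def U_def intro: bdd_aboveI[of _ x] bdd_belowI[of _ x])
  have a: "Sup L \<in> L" using closed_contains_Sup[OF ne(1) bd(1) cl(1)] .
  have b: "Inf U \<in> U" using closed_contains_Inf[OF ne(2) bd(2) cl(2)] .
  show thesis
  proof (rule that[of "Sup L" "Inf U"])
    show "Sup L \<in> S" "Inf U \<in> S" using a b by (auto simp: L_def U_def)
    then have "Sup L \<noteq> x" "Inf U \<noteq> x" using x by auto
    then show "Sup L < x" "x < Inf U" using a b by (auto simp: L_def U_def)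
    fix t assume "t \<in> S"
    then have "t \<in> L \<or> t \<in> U" by (auto simp: L_def U_def)
    then show "t \<le> Sup L \<or> Inf U \<le> t" using cSup_upper[OF _ bd(1)] cInf_lower[OF _ bd(2)] by blast
  qed
qed

context equilibrium
begin

section \<open>The support of the constrained component\<close>

lemma AE_ne: "AE t in \<kappa>1. t \<noteq> x" "AE t in \<kappa>2. t \<noteq> x"
  by (rule pot1(2) pot2(2))+

lemma mass_ne_0: "emeasure \<kappa>1 (space \<kappa>1) \<noteq> 0" "emeasure \<kappa>2 (space \<kappa>2) \<noteq> 0"
proof -
  interpret k1: finite_borel_measure \<kappa>1 by (rule kA)
  interpret k2: finite_borel_measure \<kappa>2 by (rule kA)
  show "emeasure \<kappa>1 (space \<kappa>1) \<noteq> 0" "emeasure \<kappa>2 (space \<kappa>2) \<noteq> 0"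
    using kA(3,4) by (auto simp: k1.borel_UNIV k2.borel_UNIV k1.emeasure_eq_measure k2.emeasure_eq_measure)
qed

lemma support_nonempty: "measure_support \<kappa>1 \<noteq> {}" "measure_support \<kappa>2 \<noteq> {}"
proof -
  interpret k1: finite_borel_measure \<kappa>1 by (rule kA)
  interpret k2: finite_borel_measure \<kappa>2 by (rule kA)
  show "measure_support \<kappa>1 \<noteq> {}" using emeasure_compl_support[OF kA(9)] mass_ne_0 by (auto simp: k1.borel_UNIV)
  show "measure_support \<kappa>2 \<noteq> {}" using emeasure_compl_support[OF kA(10)] mass_ne_0 by (auto simp: k2.borel_UNIV)
qed

text \<open>On the left half line \<open>U\<^sup>\<kappa>\<^sup>2\<close> is convex along geometric means in a gap of \<open>\<kappa>2\<close>, and \<open>U\<^sup>\<kappa>\<^sup>1\<close> is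
  strictly concave.\<close>
lemma W2r_geo:
  assumes xy: "x < 0" "y < 0" "x \<noteq> y" and z: "z < 0" "x * y = z\<^sup>2"
    and gap: "\<And>t. t \<in> measure_support \<kappa>2 \<Longrightarrow> t \<noteq> x \<Longrightarrow> t \<noteq> y \<Longrightarrow> 0 < (x - t) * (y - t)"
  shows "W2r z < (W2r x + W2r y) / 2"
proof -
  have neg: "x + y - 2 * z < 0"
  proof (rule ccontr)
    assume "\<not> x + y - 2 * z < 0"
    then have "(- (x + y))\<^sup>2 \<le> (- (2 * z))\<^sup>2" using xy by (intro power_mono) auto
    also have "\<dots> = 4 * (x * y)" unfolding z(2) by (simp add: power2_eq_square)
    finally have "(x - y)\<^sup>2 \<le> 0" by (simp add: power2_eq_square algebra_simps)
    then show False using xy(3) by simp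
  qed
  have "2 * pot \<kappa>2 z \<le> pot \<kappa>2 x + pot \<kappa>2 y"
  proof (rule pot_geo_le[OF z(2) pot2(1)])
    show "AE t in \<kappa>2. 0 < (x - t) * (y - t) \<and> 0 \<le> t * (x + y - 2 * z)"
      using AE_support[OF kA(10)] AE_ne(2)[of x] AE_ne(2)[of y] kA(6)
      by eventually_elim (use gap neg in \<open>auto intro: mult_nonpos_nonpos\<close>)
  qed
  moreover have "pot \<kappa>1 x + pot \<kappa>1 y < 2 * pot \<kappa>1 z"
  proof (rule pot_geo_less[OF z(2) finite_borel_measureD(3)[OF kA(1)] mass_ne_0(1) pot1(1)])
    show "AE t in \<kappa>1. z \<noteq> t \<and> t * (x + y - 2 * z) < 0"
      using kA(5) AE_ne(1)[of 0]
      by eventually_elim (use neg z(1) in \<open>auto intro: mult_pos_neg\<close>)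
  qed
  ultimately show ?thesis unfolding W2r_def by argo
qed

text \<open>The support of \<open>\<sigma>\<close> is the whole half line, so \<open>\<sigma>\<close> charges every neighbourhood of \<open>p\<close>, and \<open>\<kappa>2\<close> takes
  nothing of it.\<close>
lemma gap_in_rest:
  assumes p: "p \<le> 0" "p \<notin> measure_support \<kappa>2"
  shows "p \<in> measure_support rest"
  unfolding measure_support_def
proof (intro CollectI allI impI)
  fix O' :: "real set" assume O: "open O'" "p \<in> O'"
  let ?V = "O' \<inter> - measure_support \<kappa>2"
  have V: "open ?V" "p \<in> ?V" using O p closed_measure_support[of \<kappa>2] by auto
  have b: "?V \<in> sets borel" "O' \<in> sets borel" using V(1) O(1) by (blast intro: borel_open)+
  have "emeasure \<sigma> ?V > 0" by (rule support_pos[OF _ V]) (use p supp_sigma in auto)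
  moreover have "emeasure \<kappa>2 ?V = 0"
    using emeasure_mono[of ?V "- measure_support \<kappa>2" \<kappa>2] emeasure_compl_support[OF kA(10)] closed_measure_support[of \<kappa>2]
    by (auto simp: kA(10))
  ultimately have "emeasure rest ?V > 0" using emeasure_rest[OF b(1)] by simp
  also have "emeasure rest ?V \<le> emeasure rest O'" using b by (intro emeasure_mono) (auto simp: sets_rest)
  finally show "emeasure rest O' > 0" .
qed

lemma W2r_gap_ge: "p \<le> 0 \<Longrightarrow> p \<notin> measure_support \<kappa>2 \<Longrightarrow> q \<in> measure_support \<kappa>2 \<Longrightarrow> W2r q \<le> W2r p"
  using exchange gap_in_rest by blast

text \<open>A gap that reaches zero has only one end \<open>a\<close> at which convexity can be used.  With \<open>c\<close> as the geometric
  mean of \<open>a\<close> and \<open>c' = c\<^sup>2 / a\<close>, convexity makes the excess of \<open>W2\<close> over its value at \<open>a\<close> more than twice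
  as large at \<open>c'\<close> as at \<open>c\<close>, although \<open>W2\<close> is bounded near the origin.\<close>
lemma no_gap_at_origin:
  assumes a: "a \<in> measure_support \<kappa>2" "a < 0" and gap: "\<And>t. t \<in> measure_support \<kappa>2 \<Longrightarrow> t \<le> a \<or> 0 \<le> t"
  shows False
proof -
  have "compact (W2r ` {a..0})" by (intro compact_continuous_image W2r_cont) auto
  then obtain B where B: "\<And>x. a \<le> x \<Longrightarrow> x \<le> 0 \<Longrightarrow> \<bar>W2r x\<bar> \<le> B"
    unfolding compact_eq_bounded_closed bounded_iff by (metis atLeastAtMost_iff imageI real_norm_def)
  show False
  proof (rule no_doubling_orbit[of "{a<..<0}" "\<lambda>p. W2r p - W2r a" "B - W2r a"])
    show "{a<..<0} \<noteq> {}" using a by simp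
    fix c assume c: "c \<in> {a<..<0}"
    show "0 \<le> W2r c - W2r a" using W2r_gap_ge[of c a] c a gap[of c] by force
    show "W2r c - W2r a \<le> B - W2r a" using B[of c] c by auto
    define c' where "c' = c\<^sup>2 / a"
    have "c\<^sup>2 < a * c" using c by (simp add: power2_eq_square)
    then have c1: "c < c'" using a(2) by (simp add: c'_def field_simps)
    have c2: "c' < 0" using c a(2) by (simp add: c'_def divide_pos_neg)
    have "W2r c < (W2r a + W2r c') / 2"
    proof (rule W2r_geo)
      show "a * c' = c\<^sup>2" using a(2) by (simp add: c'_def)
      fix t assume t: "t \<in> measure_support \<kappa>2" "t \<noteq> a" "t \<noteq> c'"
      consider "t < a" | "t = 0" using gap[OF t(1)] t(2) support_k2_subset t(1) by force
      then show "0 < (a - t) * (c' - t)"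
      proof cases
        case 1 then show ?thesis using c c1 by (intro mult_pos_pos) auto
      next
        case 2 then show ?thesis using a(2) c2 by (simp add: mult_neg_neg)
      qed
    qed (use a(2) c c1 c2 in auto)
    then show "\<exists>c'\<in>{a<..<0}. W2r c - W2r a < (W2r c' - W2r a) / 2"
      using c c1 c2 by (intro bexI[of _ c']) auto
  qed
qed

text \<open>The doubling argument again, now with points that tend to \<open>-\<infinity>\<close>.  There \<open>W2\<close> is bounded above, because
  \<open>2 \<kappa>2\<close> and \<open>\<kappa>1\<close> have equal mass and the logarithmic terms cancel.\<close>
lemma no_gap_at_infinity:
  assumes b: "b \<in> measure_support \<kappa>2" "b < 0" and gap: "\<And>t. t \<in> measure_support \<kappa>2 \<Longrightarrow> b \<le> t"
  shows False
proof -
  interpret k1: finite_borel_measure \<kappa>1 by (rule kA)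
  interpret k2: finite_borel_measure \<kappa>2 by (rule kA)
  (* to the left of p1 the distance to all of \<kappa>2 is at least half the modulus *)
  define p1 where "p1 = min (2 * b) (-1)"
  have "compact (W2r ` {p1..b})" by (intro compact_continuous_image W2r_cont) auto
  then obtain B where B: "\<And>x. p1 \<le> x \<Longrightarrow> x \<le> b \<Longrightarrow> \<bar>W2r x\<bar> \<le> B"
    unfolding compact_eq_bounded_closed bounded_iff by (metis atLeastAtMost_iff imageI real_norm_def)
  define L where "L = (\<integral>t. ln (1 + \<bar>t\<bar>) \<partial>\<kappa>1)"
  have il: "integrable \<kappa>1 (\<lambda>t. ln (1 + \<bar>t\<bar>))" using log_moment_k(1) by (simp add: log_moment_def)
  have far: "W2r p \<le> 2 * ln 2 + L" if p: "p \<le> p1" for p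
  proof -
    have p': "p \<le> 2 * b" "p \<le> -1" using p by (auto simp: p1_def)
    have "pot \<kappa>2 p \<le> (\<integral>t. - ln (- p / 2) \<partial>\<kappa>2)"
      unfolding pot_def
    proof (rule integral_mono_AE[OF pot2(1)])
      show "AE t in \<kappa>2. - ln \<bar>p - t\<bar> \<le> - ln (- p / 2)"
        using AE_support[OF kA(10)]
      proof eventually_elim
        case (elim t)
        then have "- p / 2 \<le> \<bar>p - t\<bar>" using gap[of t] p' by auto
        then show ?case using p' by (simp add: ln_mono)
      qed
    qed simp
    moreover have "ln (- p / 2) = ln (- p) - ln 2" using p' by (intro ln_divide_pos) auto
    ultimately have 1: "pot \<kappa>2 p \<le> - ln (- p) + ln 2" using kA(4) by (simp add: k2.borel_UNIV)
    have "(\<integral>t. - ln (- p) - ln (1 + \<bar>t\<bar>) \<partial>\<kappa>1) \<le> pot \<kappa>1 p"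
      unfolding pot_def
    proof (rule integral_mono_AE[OF _ pot1(1)])
      show "integrable \<kappa>1 (\<lambda>t. - ln (- p) - ln (1 + \<bar>t\<bar>))" using il by simp
      show "AE t in \<kappa>1. - ln (- p) - ln (1 + \<bar>t\<bar>) \<le> - ln \<bar>p - t\<bar>"
        using kA(5)
      proof eventually_elim
        case (elim t)
        have "\<bar>p - t\<bar> \<le> (- p) * (1 + \<bar>t\<bar>)"
        proof -
          have "1 * t \<le> (- p) * t" using p' elim by (intro mult_right_mono) auto
          then show ?thesis using p' elim by (simp add: algebra_simps)
        qed
        then have "ln \<bar>p - t\<bar> \<le> ln ((- p) * (1 + \<bar>t\<bar>))" using p' elim by (intro ln_mono) auto
        also have "\<dots> = ln (- p) + ln (1 + \<bar>t\<bar>)" using p' by (intro ln_mult_pos) auto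
        finally show ?case by linarith
      qed
    qed
    then have 2: "- 2 * ln (- p) - L \<le> pot \<kappa>1 p" using il kA(3) by (simp add: k1.borel_UNIV L_def)
    show ?thesis using 1 2 unfolding W2r_def by linarith
  qed
  show False
  proof (rule no_doubling_orbit[of "{..<b}" "\<lambda>p. W2r p - W2r b" "max B (2 * ln 2 + L) - W2r b"])
    show "{..<b} \<noteq> {}" by simp
    fix c assume c: "c \<in> {..<b}"
    show "0 \<le> W2r c - W2r b" using W2r_gap_ge[of c b] c b gap[of c] by force
    show "W2r c - W2r b \<le> max B (2 * ln 2 + L) - W2r b"
    proof (cases "c \<le> p1")
      case True then show ?thesis using far[OF True] by simp
    next
      case False then show ?thesis using B[of c] c by auto
    qed
    define c' where "c' = c\<^sup>2 / b"
    have "c\<^sup>2 > b * c" using c b(2) by (simp add: power2_eq_square)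
    then have c1: "c' < c" using b(2) by (simp add: c'_def field_simps)
    have "W2r c < (W2r b + W2r c') / 2"
    proof (rule W2r_geo)
      show "b * c' = c\<^sup>2" using b(2) by (simp add: c'_def)
      fix t assume t: "t \<in> measure_support \<kappa>2" "t \<noteq> b" "t \<noteq> c'"
      have "b < t" using gap[OF t(1)] t(2) by simp
      then show "0 < (b - t) * (c' - t)" using c c1 by (intro mult_neg_neg) auto
    qed (use b(2) c c1 in auto)
    then show "\<exists>c'\<in>{..<b}. W2r c - W2r b < (W2r c' - W2r b) / 2"
      using c c1 by (intro bexI[of _ c']) auto
  qed
qed

lemma geo_mean_between:
  fixes a b :: real
  assumes "0 < a" "a < b" shows "a < sqrt (a * b)" "sqrt (a * b) < b"
proof -
  have "sqrt (a * a) < sqrt (a * b)" "sqrt (a * b) < sqrt (b * b)"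
    using assms by (auto simp only: real_sqrt_less_iff intro!: mult_strict_left_mono mult_strict_right_mono)
  moreover have "sqrt (a * a) = a" "sqrt (b * b) = b" using assms by (simp_all add: real_sqrt_mult_self)
  ultimately show "a < sqrt (a * b)" "sqrt (a * b) < b" by simp_all
qed

text \<open>A bounded gap \<open>(a, b)\<close> contradicts convexity at the geometric mean of its ends, where \<open>W2\<close> would be less
  than the mean of two values that it is not allowed to fall below.  The remaining gaps reach zero or
  infinity.\<close>
lemma support_k2: "measure_support \<kappa>2 = {..0}"
proof (rule ccontr)
  let ?S = "measure_support \<kappa>2"
  assume "?S \<noteq> {..0}"
  then obtain p where p: "p \<le> 0" "p \<notin> ?S" using support_k2_subset by auto
  have op: "open (- ?S)" using closed_measure_support by auto
  obtain e where e: "e > 0" "ball p e \<subseteq> - ?S" using openE[OF op] p by blast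
  (* a point of the gap that is strictly negative even if p = 0 *)
  define x0 where "x0 = p - e / 2"
  have "x0 \<in> ball p e" using e(1) by (simp add: x0_def dist_real_def)
  then have "x0 \<notin> ?S" using e(2) by blast
  moreover have "x0 < 0" using e(1) p(1) by (simp add: x0_def)
  ultimately have x0: "x0 < 0" "x0 \<notin> ?S" by auto
  have cl: "closed ?S" by (rule closed_measure_support)
  show False
  proof (cases "\<exists>l\<in>?S. l < x0")
    case True
    then obtain l where l: "l \<in> ?S" "l < x0" by blast
    show False
    proof (cases "\<exists>r\<in>?S. x0 < r")
      case True
      then obtain r where r: "r \<in> ?S" "x0 < r" by blast
      obtain a b where ab: "a \<in> ?S" "b \<in> ?S" "a < x0" "x0 < b" "\<And>t. t \<in> ?S \<Longrightarrow> t \<le> a \<or> b \<le> t"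
        using closed_gap[OF cl x0(2) l r] by blast
      have b0: "b \<le> 0" using ab(2) support_k2_subset by auto
      show False
      proof (cases "b = 0")
        case True
        then show False using no_gap_at_origin[OF ab(1)] ab(3,5) x0 by auto
      next
        case False
        then have bn: "b < 0" using b0 by simp
        define z where "z = - sqrt ((- b) * (- a))"
        have z: "a < z" "z < b" using geo_mean_between[of "- b" "- a"] bn ab(3,4) by (auto simp: z_def)
        have "0 \<le> a * b" using ab(3,4) bn by (intro mult_nonpos_nonpos) auto
        then have zz: "a * b = z\<^sup>2" by (simp add: z_def mult.commute)
        have zS: "z \<notin> ?S" using ab(5)[of z] z by auto
        have "W2r z < (W2r a + W2r b) / 2"
        proof (rule W2r_geo)
          fix t assume t: "t \<in> ?S" "t \<noteq> a" "t \<noteq> b"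
          consider "t < a" | "b < t" using ab(5)[OF t(1)] t by force
          then show "0 < (a - t) * (b - t)"
          proof cases
            case 1 then show ?thesis using z by (intro mult_pos_pos) auto
          next
            case 2 then show ?thesis using z by (intro mult_neg_neg) auto
          qed
        qed (use z bn zz in auto)
        moreover have "W2r a \<le> W2r z" "W2r b \<le> W2r z" using W2r_gap_ge[OF _ zS] ab z bn by auto
        ultimately show False by argo
      qed
    next
      case False
      define a where "a = Sup ?S"
      have bd: "bdd_above ?S" using support_k2_subset by (auto intro: bdd_aboveI[of _ 0])
      have a: "a \<in> ?S" unfolding a_def using closed_contains_Sup[OF support_nonempty(2) bd cl] .
      then have "a < x0" using False x0(2) by (metis linorder_neqE_linordered_idom)
      then show False using no_gap_at_origin[OF a] x0 cSup_upper[OF _ bd] unfolding a_def by force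
    qed
  next
    case False
    define b where "b = Inf ?S"
    have bd: "bdd_below ?S" using False by (auto intro!: bdd_belowI[of _ x0] simp: not_less)
    have b: "b \<in> ?S" unfolding b_def using closed_contains_Inf[OF support_nonempty(2) bd cl] .
    have low: "\<And>t. t \<in> ?S \<Longrightarrow> b \<le> t" unfolding b_def by (rule cInf_lower[OF _ bd])
    have "b \<noteq> 0"
    proof
      assume "b = 0"
      have "AE t in \<kappa>2. False" using AE_support[OF kA(10)] AE_ne(2)[of 0]
      proof eventually_elim
        case (elim t)
        then show ?case using low[OF elim(1)] support_k2_subset \<open>b = 0\<close> by auto
      qed
      then show False using mass_ne_0(2) AE_iff_measurable[of "space \<kappa>2" \<kappa>2 "\<lambda>_. False"] by auto
    qed
    then have "b < 0" using b support_k2_subset by force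
    then show False using no_gap_at_infinity[OF b] low by blast
  qed
qed

section \<open>The equilibrium conditions\<close>

lemma support_rest_subset: "measure_support rest \<subseteq> {..0}"
proof -
  have "emeasure rest S \<le> emeasure \<sigma> S" if "S \<in> sets borel" for S
    using emeasure_rest[OF that] by (simp add: diff_le_self_ennreal)
  then show ?thesis using support_subset_iff[OF sets_rest, of "{..0}"] AE_nonpos_of_le_sigma[OF sets_rest] by simp
qed

lemma support_rest_nonempty: "measure_support rest \<noteq> {}"
proof
  assume "measure_support rest = {}"
  then have "emeasure rest UNIV = 0" using emeasure_compl_support[OF sets_rest] by simp
  moreover have "emeasure \<kappa>2 UNIV = 1"
    using kA(4) finite_measure.emeasure_eq_measure[OF finite_borel_measureD(3)[OF kA(2)]] by simp
  then have "emeasure rest UNIV > 0" using mass_sigma by (simp add: emeasure_rest diff_gt_0_iff_gt_ennreal)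
  ultimately show False by simp
qed

text \<open>By \<open>exchange\<close> the choice of the point is immaterial once the support of \<open>\<kappa>2\<close> is known to be the
  whole half line.\<close>
definition w2 :: real where "w2 = W2r (SOME y. y \<in> measure_support rest)"

lemma W2r_on_rest: "y \<in> measure_support rest \<Longrightarrow> W2r y = w2"
proof -
  assume y: "y \<in> measure_support rest"
  have s: "(SOME y. y \<in> measure_support rest) \<in> measure_support rest" using support_rest_nonempty by (simp add: some_in_eq)
  show ?thesis unfolding w2_def
    by (rule antisym; rule exchange) (use y s support_rest_subset support_k2 in auto)
qed

lemma W2r_le: "x \<le> 0 \<Longrightarrow> W2r x \<le> w2"
  using exchange[of x] support_rest_nonempty W2r_on_rest support_k2 by force

lemma equilibrium_holds: "equilibrium_conditions \<sigma> \<phi> (\<kappa>1, \<kappa>2) w1 w2"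
  unfolding equilibrium_conditions_def
proof (intro conjI ballI)
  show "(\<kappa>1, \<kappa>2) \<in> admissible_star \<sigma>" using kD by (simp add: admissible_star_iff)
  show "measure_support (snd (\<kappa>1, \<kappa>2)) = {..0}" using support_k2 by simp
  fix x
  show "W1 \<phi> (\<kappa>1, \<kappa>2) x = ereal w1" if "x \<in> measure_support (fst (\<kappa>1, \<kappa>2))"
    using that W1r_eq_on_support[of x] support_k1_subset W1_eq[of x] by auto
  show "ereal w1 \<le> W1 \<phi> (\<kappa>1, \<kappa>2) x" if "x \<in> {0..}"
    using that W1r_lower[of x] W1_eq[of x] by simp
  show "W2 (\<kappa>1, \<kappa>2) x \<le> ereal w2" if "x \<in> measure_support (snd (\<kappa>1, \<kappa>2))"
    using that W2r_le[of x] support_k2 W2_eq[of x] by simp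
  show "W2 (\<kappa>1, \<kappa>2) x = ereal w2" if "x \<in> measure_support (diff_measure \<sigma> (snd (\<kappa>1, \<kappa>2)))"
    using that W2r_on_rest[of x] W2_eq[of x] by (simp add: rest_def)
qed

end

context constrained_problem
begin

text \<open>The first condition gives the part of the variational inequality that concerns \<open>\<nu>1\<close> by integration.
  For the second part, \<open>v2 - W2\<close> is nonnegative and vanishes on the support of \<open>\<sigma> - \<mu>2\<close>; off this
  support \<open>\<mu>2\<close> coincides with \<open>\<sigma>\<close>, so that no admissible \<open>\<nu>2\<close> can integrate \<open>v2 - W2\<close> to more than
  \<open>\<mu>2\<close> does.\<close>
lemma is_min_of_equilibrium:
  assumes eq: "equilibrium_conditions \<sigma> \<phi> (\<mu>1, \<mu>2) v1 v2"
  shows "is_min \<mu>1 \<mu>2"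
proof -
  have a: "adm \<mu>1 \<mu>2" "fin_energy \<mu>1" "fin_energy \<mu>2" using eq by (auto simp: equilibrium_conditions_def admissible_star_iff)
  note d = admD[OF a(1)]
  have e1: "\<And>x. x \<in> measure_support \<mu>1 \<Longrightarrow> W1 \<phi> (\<mu>1, \<mu>2) x = ereal v1"
    and e2: "\<And>x. 0 \<le> x \<Longrightarrow> ereal v1 \<le> W1 \<phi> (\<mu>1, \<mu>2) x"
    and e3: "\<And>x. x \<le> 0 \<Longrightarrow> W2 (\<mu>1, \<mu>2) x \<le> ereal v2"
    and e4: "\<And>x. x \<in> measure_support (diff_measure \<sigma> \<mu>2) \<Longrightarrow> W2 (\<mu>1, \<mu>2) x = ereal v2"
    using eq unfolding equilibrium_conditions_def by auto
  interpret m1: finite_borel_measure \<mu>1 by (rule d)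
  interpret m2: finite_borel_measure \<mu>2 by (rule d)
  note [measurable_cong] = m1.M_is_borel m2.M_is_borel
  define w where "w x = 2 * pot \<mu>1 x - pot \<mu>2 x" for x
  have iw: "integrable \<alpha> w" "(\<integral>x. w x \<partial>\<alpha>) = 2 * energy \<alpha> \<mu>1 - energy \<alpha> \<mu>2" if "fin_energy \<alpha>" for \<alpha>
    unfolding w_def using energy_eq_integral_pot(1,2)[OF that a(2)] energy_eq_integral_pot(1,2)[OF that a(3)] by auto
  have aeW: "AE x in \<alpha>. W1 \<phi> (\<mu>1, \<mu>2) x = ereal (w x + phi0 x)" if "fin_energy \<alpha>" "AE x in \<alpha>. 0 \<le> x" for \<alpha>
    using AE_log_potential[OF that(1) a(2)] AE_log_potential[OF that(1) a(3)] that(2)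
    by eventually_elim (simp add: w_def phi0_eq)
  have ae1: "AE x in \<mu>1. w x + phi0 x = v1"
    using aeW[OF a(2) d(5)] AE_support[OF d(9)] by eventually_elim (use e1 in \<open>auto simp del: W1.simps\<close>)
  have "integrable \<mu>1 (\<lambda>x. v1 - w x)" using iw(1)[OF a(2)] by simp
  then have ip: "integrable \<mu>1 phi0"
    by (rule integrable_cong_AE_imp) (use ae1 in \<open>measurable, eventually_elim, simp add: algebra_simps\<close>)
  have f: "feas \<mu>1 \<mu>2" using a ip by (simp add: feas_def)
  have "0 \<le> slope \<mu>1 \<mu>2 \<nu>1 \<nu>2" if n: "feas \<nu>1 \<nu>2" for \<nu>1 \<nu>2
  proof -
    note nd = feasD[OF n]
    note na = admD[OF nd(1)]
    interpret n1: finite_borel_measure \<nu>1 by (rule nd)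
    interpret n2: finite_borel_measure \<nu>2 by (rule nd)
    note [measurable_cong] = n2.M_is_borel
    have "(\<integral>x. w x + phi0 x \<partial>\<mu>1) = (\<integral>x. v1 \<partial>\<mu>1)"
      by (rule integral_cong_AE) (use ae1 borel_measurable_integrable[OF iw(1)[OF a(2)]] in auto)
    then have L1: "2 * energy \<mu>1 \<mu>1 - energy \<mu>1 \<mu>2 + (\<integral>x. phi0 x \<partial>\<mu>1) = 2 * v1"
      using iw[OF a(2)] ip d(3) by (simp add: m1.borel_UNIV)
    have "(\<integral>x. v1 \<partial>\<nu>1) \<le> (\<integral>x. w x + phi0 x \<partial>\<nu>1)"
    proof (rule integral_mono_AE)
      show "AE x in \<nu>1. v1 \<le> w x + phi0 x"
        using aeW[OF nd(2) na(5)] na(5)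
      proof eventually_elim
        case (elim x)
        then show ?case using e2[OF elim(2)] by (simp del: W1.simps)
      qed
    qed (use iw(1)[OF nd(2)] nd(4) in auto)
    then have R1: "2 * v1 \<le> 2 * energy \<nu>1 \<mu>1 - energy \<nu>1 \<mu>2 + (\<integral>x. phi0 x \<partial>\<nu>1)"
      using iw[OF nd(2)] nd(4) na(3) by (simp add: n1.borel_UNIV)
    (* v2 - W2, which is nonnegative and vanishes on the support of \<sigma> - \<mu>2 *)
    define g where "g x = v2 - (2 * pot \<mu>2 x - pot \<mu>1 x)" for x
    have ig: "integrable \<alpha> g" "(\<integral>x. g x \<partial>\<alpha>) = v2 * measure \<alpha> UNIV - (2 * energy \<alpha> \<mu>2 - energy \<alpha> \<mu>1)" if "fin_energy \<alpha>" for \<alpha>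
    proof -
      interpret finite_borel_measure \<alpha> using fin_energyD[OF that] by simp
      note i = energy_eq_integral_pot(1,2)[OF that a(2)] energy_eq_integral_pot(1,2)[OF that a(3)]
      show "integrable \<alpha> g" unfolding g_def using i by auto
      show "(\<integral>x. g x \<partial>\<alpha>) = v2 * measure \<alpha> UNIV - (2 * energy \<alpha> \<mu>2 - energy \<alpha> \<mu>1)"
        unfolding g_def using i by (simp add: borel_UNIV)
    qed
    have gm: "g \<in> borel_measurable borel"
      using borel_measurable_integrable[OF ig(1)[OF a(3)]] by (simp cong: measurable_cong_sets)
    note [measurable] = gm
    let ?T = "measure_support (diff_measure \<sigma> \<mu>2)"
    have T: "?T \<in> sets borel" using closed_measure_support[of "diff_measure \<sigma> \<mu>2"] by (rule borel_closed)
    then have Tc[measurable]: "- ?T \<in> sets borel" by auto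
    have g0: "AE x in \<alpha>. 0 \<le> g x \<and> (x \<in> ?T \<longrightarrow> g x = 0)" if "fin_energy \<alpha>" "AE x in \<alpha>. x \<le> 0" for \<alpha>
      using AE_log_potential[OF that(1) a(2)] AE_log_potential[OF that(1) a(3)] that(2)
    proof eventually_elim
      case (elim x)
      then have "W2 (\<mu>1, \<mu>2) x = ereal (2 * pot \<mu>2 x - pot \<mu>1 x)" by simp
      then show ?case using e3[OF elim(3)] e4[of x] by (auto simp: g_def simp del: W2.simps)
    qed
    let ?h = "\<lambda>x. ennreal (g x) * indicator (- ?T) x"
    have nn: "ennreal (\<integral>x. g x \<partial>\<alpha>) = (\<integral>\<^sup>+x. ?h x \<partial>\<alpha>)" if "fin_energy \<alpha>" "AE x in \<alpha>. x \<le> 0" for \<alpha>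
    proof -
      have "ennreal (\<integral>x. g x \<partial>\<alpha>) = (\<integral>\<^sup>+x. ennreal (g x) \<partial>\<alpha>)"
        by (rule nn_integral_eq_integral[symmetric, OF ig(1)[OF that(1)]]) (use g0[OF that] in \<open>auto elim: eventually_mono\<close>)
      also have "\<dots> = (\<integral>\<^sup>+x. ?h x \<partial>\<alpha>)"
        by (rule nn_integral_cong_AE, use g0[OF that] in eventually_elim) (auto split: split_indicator)
      finally show ?thesis .
    qed
    have rs: "(\<integral>\<^sup>+x. ?h x \<partial>\<alpha>) = (\<integral>\<^sup>+x. ennreal (g x) \<partial>measure_restrict \<alpha> (- ?T))" if "sets \<alpha> = sets borel" for \<alpha>
    proof -
      note [measurable_cong] = that
      show ?thesis unfolding measure_restrict_def
        by (subst nn_integral_density) (auto simp: mult.commute)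
    qed
    have "(\<integral>\<^sup>+x. ennreal (g x) \<partial>measure_restrict \<nu>2 (- ?T)) \<le> (\<integral>\<^sup>+x. ennreal (g x) \<partial>measure_restrict \<mu>2 (- ?T))"
    proof (rule nn_integral_le_of_le)
      fix S :: "real set" assume S: "S \<in> sets borel"
      have b: "- ?T \<inter> S \<in> sets borel" using S Tc by auto
      have "emeasure (diff_measure \<sigma> \<mu>2) (- ?T \<inter> S) \<le> emeasure (diff_measure \<sigma> \<mu>2) (- ?T)"
        using Tc by (intro emeasure_mono) (auto simp: sets_sigma)
      then have "emeasure (diff_measure \<sigma> \<mu>2) (- ?T \<inter> S) = 0"
        using emeasure_compl_support[of "diff_measure \<sigma> \<mu>2"] by (simp add: sets_sigma)
      then have z: "emeasure \<sigma> (- ?T \<inter> S) - emeasure \<mu>2 (- ?T \<inter> S) = 0"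
        using emeasure_diff_of_le[OF sets_sigma d(2) d(7) b] by simp
      have "emeasure \<nu>2 (- ?T \<inter> S) \<le> emeasure \<sigma> (- ?T \<inter> S)" by (rule na(7)[OF b])
      also have "\<dots> = (emeasure \<sigma> (- ?T \<inter> S) - emeasure \<mu>2 (- ?T \<inter> S)) + emeasure \<mu>2 (- ?T \<inter> S)"
        by (rule diff_add_cancel_ennreal[symmetric, OF d(7)[OF b]])
      also have "\<dots> = emeasure \<mu>2 (- ?T \<inter> S)" unfolding z by simp
      finally show "emeasure (measure_restrict \<nu>2 (- ?T)) S \<le> emeasure (measure_restrict \<mu>2 (- ?T)) S"
        using S Tc by (simp add: emeasure_measure_restrict m2.M_is_borel n2.M_is_borel)
    qed (simp_all add: sets_measure_restrict m2.M_is_borel n2.M_is_borel)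
    then have "ennreal (\<integral>x. g x \<partial>\<nu>2) \<le> ennreal (\<integral>x. g x \<partial>\<mu>2)"
      unfolding nn[OF nd(3) na(6)] nn[OF a(3) d(6)] rs[OF n2.M_is_borel] rs[OF m2.M_is_borel] .
    moreover have "0 \<le> (\<integral>x. g x \<partial>\<mu>2)"
      using g0[OF a(3) d(6)] by (intro integral_nonneg_AE) (auto elim: eventually_mono)
    ultimately have "(\<integral>x. g x \<partial>\<nu>2) \<le> (\<integral>x. g x \<partial>\<mu>2)" by (simp add: ennreal_le_iff)
    then have "2 * energy \<mu>2 \<mu>2 - energy \<mu>2 \<mu>1 \<le> 2 * energy \<nu>2 \<mu>2 - energy \<nu>2 \<mu>1"
      unfolding ig(2)[OF nd(3)] ig(2)[OF a(3)] using d(4) na(4) by simp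
    then show ?thesis using L1 R1 unfolding slope_def by linarith
  qed
  then show ?thesis using slope_nonneg_iff_min[OF f] f unfolding is_min_def by blast
qed

end

context equilibrium
begin

lemma equilibrium_iff:
  "equilibrium_conditions \<sigma> \<phi> (\<mu>1, \<mu>2) v1 v2 \<longleftrightarrow> \<mu>1 = \<kappa>1 \<and> \<mu>2 = \<kappa>2 \<and> v1 = w1 \<and> v2 = w2"
proof
  assume e: "equilibrium_conditions \<sigma> \<phi> (\<mu>1, \<mu>2) v1 v2"
  then have m: "\<mu>1 = \<kappa>1" "\<mu>2 = \<kappa>2" using is_min_unique[OF minimal is_min_of_equilibrium[OF e]] by auto
  obtain x y where x: "x \<in> measure_support \<kappa>1" and y: "y \<in> measure_support rest"
    using support_nonempty(1) support_rest_nonempty by blast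
  have "W1 \<phi> (\<kappa>1, \<kappa>2) x = ereal v1" "W1 \<phi> (\<kappa>1, \<kappa>2) x = ereal w1" "W2 (\<kappa>1, \<kappa>2) y = ereal v2" "W2 (\<kappa>1, \<kappa>2) y = ereal w2"
    using e equilibrium_holds x y unfolding m equilibrium_conditions_def rest_def by (auto simp del: W1.simps W2.simps)
  then show "\<mu>1 = \<kappa>1 \<and> \<mu>2 = \<kappa>2 \<and> v1 = w1 \<and> v2 = w2" using m by simp
qed (use equilibrium_holds in simp)

section \<open>Shape of the support of the first component\<close>

text \<open>Monotonicity of \<open>x \<phi>'(x)\<close> means that \<open>\<phi> \<circ> exp\<close> is convex.  In a gap of the support \<open>W1\<close> is then strictly
  convex along geometric means, and equal to its minimum at both ends.  If the left end of the gap is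
  zero, the doubling argument applies to points that tend to zero.\<close>
lemma connected_support_k1:
  assumes d: "\<And>x. 0 < x \<Longrightarrow> \<phi> differentiable (at x)" and mono: "mono_on {0<..} (\<lambda>x. x * deriv \<phi> x)"
  shows "connected (measure_support \<kappa>1)"
proof (rule ccontr)
  let ?S = "measure_support \<kappa>1"
  have conv: "convex_on UNIV (\<lambda>s. \<phi> (exp s))"
  proof (rule convex_on_realI)
    fix s :: real
    have "(\<phi> has_real_derivative deriv \<phi> (exp s)) (at (exp s))"
      using d[of "exp s"] by (simp add: DERIV_deriv_iff_real_differentiable)
    from DERIV_chain2[OF this DERIV_exp] show "((\<lambda>s. \<phi> (exp s)) has_real_derivative deriv \<phi> (exp s) * exp s) (at s)" .
  next
    fix s t :: real assume "s \<le> t"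
    then show "deriv \<phi> (exp s) * exp s \<le> deriv \<phi> (exp t) * exp t"
      using mono_onD[OF mono, of "exp s" "exp t"] by (simp add: mult.commute)
  qed auto
  have phi_geo: "phi0 z \<le> (phi0 x + phi0 y) / 2" if "0 < x" "0 < y" "0 < z" "x * y = z\<^sup>2" for x y z
  proof -
    have "ln z = (ln x + ln y) / 2"
    proof -
      have "2 * ln z = ln (z\<^sup>2)" using that by (subst ln_realpow) auto
      also have "\<dots> = ln x + ln y" unfolding that(4)[symmetric] using that by (intro ln_mult_pos)
      finally show ?thesis by simp
    qed
    then have "ln z = (1 - 1/2) *\<^sub>R ln x + (1/2) *\<^sub>R ln y" by simp
    then have "\<phi> (exp (ln z)) = \<phi> (exp ((1 - 1/2) *\<^sub>R ln x + (1/2) *\<^sub>R ln y))" by presburger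
    also have "\<dots> \<le> (1 - 1/2) * \<phi> (exp (ln x)) + (1/2) * \<phi> (exp (ln y))"
      by (rule convex_onD[OF conv]) auto
    finally show ?thesis using that by (simp add: phi0_eq field_simps)
  qed
  have geo: "W1r z < (W1r x + W1r y) / 2"
    if xy: "0 < x" "0 < y" "x \<noteq> y" and z: "0 < z" "x * y = z\<^sup>2"
      and gap: "\<And>t. t \<in> ?S \<Longrightarrow> t \<noteq> x \<Longrightarrow> t \<noteq> y \<Longrightarrow> 0 < (x - t) * (y - t)" for x y z
  proof -
    have pos: "0 < x + y - 2 * z"
    proof (rule ccontr)
      assume "\<not> 0 < x + y - 2 * z"
      then have "(x + y)\<^sup>2 \<le> (2 * z)\<^sup>2" using xy by (intro power_mono) auto
      also have "\<dots> = 4 * (x * y)" unfolding z(2) by (simp add: power2_eq_square)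
      finally have "(x - y)\<^sup>2 \<le> 0" by (simp add: power2_eq_square algebra_simps)
      then show False using xy(3) by simp
    qed
    have "2 * pot \<kappa>1 z \<le> pot \<kappa>1 x + pot \<kappa>1 y"
    proof (rule pot_geo_le[OF z(2) pot1(1)])
      show "AE t in \<kappa>1. 0 < (x - t) * (y - t) \<and> 0 \<le> t * (x + y - 2 * z)"
        using AE_support[OF kA(9)] AE_ne(1)[of x] AE_ne(1)[of y] kA(5)
        by eventually_elim (use gap pos in auto)
    qed
    moreover have "pot \<kappa>2 x + pot \<kappa>2 y < 2 * pot \<kappa>2 z"
    proof (rule pot_geo_less[OF z(2) finite_borel_measureD(3)[OF kA(2)] mass_ne_0(2) pot2(1)])
      show "AE t in \<kappa>2. z \<noteq> t \<and> t * (x + y - 2 * z) < 0"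
        using kA(6) AE_ne(2)[of 0]
        by eventually_elim (use pos z(1) in \<open>auto intro: mult_neg_pos\<close>)
    qed
    ultimately show ?thesis using phi_geo[OF xy(1,2) z] unfolding W1r_def by argo
  qed
  assume "\<not> connected ?S"
  then obtain l r x where lr: "l \<in> ?S" "r \<in> ?S" "l \<le> x" "x \<le> r" "x \<notin> ?S"
    unfolding connected_iff_interval by blast
  then have "l < x" "x < r" by (auto simp: less_le)
  obtain a b where ab: "a \<in> ?S" "b \<in> ?S" "a < x" "x < b" "\<And>t. t \<in> ?S \<Longrightarrow> t \<le> a \<or> b \<le> t"
    using closed_gap[OF closed_measure_support lr(5,1) \<open>l < x\<close> lr(2) \<open>x < r\<close>] by blast
  have Wab: "W1r a = w1" "W1r b = w1" using W1r_eq_on_support ab by auto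
  have a0: "0 \<le> a" using ab(1) support_k1_subset by auto
  show False
  proof (cases "a = 0")
    case False
    then have ap: "0 < a" using a0 by simp
    define z where "z = sqrt (a * b)"
    have z: "a < z" "z < b" using geo_mean_between[OF ap, of b] ab(3,4) by (auto simp: z_def)
    have zz: "a * b = z\<^sup>2" using ap ab(3,4) by (simp add: z_def)
    have "W1r z < (W1r a + W1r b) / 2"
    proof (rule geo)
      fix t assume t: "t \<in> ?S" "t \<noteq> a" "t \<noteq> b"
      consider "t < a" | "b < t" using ab(5)[OF t(1)] t by force
      then show "0 < (a - t) * (b - t)"
      proof cases
        case 1 then show ?thesis using z by (intro mult_pos_pos) auto
      next
        case 2 then show ?thesis using z by (intro mult_neg_neg) auto
      qed
    qed (use z zz ap in auto)
    then show False using W1r_lower[of z] z ap unfolding Wab by simp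
  next
    case True
    have b0: "0 < b" using True ab(3,4) by simp
    have "compact (W1r ` {0..b})" by (intro compact_continuous_image W1r_cont) auto
    then obtain B where B: "\<And>x. 0 \<le> x \<Longrightarrow> x \<le> b \<Longrightarrow> \<bar>W1r x\<bar> \<le> B"
      unfolding compact_eq_bounded_closed bounded_iff by (metis atLeastAtMost_iff imageI real_norm_def)
    show False
    proof (rule no_doubling_orbit[of "{0<..<b}" "\<lambda>p. W1r p - w1" "B - w1"])
      show "{0<..<b} \<noteq> {}" using b0 by simp
      fix c assume c: "c \<in> {0<..<b}"
      show "0 \<le> W1r c - w1" using W1r_lower[of c] c by simp
      show "W1r c - w1 \<le> B - w1" using B[of c] c by auto
      define c' where "c' = c\<^sup>2 / b"
      have "c\<^sup>2 < b * c" using c by (simp add: power2_eq_square)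
      then have c1: "c' < c" using b0 by (simp add: c'_def field_simps)
      have c2: "0 < c'" using c b0 by (simp add: c'_def)
      have "W1r c < (W1r c' + W1r b) / 2"
      proof (rule geo)
        show "c' * b = c\<^sup>2" using b0 by (simp add: c'_def)
        fix t assume t: "t \<in> ?S" "t \<noteq> c'" "t \<noteq> b"
        consider "t = 0" | "b < t" using ab(5)[OF t(1)] t True support_k1_subset by force
        then show "0 < (c' - t) * (b - t)"
        proof cases
          case 1 then show ?thesis using c2 b0 by simp
        next
          case 2 then show ?thesis using c c1 by (intro mult_neg_neg) auto
        qed
      qed (use c c1 c2 b0 in auto)
      then show "\<exists>c'\<in>{0<..<b}. W1r c - w1 < (W1r c' - w1) / 2"
        unfolding Wab using c c1 c2 by (intro bexI[of _ c']) auto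
    qed
  qed
qed

text \<open>Moving from the left end \<open>a > 0\<close> of the support to zero increases the distance to almost all points of
  \<open>\<kappa>1\<close> and decreases the distance to all points of \<open>\<kappa>2\<close>, so \<open>W1\<close> would fall strictly below its minimum.\<close>
lemma zero_in_support_k1:
  assumes mono: "mono_on {0..} \<phi>"
  shows "0 \<in> measure_support \<kappa>1"
proof (rule ccontr)
  let ?S = "measure_support \<kappa>1"
  assume n: "0 \<notin> ?S"
  define a where "a = Inf ?S"
  have bd: "bdd_below ?S" using support_k1_subset by (auto intro: bdd_belowI[of _ 0])
  have a: "a \<in> ?S" unfolding a_def using closed_contains_Inf[OF support_nonempty(1) bd closed_measure_support] .
  have ap: "0 < a" using a n support_k1_subset by (metis atLeast_iff less_eq_real_def subsetD)
  have "(\<integral>t. - ln \<bar>0 - t\<bar> \<partial>\<kappa>1) < (\<integral>t. - ln \<bar>a - t\<bar> \<partial>\<kappa>1)"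
  proof (rule finite_measure.integral_less_AE_space[OF finite_borel_measureD(3)[OF kA(1)] pot1(1) pot1(1) _ mass_ne_0(1)])
    show "AE t in \<kappa>1. - ln \<bar>0 - t\<bar> < - ln \<bar>a - t\<bar>"
      using AE_support[OF kA(9)] AE_ne(1)[of a]
    proof eventually_elim
      case (elim t)
      then have "a < t" using cInf_lower[OF elim(1) bd] by (simp add: a_def)
      then show ?case using ap by simp
    qed
  qed
  moreover have "(\<integral>t. - ln \<bar>a - t\<bar> \<partial>\<kappa>2) \<le> (\<integral>t. - ln \<bar>0 - t\<bar> \<partial>\<kappa>2)"
  proof (rule integral_mono_AE[OF pot2(1) pot2(1)])
    show "AE t in \<kappa>2. - ln \<bar>a - t\<bar> \<le> - ln \<bar>0 - t\<bar>"
      using kA(6) AE_ne(2)[of 0] by eventually_elim (use ap in auto)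
  qed
  moreover have "phi0 0 \<le> phi0 a" using mono_onD[OF mono, of 0 a] ap by (simp add: phi0_eq)
  ultimately have "W1r 0 < W1r a" unfolding W1r_def pot_def by linarith
  then show False using W1r_lower[of 0] W1r_eq_on_support[OF a] by simp
qed

section \<open>Vanishing of the second constant\<close>

text \<open>Otherwise the logarithmic moment of \<open>\<sigma>\<close> would be the sum of the finite moment of \<open>\<kappa>2\<close> and that of a
  finite measure on a bounded interval.\<close>
lemma rest_unbounded:
  assumes inf: "(\<integral>\<^sup>+ y. ennreal (ln (1 + y\<^sup>2)) \<partial>\<sigma>) = \<infinity>"
  shows "\<exists>y\<in>measure_support rest. y < - M"
proof (rule ccontr)
  assume "\<not> ?thesis"
  then have sub: "measure_support rest \<subseteq> {-M..0}" using support_rest_subset by force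
  then have ae: "AE y in rest. y \<in> {-M..0}" using support_subset_iff[OF sets_rest, of "{-M..0}"] by simp
  note [measurable_cong] = sets_rest
  have "(\<integral>\<^sup>+ y. ennreal (ln (1 + y\<^sup>2)) \<partial>\<sigma>) \<le> (\<integral>\<^sup>+ y. ennreal (ln (1 + y\<^sup>2)) \<partial>mix 1 \<kappa>2 1 rest)"
  proof (rule nn_integral_le_of_le)
    fix S :: "real set" assume S: "S \<in> sets borel"
    have "emeasure rest S + emeasure \<kappa>2 S = emeasure \<sigma> S"
      unfolding emeasure_rest[OF S] by (rule diff_add_cancel_ennreal[OF kA(7)[OF S]])
    then show "emeasure \<sigma> S \<le> emeasure (mix 1 \<kappa>2 1 rest) S"
      using S by (simp add: emeasure_mix kA(10) sets_rest add.commute)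
  qed (simp_all add: sets_sigma)
  also have "\<dots> = (\<integral>\<^sup>+ y. ennreal (ln (1 + y\<^sup>2)) \<partial>\<kappa>2) + (\<integral>\<^sup>+ y. ennreal (ln (1 + y\<^sup>2)) \<partial>rest)"
    using nn_integral_mix[OF kA(10) sets_rest, of "\<lambda>y. ennreal (ln (1 + y\<^sup>2))" 1 1] by simp
  also have "\<dots> < \<infinity>"
  proof -
    have "(\<integral>\<^sup>+ y. ennreal (ln (1 + y\<^sup>2)) \<partial>rest) \<le> (\<integral>\<^sup>+ y. ennreal (ln (1 + M\<^sup>2)) * indicator {-M..0} y \<partial>rest)"
    proof (rule nn_integral_mono_AE, use ae in eventually_elim)
      fix y assume y: "y \<in> {-M..0}"
      then have "y\<^sup>2 \<le> M\<^sup>2" by (intro abs_le_square_iff[THEN iffD1]) auto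
      then show "ennreal (ln (1 + y\<^sup>2)) \<le> ennreal (ln (1 + M\<^sup>2)) * indicator {-M..0} y"
        using y by (auto intro!: ennreal_leI ln_mono add_pos_nonneg)
    qed
    also have "\<dots> = ennreal (ln (1 + M\<^sup>2)) * emeasure rest {-M..0}" by (rule nn_integral_cmult_indicator) (simp add: sets_rest)
    also have "\<dots> < \<infinity>"
    proof -
      have "emeasure rest {-M..0} \<le> emeasure \<sigma> {-M..0}" by (simp add: emeasure_rest diff_le_self_ennreal)
      also have "\<dots> < \<infinity>" by (rule sigma_finite_compact)
      finally show ?thesis by (simp add: ennreal_mult_less_top)
    qed
    finally show ?thesis using kD(3) by (simp add: fin_energy_def)
  qed
  finally show False using inf by simp
qed

lemma near_pot_vanishing:
  assumes v: "0 < \<delta>" "\<delta> < 1/2"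
    and sup: "(SUP R \<in> {R. \<bar>R\<bar> \<ge> R0}. ext_integral (measure_restrict \<sigma> {R - \<delta>..R + \<delta>}) (\<lambda>y. log_kernel R y)) < ereal \<epsilon>"
    and x: "\<bar>x\<bar> \<ge> R0"
  shows "near_pot \<delta> \<kappa>2 x \<le> ennreal \<epsilon>"
proof -
  note [measurable_cong] = sets_sigma
  let ?r = "measure_restrict \<sigma> {x - \<delta>..x + \<delta>}"
  have k: "klog x t = e2ennreal (log_kernel x t)" for t
    by (auto simp: klog_def log_kernel_def dist_real_def e2ennreal_ereal ln_div)
  have ae: "AE t in ?r. t \<in> {x - \<delta>..x + \<delta>}"
    unfolding measure_restrict_def by (subst AE_density) (auto split: split_indicator)
  have "(\<integral>\<^sup>+t. e2ennreal (- log_kernel x t) \<partial>?r) = (\<integral>\<^sup>+t. 0 \<partial>?r)"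
  proof (rule nn_integral_cong_AE, use ae in eventually_elim)
    fix t assume "t \<in> {x - \<delta>..x + \<delta>}"
    then have "\<bar>x - t\<bar> \<le> 1" using v by auto
    then have "x \<noteq> t \<Longrightarrow> ln \<bar>x - t\<bar> \<le> 0" by simp
    then show "e2ennreal (- log_kernel x t) = 0"
      by (auto simp: log_kernel_def dist_real_def e2ennreal_ereal ln_div ennreal_neg e2ennreal_neg)
  qed
  then have e: "ext_integral ?r (\<lambda>y. log_kernel x y) = enn2ereal (\<integral>\<^sup>+t. klog x t \<partial>?r)"
    by (simp add: ext_integral_def k zero_ennreal.rep_eq)
  have "ext_integral ?r (\<lambda>y. log_kernel x y) \<le> (SUP R \<in> {R. \<bar>R\<bar> \<ge> R0}. ext_integral (measure_restrict \<sigma> {R - \<delta>..R + \<delta>}) (\<lambda>y. log_kernel R y))"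
    by (rule SUP_upper) (use x in simp)
  then have lt: "enn2ereal (\<integral>\<^sup>+t. klog x t \<partial>?r) < ereal \<epsilon>" unfolding e using sup by (rule le_less_trans)
  have le: "(\<integral>\<^sup>+t. klog x t \<partial>?r) \<le> ennreal \<epsilon>"
  proof (cases "\<integral>\<^sup>+t. klog x t \<partial>?r")
    case (real r)
    then show ?thesis using lt by (simp add: ennreal_leI)
  next
    case top
    then show ?thesis using lt by simp
  qed
  have "near_pot \<delta> \<kappa>2 x \<le> near_pot \<delta> \<sigma> x"
    unfolding near_pot_def by (rule nn_integral_le_of_le[OF sets_sigma kA(10) kA(7)])
  also have "\<dots> \<le> (\<integral>\<^sup>+t. indicator {x - \<delta>..x + \<delta>} t * klog x t \<partial>\<sigma>)"
    unfolding near_pot_def by (rule nn_integral_mono) (auto split: split_indicator)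
  also have "\<dots> = (\<integral>\<^sup>+t. klog x t \<partial>?r)"
    unfolding measure_restrict_def by (subst nn_integral_density) auto
  finally show ?thesis using le by simp
qed

text \<open>Along points \<open>X n\<close> of the support of \<open>\<sigma> - \<kappa>2\<close> that tend to \<open>-\<infinity>\<close>, both \<open>U\<^sup>\<kappa>\<^sup>1\<close> and twice the truncated
  potential of \<open>\<kappa>2\<close> are \<open>- 2 ln \<bar>X n\<bar>\<close> up to a vanishing error, and the local condition on \<open>\<sigma>\<close> bounds
  what truncation removes by an arbitrarily small number.\<close>
lemma w2_eq_0:
  assumes inf: "(\<integral>\<^sup>+ y. ennreal (ln (1 + y\<^sup>2)) \<partial>\<sigma>) = \<infinity>" and v: "vanishing_local_potentials \<sigma>"
  shows "w2 = 0"
proof -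
  interpret k1: finite_borel_measure \<kappa>1 by (rule kA)
  interpret k2: finite_borel_measure \<kappa>2 by (rule kA)
  note [measurable_cong] = k1.M_is_borel k2.M_is_borel
  have "\<forall>n. \<exists>y. y \<in> measure_support rest \<and> y < - real (Suc n)" using rest_unbounded[OF inf] by blast
  then obtain X where X: "\<And>n. X n \<in> measure_support rest" "\<And>n. X n < - real (Suc n)" by metis
  have X1: "1 \<le> \<bar>X n\<bar>" "X n < 0" "real (Suc n) \<le> \<bar>X n\<bar>" for n using X(2)[of n] by auto
  have t0: "(\<lambda>n. t / X n) \<longlonglongrightarrow> 0" for t
  proof (rule Lim_null_comparison)
    show "\<forall>\<^sub>F n in sequentially. norm (t / X n) \<le> \<bar>t\<bar> / real (Suc n)"
    proof (intro always_eventually allI)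
      fix n
      have "\<bar>t\<bar> / \<bar>X n\<bar> \<le> \<bar>t\<bar> / real (Suc n)"
        using X1(1,3)[of n] by (intro divide_left_mono mult_pos_pos) auto
      then show "norm (t / X n) \<le> \<bar>t\<bar> / real (Suc n)" by (simp only: real_norm_def abs_divide)
    qed
    show "(\<lambda>n. \<bar>t\<bar> / real (Suc n)) \<longlonglongrightarrow> 0" by (rule LIMSEQ_Suc, rule lim_const_over_n)
  qed
  have lim0: "(\<lambda>n. ln \<bar>X n\<bar> - ln \<bar>X n - t\<bar>) \<longlonglongrightarrow> 0" for t
  proof -
    have "(\<lambda>n. - ln \<bar>1 - t / X n\<bar>) \<longlonglongrightarrow> - ln \<bar>1 - 0\<bar>" by (intro tendsto_intros t0) auto
    then have "(\<lambda>n. - ln \<bar>1 - t / X n\<bar>) \<longlonglongrightarrow> 0" by simp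
    moreover have "\<forall>\<^sub>F n in sequentially. - ln \<bar>1 - t / X n\<bar> = ln \<bar>X n\<bar> - ln \<bar>X n - t\<bar>"
      using eventually_gt_at_top[of "nat \<lceil>\<bar>t\<bar>\<rceil>"]
    proof eventually_elim
      case (elim n)
      then have "\<bar>t\<bar> < \<bar>X n\<bar>" using X1(3)[of n] by linarith
      then have ne: "X n \<noteq> t" "X n \<noteq> 0" using X1(2)[of n] by auto
      have "1 - t / X n = (X n - t) / X n" using ne by (simp add: field_simps)
      then have "\<bar>1 - t / X n\<bar> = \<bar>X n - t\<bar> / \<bar>X n\<bar>" by (simp add: abs_divide)
      then show ?case using ne by (simp add: ln_div)
    qed
    ultimately show ?thesis by (rule Lim_transform_eventually)
  qed
  have B0: "(\<lambda>n. pot \<kappa>1 (X n) + 2 * ln \<bar>X n\<bar>) \<longlonglongrightarrow> 0"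
  proof -
    have "(\<lambda>n. \<integral>t. ln \<bar>X n\<bar> - ln \<bar>X n - t\<bar> \<partial>\<kappa>1) \<longlonglongrightarrow> (\<integral>t. 0 \<partial>\<kappa>1)"
    proof (rule integral_dominated_convergence)
      show "integrable \<kappa>1 (\<lambda>t. ln (1 + \<bar>t\<bar>))" using log_moment_k(1) by (simp add: log_moment_def)
      show "AE t in \<kappa>1. (\<lambda>n. ln \<bar>X n\<bar> - ln \<bar>X n - t\<bar>) \<longlonglongrightarrow> 0" using lim0 by simp
      show "AE t in \<kappa>1. norm (ln \<bar>X n\<bar> - ln \<bar>X n - t\<bar>) \<le> ln (1 + \<bar>t\<bar>)" for n
        using kA(5)
      proof eventually_elim
        case (elim t)
        have 1: "ln \<bar>X n\<bar> \<le> ln \<bar>X n - t\<bar>" using X1(2)[of n] elim by (intro ln_mono) auto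
        have "1 * t \<le> \<bar>X n\<bar> * t" using X1(1)[of n] elim by (intro mult_right_mono) auto
        then have "\<bar>X n - t\<bar> \<le> \<bar>X n\<bar> * (1 + \<bar>t\<bar>)" using X1(2)[of n] elim by (simp add: algebra_simps)
        then have "ln \<bar>X n - t\<bar> \<le> ln (\<bar>X n\<bar> * (1 + \<bar>t\<bar>))" using X1(2)[of n] elim by (intro ln_mono) auto
        also have "\<dots> = ln \<bar>X n\<bar> + ln (1 + \<bar>t\<bar>)" using X1(2)[of n] by (intro ln_mult_pos) auto
        finally show ?case using 1 by simp
      qed
    qed measurable
    moreover have "(\<integral>t. ln \<bar>X n\<bar> - ln \<bar>X n - t\<bar> \<partial>\<kappa>1) = pot \<kappa>1 (X n) + 2 * ln \<bar>X n\<bar>" for n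
    proof -
      have "(\<integral>t. ln \<bar>X n\<bar> + - ln \<bar>X n - t\<bar> \<partial>\<kappa>1) = (\<integral>t. ln \<bar>X n\<bar> \<partial>\<kappa>1) + pot \<kappa>1 (X n)"
        unfolding pot_def by (rule Bochner_Integration.integral_add[OF _ pot1(1)]) simp
      then show ?thesis using kA(3) by (simp add: k1.borel_UNIV)
    qed
    ultimately show ?thesis by simp
  qed
  have bound: "0 \<le> w2 \<and> w2 \<le> 2 * \<epsilon>" if \<epsilon>: "\<epsilon> > 0" for \<epsilon>
  proof -
    obtain \<delta> R0 where \<delta>: "0 < \<delta>" "\<delta> < 1/2" "R0 > 0"
      "(SUP R \<in> {R. \<bar>R\<bar> \<ge> R0}. ext_integral (measure_restrict \<sigma> {R - \<delta>..R + \<delta>}) (\<lambda>y. log_kernel R y)) < ereal \<epsilon>"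
      using v \<epsilon> unfolding vanishing_local_potentials_def by blast
    (* the truncated potential of \<kappa>2, compared with that of a point mass *)
    define A where "A n = (\<integral>t. trunc_log \<delta> (of_real (X n)) t \<partial>\<kappa>2) + ln \<bar>X n\<bar>" for n
    have dl: "\<delta> \<le> 1" using \<delta> by simp
    note ti = trunc_log_integrable[OF log_moment_k(2) \<delta>(1) dl]
    have Aeq: "A n = (\<integral>t. trunc_log \<delta> (of_real (X n)) t + ln \<bar>X n\<bar> \<partial>\<kappa>2)" for n
      unfolding A_def using ti kA(4) by (simp add: k2.borel_UNIV)
    have A0: "A \<longlonglongrightarrow> 0"
    proof -
      have "(\<lambda>n. \<integral>t. trunc_log \<delta> (of_real (X n)) t + ln \<bar>X n\<bar> \<partial>\<kappa>2) \<longlonglongrightarrow> (\<integral>t. 0 \<partial>\<kappa>2)"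
      proof (rule integral_dominated_convergence)
        show "integrable \<kappa>2 (\<lambda>t. ln (1 + \<bar>t\<bar>) - ln \<delta>)" using log_moment_k(2) by (simp add: log_moment_def)
        show "AE t in \<kappa>2. (\<lambda>n. trunc_log \<delta> (of_real (X n)) t + ln \<bar>X n\<bar>) \<longlonglongrightarrow> 0"
        proof (rule AE_I2)
          fix t
          have "\<forall>\<^sub>F n in sequentially. ln \<bar>X n\<bar> - ln \<bar>X n - t\<bar> = trunc_log \<delta> (of_real (X n)) t + ln \<bar>X n\<bar>"
            using eventually_gt_at_top[of "nat \<lceil>\<bar>t\<bar> + 1\<rceil>"]
          proof eventually_elim
            case (elim n)
            then have "\<bar>t\<bar> + 1 < \<bar>X n\<bar>" using X1(3)[of n] by linarith
            then have "\<delta> \<le> \<bar>X n - t\<bar>" using \<delta>(2) X1(2)[of n] by linarith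
            then show ?case by (simp add: trunc_log_def cmod_diff_of_real max_absorb2)
          qed
          then show "(\<lambda>n. trunc_log \<delta> (of_real (X n)) t + ln \<bar>X n\<bar>) \<longlonglongrightarrow> 0"
            by (rule Lim_transform_eventually[OF lim0])
        qed
        show "AE t in \<kappa>2. norm (trunc_log \<delta> (of_real (X n)) t + ln \<bar>X n\<bar>) \<le> ln (1 + \<bar>t\<bar>) - ln \<delta>" for n
        proof (rule AE_I2)
          fix t
          define m where "m = max \<delta> \<bar>X n - t\<bar>"
          have m: "m \<ge> \<delta>" "m \<ge> \<bar>X n - t\<bar>" "m > 0" using \<delta>(1) by (auto simp: m_def)
          have tl: "trunc_log \<delta> (of_real (X n)) t = - ln m" by (simp add: trunc_log_def cmod_diff_of_real m_def)
          have "\<bar>X n\<bar> \<le> m + \<bar>t\<bar>" using m(2) by linarith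
          also have "\<dots> \<le> m * ((1 + \<bar>t\<bar>) / \<delta>)"
          proof -
            have "m * 1 + \<delta> * \<bar>t\<bar> \<le> m * 1 + m * \<bar>t\<bar>" using m by (intro add_left_mono mult_right_mono) auto
            moreover have "(m + \<bar>t\<bar>) * \<delta> \<le> m * 1 + \<delta> * \<bar>t\<bar>"
              using mult_left_mono[of \<delta> 1 m] dl m by (simp add: algebra_simps)
            ultimately have "(m + \<bar>t\<bar>) * \<delta> \<le> m * (1 + \<bar>t\<bar>)" by (simp add: algebra_simps)
            then show ?thesis using \<delta>(1) by (simp add: field_simps)
          qed
          finally have "ln \<bar>X n\<bar> \<le> ln (m * ((1 + \<bar>t\<bar>) / \<delta>))" using X1(2)[of n] m \<delta>(1) by (intro ln_mono) auto
          also have "\<dots> = ln m + ln ((1 + \<bar>t\<bar>) / \<delta>)" using m \<delta>(1) by (intro ln_mult_pos) (auto intro!: divide_pos_pos)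
          also have "ln ((1 + \<bar>t\<bar>) / \<delta>) = ln (1 + \<bar>t\<bar>) - ln \<delta>" using \<delta>(1) by (intro ln_divide_pos) auto
          finally have up: "- ln m + ln \<bar>X n\<bar> \<le> ln (1 + \<bar>t\<bar>) - ln \<delta>" by linarith
          have "m \<le> \<bar>X n\<bar> + \<bar>t\<bar>" using dl X1(1)[of n] by (auto simp: m_def)
          also have "\<dots> \<le> \<bar>X n\<bar> * (1 + \<bar>t\<bar>)"
            using mult_right_mono[OF X1(1)[of n], of "\<bar>t\<bar>"] by (simp add: algebra_simps)
          finally have "ln m \<le> ln (\<bar>X n\<bar> * (1 + \<bar>t\<bar>))" using m by (intro ln_mono) auto
          also have "\<dots> = ln \<bar>X n\<bar> + ln (1 + \<bar>t\<bar>)" using X1(2)[of n] by (intro ln_mult_pos) auto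
          finally have "ln m - ln \<bar>X n\<bar> \<le> ln (1 + \<bar>t\<bar>)" by linarith
          moreover have "ln \<delta> \<le> 0" using \<delta> by simp
          ultimately show "norm (trunc_log \<delta> (of_real (X n)) t + ln \<bar>X n\<bar>) \<le> ln (1 + \<bar>t\<bar>) - ln \<delta>"
            unfolding tl real_norm_def using up by (auto simp: abs_le_iff)
        qed
      qed measurable
      then show ?thesis unfolding Aeq[abs_def] by simp
    qed
    have bds: "\<forall>\<^sub>F n in sequentially. 2 * A n - (pot \<kappa>1 (X n) + 2 * ln \<bar>X n\<bar>) \<le> w2
       \<and> w2 \<le> 2 * A n + 2 * \<epsilon> - (pot \<kappa>1 (X n) + 2 * ln \<bar>X n\<bar>)"
      using eventually_gt_at_top[of "nat \<lceil>R0\<rceil>"]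
    proof eventually_elim
      case (elim n)
      then have "R0 \<le> \<bar>X n\<bar>" using X1(3)[of n] by linarith
      then have "near_pot \<delta> \<kappa>2 (X n) \<le> ennreal \<epsilon>" by (rule near_pot_vanishing[OF \<delta>(1,2,4)])
      then have "(\<integral>t. trunc_log \<delta> (of_real (X n)) t \<partial>\<kappa>2) \<le> pot \<kappa>2 (X n)" "pot \<kappa>2 (X n) \<le> (\<integral>t. trunc_log \<delta> (of_real (X n)) t \<partial>\<kappa>2) + \<epsilon>"
        using near_pot_excess(3,4)[OF log_moment_k(2) \<delta>(1) dl, of "of_real (X n)" \<epsilon>] \<epsilon> by (auto simp: cpot_of_real)
      moreover have "w2 = 2 * pot \<kappa>2 (X n) - pot \<kappa>1 (X n)" using W2r_on_rest[OF X(1)[of n]] by (simp add: W2r_def)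
      ultimately show ?case unfolding A_def by (auto simp: algebra_simps)
    qed
    have l1: "(\<lambda>n. 2 * A n - (pot \<kappa>1 (X n) + 2 * ln \<bar>X n\<bar>)) \<longlonglongrightarrow> 2 * 0 - 0" by (intro tendsto_intros A0 B0)
    have l2: "(\<lambda>n. 2 * A n + 2 * \<epsilon> - (pot \<kappa>1 (X n) + 2 * ln \<bar>X n\<bar>)) \<longlonglongrightarrow> 2 * 0 + 2 * \<epsilon> - 0" by (intro tendsto_intros A0 B0)
    have "2 * 0 - 0 \<le> w2" by (rule tendsto_upperbound[OF l1]) (use bds in \<open>auto elim: eventually_mono\<close>)
    moreover have "w2 \<le> 2 * 0 + 2 * \<epsilon> - 0" by (rule tendsto_lowerbound[OF l2]) (use bds in \<open>auto elim: eventually_mono\<close>)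
    ultimately show ?thesis by simp
  qed
  have "w2 \<le> 0"
  proof (rule field_le_epsilon)
    fix e :: real assume "0 < e"
    then show "w2 \<le> 0 + e" using bound[of "e / 2"] by simp
  qed
  then show ?thesis using bound[of 1] by simp
qed

end

theorem theorem2p1:
  fixes \<sigma> :: "real measure" and \<phi> :: "real \<Rightarrow> real"
  assumes "sets \<sigma> = sets borel"
    and "measure_support \<sigma> = {..0}"
    and "emeasure \<sigma> UNIV > 1"
    and "\<And>K. compact K \<Longrightarrow> K \<subseteq> {..0} \<Longrightarrow> continuous_potential (measure_restrict \<sigma> K)"
    and "continuous_on {0..} \<phi>"
    and "filterlim (\<lambda>x. \<phi> x - 4 * ln x) at_top at_top"
  shows "\<exists>\<mu>1 \<mu>2 w1 w2.
    (\<forall>\<mu>. minimizes_energy \<sigma> \<phi> \<mu> \<longleftrightarrow> \<mu> = (\<mu>1, \<mu>2)) \<and>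
    (\<forall>\<mu>. variational_inequality \<sigma> \<phi> \<mu> \<longleftrightarrow> \<mu> = (\<mu>1, \<mu>2)) \<and>
    (\<forall>\<mu> v1 v2. equilibrium_conditions \<sigma> \<phi> \<mu> v1 v2 \<longleftrightarrow> \<mu> = (\<mu>1, \<mu>2) \<and> v1 = w1 \<and> v2 = w2) \<and>
    continuous_potential \<mu>1 \<and> continuous_potential \<mu>2 \<and>
    compact (measure_support \<mu>1) \<and>
    ((\<forall>x>0. \<phi> differentiable (at x) \<and> x * deriv \<phi> x > 0) \<and> mono_on {0<..} (\<lambda>x. x * deriv \<phi> x)
       \<longrightarrow> connected (measure_support \<mu>1)) \<and>
    (mono_on {0..} \<phi> \<longrightarrow> 0 \<in> measure_support \<mu>1) \<and>
    ((\<integral>\<^sup>+ y. ennreal (ln (1 + y\<^sup>2)) \<partial>\<sigma>) = \<infinity> \<and> vanishing_local_potentials \<sigma> \<longrightarrow> w2 = 0)"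
proof -
  interpret constrained_problem \<sigma> \<phi>
    using assms by unfold_locales
  obtain \<kappa>1 \<kappa>2 where m: "is_min \<kappa>1 \<kappa>2" using ex_is_min by blast
  interpret equilibrium \<sigma> \<phi> \<kappa>1 \<kappa>2 by unfold_locales (rule m)
  have min: "minimizes_energy \<sigma> \<phi> \<mu> \<longleftrightarrow> \<mu> = (\<kappa>1, \<kappa>2)" for \<mu>
  proof (cases \<mu>)
    case (Pair \<mu>1 \<mu>2)
    show ?thesis unfolding Pair minimizes_energy_iff using is_min_unique[OF m, of \<mu>1 \<mu>2] m by blast
  qed
  have var: "variational_inequality \<sigma> \<phi> \<mu> \<longleftrightarrow> \<mu> = (\<kappa>1, \<kappa>2)" for \<mu>
  proof (cases \<mu>)
    case (Pair \<mu>1 \<mu>2)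
    show ?thesis unfolding Pair variational_inequality_iff using is_min_unique[OF m, of \<mu>1 \<mu>2] m by blast
  qed
  have eqc: "equilibrium_conditions \<sigma> \<phi> \<mu> v1 v2 \<longleftrightarrow> \<mu> = (\<kappa>1, \<kappa>2) \<and> v1 = w1 \<and> v2 = w2" for \<mu> v1 v2
  proof (cases \<mu>)
    case (Pair \<mu>1 \<mu>2)
    show ?thesis unfolding Pair equilibrium_iff by blast
  qed
  have c1: "continuous_potential \<kappa>1" by (rule kato_cpot(5)[OF log_moment_k(1) kato_k1])
  have c2: "continuous_potential \<kappa>2" by (rule kato_cpot(5)[OF log_moment_k(2) kA(8)])
  have cpt: "compact (measure_support \<kappa>1)" by (rule compact_support_k1)
  have conn: "connected (measure_support \<kappa>1)"
    if "(\<forall>x>0. \<phi> differentiable (at x) \<and> x * deriv \<phi> x > 0) \<and> mono_on {0<..} (\<lambda>x. x * deriv \<phi> x)"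
    using connected_support_k1 that by blast
  have zero: "0 \<in> measure_support \<kappa>1" if "mono_on {0..} \<phi>" using that by (rule zero_in_support_k1)
  have w2z: "w2 = 0" if "(\<integral>\<^sup>+ y. ennreal (ln (1 + y\<^sup>2)) \<partial>\<sigma>) = \<infinity> \<and> vanishing_local_potentials \<sigma>"
    using w2_eq_0 that by blast
  show ?thesis
    by (rule exI[of _ \<kappa>1], rule exI[of _ \<kappa>2], rule exI[of _ w1], rule exI[of _ w2], intro conjI allI impI)
      (rule min | rule var | rule eqc | rule c1 | rule c2 | rule cpt | erule conn | erule zero | erule w2z)+
qed

end
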